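(* Let $\{L(t)\}_{t\in\mathbb R}$ be a family of linear operators satisfying the following three conditions. (H0) There exist integers $\mathsf m\ge 0$ and $k_0>2\mathsf m$ such that $t\mapsto L(t)\in C_b(\mathbb R,\mathcal L(\mathcal H^{k+2\mathsf m},\mathcal H^{k}))$ for $0\le k\le k_0$. (H1) For every $t\in\mathbb R$, $L(t)$ is symmetric on $\mathcal H^{k_0+2\mathsf m}$ with respect to the scalar product of $\mathcal H^0$: $\langle L(t)\psi,\phi\rangle_0=\langle \psi,L(t)\phi\rangle_0$ for all $\psi,\phi\in\mathcal H^{k_0+2\mathsf m}$. (H2) There exists $k_1>2\mathsf m$ such that $[L(\cdot),H]H^{-1}\in C_b(\mathbb R,\mathcal L(\mathcal H^k))$ for $0\le k\le 2k_1$. Then, for all $k$ with $0\le k\le \min(k_0,k_1)-4\mathsf m$, the equation $$ \mathrm i\,\partial_t\psi(t)=L(t)\psi(t),\qquad \psi|_{t=s}=\psi_s,\quad s\in\mathbb R, $$ admits a unique propagator $\mathcal U(t,s)\in C^0\left(\mathbb R\times\mathbb R,\mathcal L(\mathcal H^k)\right)$ fulfilling: (i) (Well-posedness) for every initial datum $\psi_s\in\mathcal H^{k+2\mathsf m}$ there exists a unique global solution $\psi(t):=\mathcal U(t,s)\psi_s\in\mathcal H^k$ of the equation such that $\psi(\cdot)\in C^0(\mathbb R,\mathcal H^{k+2\mathsf m})\cap C^1(\mathbb R,\mathcal H^k)$. (ii) (Unitarity) for every initial datum $\psi_s\in\mathcal H^k$, the $\mathcal H^0$ norm is preserved by the flow: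 $\|\psi(t)\|_{0}=\|\psi_s\|_{0}$ for all $t\in\mathbb R$, where $\psi(t)=\mathcal U(t,s)\psi_s$. (iii) (Group property) $\mathcal U(t,s)=\mathcal U(t,r)\,\mathcal U(r,s)$ and $\mathcal U(s,s)=\mathbb I$ for all $t,r,s\in\mathbb R$. (iv) (Upper bound on growth) for every $k\ge 0$ there exists $C_k>0$ such that $\|\mathcal U(t,s)\|_{\mathcal L(\mathcal H^k)}\le C_k e^{C_k|t-s|}$ for all $t,s\in\mathbb R$. In particular $\mathcal U(t,s)$ extends to a unique unitary operator in $\mathcal H^0$ fulfilling the group property (iii). Furthermore, for every $t\in\mathbb R$ and every $k\ge 2\mathsf m$, $(L(t),\mathcal H^k,\mathcal H^0)$ is essentially self-adjoint, i.e. $L(t)$ with domain $\mathcal H^k$ is essentially self-adjoint in $\mathcal H^0$.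
   Context: $\mathcal H^0$ is a complex Hilbert space with scalar product $\langle\cdot,\cdot\rangle_0$ and norm $\|\cdot\|_0$. $H$ is a positive self-adjoint operator in $\mathcal H^0$ with dense domain; its real powers are defined by spectral calculus. For $k\ge0$, $\mathcal H^k:=D(H^{k/2})$ with norm $\|u\|_k$ (equivalent to) $\|H^{k/2}u\|_0$; for $k<0$, $\mathcal H^k$ is the completion of $\mathcal H^0$ for the dual norm $\|u\|_k=\sup\{|\langle v,u\rangle_0|:\|v\|_{-k}\le1\}$. It is understood that $H^m$ is an isometry from $\mathcal H^{k+2m}$ onto $\mathcal H^k$ for all real $m,k$. $\mathcal L(\mathcal A,\mathcal B)$ is the Banach space of bounded linear maps between Banach spaces $\mathcal A,\mathcal B$, and $\mathcal L(\mathcal A)=\mathcal L(\mathcal A,\mathcal A)$; $C_b(\mathbb R,\mathcal B)$ is the Banach space of bounded continuous maps $\mathbb R\to\mathcal B$ with the sup norm; $C^0(X,\mathcal B)$ and $C^1(\mathbb R,\mathcal B)$ denote the continuous, respectively continuously differentiable, maps into $\mathcal B$. $[A,B]=AB-BA$.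
   Formalization: Continuity of U(t,s) in L(H^k) is taken in the strong sense, since operator-norm continuity fails for L(t)=H unbounded (U=exp(-i(t-s)H)); in (iv), "every k≥0" means k in the theorem's stated range, outside which U need not preserve H^k. *)

theory Defs
  imports "HOL-Analysis.Analysis"
begin

section \<open>Complex Hilbert spaces\<close>

class complex_hilbert = banach +
  fixes scaleC :: "complex \<Rightarrow> 'a \<Rightarrow> 'a" (infixr "*\<^sub>C" 75)
    and cinner :: "'a \<Rightarrow> 'a \<Rightarrow> complex"
  assumes scaleC_add_right: "a *\<^sub>C (x + y) = a *\<^sub>C x + a *\<^sub>C y"
    and scaleC_add_left: "(a + b) *\<^sub>C x = a *\<^sub>C x + b *\<^sub>C x"
    and scaleC_scaleC: "a *\<^sub>C b *\<^sub>C x = (a * b) *\<^sub>C x"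
    and scaleR_eq_scaleC: "r *\<^sub>R x = complex_of_real r *\<^sub>C x"
    and cinner_commute: "cinner x y = cnj (cinner y x)"
    and cinner_add_right: "cinner x (y + z) = cinner x y + cinner x z"
    and cinner_scaleC_right: "cinner x (a *\<^sub>C y) = a * cinner x y"
    and cinner_self: "cinner x x = complex_of_real ((norm x)\<^sup>2)"

section \<open>Unbounded operators\<close>

text \<open>An unbounded operator is given by its domain and a function of which only the
  values on that domain matter.\<close>

definition csubspace :: "'h::complex_hilbert set \<Rightarrow> bool" where
  "csubspace S \<longleftrightarrow> 0 \<in> S \<and> (\<forall>x\<in>S. \<forall>y\<in>S. x + y \<in> S) \<and> (\<forall>a. \<forall>x\<in>S. a *\<^sub>C x \<in> S)"

definition clinear_on :: "'h::complex_hilbert set \<Rightarrow> ('h \<Rightarrow> 'h) \<Rightarrow> bool" where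
  "clinear_on S A \<longleftrightarrow> csubspace S \<and>
     (\<forall>x\<in>S. \<forall>y\<in>S. A (x + y) = A x + A y) \<and> (\<forall>a. \<forall>x\<in>S. A (a *\<^sub>C x) = a *\<^sub>C A x)"

definition op_graph :: "'h::complex_hilbert set \<Rightarrow> ('h \<Rightarrow> 'h) \<Rightarrow> ('h \<times> 'h) set" where
  "op_graph S A = (\<lambda>u. (u, A u)) ` S"

definition adjoint_graph :: "('h::complex_hilbert \<times> 'h) set \<Rightarrow> ('h \<times> 'h) set" where
  "adjoint_graph G = {(v, w). \<forall>(u, z)\<in>G. cinner v z = cinner w u}"

definition symmetric_on :: "'h::complex_hilbert set \<Rightarrow> ('h \<Rightarrow> 'h) \<Rightarrow> bool" where
  "symmetric_on S A \<longleftrightarrow> (\<forall>\<psi>\<in>S. \<forall>\<phi>\<in>S. cinner (A \<psi>) \<phi> = cinner \<psi> (A \<phi>))"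

definition self_adjoint :: "'h::complex_hilbert set \<Rightarrow> ('h \<Rightarrow> 'h) \<Rightarrow> bool" where
  "self_adjoint S A \<longleftrightarrow> clinear_on S A \<and> closure S = UNIV \<and>
     op_graph S A = adjoint_graph (op_graph S A)"

text \<open>Essential self-adjointness: symmetric, densely defined, with self-adjoint closure
  (the closure of an operator being the one whose graph is the closure of its graph).\<close>

definition essentially_self_adjoint :: "'h::complex_hilbert set \<Rightarrow> ('h \<Rightarrow> 'h) \<Rightarrow> bool" where
  "essentially_self_adjoint S A \<longleftrightarrow> clinear_on S A \<and> closure S = UNIV \<and> symmetric_on S A \<and>
     closure (op_graph S A) = adjoint_graph (closure (op_graph S A))"

text \<open>Positivity is strict: the spectrum lies in \<open>[c, \<infinity>)\<close> for some \<open>c > 0\<close>. This is what it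
  takes for all real powers, in particular the inverse, to be isometries between the spaces
  of the scale.\<close>

definition positive_self_adjoint :: "'h::complex_hilbert set \<Rightarrow> ('h \<Rightarrow> 'h) \<Rightarrow> bool" where
  "positive_self_adjoint S A \<longleftrightarrow> self_adjoint S A \<and>
     (\<exists>c>0. \<forall>u\<in>S. c * (norm u)\<^sup>2 \<le> Re (cinner u (A u)))"

definition unitary :: "('h::complex_hilbert \<Rightarrow> 'h) \<Rightarrow> bool" where
  "unitary W \<longleftrightarrow> clinear_on UNIV W \<and> surj W \<and> (\<forall>u v. cinner (W u) (W v) = cinner u v)"

section \<open>Spectral calculus and real powers\<close>

definition projection_valued_measure :: "(real set \<Rightarrow> 'h::complex_hilbert \<Rightarrow> 'h) \<Rightarrow> bool" where
  "projection_valued_measure E \<longleftrightarrow>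
     (\<forall>A\<in>sets borel. clinear_on UNIV (E A) \<and> (\<forall>u v. cinner (E A u) v = cinner u (E A v))) \<and>
     (\<forall>A\<in>sets borel. \<forall>B\<in>sets borel. E (A \<inter> B) = E A \<circ> E B) \<and>
     E UNIV = id \<and>
     (\<forall>A u. range A \<subseteq> sets borel \<and> disjoint_family A \<longrightarrow>
        (\<lambda>n. E (A n) u) sums E (\<Union>n::nat. A n) u)"

text \<open>The scalar spectral measure \<open>A \<mapsto> \<langle>u, E(A) u\<rangle> = \<parallel>E(A) u\<parallel>\<^sup>2\<close>.\<close>

definition scalar_measure ::
    "(real set \<Rightarrow> 'h::complex_hilbert \<Rightarrow> 'h) \<Rightarrow> 'h \<Rightarrow> real measure" where
  "scalar_measure E u = measure_of UNIV (sets borel) (\<lambda>A. ennreal ((norm (E A u))\<^sup>2))"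

definition spectral_domain ::
    "(real set \<Rightarrow> 'h::complex_hilbert \<Rightarrow> 'h) \<Rightarrow> (real \<Rightarrow> real) \<Rightarrow> 'h set" where
  "spectral_domain E f = {u. integrable (scalar_measure E u) (\<lambda>x. (f x)\<^sup>2)}"

text \<open>\<open>T = \<integral> f dE\<close>. By polarization and density of the domain, the quadratic form
  determines the values of \<open>T\<close> on \<open>spectral_domain E f\<close>.\<close>

definition is_spectral_integral ::
    "(real set \<Rightarrow> 'h::complex_hilbert \<Rightarrow> 'h) \<Rightarrow> (real \<Rightarrow> real) \<Rightarrow> ('h \<Rightarrow> 'h) \<Rightarrow> bool" where
  "is_spectral_integral E f T \<longleftrightarrow> clinear_on (spectral_domain E f) T \<and>
     (\<forall>u\<in>spectral_domain E f.
        cinner u (T u) = complex_of_real (integral\<^sup>L (scalar_measure E u) f))"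

text \<open>The projection-valued measure of a self-adjoint operator; by the spectral theorem it
  exists and is unique (on Borel sets).\<close>

definition spectral_measure ::
    "'h::complex_hilbert set \<Rightarrow> ('h \<Rightarrow> 'h) \<Rightarrow> real set \<Rightarrow> 'h \<Rightarrow> 'h" where
  "spectral_measure D H = (SOME E. projection_valued_measure E \<and>
     D = spectral_domain E (\<lambda>x. x) \<and> is_spectral_integral E (\<lambda>x. x) H)"

definition pow_domain :: "'h::complex_hilbert set \<Rightarrow> ('h \<Rightarrow> 'h) \<Rightarrow> real \<Rightarrow> 'h set" where
  "pow_domain D H s = spectral_domain (spectral_measure D H) (\<lambda>x. x powr s)"

definition op_pow ::
    "'h::complex_hilbert set \<Rightarrow> ('h \<Rightarrow> 'h) \<Rightarrow> real \<Rightarrow> 'h \<Rightarrow> 'h" where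
  "op_pow D H s = (SOME T. is_spectral_integral (spectral_measure D H) (\<lambda>x. x powr s) T)"

section \<open>The scale of spaces, for nonnegative index\<close>

definition sob :: "'h::complex_hilbert set \<Rightarrow> ('h \<Rightarrow> 'h) \<Rightarrow> real \<Rightarrow> 'h set" where
  "sob D H k = pow_domain D H (k / 2)"

definition snorm :: "'h::complex_hilbert set \<Rightarrow> ('h \<Rightarrow> 'h) \<Rightarrow> real \<Rightarrow> 'h \<Rightarrow> real" where
  "snorm D H k u = norm (op_pow D H (k / 2) u)"

definition bounded_op ::
    "'h::complex_hilbert set \<Rightarrow> ('h \<Rightarrow> 'h) \<Rightarrow> real \<Rightarrow> real \<Rightarrow> ('h \<Rightarrow> 'h) \<Rightarrow> bool" where
  "bounded_op D H a b A \<longleftrightarrow> clinear_on (sob D H a) A \<and> A ` sob D H a \<subseteq> sob D H b \<and>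
     (\<exists>C. \<forall>u\<in>sob D H a. snorm D H b (A u) \<le> C * snorm D H a u)"

definition op_norm ::
    "'h::complex_hilbert set \<Rightarrow> ('h \<Rightarrow> 'h) \<Rightarrow> real \<Rightarrow> real \<Rightarrow> ('h \<Rightarrow> 'h) \<Rightarrow> real" where
  "op_norm D H a b A = (SUP u\<in>{u \<in> sob D H a. snorm D H a u \<le> 1}. snorm D H b (A u))"

text \<open>\<open>t \<mapsto> A t\<close> restricted to the space of index \<open>a\<close> is a bounded continuous map into the
  Banach space of bounded operators from index \<open>a\<close> to index \<open>b\<close> (operator norm topology).\<close>

definition Cb_op ::
    "'h::complex_hilbert set \<Rightarrow> ('h \<Rightarrow> 'h) \<Rightarrow> real \<Rightarrow> real \<Rightarrow> (real \<Rightarrow> 'h \<Rightarrow> 'h) \<Rightarrow> bool" where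
  "Cb_op D H a b A \<longleftrightarrow> (\<forall>t. bounded_op D H a b (A t)) \<and>
     (\<exists>C. \<forall>t. op_norm D H a b (A t) \<le> C) \<and>
     (\<forall>t. ((\<lambda>\<tau>. op_norm D H a b (\<lambda>u. A \<tau> u - A t u)) \<longlongrightarrow> 0) (at t))"

text \<open>The operator \<open>[A, H] H\<^sup>-\<^sup>1\<close>, with the functional-calculus inverse of \<open>H\<close>.\<close>

definition comm_inv ::
    "'h::complex_hilbert set \<Rightarrow> ('h \<Rightarrow> 'h) \<Rightarrow> ('h \<Rightarrow> 'h) \<Rightarrow> 'h \<Rightarrow> 'h" where
  "comm_inv D H A u =
     (let v = op_pow D H (- 1) u in A (H v) - H (A v))"

definition C0_sob ::
    "'h::complex_hilbert set \<Rightarrow> ('h \<Rightarrow> 'h) \<Rightarrow> real \<Rightarrow> ('a::topological_space \<Rightarrow> 'h) \<Rightarrow> bool" where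
  "C0_sob D H k \<psi> \<longleftrightarrow> (\<forall>x. \<psi> x \<in> sob D H k) \<and>
     (\<forall>x. ((\<lambda>y. snorm D H k (\<psi> y - \<psi> x)) \<longlongrightarrow> 0) (at x))"

definition has_sob_derivative ::
    "'h::complex_hilbert set \<Rightarrow> ('h \<Rightarrow> 'h) \<Rightarrow> real \<Rightarrow> (real \<Rightarrow> 'h) \<Rightarrow> (real \<Rightarrow> 'h) \<Rightarrow> bool" where
  "has_sob_derivative D H k \<psi> \<psi>' \<longleftrightarrow>
     (\<forall>t. ((\<lambda>h. snorm D H k ((1 / h) *\<^sub>R (\<psi> (t + h) - \<psi> t) - \<psi>' t)) \<longlongrightarrow> 0) (at 0))"

section \<open>The Schroedinger equation\<close>

text \<open>\<open>\<psi>\<close> is a global solution of \<open>i \<psi>' = L(t) \<psi>\<close>, \<open>\<psi>(s) = \<psi>\<^sub>s\<close>, continuous with values in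
  the space of index \<open>k + 2m\<close> and continuously differentiable with values in that of index \<open>k\<close>.\<close>

definition is_solution ::
    "'h::complex_hilbert set \<Rightarrow> ('h \<Rightarrow> 'h) \<Rightarrow> (real \<Rightarrow> 'h \<Rightarrow> 'h) \<Rightarrow> nat \<Rightarrow> real \<Rightarrow>
     real \<Rightarrow> 'h \<Rightarrow> (real \<Rightarrow> 'h) \<Rightarrow> bool" where
  "is_solution D H L m k s \<psi>s \<psi> \<longleftrightarrow>
     C0_sob D H (k + 2 * real m) \<psi> \<and> \<psi> s = \<psi>s \<and>
     (\<exists>\<psi>'. C0_sob D H k \<psi> \<and> C0_sob D H k \<psi>' \<and> has_sob_derivative D H k \<psi> \<psi>' \<and>
        (\<forall>t. \<i> *\<^sub>C \<psi>' t = L t (\<psi> t)))"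

definition group_property :: "'h set \<Rightarrow> (real \<Rightarrow> real \<Rightarrow> 'h \<Rightarrow> 'h) \<Rightarrow> bool" where
  "group_property S U \<longleftrightarrow>
     (\<forall>t r s. \<forall>u\<in>S. U t s u = U t r (U r s u)) \<and> (\<forall>s. \<forall>u\<in>S. U s s u = u)"

text \<open>As always for propagators of unbounded generators, continuity of \<open>(t, s) \<mapsto> U(t, s)\<close> is
  strong continuity. (It fails in operator norm already for \<open>L(t) = H\<close> unbounded.)\<close>

definition is_propagator ::
    "'h::complex_hilbert set \<Rightarrow> ('h \<Rightarrow> 'h) \<Rightarrow> (real \<Rightarrow> 'h \<Rightarrow> 'h) \<Rightarrow> nat \<Rightarrow> real \<Rightarrow>
     (real \<Rightarrow> real \<Rightarrow> 'h \<Rightarrow> 'h) \<Rightarrow> bool" where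
  "is_propagator D H L m k U \<longleftrightarrow>
     (\<forall>t s. bounded_op D H k k (U t s)) \<and>
     (\<forall>u\<in>sob D H k. C0_sob D H k (\<lambda>(t, s). U t s u)) \<and>
     (\<forall>s. \<forall>\<psi>s\<in>sob D H (k + 2 * real m).
        is_solution D H L m k s \<psi>s (\<lambda>t. U t s \<psi>s) \<and>
        (\<forall>\<phi>. is_solution D H L m k s \<psi>s \<phi> \<longrightarrow> \<phi> = (\<lambda>t. U t s \<psi>s))) \<and>
     (\<forall>t s. \<forall>\<psi>s\<in>sob D H k. norm (U t s \<psi>s) = norm \<psi>s) \<and>
     group_property (sob D H k) U \<and>
     (\<exists>C>0. \<forall>t s. op_norm D H k k (U t s) \<le> C * exp (C * \<bar>t - s\<bar>))"

end

theory Submission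
  imports Defs "HOL-Probability.Probability" "HOL-Real_Asymp.Real_Asymp"
begin

text \<open>The spectral measure of \<open>H\<close> comes from that of the positive contraction \<open>c H\<^sup>-\<^sup>1\<close>,
  whose scalar measures solve the Hausdorff moment problem for \<open>p \<mapsto> \<langle>u, p(c H\<^sup>-\<^sup>1) u\<rangle>\<close>. Let \<open>P\<^sub>N\<close>
  be the spectral projection of \<open>H\<close> onto \<open>(-\<infinity>, N]\<close>. The generators \<open>P\<^sub>N L(t) P\<^sub>N\<close> are bounded and
  symmetric, so they have unitary propagators. Writing \<open>B = [L, H] H\<^sup>-\<^sup>1\<close>, the identity
  \<open>H\<^sup>n L H\<^sup>-\<^sup>n = L - (\<Sum>j<n. H\<^sup>j B H\<^sup>-\<^sup>j)\<close> bounds the growth of \<open>\<parallel>H\<^sup>n u(t)\<parallel>\<close> uniformly in \<open>N\<close> because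
  \<open>L\<close> itself is symmetric. Since \<open>b = \<lfloor>k\<^sub>1\<rfloor> + 1\<close> exceeds \<open>m\<close>, these bounds make the approximations Cauchy
  on \<open>D(H\<^sup>b)\<close>, hence strongly convergent in \<open>\<H>\<^sup>0\<close> to a unitary propagator; interpolation carries the
  bounds to all exponents between \<open>0\<close> and \<open>b\<close>. The same identity with \<open>n = m\<close> shows that \<open>L(t) \<plusminus> \<i> \<nu>\<close>
  has dense range for large \<open>\<nu>\<close>, which is essential self-adjointness.\<close>

section \<open>Complex Hilbert spaces\<close>

text \<open>L(t) costs m powers of H: at level 0 it is only known to map D(H^m) into the base space,
  so the bounded theory cannot be applied to it directly. Truncating on both sides by P_N keeps the
  generator symmetric, and P_N commutes with all powers of H, so norm conservation and the
  conjugation identity survive with constants independent of N. Undoing the truncation costs one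
  more power of H and gains 1/N. This is why bounds at level m + 1 are wanted, and b >= m + 1
  provides them. The sum in the conjugation identity stops at j = n - 1, so control of H^j B H^-j
  for integers j <= floor(k1) reaches n = floor(k1) + 1. Continuity and differentiability at other
  levels come from trading convergence in the base norm against a bound at level b. That demands k/2
  + m < b, which k <= k1 - 4m guarantees. The detour through c H^-1 works because H >= c makes it a
  positive contraction, on which polynomials are bounded operators; the map x -> c/x carries its
  spectral measure back to H.\<close>

lemma cinner_add_left: "cinner (x + y) z = cinner x z + cinner y (z::'h::complex_hilbert)"
  by (metis cinner_add_right cinner_commute complex_cnj_add)

lemma cinner_scaleC_left: "cinner (a *\<^sub>C x) y = cnj a * cinner x (y::'h::complex_hilbert)"
  by (metis cinner_scaleC_right cinner_commute complex_cnj_mult)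

lemma cinner_scaleR_right: "cinner x (r *\<^sub>R y) = of_real r * cinner x (y::'h::complex_hilbert)"
  by (simp add: scaleR_eq_scaleC cinner_scaleC_right)

lemma cinner_scaleR_left: "cinner (r *\<^sub>R x) y = of_real r * cinner x (y::'h::complex_hilbert)"
  by (simp add: scaleR_eq_scaleC cinner_scaleC_left)

lemma scaleC_one [simp]: "1 *\<^sub>C x = (x::'h::complex_hilbert)"
  using scaleR_eq_scaleC[of 1 x] by simp

lemma scaleC_zero_left [simp]: "0 *\<^sub>C x = (0::'h::complex_hilbert)"
  using scaleR_eq_scaleC[of 0 x] by simp

lemma scaleC_zero_right [simp]: "a *\<^sub>C 0 = (0::'h::complex_hilbert)"
  using scaleC_add_right[of a 0 "0::'h"] by simp

lemma scaleC_minus_right [simp]: "a *\<^sub>C (- x) = - (a *\<^sub>C (x::'h::complex_hilbert))"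
  using scaleC_add_right[of a x "-x"] by (simp add: eq_neg_iff_add_eq_0 add.commute)

lemma scaleC_minus_left [simp]: "(- a) *\<^sub>C x = - (a *\<^sub>C (x::'h::complex_hilbert))"
  using scaleC_add_left[of a "-a" x] by (simp add: eq_neg_iff_add_eq_0 add.commute)

lemma scaleC_diff_right: "a *\<^sub>C (x - y) = a *\<^sub>C x - a *\<^sub>C (y::'h::complex_hilbert)"
  using scaleC_add_right[of a x "-y"] by simp

lemma scaleC_scaleR: "a *\<^sub>C (r *\<^sub>R x) = r *\<^sub>R (a *\<^sub>C (x::'h::complex_hilbert))"
  by (simp add: scaleR_eq_scaleC scaleC_scaleC mult.commute)

lemma cinner_zero_right [simp]: "cinner x (0::'h::complex_hilbert) = 0"
  using cinner_add_right[of x 0 0] by simp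

lemma cinner_zero_left [simp]: "cinner (0::'h::complex_hilbert) x = 0"
  using cinner_add_left[of 0 0 x] by simp

lemma cinner_minus_right [simp]: "cinner x (- y) = - cinner x (y::'h::complex_hilbert)"
  using cinner_add_right[of x y "-y"] by (simp add: eq_neg_iff_add_eq_0 add.commute)

lemma cinner_minus_left [simp]: "cinner (- x) y = - cinner x (y::'h::complex_hilbert)"
  using cinner_add_left[of x "-x" y] by (simp add: eq_neg_iff_add_eq_0 add.commute)

lemma cinner_diff_right: "cinner x (y - z) = cinner x y - cinner x (z::'h::complex_hilbert)"
  using cinner_add_right[of x y "-z"] by simp

lemma cinner_diff_left: "cinner (x - y) z = cinner x z - cinner y (z::'h::complex_hilbert)"
  using cinner_add_left[of x "-y" z] by simp

lemmas cinner_simps = cinner_add_left cinner_add_right cinner_diff_left cinner_diff_right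
  cinner_scaleC_left cinner_scaleC_right cinner_scaleR_left cinner_scaleR_right

lemma norm_sq_cinner: "(norm x)\<^sup>2 = Re (cinner x (x::'h::complex_hilbert))"
  by (simp add: cinner_self)

lemma Re_cinner_commute: "Re (cinner x y) = Re (cinner y (x::'h::complex_hilbert))"
  by (subst cinner_commute) simp

lemma norm_sq_add: "(norm (x + y))\<^sup>2 = (norm x)\<^sup>2 + 2 * Re (cinner x y) + (norm (y::'h::complex_hilbert))\<^sup>2"
  by (simp add: norm_sq_cinner cinner_simps Re_cinner_commute[of y x])

lemma norm_sq_diff: "(norm (x - y))\<^sup>2 = (norm x)\<^sup>2 - 2 * Re (cinner x y) + (norm (y::'h::complex_hilbert))\<^sup>2"
  by (simp add: norm_sq_cinner cinner_simps Re_cinner_commute[of y x])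

lemma norm_scaleC: "norm (a *\<^sub>C x) = cmod a * norm (x::'h::complex_hilbert)"
proof -
  have "cinner (a *\<^sub>C x) (a *\<^sub>C x) = (a * cnj a) * cinner x x"
    by (simp only: cinner_simps mult_ac)
  also have "\<dots> = of_real ((cmod a)\<^sup>2 * (norm x)\<^sup>2)"
    by (simp only: complex_norm_square[symmetric] cinner_self of_real_mult)
  finally have "(norm (a *\<^sub>C x))\<^sup>2 = (cmod a * norm x)\<^sup>2"
    unfolding norm_sq_cinner[of "a *\<^sub>C x"] by (simp only: Re_complex_of_real power_mult_distrib)
  then show ?thesis
    by (metis mult_nonneg_nonneg norm_ge_zero power2_eq_imp_eq)
qed

lemma parallelogram_le: "(norm (x + y))\<^sup>2 \<le> 2 * (norm x)\<^sup>2 + 2 * (norm (y::'h::complex_hilbert))\<^sup>2"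
  using norm_sq_add[of x y] norm_sq_diff[of x y] zero_le_power2[of "norm (x - y)"] by linarith

lemma Re_cinner_le: "Re (cinner x y) \<le> norm x * norm (y::'h::complex_hilbert)"
proof (cases "norm x = 0 \<or> norm y = 0")
  case False
  then have p: "norm x > 0" "norm y > 0" by auto
  \<comment> \<open>With this factor a x and y have equal norms, so the square of their distance is
    2a times the difference of the two sides of the claim.\<close>
  define a where "a = norm y / norm x"
  have "0 \<le> (norm (a *\<^sub>R x - y))\<^sup>2" by simp
  also have "\<dots> = a\<^sup>2 * (norm x)\<^sup>2 - 2 * a * Re (cinner x y) + (norm y)\<^sup>2"
    by (simp add: norm_sq_diff cinner_simps power_mult_distrib)
  also have "\<dots> = 2 * a * (norm x * norm y - Re (cinner x y))"
    using p by (simp add: a_def field_simps power2_eq_square)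
  finally have "0 \<le> a * (norm x * norm y - Re (cinner x y))" by simp
  moreover have "a > 0" using p by (simp add: a_def)
  ultimately show ?thesis by (simp add: zero_le_mult_iff)
qed auto

lemma cinner_le: "cmod (cinner x y) \<le> norm x * norm (y::'h::complex_hilbert)"
proof (cases "cinner x y = 0")
  case False
  \<comment> \<open>A phase that turns the inner product into its modulus and reduces the claim to
    real parts.\<close>
  define a where "a = cnj (cinner x y) / cmod (cinner x y)"
  have "cinner x (a *\<^sub>C y) = cinner x y * cnj (cinner x y) / cmod (cinner x y)"
    by (simp add: a_def cinner_scaleC_right)
  also have "\<dots> = of_real (cmod (cinner x y))"
    unfolding complex_norm_square[symmetric] using False by (simp add: power2_eq_square)
  finally have "cmod (cinner x y) = Re (cinner x (a *\<^sub>C y))" by simp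
  also have "\<dots> \<le> norm x * norm (a *\<^sub>C y)" by (rule Re_cinner_le)
  also have "norm (a *\<^sub>C y) = norm y" using False by (simp add: norm_scaleC a_def norm_divide del: of_real_power)
  finally show ?thesis .
qed auto

lemma bounded_bilinear_cinner: "bounded_bilinear (cinner :: 'h::complex_hilbert \<Rightarrow> 'h \<Rightarrow> complex)"
proof
  show "\<exists>K. \<forall>a b. cmod (cinner a (b::'h)) \<le> norm a * norm b * K"
    by (rule exI[of _ 1]) (simp add: cinner_le)
qed (auto simp: cinner_simps scaleR_conv_of_real)

lemmas tendsto_cinner = bounded_bilinear.tendsto[OF bounded_bilinear_cinner]

lemma bounded_linear_scaleC: "bounded_linear (\<lambda>x::'h::complex_hilbert. a *\<^sub>C x)"
  by (rule bounded_linear_intro[of _ "cmod a"])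
    (auto simp: scaleC_add_right scaleC_scaleR norm_scaleC)

lemmas tendsto_scaleC = bounded_linear.tendsto[OF bounded_linear_scaleC]

lemma csubspaceD:
  assumes "csubspace S"
  shows "0 \<in> S" "\<And>x y. x \<in> S \<Longrightarrow> y \<in> S \<Longrightarrow> x + y \<in> S" "\<And>a x. x \<in> S \<Longrightarrow> a *\<^sub>C x \<in> S"
    "\<And>x y. x \<in> S \<Longrightarrow> y \<in> S \<Longrightarrow> x - y \<in> S" "\<And>r x. x \<in> S \<Longrightarrow> r *\<^sub>R x \<in> S"
proof -
  show "0 \<in> S" "\<And>x y. x \<in> S \<Longrightarrow> y \<in> S \<Longrightarrow> x + y \<in> S" and sc: "\<And>a x. x \<in> S \<Longrightarrow> a *\<^sub>C x \<in> S"
    using assms by (auto simp: csubspace_def)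
  show "x - y \<in> S" if "x \<in> S" "y \<in> S" for x y
  proof -
    have "x + (-1) *\<^sub>C y \<in> S" using assms that unfolding csubspace_def by blast
    then show ?thesis by simp
  qed
  show "r *\<^sub>R x \<in> S" if "x \<in> S" for r x using sc[OF that] by (simp add: scaleR_eq_scaleC)
qed

lemma clinear_onD:
  assumes "clinear_on S A"
  shows "csubspace S" "\<And>x y. x \<in> S \<Longrightarrow> y \<in> S \<Longrightarrow> A (x + y) = A x + A y"
    "\<And>a x. x \<in> S \<Longrightarrow> A (a *\<^sub>C x) = a *\<^sub>C A x" "A 0 = 0"
    "\<And>x y. x \<in> S \<Longrightarrow> y \<in> S \<Longrightarrow> A (x - y) = A x - A y"
    "\<And>r x. x \<in> S \<Longrightarrow> A (r *\<^sub>R x) = r *\<^sub>R A x"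
proof -
  show S: "csubspace S" and add: "\<And>x y. x \<in> S \<Longrightarrow> y \<in> S \<Longrightarrow> A (x + y) = A x + A y"
    and sc: "\<And>a x. x \<in> S \<Longrightarrow> A (a *\<^sub>C x) = a *\<^sub>C A x"
    using assms by (auto simp: clinear_on_def)
  show "A 0 = 0" using sc[of 0 0] csubspaceD[OF S] by simp
  show "A (x - y) = A x - A y" if "x \<in> S" "y \<in> S" for x y
    using add[of "x - y" y] csubspaceD(4)[OF S that] that by simp
  show "A (r *\<^sub>R x) = r *\<^sub>R A x" if "x \<in> S" for r x
    using sc[OF that] by (simp add: scaleR_eq_scaleC)
qed

lemma clinear_onI:
  assumes "csubspace S" "\<And>x y. x \<in> S \<Longrightarrow> y \<in> S \<Longrightarrow> A (x + y) = A x + A y"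
    "\<And>a x. x \<in> S \<Longrightarrow> A (a *\<^sub>C x) = a *\<^sub>C A x"
  shows "clinear_on S A"
  using assms by (auto simp: clinear_on_def)

lemma csubspace_UNIV [simp]: "csubspace UNIV"
  by (simp add: csubspace_def)

lemma clinear_on_subset: "clinear_on S A \<Longrightarrow> csubspace T \<Longrightarrow> T \<subseteq> S \<Longrightarrow> clinear_on T A"
  unfolding clinear_on_def by blast

lemma clinear_bounded_linear:
  assumes "clinear_on UNIV A" "\<And>u. norm (A u) \<le> M * norm u"
  shows "bounded_linear (A::'h::complex_hilbert \<Rightarrow> 'h)"
  using clinear_onD[OF assms(1)] assms(2)
  by (intro bounded_linear_intro[of _ M]) (auto simp: mult.commute)

text \<open>Polarization: u + v yields the sum of <u, A v> and <v, A u>, and u + i v their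
  difference. Complex scalars are essential, since a quarter turn of the real plane has zero
  quadratic form.\<close>

lemma polarization_zero:
  assumes A: "clinear_on S A" and z: "\<And>u. u \<in> S \<Longrightarrow> cinner u (A u) = 0"
    and uv: "u \<in> S" "v \<in> S"
  shows "cinner u (A (v::'h::complex_hilbert)) = 0"
proof -
  note l = clinear_onD[OF A] and s = csubspaceD[OF clinear_onD(1)[OF A]]
  have 1: "cinner u (A v) + cinner v (A u) = 0"
    using z[of "u + v"] z[of u] z[of v] uv s l by (simp add: cinner_simps add.commute)
  have iv: "\<i> *\<^sub>C v \<in> S" using uv s by auto
  have "cinner u (A (\<i> *\<^sub>C v)) + cinner (\<i> *\<^sub>C v) (A u) = 0"
    using z[of "u + \<i> *\<^sub>C v"] z[of u] z[OF iv] uv s l iv by (simp add: cinner_simps)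
  then have "\<i> * (cinner u (A v) - cinner v (A u)) = 0"
    using l uv by (simp add: cinner_simps algebra_simps)
  then have "cinner u (A v) = cinner v (A u)" by simp
  with 1 show ?thesis by simp
qed

lemma dense_orthogonal_zero:
  assumes "closure S = UNIV" "\<And>u. u \<in> S \<Longrightarrow> cinner u (v::'h::complex_hilbert) = 0"
  shows "v = 0"
proof -
  have "v \<in> closure S" using assms by auto
  then obtain s where s: "\<And>n. s n \<in> S" "s \<longlonglongrightarrow> v" by (auto simp: closure_sequential)
  have "(\<lambda>n. cinner (s n) v) \<longlonglongrightarrow> cinner v v" by (intro tendsto_cinner s tendsto_const)
  then have "cinner v v = 0" using assms(2) s(1) by (simp add: LIMSEQ_const_iff)
  then show ?thesis by (simp add: cinner_self)
qed

text \<open>The way operators are identified throughout: spectral measures prescribe quadratic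
  forms, and on a dense domain the form fixes the values.\<close>

lemma quadratic_form_determines:
  assumes "clinear_on S A" "clinear_on S B" "closure S = UNIV"
    and "\<And>u. u \<in> S \<Longrightarrow> cinner u (A u) = cinner u (B u)" and "v \<in> S"
  shows "A v = (B v::'h::complex_hilbert)"
proof -
  have "clinear_on S (\<lambda>u. A u - B u)"
    using assms(1,2) by (auto simp: clinear_on_def scaleC_diff_right)
  then have "cinner u (A v - B v) = 0" if "u \<in> S" for u
    using polarization_zero[of S "\<lambda>u. A u - B u" u v] assms(4,5) that by (auto simp: cinner_simps)
  then show ?thesis using dense_orthogonal_zero[OF assms(3), of "A v - B v"] by auto
qed

text \<open>The vector is x minus its nearest point in S, found as the limit of a minimizing
  sequence.\<close>

lemma orthogonal_complement_exists:
  fixes S :: "'h::complex_hilbert set"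
  assumes S: "csubspace S" "closed S" and x: "x \<notin> S"
  obtains v where "v \<noteq> 0" "\<And>u. u \<in> S \<Longrightarrow> cinner v u = 0"
proof -
  note s = csubspaceD[OF S(1)]
  define d where "d = infdist x S"
  have ne: "S \<noteq> {}" using s by auto
  have "\<exists>y\<in>S. dist x y < d + 1 / Suc n" for n
  proof (rule ccontr)
    assume "\<not> ?thesis"
    then have "d + 1 / Suc n \<le> infdist x S" using ne
      unfolding infdist_def by (auto intro!: cINF_greatest simp: not_less)
    then show False by (simp add: d_def add_increasing2 field_simps)
  qed
  then obtain y where y: "\<And>n. y n \<in> S" "\<And>n. dist x (y n) < d + 1 / Suc n" by metis
  have dle: "d \<le> norm (x - z)" if "z \<in> S" for z
    using infdist_le[OF that, of x] by (simp add: d_def dist_norm)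
  have d0: "0 \<le> d" by (simp add: d_def infdist_nonneg)
  \<comment> \<open>Parallelogram identity: the midpoint of \<open>y i\<close> and
    \<open>y j\<close> lies in S, so its distance from x is at least d.\<close>
  have est: "(norm (y i - y j))\<^sup>2 \<le> 2 * (d + 1 / Suc i)\<^sup>2 + 2 * (d + 1 / Suc j)\<^sup>2 - 4 * d\<^sup>2" for i j
  proof -
    have "(1/2) *\<^sub>R (y i + y j) \<in> S" using s y by auto
    then have "d \<le> norm (x - (1/2) *\<^sub>R (y i + y j))" by (rule dle)
    also have "x - (1/2) *\<^sub>R (y i + y j) = (1/2) *\<^sub>R ((x - y i) + (x - y j))"
      by (simp add: scaleR_add_right scaleR_diff_right) (metis scaleR_half_double scaleR_add_right)
    finally have "2 * d \<le> norm ((x - y i) + (x - y j))" by simp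
    then have "(2 * d)\<^sup>2 \<le> (norm ((x - y i) + (x - y j)))\<^sup>2" using d0 by (intro power_mono) auto
    moreover have "(norm (y i - y j))\<^sup>2 = 2 * (norm (x - y i))\<^sup>2 + 2 * (norm (x - y j))\<^sup>2
        - (norm ((x - y i) + (x - y j)))\<^sup>2"
      using norm_sq_add[of "x - y i" "x - y j"] norm_sq_diff[of "x - y i" "x - y j"]
      by (simp add: norm_minus_commute)
    moreover have "(norm (x - y k))\<^sup>2 \<le> (d + 1 / Suc k)\<^sup>2" for k
      using y(2)[of k] by (intro power_mono) (auto simp: dist_norm)
    ultimately show ?thesis
      by (smt (verit) power_mult_distrib four_x_squared)
  qed
  have lim: "(\<lambda>i. 1 / real (Suc i)) \<longlonglongrightarrow> 0" by (rule LIMSEQ_Suc[OF lim_1_over_n])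
  have "Cauchy y"
  proof (rule metric_CauchyI)
    fix e :: real assume e: "0 < e"
    have "(\<lambda>i. 4 * (d + 1 / Suc i)\<^sup>2 - 4 * d\<^sup>2) \<longlonglongrightarrow> 4 * (d + 0)\<^sup>2 - 4 * d\<^sup>2"
      by (intro tendsto_intros lim)
    then have "\<forall>\<^sub>F i in sequentially. 4 * (d + 1 / Suc i)\<^sup>2 - 4 * d\<^sup>2 < e\<^sup>2"
      by (rule order_tendstoD) (use e in auto)
    then obtain N where N: "4 * (d + 1 / Suc N)\<^sup>2 - 4 * d\<^sup>2 < e\<^sup>2"
      by (auto simp: eventually_sequentially)
    show "\<exists>M. \<forall>m\<ge>M. \<forall>n\<ge>M. dist (y m) (y n) < e"
    proof (intro exI[of _ N] allI impI)
      fix i j assume "N \<le> i" "N \<le> j"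
      then have "(d + 1 / Suc i)\<^sup>2 \<le> (d + 1 / Suc N)\<^sup>2" "(d + 1 / Suc j)\<^sup>2 \<le> (d + 1 / Suc N)\<^sup>2"
        using d0 by (auto intro!: power_mono add_left_mono simp: frac_le)
      then have "(norm (y i - y j))\<^sup>2 < e\<^sup>2" using est[of i j] N by linarith
      then show "dist (y i) (y j) < e" using e by (simp add: dist_norm power_less_imp_less_base)
    qed
  qed
  then obtain z where z: "y \<longlonglongrightarrow> z" by (auto simp: Cauchy_convergent_iff convergent_def)
  have zS: "z \<in> S" using closed_sequentially[OF S(2)] y(1) z by blast
  have "norm (x - z) \<le> d"
  proof (rule LIMSEQ_le)
    show "(\<lambda>n. norm (x - y n)) \<longlonglongrightarrow> norm (x - z)" by (intro tendsto_intros z)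
    show "(\<lambda>n. d + 1 / real (Suc n)) \<longlonglongrightarrow> d"
      using tendsto_add[OF tendsto_const[of d] lim] by simp
    show "\<exists>N. \<forall>n\<ge>N. norm (x - y n) \<le> d + 1 / real (Suc n)"
      using y(2) by (auto simp: dist_norm intro!: less_imp_le)
  qed
  then have min: "(norm (x - z))\<^sup>2 \<le> (norm (x - z - w))\<^sup>2" if "w \<in> S" for w
    using dle[of "z + w"] s(2)[OF zS that] by (intro power_mono) (auto simp: algebra_simps)
  show ?thesis
  proof
    show "x - z \<noteq> 0" using x zS by auto
    fix u assume u: "u \<in> S"
    define a where "a = cinner u (x - z)"
    show "cinner (x - z) u = 0"
    proof (rule ccontr)
      assume "cinner (x - z) u \<noteq> 0"
      then have a0: "a \<noteq> 0" by (metis a_def cinner_commute complex_cnj_zero)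
      have u0: "u \<noteq> 0" using \<open>cinner (x - z) u \<noteq> 0\<close> by auto
      \<comment> \<open>With this r, \<open>b *\<^sub>C u\<close> is the projection of x - z onto
        the line through u; subtracting it would bring the point closer to x.\<close>
      define r where "r = 1 / (norm u)\<^sup>2"
      have r: "r > 0" using u0 by (simp add: r_def)
      define b where "b = of_real r * a"
      have "(norm (x - z))\<^sup>2 \<le> (norm (x - z - b *\<^sub>C u))\<^sup>2" using s u by (intro min) auto
      also have "\<dots> = (norm (x - z))\<^sup>2 - 2 * Re (b * cnj a) + (cmod b)\<^sup>2 * (norm u)\<^sup>2"
        by (simp add: norm_sq_diff[of "x - z"] cinner_scaleC_right a_def norm_scaleC power_mult_distrib
            cinner_commute[of u "x - z"])
      also have "b * cnj a = of_real (r * (cmod a)\<^sup>2)"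
        by (simp add: b_def complex_norm_square mult.assoc del: of_real_power)
      also have "(cmod b)\<^sup>2 * (norm u)\<^sup>2 = r * (cmod a)\<^sup>2"
        using u0 r by (simp add: b_def norm_mult norm_divide r_def field_simps power2_eq_square)
      finally have "r * (cmod a)\<^sup>2 \<le> 0" by simp
      moreover have "r * (cmod a)\<^sup>2 > 0" using r a0 by simp
      ultimately show False by simp
    qed
  qed
qed

text \<open>Serves twice: for the range of H, and for the range of a closed symmetric operator
  shifted by an imaginary number.\<close>

lemma range_dense_onto:
  fixes S :: "'h::complex_hilbert set"
  assumes "csubspace S" "closed S" "\<And>v. (\<And>u. u \<in> S \<Longrightarrow> cinner v u = 0) \<Longrightarrow> v = 0"
  shows "S = UNIV"
  using orthogonal_complement_exists[OF assms(1,2)] assms(3) by (metis UNIV_eq_I)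

section \<open>The Hausdorff moment problem\<close>

lemma poly_sum_monomials: "p = (\<Sum>i\<le>degree p. smult (coeff p i) ([:0, 1::real:] ^ i))"
  by (subst poly_as_sum_of_monoms[symmetric]) (simp add: monom_altdef)

text \<open>Hausdorff's complete monotonicity, phrased for a functional instead of iterated
  differences: \<open>\<Lambda>\<close> is to be nonnegative on the products from which the
  Bernstein polynomials are built.\<close>

definition positive_functional :: "(real poly \<Rightarrow> real) \<Rightarrow> bool" where
  "positive_functional \<Lambda> \<longleftrightarrow> (\<forall>p q. \<Lambda> (p + q) = \<Lambda> p + \<Lambda> q) \<and> (\<forall>c p. \<Lambda> (smult c p) = c * \<Lambda> p) \<and>
     (\<forall>k l. 0 \<le> \<Lambda> ([:0, 1:] ^ k * [:1, -1:] ^ l))"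

lemma positive_functionalD:
  assumes "positive_functional \<Lambda>"
  shows "\<Lambda> (p + q) = \<Lambda> p + \<Lambda> q" "\<Lambda> (smult c p) = c * \<Lambda> p"
    "0 \<le> \<Lambda> ([:0, 1:] ^ k * [:1, -1:] ^ l)" "\<Lambda> (\<Sum>i\<in>I. f i) = (\<Sum>i\<in>I. \<Lambda> (f i))"
proof -
  show *: "\<Lambda> (p + q) = \<Lambda> p + \<Lambda> q" and sm: "\<Lambda> (smult c p) = c * \<Lambda> p" for p q c
    using assms by (auto simp: positive_functional_def)
  show "0 \<le> \<Lambda> ([:0, 1:] ^ k * [:1, -1:] ^ l)"
    using assms by (auto simp: positive_functional_def)
  have "\<Lambda> 0 = 0" using sm[of 0 0] by simp
  then show "\<Lambda> (\<Sum>i\<in>I. f i) = (\<Sum>i\<in>I. \<Lambda> (f i))"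
    by (induction I rule: infinite_finite_induct) (auto simp: *)
qed

text \<open>\<open>\<Lambda>\<close> at the k-th Bernstein polynomial of degree n, taken as the mass
  of the point k / n.\<close>

definition bernstein_weight :: "(real poly \<Rightarrow> real) \<Rightarrow> nat \<Rightarrow> nat \<Rightarrow> real" where
  "bernstein_weight \<Lambda> n k = real (n choose k) * \<Lambda> ([:0, 1:] ^ k * [:1, -1:] ^ (n - k))"

lemma bernstein_weight_nonneg: "positive_functional \<Lambda> \<Longrightarrow> 0 \<le> bernstein_weight \<Lambda> n k"
  by (simp add: bernstein_weight_def positive_functionalD)

text \<open>Partition of unity: expand (X + (1 - X))^n.\<close>

lemma sum_bernstein_weight:
  assumes "positive_functional \<Lambda>"
  shows "(\<Sum>k\<le>n. bernstein_weight \<Lambda> n k) = \<Lambda> 1"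
proof -
  have "[:0, 1:] + [:1, -1::real:] = 1" by (simp add: one_pCons)
  then have "1 = ([:0, 1:] + [:1, -1::real:]) ^ n" by (simp only: power_one)
  also have "\<dots> = (\<Sum>k\<le>n. smult (real (n choose k)) ([:0, 1:] ^ k * [:1, -1:] ^ (n - k)))"
    unfolding binomial_ring by (intro sum.cong) (auto simp: of_nat_poly)
  finally have "\<Lambda> 1 = \<Lambda> (\<Sum>k\<le>n. smult (real (n choose k)) ([:0, 1:] ^ k * [:1, -1:] ^ (n - k)))"
    by simp
  then show ?thesis
    by (simp add: positive_functionalD[OF assms] bernstein_weight_def)
qed

text \<open>The shifts \<open>a\<close> and \<open>b\<close> make the induction on \<open>j\<close> go through: by
  \<open>k \<cdot> (n choose k) = n \<cdot> (n - 1 choose k - 1)\<close> one factor \<open>k / n\<close> is absorbed into the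
  functional \<open>p \<mapsto> \<Lambda> (X p)\<close>.\<close>

lemma bernstein_moment_limit:
  assumes "positive_functional \<Lambda>"
  shows "(\<lambda>n. \<Sum>k\<le>n. (real (k + a) / real (n + b)) ^ j * bernstein_weight \<Lambda> n k)
    \<longlonglongrightarrow> \<Lambda> ([:0, 1:] ^ j)"
  using assms
proof (induction j arbitrary: \<Lambda> a b)
  case 0
  then show ?case by (simp add: sum_bernstein_weight one_pCons[symmetric])
next
  case (Suc j)
  define S where "S n = (\<Sum>k\<le>n. (real (k + a) / real (n + b)) ^ j * bernstein_weight \<Lambda> n k)" for n
  define \<Lambda>' where "\<Lambda>' p = \<Lambda> ([:0, 1:] * p)" for p
  note l = positive_functionalD[OF Suc.prems]
  have \<Lambda>': "positive_functional \<Lambda>'"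
    unfolding positive_functional_def
  proof (intro conjI allI)
    show "0 \<le> \<Lambda>' ([:0, 1:] ^ k * [:1, - 1:] ^ l')" for k l'
      using l(3)[of "Suc k" l'] by (simp add: \<Lambda>'_def mult.assoc del: mult_pCons_left)
    show "\<Lambda>' (p + q) = \<Lambda>' p + \<Lambda>' q" for p q
      by (simp add: \<Lambda>'_def distrib_left l del: mult_pCons_left)
    show "\<Lambda>' (smult c p) = c * \<Lambda>' p" for c p
      by (simp add: \<Lambda>'_def l mult_smult_right del: mult_pCons_left)
  qed
  define T where "T n = (\<Sum>k\<le>n. (real (k + a) / real (n + b)) ^ j * (real k / real (n + b))
      * bernstein_weight \<Lambda> n k)" for n
  \<comment> \<open>One factor k + a is split into k and a; the second part carries the vanishing
    weight a / (n + b) times a convergent sum.\<close>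
  have split: "(\<Sum>k\<le>n. (real (k + a) / real (n + b)) ^ Suc j * bernstein_weight \<Lambda> n k)
      = T n + real a / real (n + b) * S n" for n
    unfolding T_def S_def sum_distrib_left sum.distrib[symmetric]
    by (intro sum.cong) (auto simp: add_divide_distrib algebra_simps)
  have c0: "(\<lambda>n. real a / real (n + b)) \<longlonglongrightarrow> 0"
    by (rule LIMSEQ_ignore_initial_segment[OF lim_const_over_n])
  have 2: "(\<lambda>n. real a / real (n + b) * S n) \<longlonglongrightarrow> 0"
    using tendsto_mult[OF c0 Suc.IH[OF Suc.prems, of a b]] by (simp add: S_def)
  have "T (Suc n) = real (Suc n) / real (Suc n + b) *
      (\<Sum>k\<le>n. (real (k + Suc a) / real (n + Suc b)) ^ j * bernstein_weight \<Lambda>' n k)" for n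
  proof -
    have "T (Suc n) = (\<Sum>k\<le>n. (real (Suc k + a) / real (Suc n + b)) ^ j
        * (real (Suc k) / real (Suc n + b)) * bernstein_weight \<Lambda> (Suc n) (Suc k))"
      unfolding T_def by (subst sum.atMost_Suc_shift) simp
    also have "\<dots> = (\<Sum>k\<le>n. real (Suc n) / real (Suc n + b) *
        ((real (k + Suc a) / real (n + Suc b)) ^ j * bernstein_weight \<Lambda>' n k))"
    proof (intro sum.cong refl)
      fix k assume "k \<in> {..n}"
      have "real (Suc k) * real (Suc n choose Suc k) = real (Suc n) * real (n choose k)"
        by (metis Suc_times_binomial of_nat_mult)
      then have "real (Suc k) * bernstein_weight \<Lambda> (Suc n) (Suc k)
          = real (Suc n) * bernstein_weight \<Lambda>' n k"
        by (simp add: bernstein_weight_def \<Lambda>'_def mult.assoc[symmetric] del: mult_pCons_left)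
      then have "(x * (real (Suc k) / y)) * bernstein_weight \<Lambda> (Suc n) (Suc k)
          = real (Suc n) / y * (x * bernstein_weight \<Lambda>' n k)" for x y
        by (metis (no_types, opaque_lifting) mult.assoc mult.commute times_divide_eq_left)
      from this[of "(real (Suc k + a) / real (Suc n + b)) ^ j" "real (Suc n + b)"]
      show "(real (Suc k + a) / real (Suc n + b)) ^ j * (real (Suc k) / real (Suc n + b))
          * bernstein_weight \<Lambda> (Suc n) (Suc k) = real (Suc n) / real (Suc n + b) *
        ((real (k + Suc a) / real (n + Suc b)) ^ j * bernstein_weight \<Lambda>' n k)"
        by simp
    qed
    finally show ?thesis by (simp only: sum_distrib_left)
  qed
  moreover have \<Lambda>'_pow: "\<Lambda>' ([:0, 1:] ^ j) = \<Lambda> ([:0, 1:] ^ Suc j)"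
    by (simp add: \<Lambda>'_def del: mult_pCons_left)
  have "(\<lambda>n. real (Suc n) / real (Suc n + b)) \<longlonglongrightarrow> 1"
    by real_asymp
  from tendsto_mult[OF this Suc.IH[OF \<Lambda>', of "Suc a" "Suc b"]]
  have "(\<lambda>n. real (Suc n) / real (Suc n + b) * (\<Sum>k\<le>n. (real (k + Suc a) / real (n + Suc b)) ^ j
      * bernstein_weight \<Lambda>' n k)) \<longlonglongrightarrow> \<Lambda> ([:0, 1:] ^ Suc j)"
    by (simp only: \<Lambda>'_pow mult_1_left)
  ultimately have "(\<lambda>n. T (Suc n)) \<longlonglongrightarrow> \<Lambda> ([:0, 1:] ^ Suc j)" by simp
  then have "T \<longlonglongrightarrow> \<Lambda> ([:0, 1:] ^ Suc j)" by (rule LIMSEQ_imp_Suc)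
  from tendsto_add[OF this 2] show ?case by (simp only: split add_0_right)
qed

definition bernstein_measure :: "(real poly \<Rightarrow> real) \<Rightarrow> nat \<Rightarrow> real measure" where
  "bernstein_measure \<Lambda> n = distr (point_measure {..n} (\<lambda>k. ennreal (bernstein_weight \<Lambda> n k)))
     borel (\<lambda>k. real k / real n)"

lemma integral_bernstein_measure:
  assumes "positive_functional \<Lambda>" and [measurable]: "f \<in> borel_measurable borel"
  shows "integral\<^sup>L (bernstein_measure \<Lambda> n) f = (\<Sum>k\<le>n. f (real k / real n) * bernstein_weight \<Lambda> n k)"
  unfolding bernstein_measure_def
  by (subst integral_distr)
    (auto simp: lebesgue_integral_point_measure_finite bernstein_weight_nonneg[OF assms(1)] mult.commute)

lemma real_distribution_bernstein_measure:
  assumes "positive_functional \<Lambda>" "\<Lambda> 1 = 1"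
  shows "real_distribution (bernstein_measure \<Lambda> n)"
proof -
  interpret prob_space "point_measure {..n} (\<lambda>k. ennreal (bernstein_weight \<Lambda> n k))"
    using sum_bernstein_weight[OF assms(1), of n] assms(2)
    by (intro prob_spaceI)
      (simp add: space_point_measure emeasure_point_measure_finite sum_ennreal bernstein_weight_nonneg[OF assms(1)])
  show ?thesis unfolding bernstein_measure_def by (rule real_distribution_distr) auto
qed

text \<open>The measures with masses \<open>bernstein_weight\<close> at the points k / n sit on
  [0, 1], so a subsequence converges weakly; the convergence of their moments identifies those of
  the limit.\<close>

theorem hausdorff_moment:
  assumes \<Lambda>: "positive_functional \<Lambda>" "\<Lambda> 1 = 1"
  obtains M where "real_distribution M" "AE x in M. 0 \<le> x \<and> x \<le> 1"
    "\<And>p. integral\<^sup>L M (poly p) = \<Lambda> p"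
proof -
  note l = positive_functionalD[OF \<Lambda>(1)]
  define \<mu> where "\<mu> = bernstein_measure \<Lambda>"
  have rd: "real_distribution (\<mu> n)" for n
    unfolding \<mu>_def by (rule real_distribution_bernstein_measure[OF \<Lambda>])
  have int: "integral\<^sup>L (\<mu> n) f = (\<Sum>k\<le>n. f (real k / real n) * bernstein_weight \<Lambda> n k)"
    if "f \<in> borel_measurable borel" for f n
    unfolding \<mu>_def by (rule integral_bernstein_measure[OF \<Lambda>(1) that])
  have le1: "real k / real n \<le> 1" if "k \<le> n" for k n using that by (cases "n = 0") (simp_all add: divide_simps)
  have gtm1: "-1 < real k / real n" for k n by (rule less_le_trans[of _ 0]) auto
  have "tight \<mu>"
    unfolding tight_def
  proof (intro conjI allI impI rd)
    fix e :: real assume e: "0 < e"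
    \<comment> \<open>Tightness is phrased with half-open intervals; starting at -1 includes a
      possible atom at 0.\<close>
    have "measure (\<mu> n) {-1<..1} = 1" for n
    proof -
      interpret real_distribution "\<mu> n" by (rule rd)
      have "measure (\<mu> n) {-1<..1} = integral\<^sup>L (\<mu> n) (indicator {-1<..1})" by simp
      also have "\<dots> = (\<Sum>k\<le>n. bernstein_weight \<Lambda> n k)"
        by (subst int, simp, intro sum.cong refl) (use le1 gtm1 in \<open>simp only: indicator_def greaterThanAtMost_iff atMost_iff simp_thms if_True mult_1_left of_bool_eq\<close>)
      finally show ?thesis by (simp add: sum_bernstein_weight[OF \<Lambda>(1)] \<Lambda>(2))
    qed
    then show "\<exists>a b. a < b \<and> (\<forall>n. 1 - e < measure (\<mu> n) {a<..b})"
      using e by (intro exI[of _ "-1"] exI[of _ 1]) auto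
  qed
  then obtain r M where r: "strict_mono r" and M: "real_distribution M"
    and w: "weak_conv_m (\<mu> \<circ> id \<circ> r) M"
    using tight_imp_convergent_subsubsequence[of \<mu> id] by (auto simp: strict_mono_def)
  interpret M: real_distribution M by (rule M)
  have conv: "(\<lambda>n. integral\<^sup>L (\<mu> (r n)) f) \<longlonglongrightarrow> integral\<^sup>L M f"
    if "\<And>x. isCont f x" "\<And>x. norm (f x) \<le> B" for f :: "real \<Rightarrow> real" and B
    using weak_conv_imp_integral_bdd_continuous_conv[of "\<mu> \<circ> id \<circ> r" M f B] rd M w that by (simp add: o_def)
  \<comment> \<open>Bounded, continuous and zero exactly on [0, 1]: its vanishing integral survives
    the weak limit and confines M to the interval.\<close>
  define g where "g x = min 1 (max (x - 1) (max (- x) 0))" for x :: real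
  have cg: "isCont g x" for x unfolding g_def by (intro continuous_intros)
  have gm [measurable]: "g \<in> borel_measurable borel"
    by (intro borel_measurable_continuous_onI continuous_at_imp_continuous_on) (auto simp: cg)
  have g1: "norm (g x) \<le> 1" for x by (auto simp: g_def)
  have "integral\<^sup>L (\<mu> n) g = 0" for n
    by (subst int) (auto intro!: sum.neutral simp: g_def le1 max_def)
  then have "(\<lambda>n. 0) \<longlonglongrightarrow> integral\<^sup>L M g" using conv[OF cg g1] by simp
  then have "integral\<^sup>L M g = 0" by (rule LIMSEQ_unique[OF _ tendsto_const])
  moreover have "integrable M g" using g1 by (intro M.integrable_const_bound[of _ 1]) auto
  moreover have "g x \<ge> 0" for x by (auto simp: g_def)
  ultimately have "AE x in M. g x = 0"
    by (subst (asm) integral_nonneg_eq_0_iff_AE) auto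
  then have AE: "AE x in M. 0 \<le> x \<and> x \<le> 1"
    by (rule AE_mp) (auto simp: g_def min_def max_def split: if_splits)
  have mom: "integrable M (\<lambda>x. x ^ j)" "integral\<^sup>L M (\<lambda>x. x ^ j) = \<Lambda> ([:0, 1:] ^ j)" for j
  proof -
    \<comment> \<open>The power is clamped outside [0, 1], because weak convergence tests bounded
      continuous functions.\<close>
    define f where "f x = (max 0 (min 1 x)) ^ j" for x :: real
    have cf: "isCont f x" for x unfolding f_def by (intro continuous_intros)
    have fm [measurable]: "f \<in> borel_measurable borel"
      by (intro borel_measurable_continuous_onI continuous_at_imp_continuous_on) (auto simp: cf)
    have f1: "norm (f x) \<le> 1" for x by (auto simp: f_def intro!: power_le_one)
    have eq: "AE x in M. x ^ j = f x" using AE by (rule AE_mp) (auto simp: f_def)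
    show "integrable M (\<lambda>x. x ^ j)"
      using AE by (intro M.integrable_const_bound[of _ 1]) (auto elim!: AE_mp intro!: power_le_one)
    have "integral\<^sup>L (\<mu> n) f = (\<Sum>k\<le>n. (real (k + 0) / real (n + 0)) ^ j * bernstein_weight \<Lambda> n k)" for n
      by (subst int) (auto intro!: sum.cong simp: f_def le1)
    then have "(\<lambda>n. integral\<^sup>L (\<mu> n) f) \<longlonglongrightarrow> \<Lambda> ([:0, 1:] ^ j)"
      using bernstein_moment_limit[OF \<Lambda>(1), of 0 0 j] by simp
    from LIMSEQ_subseq_LIMSEQ[OF this r] conv[OF cf f1]
    have "integral\<^sup>L M f = \<Lambda> ([:0, 1:] ^ j)" by (auto simp: o_def intro: LIMSEQ_unique)
    moreover have "integral\<^sup>L M (\<lambda>x. x ^ j) = integral\<^sup>L M f"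
      by (rule integral_cong_AE) (use eq in auto)
    ultimately show "integral\<^sup>L M (\<lambda>x. x ^ j) = \<Lambda> ([:0, 1:] ^ j)" by simp
  qed
  have "integral\<^sup>L M (poly p) = \<Lambda> p" for p
  proof -
    have "integral\<^sup>L M (poly p) = (\<Sum>i\<le>degree p. coeff p i * integral\<^sup>L M (\<lambda>x. x ^ i))"
      unfolding poly_altdef by (simp add: mom(1) Bochner_Integration.integral_sum)
    also have "\<dots> = \<Lambda> (\<Sum>i\<le>degree p. smult (coeff p i) ([:0, 1:] ^ i))"
      by (simp add: l mom(2))
    finally show ?thesis by (simp only: poly_sum_monomials[symmetric])
  qed
  with M AE show ?thesis by (rule that)
qed

section \<open>Mean-square approximation of indicators by polynomials\<close>

lemma open_outer_approx:
  assumes "finite_measure \<nu>" "sets \<nu> = sets (borel::real measure)" "A \<in> sets borel" "e > 0"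
  obtains U where "open U" "A \<subseteq> U" "measure \<nu> (U - A) < e"
proof -
  interpret finite_measure \<nu> by fact
  have "emeasure \<nu> A < ennreal (measure \<nu> A + e)"
    using assms(4) by (simp add: emeasure_eq_measure ennreal_less_iff)
  then have "(INF U \<in> {U. A \<subseteq> U \<and> open U}. emeasure \<nu> U) < ennreal (measure \<nu> A + e)"
    using outer_regular[OF assms(2) _ assms(3)] by (simp add: emeasure_eq_measure)
  then obtain U where U: "A \<subseteq> U" "open U" "emeasure \<nu> U < ennreal (measure \<nu> A + e)"
    by (auto simp: INF_less_iff)
  then have "measure \<nu> U < measure \<nu> A + e" by (simp add: emeasure_eq_measure ennreal_less_iff)
  moreover have "measure \<nu> (U - A) = measure \<nu> U - measure \<nu> A"
    using U assms by (intro finite_measure_Diff) auto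
  ultimately show ?thesis using that[OF U(2,1)] by simp
qed

lemma real_sq_sum_le: "(a + b)\<^sup>2 \<le> 2 * a\<^sup>2 + 2 * (b::real)\<^sup>2"
  using sum_squares_bound[of a b] by (simp add: power2_sum)

lemma sq_le_bound:
  assumes "\<bar>a\<bar> \<le> b" "b \<le> (1::real)"
  shows "a\<^sup>2 \<le> b"
proof -
  have "\<bar>a\<bar> * \<bar>a\<bar> \<le> b * 1" using assms by (intro mult_mono) auto
  then show ?thesis by (simp add: power2_eq_square)
qed

lemma open_outer_approx_finite:
  assumes "finite I" "A \<in> sets borel" "e > 0"
    and "\<And>i. i \<in> I \<Longrightarrow> finite_measure (\<nu> i) \<and> sets (\<nu> i) = sets (borel::real measure)"
  obtains U where "open U" "A \<subseteq> U" "\<And>i. i \<in> I \<Longrightarrow> measure (\<nu> i) (U - A) < e"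
proof -
  have "\<exists>U. open U \<and> A \<subseteq> U \<and> measure (\<nu> i) (U - A) < e" if "i \<in> I" for i
    using open_outer_approx[of "\<nu> i" A e] assms that by metis
  then obtain U where U: "\<And>i. i \<in> I \<Longrightarrow> open (U i) \<and> A \<subseteq> U i \<and> measure (\<nu> i) (U i - A) < e"
    by metis
  show ?thesis
  proof (rule that[of "\<Inter>i\<in>I. U i"])
    show "open (\<Inter>i\<in>I. U i)" "A \<subseteq> (\<Inter>i\<in>I. U i)" using U assms(1) by auto
    fix i assume i: "i \<in> I"
    interpret finite_measure "\<nu> i" using assms(4) i by auto
    have "measure (\<nu> i) ((\<Inter>i\<in>I. U i) - A) \<le> measure (\<nu> i) (U i - A)"
      using U[OF i] i assms(2,4) by (intro finite_measure_mono) auto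
    also have "\<dots> < e" using U[OF i] by simp
    finally show "measure (\<nu> i) ((\<Inter>i\<in>I. U i) - A) < e" .
  qed
qed

text \<open>Regularity provides open sets slightly larger than A and its complement, Urysohn's lemma
  a continuous function between them, and Bernstein polynomials approximate that function. One p
  serves finitely many measures, since linearity of the calculus compares u, v and u + v.\<close>

lemma polynomial_L2_dense:
  assumes I: "finite I"
    and fin: "\<And>i. i \<in> I \<Longrightarrow> finite_measure (\<nu> i)"
    and sets: "\<And>i. i \<in> I \<Longrightarrow> sets (\<nu> i) = sets (borel::real measure)"
    and AE: "\<And>i. i \<in> I \<Longrightarrow> AE x in \<nu> i. 0 \<le> x \<and> x \<le> 1"
    and A [measurable]: "A \<in> sets borel" and e: "e > 0"
  obtains p where "\<And>i. i \<in> I \<Longrightarrow> integral\<^sup>L (\<nu> i) (\<lambda>x. (indicator A x - poly p x)\<^sup>2) < e"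
proof -
  define c where "c = (\<Sum>i\<in>I. measure (\<nu> i) UNIV)"
  have c: "c \<ge> 0" by (simp add: c_def sum_nonneg)
  obtain U where U: "open U" "A \<subseteq> U" "\<And>i. i \<in> I \<Longrightarrow> measure (\<nu> i) (U - A) < e / 8"
    using open_outer_approx_finite[OF I A, of "e / 8" \<nu>] e fin sets by auto
  obtain V where V: "open V" "- A \<subseteq> V" "\<And>i. i \<in> I \<Longrightarrow> measure (\<nu> i) (V - (- A)) < e / 8"
    using open_outer_approx_finite[OF I, of "-A" "e / 8" \<nu>] e A fin sets by auto
  have [measurable]: "U \<in> sets borel" "V \<in> sets borel" using U V by auto
  have disj: "- V \<inter> - U = {}" using U V by auto
  obtain f :: "real \<Rightarrow> real" where f: "continuous_on UNIV f" "\<And>x. f x \<in> closed_segment 1 0"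
    "\<And>x. f x = 1 \<longleftrightarrow> x \<in> - V" "\<And>x. f x = 0 \<longleftrightarrow> x \<in> - U"
    using Urysohn_strong[of "- V" "- U" "1::real" 0] U V disj by (metis closed_Compl zero_neq_one)
  have f01: "0 \<le> f x" "f x \<le> 1" for x using f(2)[of x] by (auto simp: closed_segment_eq_real_ivl)
  \<comment> \<open>Chosen so that 2 d^2 times any of the total masses is at most e / 4; the two
    regularity errors contribute less than e / 4 each.\<close>
  define d where "d = sqrt (e / (8 * (c + 1)))"
  have d: "d > 0" "d\<^sup>2 = e / (8 * (c + 1))" using e c by (auto simp: d_def)
  obtain n where n: "\<And>x. x \<in> {0..1} \<Longrightarrow> \<bar>f x - (\<Sum>k\<le>n. f (real k / real n) * Bernstein n k x)\<bar> < d"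
    using Bernstein_Weierstrass[of f d] f(1) d(1) by (meson continuous_on_subset le_refl subset_UNIV)
  define p where "p = (\<Sum>k\<le>n. smult (f (real k / real n) * real (n choose k)) ([:0, 1:] ^ k * [:1, -1:] ^ (n - k)))"
  have p: "poly p x = (\<Sum>k\<le>n. f (real k / real n) * Bernstein n k x)" for x
    by (simp add: p_def poly_sum Bernstein_def mult.assoc)
  show ?thesis
  proof (rule that)
    fix i assume i: "i \<in> I"
    interpret finite_measure "\<nu> i" by (rule fin[OF i])
    note [measurable_cong] = sets[OF i]
    have bd: "AE x in \<nu> i. (indicator A x - poly p x)\<^sup>2 \<le> 2 * indicator (U - A) x + 2 * indicator (V - (- A)) x + 2 * d\<^sup>2"
      using AE[OF i]
    proof (rule AE_mp, intro AE_I2 impI)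
      fix x :: real assume "0 \<le> x \<and> x \<le> 1"
      then have "\<bar>f x - poly p x\<bar> < d" using n[of x] by (simp add: p)
      then have 1: "(f x - poly p x)\<^sup>2 \<le> d\<^sup>2" using abs_le_square_iff[of "f x - poly p x" d] d by simp
      have "\<bar>indicator A x - f x\<bar> \<le> indicator (U - A) x + indicator (V - (- A)) x"
        using f(3,4)[of x] f01[of x] U V by (auto simp: indicator_def)
      moreover have "indicator (U - A) x + indicator (V - (- A)) x \<le> (1::real)"
        by (auto simp: indicator_def)
      ultimately have 2: "(indicator A x - f x)\<^sup>2 \<le> indicator (U - A) x + indicator (V - (- A)) x"
        by (rule sq_le_bound)
      have "(indicator A x - poly p x)\<^sup>2 \<le> 2 * (indicator A x - f x)\<^sup>2 + 2 * (f x - poly p x)\<^sup>2"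
        using real_sq_sum_le[of "indicator A x - f x" "f x - poly p x"] by simp
      with 1 2 show "(indicator A x - poly p x)\<^sup>2 \<le> 2 * indicator (U - A) x + 2 * indicator (V - (- A)) x + 2 * d\<^sup>2"
        by linarith
    qed
    have int: "integrable (\<nu> i) (\<lambda>x. 2 * indicator (U - A) x + 2 * indicator (V - (- A)) x + 2 * d\<^sup>2)"
      by (intro integrable_const_bound[of _ "4 + 2 * d\<^sup>2"]) (auto simp: indicator_def)
    have "integral\<^sup>L (\<nu> i) (\<lambda>x. (indicator A x - poly p x)\<^sup>2)
        \<le> integral\<^sup>L (\<nu> i) (\<lambda>x. 2 * indicator (U - A) x + 2 * indicator (V - (- A)) x + 2 * d\<^sup>2)"
      using bd by (intro integral_mono_AE' int) auto
    also have "\<dots> = 2 * measure (\<nu> i) (U - A) + 2 * measure (\<nu> i) (V - (- A)) + 2 * d\<^sup>2 * measure (\<nu> i) UNIV"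
      by (simp add: sets_eq_imp_space_eq[OF sets[OF i]] emeasure_eq_measure)
    also have "\<dots> < 2 * (e / 8) + 2 * (e / 8) + 2 * (e / 8)"
    proof -
      have "measure (\<nu> i) UNIV \<le> c"
        unfolding c_def using i I by (intro member_le_sum) auto
      then have "d\<^sup>2 * measure (\<nu> i) UNIV \<le> d\<^sup>2 * c" by (intro mult_left_mono) auto
      also have "d\<^sup>2 * c \<le> e / 8" unfolding d(2) using c e by (simp add: field_simps)
      finally show ?thesis using U(3)[OF i] V(3)[OF i] by linarith
    qed
    also have "\<dots> < e" using e by simp
    finally show "integral\<^sup>L (\<nu> i) (\<lambda>x. (indicator A x - poly p x)\<^sup>2) < e" .
  qed
qed

section \<open>Square integrable functions\<close>

lemma integrable_mult_sq:
  assumes [measurable]: "f \<in> borel_measurable M" "g \<in> borel_measurable M"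
    and "integrable M (\<lambda>x. (f x)\<^sup>2)" "integrable M (\<lambda>x. (g x :: real)\<^sup>2)"
  shows "integrable M (\<lambda>x. f x * g x)"
proof (rule Bochner_Integration.integrable_bound)
  show "integrable M (\<lambda>x. (f x)\<^sup>2 + (g x)\<^sup>2)" using assms by simp
  show "AE x in M. norm (f x * g x) \<le> norm ((f x)\<^sup>2 + (g x)\<^sup>2)"
  proof (rule AE_I2)
    fix x
    have "2 * (\<bar>f x\<bar> * \<bar>g x\<bar>) \<le> (f x)\<^sup>2 + (g x)\<^sup>2"
      using sum_squares_bound[of "\<bar>f x\<bar>" "\<bar>g x\<bar>"] by simp
    moreover have "0 \<le> \<bar>f x\<bar> * \<bar>g x\<bar>" by simp
    ultimately have "\<bar>f x\<bar> * \<bar>g x\<bar> \<le> (f x)\<^sup>2 + (g x)\<^sup>2" by linarith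
    then show "norm (f x * g x) \<le> norm ((f x)\<^sup>2 + (g x)\<^sup>2)" by (simp add: abs_mult)
  qed
qed simp

lemma integrable_add_sq:
  assumes "f \<in> borel_measurable M" "g \<in> borel_measurable M"
    and "integrable M (\<lambda>x. (f x)\<^sup>2)" "integrable M (\<lambda>x. (g x :: real)\<^sup>2)"
  shows "integrable M (\<lambda>x. (f x + g x)\<^sup>2)" "integrable M (\<lambda>x. (f x - g x)\<^sup>2)"
  using assms integrable_mult_sq[OF assms]
  by (simp_all add: power2_sum power2_diff mult.assoc)

lemma integral_cauchy_schwarz:
  assumes m: "f \<in> borel_measurable M" "g \<in> borel_measurable M"
    and i: "integrable M (\<lambda>x. (f x)\<^sup>2)" "integrable M (\<lambda>x. (g x :: real)\<^sup>2)"
  shows "(integral\<^sup>L M (\<lambda>x. f x * g x))\<^sup>2 \<le> integral\<^sup>L M (\<lambda>x. (f x)\<^sup>2) * integral\<^sup>L M (\<lambda>x. (g x)\<^sup>2)"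
proof -
  define a b c where "a = integral\<^sup>L M (\<lambda>x. (f x)\<^sup>2)" and "b = integral\<^sup>L M (\<lambda>x. f x * g x)"
    and "c = integral\<^sup>L M (\<lambda>x. (g x)\<^sup>2)"
  note fg = integrable_mult_sq[OF m i]
  have q: "0 \<le> a - 2 * t * b + t\<^sup>2 * c" for t
  proof -
    have "0 \<le> integral\<^sup>L M (\<lambda>x. (f x - t * g x)\<^sup>2)" by simp
    also have "(\<lambda>x. (f x - t * g x)\<^sup>2) = (\<lambda>x. (f x)\<^sup>2 - 2 * t * (f x * g x) + t\<^sup>2 * (g x)\<^sup>2)"
      by (auto simp: power2_diff power_mult_distrib)
    also have "integral\<^sup>L M \<dots> = a - 2 * t * b + t\<^sup>2 * c"
      using i fg by (simp add: a_def b_def c_def)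
    finally show ?thesis .
  qed
  have c: "0 \<le> c" by (simp add: c_def)
  have "b\<^sup>2 \<le> a * c"
  proof (cases "c = 0")
    case True
    have "b = 0"
    proof (rule ccontr)
      assume "b \<noteq> 0"
      \<comment> \<open>For c = 0 the quadratic is affine in t, and at this t it equals -1.\<close>
      then show False using q[of "(a + 1) / (2 * b)"] True by (simp add: field_simps)
    qed
    then show ?thesis using True by simp
  next
    case False
    then show ?thesis using c q[of "b / c"] by (simp add: field_simps power2_eq_square)
  qed
  then show ?thesis by (simp only: a_def b_def c_def)
qed

lemma integral_cross_tendsto_0:
  assumes f: "f \<in> borel_measurable M" "integrable M (\<lambda>x. (f x :: real)\<^sup>2)"
    and g: "\<And>n. g n \<in> borel_measurable M" "\<And>n. integrable M (\<lambda>x. (g n x)\<^sup>2)"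
    and lim: "(\<lambda>n. integral\<^sup>L M (\<lambda>x. (g n x)\<^sup>2)) \<longlonglongrightarrow> 0"
  shows "(\<lambda>n. integral\<^sup>L M (\<lambda>x. f x * g n x)) \<longlonglongrightarrow> 0"
proof -
  have "(\<lambda>n. (integral\<^sup>L M (\<lambda>x. f x * g n x))\<^sup>2) \<longlonglongrightarrow> 0"
  proof (rule tendsto_sandwich[OF _ _ tendsto_const])
    show "(\<lambda>n. integral\<^sup>L M (\<lambda>x. (f x)\<^sup>2) * integral\<^sup>L M (\<lambda>x. (g n x)\<^sup>2)) \<longlonglongrightarrow> 0"
      using tendsto_mult[OF tendsto_const lim] by simp
  qed (auto intro!: always_eventually integral_cauchy_schwarz f g)
  then have "(\<lambda>n. sqrt ((integral\<^sup>L M (\<lambda>x. f x * g n x))\<^sup>2)) \<longlonglongrightarrow> sqrt 0"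
    by (rule tendsto_real_sqrt)
  then show ?thesis by (simp add: tendsto_rabs_zero_iff)
qed

text \<open>Expand g around f: the cross term vanishes in the limit by Cauchy-Schwarz.\<close>

lemma integral_sq_tendsto:
  assumes f: "f \<in> borel_measurable M" "integrable M (\<lambda>x. (f x :: real)\<^sup>2)"
    and g: "\<And>n. g n \<in> borel_measurable M" "\<And>n. integrable M (\<lambda>x. (g n x)\<^sup>2)"
    and lim: "(\<lambda>n. integral\<^sup>L M (\<lambda>x. (f x - g n x)\<^sup>2)) \<longlonglongrightarrow> 0"
  shows "(\<lambda>n. integral\<^sup>L M (\<lambda>x. (g n x)\<^sup>2)) \<longlonglongrightarrow> integral\<^sup>L M (\<lambda>x. (f x)\<^sup>2)"
proof -
  note d = integrable_add_sq(2)[OF f(1) g(1) f(2) g(2)]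
  have dm: "(\<lambda>x. f x - g n x) \<in> borel_measurable M" for n using f g by simp
  have cross: "(\<lambda>n. integral\<^sup>L M (\<lambda>x. f x * (f x - g n x))) \<longlonglongrightarrow> 0"
    by (rule integral_cross_tendsto_0[OF f dm d lim])
  have "integral\<^sup>L M (\<lambda>x. (g n x)\<^sup>2) = integral\<^sup>L M (\<lambda>x. (f x)\<^sup>2)
      - 2 * integral\<^sup>L M (\<lambda>x. f x * (f x - g n x)) + integral\<^sup>L M (\<lambda>x. (f x - g n x)\<^sup>2)" for n
  proof -
    have "(\<lambda>x. (g n x)\<^sup>2) = (\<lambda>x. (f x)\<^sup>2 - 2 * (f x * (f x - g n x)) + (f x - g n x)\<^sup>2)"
      by (auto simp: power2_eq_square algebra_simps)
    then show ?thesis using f d integrable_mult_sq[OF f(1) dm f(2) d] by simp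
  qed
  moreover have "(\<lambda>n. integral\<^sup>L M (\<lambda>x. (f x)\<^sup>2) - 2 * integral\<^sup>L M (\<lambda>x. f x * (f x - g n x))
      + integral\<^sup>L M (\<lambda>x. (f x - g n x)\<^sup>2)) \<longlonglongrightarrow> integral\<^sup>L M (\<lambda>x. (f x)\<^sup>2) - 2 * 0 + 0"
    by (intro tendsto_intros cross lim)
  ultimately show ?thesis by simp
qed

lemma tendsto_of_norm_sq:
  assumes "(\<lambda>n. (norm (w - x n))\<^sup>2) \<longlonglongrightarrow> 0"
  shows "x \<longlonglongrightarrow> (w::'a::real_normed_vector)"
proof -
  have "(\<lambda>n. sqrt ((norm (w - x n))\<^sup>2)) \<longlonglongrightarrow> sqrt 0" by (intro tendsto_real_sqrt assms)
  then have "(\<lambda>n. norm (x n - w)) \<longlonglongrightarrow> 0" by (simp add: norm_minus_commute)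
  then show ?thesis using LIM_zero_cancel tendsto_norm_zero_iff by blast
qed

section \<open>Extension of a functional calculus by square-mean approximation\<close>

text \<open>Both extensions below are instances: from polynomials in a contraction to indicators,
  and from step functions to Borel functions. G pairs a function with its operator, and
  \<open>G_norm\<close> makes f to S u isometric for the square mean of \<mu> u. Completing for each
  u separately is what admits unbounded results.\<close>

locale l2_calculus =
  fixes G :: "((real \<Rightarrow> real) \<times> ('h::complex_hilbert \<Rightarrow> 'h)) set"
    and \<mu> :: "'h \<Rightarrow> real measure"
    and F :: "(real \<Rightarrow> real) set"
  assumes finite_measure [simp]: "finite_measure (\<mu> u)"
    and sets [simp, measurable_cong]: "sets (\<mu> u) = sets borel"
    and G_zero: "(\<lambda>x. 0, \<lambda>u. 0) \<in> G"
    and G_add: "(f, S) \<in> G \<Longrightarrow> (g, T) \<in> G \<Longrightarrow> (\<lambda>x. f x + g x, \<lambda>u. S u + T u) \<in> G"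
    and G_scale: "(f, S) \<in> G \<Longrightarrow> (\<lambda>x. c * f x, \<lambda>u. c *\<^sub>R S u) \<in> G"
    and G_linear: "(f, S) \<in> G \<Longrightarrow> clinear_on UNIV S"
    and G_sym: "(f, S) \<in> G \<Longrightarrow> cinner (S u) v = cinner u (S v)"
    and G_meas: "(f, S) \<in> G \<Longrightarrow> f \<in> borel_measurable borel"
    and G_int: "(f, S) \<in> G \<Longrightarrow> integrable (\<mu> u) (\<lambda>x. (f x)\<^sup>2)"
    and G_norm: "(f, S) \<in> G \<Longrightarrow> (norm (S u))\<^sup>2 = integral\<^sup>L (\<mu> u) (\<lambda>x. (f x)\<^sup>2)"
    and G_mean: "(f, S) \<in> G \<Longrightarrow> Re (cinner u (S u)) = integral\<^sup>L (\<mu> u) f"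
    and F_meas: "f \<in> F \<Longrightarrow> f \<in> borel_measurable borel"
    and G_dense: "f \<in> F \<Longrightarrow> finite V \<Longrightarrow> (\<And>v. v \<in> V \<Longrightarrow> integrable (\<mu> v) (\<lambda>x. (f x)\<^sup>2)) \<Longrightarrow> 0 < e \<Longrightarrow>
      \<exists>(g, T)\<in>G. \<forall>v\<in>V. integral\<^sup>L (\<mu> v) (\<lambda>x. (f x - g x)\<^sup>2) < e"
begin

lemma meas_mu: "f \<in> borel_measurable borel \<Longrightarrow> f \<in> borel_measurable (\<mu> u)"
  by (subst measurable_cong_sets[OF sets refl])

lemmas F_meas' = meas_mu[OF F_meas] and G_meas' = meas_mu[OF G_meas]

definition sq_int :: "(real \<Rightarrow> real) \<Rightarrow> 'h \<Rightarrow> bool" where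
  "sq_int f u \<longleftrightarrow> integrable (\<mu> u) (\<lambda>x. (f x)\<^sup>2)"

text \<open>Prescribing the distances to all vectors T u avoids any choice of an approximating
  sequence.\<close>

definition is_ext :: "(real \<Rightarrow> real) \<Rightarrow> 'h \<Rightarrow> 'h \<Rightarrow> bool" where
  "is_ext f u w \<longleftrightarrow> (\<forall>(g, T)\<in>G. (norm (w - T u))\<^sup>2 = integral\<^sup>L (\<mu> u) (\<lambda>x. (f x - g x)\<^sup>2))"

definition ext :: "(real \<Rightarrow> real) \<Rightarrow> 'h \<Rightarrow> 'h" where
  "ext f u = (THE w. is_ext f u w)"

lemma G_diff:
  assumes "(f, S) \<in> G" "(g, T) \<in> G"
  shows "(\<lambda>x. f x - g x, \<lambda>u. S u - T u) \<in> G"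
  using G_add[OF assms(1) G_scale[OF assms(2), of "-1"]] by simp

lemma approx_seq:
  assumes "f \<in> F" "finite V" "\<And>v. v \<in> V \<Longrightarrow> sq_int f v"
  obtains g T where "\<And>n. (g n, T n) \<in> G"
    "\<And>v. v \<in> V \<Longrightarrow> (\<lambda>n::nat. integral\<^sup>L (\<mu> v) (\<lambda>x. (f x - g n x)\<^sup>2)) \<longlonglongrightarrow> 0"
proof -
  have "\<exists>g T. (g, T) \<in> G \<and> (\<forall>v\<in>V. integral\<^sup>L (\<mu> v) (\<lambda>x. (f x - g x)\<^sup>2) < 1 / Suc n)" for n
    using G_dense[OF assms(1,2), of "1 / Suc n"] assms(3) by (auto simp: sq_int_def)
  then obtain g T where g: "\<And>n. (g n, T n) \<in> G"
    "\<And>n v. v \<in> V \<Longrightarrow> integral\<^sup>L (\<mu> v) (\<lambda>x. (f x - g n x)\<^sup>2) < 1 / Suc n" by metis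
  show ?thesis
  proof (rule that[OF g(1)])
    fix v assume v: "v \<in> V"
    show "(\<lambda>n. integral\<^sup>L (\<mu> v) (\<lambda>x. (f x - g n x)\<^sup>2)) \<longlonglongrightarrow> 0"
      by (rule tendsto_sandwich[OF _ _ tendsto_const LIMSEQ_Suc[OF lim_1_over_n]])
        (auto intro!: always_eventually less_imp_le[OF g(2)[OF v]] simp del: of_nat_Suc)
  qed
qed

lemma is_ext_seq:
  assumes "is_ext f u w" "\<And>n. (g n, T n) \<in> G"
    "(\<lambda>n::nat. integral\<^sup>L (\<mu> u) (\<lambda>x. (f x - g n x)\<^sup>2)) \<longlonglongrightarrow> 0"
  shows "(\<lambda>n. T n u) \<longlonglongrightarrow> w"
proof (rule tendsto_of_norm_sq)
  have "(norm (w - T n u))\<^sup>2 = integral\<^sup>L (\<mu> u) (\<lambda>x. (f x - g n x)\<^sup>2)" for n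
    using assms(1) assms(2)[of n] by (auto simp: is_ext_def)
  then show "(\<lambda>n. (norm (w - T n u))\<^sup>2) \<longlonglongrightarrow> 0" using assms(3) by (simp only:)
qed

lemma sq_int_diff_G:
  assumes "f \<in> F" "sq_int f u" "(g, T) \<in> G"
  shows "integrable (\<mu> u) (\<lambda>x. (f x - g x)\<^sup>2)"
  by (rule integrable_add_sq(2)[OF F_meas' G_meas']) (use assms G_int in \<open>auto simp: sq_int_def\<close>)

text \<open>By \<open>G_norm\<close> a sequence of functions that is Cauchy in square mean gives a
  Cauchy sequence of vectors, and the limit inherits every distance.\<close>

lemma is_ext_exists:
  assumes f: "f \<in> F" "sq_int f u"
  obtains w where "is_ext f u w"
proof -
  obtain g T where g: "\<And>n. (g n, T n) \<in> G"
    "(\<lambda>n::nat. integral\<^sup>L (\<mu> u) (\<lambda>x. (f x - g n x)\<^sup>2)) \<longlonglongrightarrow> 0"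
    using approx_seq[OF f(1), of "{u}"] f(2) by auto
  note int = sq_int_diff_G[OF f g(1)]
  have "Cauchy (\<lambda>n. T n u)"
  proof (rule metric_CauchyI)
    fix e :: real assume e: "0 < e"
    then have "\<forall>\<^sub>F n in sequentially. integral\<^sup>L (\<mu> u) (\<lambda>x. (f x - g n x)\<^sup>2) < e\<^sup>2 / 4"
      using g(2) by (intro order_tendstoD) auto
    then obtain N where N: "\<And>n. n \<ge> N \<Longrightarrow> integral\<^sup>L (\<mu> u) (\<lambda>x. (f x - g n x)\<^sup>2) < e\<^sup>2 / 4"
      by (auto simp: eventually_sequentially)
    show "\<exists>M. \<forall>m\<ge>M. \<forall>n\<ge>M. dist (T m u) (T n u) < e"
    proof (intro exI allI impI)
      fix i j assume ij: "N \<le> i" "N \<le> j"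
      have "(norm (T i u - T j u))\<^sup>2 = integral\<^sup>L (\<mu> u) (\<lambda>x. (g i x - g j x)\<^sup>2)"
        using G_norm[OF G_diff[OF g(1)[of i] g(1)[of j]]] by simp
      also have "\<dots> \<le> integral\<^sup>L (\<mu> u) (\<lambda>x. 2 * (f x - g i x)\<^sup>2 + 2 * (f x - g j x)\<^sup>2)"
      proof (rule integral_mono)
        show "integrable (\<mu> u) (\<lambda>x. (g i x - g j x)\<^sup>2)"
          using G_int[OF G_diff[OF g(1)[of i] g(1)[of j]]] by simp
        fix x show "(g i x - g j x)\<^sup>2 \<le> 2 * (f x - g i x)\<^sup>2 + 2 * (f x - g j x)\<^sup>2"
          using real_sq_sum_le[of "g i x - f x" "f x - g j x"] by (simp add: power2_commute)
      qed (use int in auto)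
      also have "\<dots> < e\<^sup>2" using N[OF ij(1)] N[OF ij(2)] int by simp
      finally show "dist (T i u) (T j u) < e" using e by (simp add: dist_norm power_less_imp_less_base)
    qed
  qed
  then obtain w where w: "(\<lambda>n. T n u) \<longlonglongrightarrow> w" by (auto simp: Cauchy_convergent_iff convergent_def)
  have "is_ext f u w"
    unfolding is_ext_def
  proof (clarify)
    fix h S assume h: "(h, S) \<in> G"
    have "(\<lambda>n. (norm (T n u - S u))\<^sup>2) \<longlonglongrightarrow> (norm (w - S u))\<^sup>2" by (intro tendsto_intros w)
    moreover have "(norm (T n u - S u))\<^sup>2 = integral\<^sup>L (\<mu> u) (\<lambda>x. (g n x - h x)\<^sup>2)" for n
      using G_norm[OF G_diff[OF g(1)[of n] h]] by simp
    moreover have "(\<lambda>n. integral\<^sup>L (\<mu> u) (\<lambda>x. (g n x - h x)\<^sup>2)) \<longlonglongrightarrow> integral\<^sup>L (\<mu> u) (\<lambda>x. (f x - h x)\<^sup>2)"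
    proof (rule integral_sq_tendsto)
      show "integrable (\<mu> u) (\<lambda>x. (g n x - h x)\<^sup>2)" for n
        using G_int[OF G_diff[OF g(1)[of n] h]] by simp
    qed (use sq_int_diff_G[OF f h] F_meas'[OF f(1)] G_meas'[OF h] G_meas'[OF g(1)] g(2) in auto)
    ultimately show "(norm (w - S u))\<^sup>2 = integral\<^sup>L (\<mu> u) (\<lambda>x. (f x - h x)\<^sup>2)"
      by (simp add: LIMSEQ_unique)
  qed
  then show ?thesis by (rule that)
qed

lemma is_ext_unique:
  assumes "f \<in> F" "sq_int f u" "is_ext f u w" "is_ext f u w'"
  shows "w = w'"
proof -
  obtain g T where g: "\<And>n. (g n, T n) \<in> G"
    "(\<lambda>n::nat. integral\<^sup>L (\<mu> u) (\<lambda>x. (f x - g n x)\<^sup>2)) \<longlonglongrightarrow> 0"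
    using approx_seq[OF assms(1), of "{u}"] assms(2) by auto
  show ?thesis
    using is_ext_seq[OF assms(3) g] is_ext_seq[OF assms(4) g] by (rule LIMSEQ_unique)
qed

lemma ext_eqI: "f \<in> F \<Longrightarrow> sq_int f u \<Longrightarrow> is_ext f u w \<Longrightarrow> ext f u = w"
  unfolding ext_def by (rule the_equality) (auto intro: is_ext_unique)

lemma is_ext_ext: "f \<in> F \<Longrightarrow> sq_int f u \<Longrightarrow> is_ext f u (ext f u)"
  using is_ext_exists[of f u] ext_eqI[of f u] by metis

lemma ext_dist: "f \<in> F \<Longrightarrow> sq_int f u \<Longrightarrow> (g, T) \<in> G \<Longrightarrow>
    (norm (ext f u - T u))\<^sup>2 = integral\<^sup>L (\<mu> u) (\<lambda>x. (f x - g x)\<^sup>2)"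
  using is_ext_ext[of f u] by (auto simp: is_ext_def)

lemma ext_seq:
  assumes "f \<in> F" "sq_int f u" "\<And>n. (g n, T n) \<in> G"
    "(\<lambda>n::nat. integral\<^sup>L (\<mu> u) (\<lambda>x. (f x - g n x)\<^sup>2)) \<longlonglongrightarrow> 0"
  shows "(\<lambda>n. T n u) \<longlonglongrightarrow> ext f u"
  by (rule is_ext_seq[OF is_ext_ext assms(3,4)]) (rule assms)+

lemma ext_G:
  assumes "f \<in> F" "(f, T) \<in> G"
  shows "ext f u = T u"
  using ext_dist[OF assms(1) _ assms(2), of u] G_int[OF assms(2)] by (simp add: sq_int_def)

text \<open>The measures of u, v and u + v differ, so one sequence has to approximate f for all
  three at once.\<close>

lemma ext_add:
  assumes f: "f \<in> F" and s: "sq_int f u" "sq_int f v" "sq_int f (u + v)"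
  shows "ext f (u + v) = ext f u + ext f v"
proof -
  obtain g T where g: "\<And>n. (g n, T n) \<in> G"
    and lim: "\<And>w. w \<in> {u, v, u + v} \<Longrightarrow> (\<lambda>n::nat. integral\<^sup>L (\<mu> w) (\<lambda>x. (f x - g n x)\<^sup>2)) \<longlonglongrightarrow> 0"
    using approx_seq[OF f, of "{u, v, u + v}"] s by auto
  have "(\<lambda>n. T n (u + v)) \<longlonglongrightarrow> ext f (u + v)" by (rule ext_seq[OF f s(3) g lim]) simp
  moreover have "(\<lambda>n. T n u + T n v) \<longlonglongrightarrow> ext f u + ext f v"
    by (intro tendsto_add ext_seq[OF f s(1) g lim] ext_seq[OF f s(2) g lim]) auto
  moreover have "T n (u + v) = T n u + T n v" for n by (rule clinear_onD(2)[OF G_linear[OF g]]) auto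
  ultimately show ?thesis by (simp add: LIMSEQ_unique)
qed

lemma ext_scaleC:
  assumes f: "f \<in> F" and s: "sq_int f u" "sq_int f (a *\<^sub>C u)"
  shows "ext f (a *\<^sub>C u) = a *\<^sub>C ext f u"
proof -
  obtain g T where g: "\<And>n. (g n, T n) \<in> G"
    and lim: "\<And>w. w \<in> {u, a *\<^sub>C u} \<Longrightarrow> (\<lambda>n::nat. integral\<^sup>L (\<mu> w) (\<lambda>x. (f x - g n x)\<^sup>2)) \<longlonglongrightarrow> 0"
    using approx_seq[OF f, of "{u, a *\<^sub>C u}"] s by auto
  have "(\<lambda>n. T n (a *\<^sub>C u)) \<longlonglongrightarrow> ext f (a *\<^sub>C u)" by (rule ext_seq[OF f s(2) g lim]) simp
  moreover have "(\<lambda>n. a *\<^sub>C T n u) \<longlonglongrightarrow> a *\<^sub>C ext f u"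
    by (intro tendsto_scaleC ext_seq[OF f s(1) g lim]) auto
  moreover have "T n (a *\<^sub>C u) = a *\<^sub>C T n u" for n by (rule clinear_onD(3)[OF G_linear[OF g]]) auto
  ultimately show ?thesis by (simp add: LIMSEQ_unique)
qed

lemma ext_sym:
  assumes f: "f \<in> F" and s: "sq_int f u" "sq_int f v"
  shows "cinner (ext f u) v = cinner u (ext f v)"
proof -
  obtain g T where g: "\<And>n. (g n, T n) \<in> G"
    and lim: "\<And>w. w \<in> {u, v} \<Longrightarrow> (\<lambda>n::nat. integral\<^sup>L (\<mu> w) (\<lambda>x. (f x - g n x)\<^sup>2)) \<longlonglongrightarrow> 0"
    using approx_seq[OF f, of "{u, v}"] s by auto
  have "(\<lambda>n. cinner (T n u) v) \<longlonglongrightarrow> cinner (ext f u) v"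
    by (intro tendsto_cinner tendsto_const ext_seq[OF f s(1) g lim]) auto
  moreover have "(\<lambda>n. cinner u (T n v)) \<longlonglongrightarrow> cinner u (ext f v)"
    by (intro tendsto_cinner tendsto_const ext_seq[OF f s(2) g lim]) auto
  ultimately show ?thesis by (simp add: LIMSEQ_unique G_sym[OF g])
qed

lemma ext_norm:
  assumes "f \<in> F" "sq_int f u"
  shows "(norm (ext f u))\<^sup>2 = integral\<^sup>L (\<mu> u) (\<lambda>x. (f x)\<^sup>2)"
  using ext_dist[OF assms G_zero] by simp

lemma ext_mean:
  assumes f: "f \<in> F" "sq_int f u"
  shows "cinner u (ext f u) = of_real (integral\<^sup>L (\<mu> u) f)"
proof -
  interpret finite_measure "\<mu> u" by simp
  obtain g T where g: "\<And>n. (g n, T n) \<in> G"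
    and lim: "(\<lambda>n::nat. integral\<^sup>L (\<mu> u) (\<lambda>x. (f x - g n x)\<^sup>2)) \<longlonglongrightarrow> 0"
    using approx_seq[OF f(1), of "{u}"] f(2) by auto
  have si: "integrable (\<mu> u) h" if "h \<in> borel_measurable borel" "integrable (\<mu> u) (\<lambda>x. (h x)\<^sup>2)" for h :: "real \<Rightarrow> real"
    using integrable_mult_sq[of "\<lambda>x. 1" "\<mu> u" h] that by (simp add: meas_mu)
  \<comment> \<open>Pairing with the constant 1, square integrable because the measure is finite,
    turns square-mean convergence into convergence of integrals.\<close>
  have "(\<lambda>n. integral\<^sup>L (\<mu> u) (\<lambda>x. 1 * (f x - g n x))) \<longlonglongrightarrow> 0"
    using sq_int_diff_G[OF f g] F_meas'[OF f(1)] G_meas'[OF g]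
    by (intro integral_cross_tendsto_0 lim) auto
  moreover have "integral\<^sup>L (\<mu> u) (\<lambda>x. 1 * (f x - g n x)) = integral\<^sup>L (\<mu> u) f - Re (cinner u (T n u))" for n
    using si[OF F_meas[OF f(1)]] f(2) si[OF G_meas[OF g] G_int[OF g]] by (simp add: sq_int_def G_mean[OF g])
  moreover have "(\<lambda>n. integral\<^sup>L (\<mu> u) f - Re (cinner u (T n u))) \<longlonglongrightarrow> integral\<^sup>L (\<mu> u) f - Re (cinner u (ext f u))"
    by (intro tendsto_intros tendsto_Re tendsto_cinner ext_seq[OF f g lim])
  ultimately have "Re (cinner u (ext f u)) = integral\<^sup>L (\<mu> u) f"
    using LIMSEQ_unique by fastforce
  moreover have "Im (cinner u (ext f u)) = 0"
    using arg_cong[OF ext_sym[OF f f(2)], of Im] by (subst (asm) cinner_commute) simp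
  ultimately show ?thesis by (simp add: complex_eq_iff)
qed

lemma ext_diff_norm:
  assumes f: "f \<in> F" "sq_int f u" and h: "h \<in> F" "sq_int h u"
  shows "(norm (ext f u - ext h u))\<^sup>2 = integral\<^sup>L (\<mu> u) (\<lambda>x. (f x - h x)\<^sup>2)"
proof -
  obtain g T where g: "\<And>n. (g n, T n) \<in> G"
    and lim: "(\<lambda>n::nat. integral\<^sup>L (\<mu> u) (\<lambda>x. (h x - g n x)\<^sup>2)) \<longlonglongrightarrow> 0"
    using approx_seq[OF h(1), of "{u}"] h(2) by auto
  have "(\<lambda>n. (norm (ext f u - T n u))\<^sup>2) \<longlonglongrightarrow> (norm (ext f u - ext h u))\<^sup>2"
    by (intro tendsto_intros ext_seq[OF h g lim])
  moreover have "(\<lambda>n. integral\<^sup>L (\<mu> u) (\<lambda>x. (f x - g n x)\<^sup>2)) \<longlonglongrightarrow> integral\<^sup>L (\<mu> u) (\<lambda>x. (f x - h x)\<^sup>2)"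
  proof (rule integral_sq_tendsto)
    show "integrable (\<mu> u) (\<lambda>x. (f x - h x)\<^sup>2)"
      by (rule integrable_add_sq(2)) (use f h F_meas' in \<open>auto simp: sq_int_def\<close>)
  qed (use sq_int_diff_G[OF f g] F_meas'[OF f(1)] F_meas'[OF h(1)] G_meas'[OF g] lim in
      \<open>auto simp: power2_commute\<close>)
  ultimately show ?thesis by (simp add: ext_dist[OF f g] LIMSEQ_unique)
qed

end

section \<open>Projection-valued measures\<close>

text \<open>The squared norm of E A u and the form of E A at u are the same number, so the symmetric
  E A and its square have equal quadratic forms. All projection laws then follow from additivity of
  the scalar measures.\<close>

lemma projection_valued_measureI:
  fixes E :: "real set \<Rightarrow> 'h::complex_hilbert \<Rightarrow> 'h"
  assumes fin: "\<And>u. finite_measure (\<mu> u)" and sets: "\<And>u. sets (\<mu> u) = sets borel"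
    and total: "\<And>u. measure (\<mu> u) UNIV = (norm u)\<^sup>2"
    and lin: "\<And>A. A \<in> sets borel \<Longrightarrow> clinear_on UNIV (E A)"
    and norm: "\<And>A u. A \<in> sets borel \<Longrightarrow> (norm (E A u))\<^sup>2 = measure (\<mu> u) A"
    and mean: "\<And>A u. A \<in> sets borel \<Longrightarrow> cinner u (E A u) = of_real (measure (\<mu> u) A)"
    and sym: "\<And>A u v. A \<in> sets borel \<Longrightarrow> cinner (E A u) v = cinner u (E A v)"
  shows "projection_valued_measure E" "scalar_measure E u = \<mu> u"
proof -
  have space [simp]: "space (\<mu> u) = UNIV" for u using sets_eq_imp_space_eq[OF sets[of u]] by simp
  have Un: "E (A \<union> B) u = E A u + E B u" if "A \<in> sets borel" "B \<in> sets borel" "A \<inter> B = {}" for A B u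
  proof (rule quadratic_form_determines[of UNIV "E (A \<union> B)" "\<lambda>u. E A u + E B u"])
    show "clinear_on UNIV (\<lambda>u. E A u + E B u)"
      using lin[OF that(1)] lin[OF that(2)] by (auto simp: clinear_on_def scaleC_add_right)
    fix u
    interpret finite_measure "\<mu> u" by (rule fin)
    show "cinner u (E (A \<union> B) u) = cinner u (E A u + E B u)"
      using that by (simp add: mean cinner_simps finite_measure_Union sets)
  qed (use that lin in auto)
  have univ: "E UNIV u = u" for u
  proof -
    have "(norm (E UNIV u - u))\<^sup>2 = (norm (E UNIV u))\<^sup>2 - 2 * Re (cinner u (E UNIV u)) + (norm u)\<^sup>2"
      by (simp add: norm_sq_diff Re_cinner_commute)
    then show ?thesis by (simp add: norm mean total)
  qed
  have proj: "E A (E A u) = E A u" if A: "A \<in> sets borel" for A u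
  proof (rule quadratic_form_determines[of UNIV "\<lambda>u. E A (E A u)" "E A"])
    show "clinear_on UNIV (\<lambda>u. E A (E A u))"
      using lin[OF A] by (auto simp: clinear_on_def)
    show "cinner u (E A (E A u)) = cinner u (E A u)" for u
      using A by (simp add: mean sym[symmetric] cinner_self norm del: of_real_power)
  qed (use A lin in auto)
  have orth: "E A (E B u) = 0" if AB: "A \<in> sets borel" "B \<in> sets borel" "A \<inter> B = {}" for A B u
  proof -
    define w where "w = E B u"
    interpret finite_measure "\<mu> w" by (rule fin)
    have "w = E B w + E (- B) w" using Un[of B "- B" w] AB univ by (simp add: Compl_partition)
    then have "E (- B) w = 0" using proj[OF AB(2), of u] by (simp add: w_def)
    then have "measure (\<mu> w) (- B) = 0" using norm[of "- B" w] AB by simp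
    moreover have "measure (\<mu> w) A \<le> measure (\<mu> w) (- B)"
      using AB by (intro finite_measure_mono) (auto simp: sets)
    ultimately have "measure (\<mu> w) A = 0" using measure_nonneg[of "\<mu> w" A] by linarith
    then show ?thesis using norm[OF AB(1), of w] by (simp add: w_def)
  qed
  have Int: "E (A \<inter> B) = E A \<circ> E B" if AB: "A \<in> sets borel" "B \<in> sets borel" for A B
  proof
    fix u
    have m: "A \<inter> B \<in> sets borel" "A - B \<in> sets borel" "B - A \<in> sets borel" using AB by auto
    have "E A (E B u) = E (A \<inter> B) (E B u) + E (A - B) (E B u)"
      using Un[OF m(1,2), of "E B u"] by (simp add: Int_Diff_Un Int_Diff_disjoint)
    moreover have "E (A - B) (E B u) = 0" using m AB by (intro orth) auto
    moreover have "E B u = E (A \<inter> B) u + E (B - A) u"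
      using Un[OF m(1,3), of u] by (simp add: Int_commute[of A] Int_Diff_Un Int_Diff_disjoint)
    moreover have "E (A \<inter> B) (E (A \<inter> B) u + E (B - A) u) = E (A \<inter> B) u"
      using clinear_onD(2)[OF lin[OF m(1)]] proj[OF m(1)] orth[OF m(1,3), of u] by auto
    ultimately show "E (A \<inter> B) u = (E A \<circ> E B) u" by simp
  qed
  \<comment> \<open>The squared distance between a partial sum and the limit is the measure of the
    part of the union not yet covered, which tends to 0.\<close>
  have sums: "(\<lambda>n. E (A n) u) sums E (\<Union>n::nat. A n) u"
    if A: "range A \<subseteq> sets borel" "disjoint_family A" for A u
  proof -
    interpret finite_measure "\<mu> u" by (rule fin)
    have Am: "A i \<in> sets borel" for i using A by auto
    define B where "B n = (\<Union>i<n. A i)" for n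
    have Bm [simp]: "B n \<in> sets borel" for n using Am by (auto simp: B_def)
    have Um [simp]: "(\<Union>n. A n) \<in> sets borel" using Am by auto
    have empty: "E {} u = 0" for u using norm[of "{}" u] by simp
    have part: "(\<Sum>i<n. E (A i) u) = E (B n) u" for n
    proof (induction n)
      case 0 then show ?case by (simp add: B_def empty)
    next
      case (Suc n)
      have "A i \<inter> A n = {}" if "i < n" for i
        using disjoint_family_onD[OF A(2), of i n] that by auto
      then have "B n \<inter> A n = {}" by (auto simp: B_def)
      moreover have "B (Suc n) = B n \<union> A n" by (auto simp: B_def lessThan_Suc)
      ultimately show ?case using Un[of "B n" "A n" u] Suc Am by simp
    qed
    have sub: "B n \<subseteq> (\<Union>n. A n)" for n by (auto simp: B_def)
    have lim: "(\<lambda>n. measure (\<mu> u) (B n)) \<longlonglongrightarrow> measure (\<mu> u) (\<Union>n. B n)"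
    proof (rule finite_Lim_measure_incseq)
      show "range B \<subseteq> sets (\<mu> u)" using Bm by (auto simp: sets)
      show "incseq B" unfolding incseq_def B_def by (intro allI impI UN_mono) auto
    qed
    have BA: "(\<Union>n. B n) = (\<Union>n. A n)" by (auto simp: B_def)
    have "(\<lambda>n. measure (\<mu> u) (\<Union>n. A n) - measure (\<mu> u) (B n)) \<longlonglongrightarrow> 0"
      using tendsto_diff[OF tendsto_const lim, of "measure (\<mu> u) (\<Union>n. A n)"] by (simp add: BA)
    moreover have "measure (\<mu> u) (\<Union>n. A n) - measure (\<mu> u) (B n) = (norm (E (\<Union>n. A n) u - E (B n) u))\<^sup>2" for n
    proof -
      have "E (\<Union>n. A n) u = E (B n) u + E ((\<Union>n. A n) - B n) u"
        using Un[OF Bm sets.Diff[OF Um Bm], of n n u] sub[of n] by (simp add: Un_absorb1)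
      then show ?thesis
        using norm[OF sets.Diff[OF Um Bm], of n u] finite_measure_Diff[of "\<Union>n. A n" "B n"] sub[of n]
        by (simp add: sets)
    qed
    ultimately have "(\<lambda>n. E (B n) u) \<longlonglongrightarrow> E (\<Union>n. A n) u"
      by - (rule tendsto_of_norm_sq, simp only:)
    then show ?thesis by (simp add: sums_def part)
  qed
  show "projection_valued_measure E"
    unfolding projection_valued_measure_def
    by (intro conjI ballI allI impI) (auto intro: lin sym Int sums simp: univ fun_eq_iff[of _ id])
  interpret finite_measure "\<mu> u" by (rule fin)
  have "scalar_measure E u = measure_of UNIV (sets borel) (emeasure (\<mu> u))"
    unfolding scalar_measure_def
    by (rule measure_of_eq)
      (use sets.sigma_sets_eq[of "borel::real measure"] in \<open>auto simp: norm emeasure_eq_measure\<close>)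
  also have "\<dots> = \<mu> u" using measure_of_of_measure[of "\<mu> u"] by (simp only: space sets)
  finally show "scalar_measure E u = \<mu> u" .
qed

section \<open>The spectral measure of a positive contraction\<close>

text \<open>\<open>pos\<close> says that the square of R is at most R, which contains both
  positivity and contractivity.\<close>

locale positive_contraction =
  fixes R :: "'h::complex_hilbert \<Rightarrow> 'h"
  assumes linear: "clinear_on UNIV R"
    and sym: "cinner (R u) v = cinner u (R v)"
    and pos: "(norm (R u))\<^sup>2 \<le> Re (cinner u (R u))"
begin

lemma R_minus: "R (- u) = - R u"
  using clinear_onD(3)[OF linear, of u "-1"] by simp

lemmas R_linear = clinear_onD(2-)[OF linear, simplified] R_minus

text \<open>Horner evaluation of the polynomial at R.\<close>

definition poly_op :: "real poly \<Rightarrow> 'h \<Rightarrow> 'h" where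
  "poly_op p = fold_coeffs (\<lambda>a f u. a *\<^sub>R u + R (f u)) p (\<lambda>u. 0)"

lemma poly_op_0 [simp]: "poly_op 0 u = 0"
  by (simp add: poly_op_def)

lemma poly_op_pCons [simp]: "poly_op (pCons a p) u = a *\<^sub>R u + R (poly_op p u)"
  by (cases "p = 0 \<and> a = 0") (auto simp: poly_op_def R_linear)

lemma poly_op_add: "poly_op (p + q) u = poly_op p u + poly_op q u"
  by (induction p q rule: poly_induct2) (simp_all add: R_linear scaleR_add_left)

lemma poly_op_smult: "poly_op (smult c p) u = c *\<^sub>R poly_op p u"
  by (induction p) (simp_all add: R_linear scaleR_add_right)

lemma poly_op_mult: "poly_op (p * q) u = poly_op p (poly_op q u)"
  by (induction p) (simp_all add: poly_op_add poly_op_smult)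

lemma poly_op_1 [simp]: "poly_op 1 u = u"
  by (simp add: one_pCons R_linear)

lemma poly_op_linear: "clinear_on UNIV (poly_op p)"
  by (induction p) (auto simp: clinear_on_def R_linear scaleR_add_right scaleC_add_right scaleC_scaleR)

lemma poly_op_commute: "poly_op p (R u) = R (poly_op p u)"
  by (induction p) (simp_all add: R_linear)

lemma poly_op_sym: "cinner (poly_op p u) v = cinner u (poly_op p v)"
  by (induction p arbitrary: v) (simp_all add: cinner_simps sym poly_op_commute)

lemma norm_R_le: "norm (R u) \<le> norm u"
proof (cases "norm (R u) = 0")
  case False
  have "norm (R u) * norm (R u) \<le> norm u * norm (R u)"
    using pos[of u] Re_cinner_le[of u "R u"] by (simp add: power2_eq_square)
  then show ?thesis using False by simp
qed auto

text \<open>The even parts of the exponents are shared between the two sides of the inner product.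
  What remains is 1, X, 1 - X or X (1 - X), whose forms are nonnegative by
  \<open>pos\<close>.\<close>

lemma positive_functional_poly_op: "positive_functional (\<lambda>p. Re (cinner u (poly_op p u)))"
  unfolding positive_functional_def
proof (intro conjI allI)
  fix k l
  define s where "s = [:0, 1::real:] ^ (k div 2) * [:1, -1:] ^ (l div 2)"
  define t where "t = [:0, 1::real:] ^ (k mod 2) * [:1, -1:] ^ (l mod 2)"
  define w where "w = poly_op s u"
  have "[:0, 1::real:] ^ k = ([:0, 1:] ^ (k div 2) * [:0, 1:] ^ (k div 2)) * [:0, 1:] ^ (k mod 2)"
    "[:1, -1::real:] ^ l = ([:1, -1:] ^ (l div 2) * [:1, -1:] ^ (l div 2)) * [:1, -1:] ^ (l mod 2)"
    by (simp_all only: power_add[symmetric] mult_2[symmetric] mult_div_mod_eq)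
  then have eq: "[:0, 1::real:] ^ k * [:1, -1:] ^ l = s * (t * s)"
    by (simp only: s_def t_def mult_ac)
  have "Re (cinner u (poly_op ([:0, 1:] ^ k * [:1, -1:] ^ l) u)) = Re (cinner w (poly_op t w))"
    unfolding eq by (simp only: poly_op_mult poly_op_sym[symmetric] w_def)
  moreover have 1: "0 \<le> Re (cinner w (R w))" using pos[of w] zero_le_power2[of "norm (R w)"] by linarith
  moreover have 2: "Re (cinner w (R w)) \<le> (norm w)\<^sup>2"
    using Re_cinner_le[of w "R w"] mult_left_mono[OF norm_R_le[of w] norm_ge_zero[of w]]
    by (simp add: power2_eq_square)
  moreover have "Re (cinner w (R (R w))) = (norm (R w))\<^sup>2" by (simp add: sym[symmetric] norm_sq_cinner)
  ultimately show "0 \<le> Re (cinner u (poly_op ([:0, 1:] ^ k * [:1, - 1:] ^ l) u))"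
    using pos[of w] mod2_eq_if[of k] mod2_eq_if[of l]
    by (auto simp: t_def poly_op_mult R_linear cinner_simps cinner_self split: if_splits)
qed (simp_all add: poly_op_add poly_op_smult cinner_simps)

definition represents :: "'h \<Rightarrow> real measure \<Rightarrow> bool" where
  "represents u M \<longleftrightarrow> finite_measure M \<and> sets M = sets borel \<and> (AE x in M. 0 \<le> x \<and> x \<le> 1) \<and>
     (\<forall>p. integral\<^sup>L M (poly p) = Re (cinner u (poly_op p u)))"

lemma represents_exists: "\<exists>M. represents u M"
proof (cases "u = 0")
  case True
  show ?thesis
    by (rule exI[of _ "null_measure borel"])
      (auto simp: represents_def True intro!: finite_measureI AE_I[of _ _ UNIV])
next
  case False
  define c where "c = (norm u)\<^sup>2"
  have c: "c > 0" using False by (simp add: c_def)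
  \<comment> \<open>The moment theorem concerns normalized functionals; the density c below restores
    the mass, which is the squared norm of u.\<close>
  define \<Lambda> where "\<Lambda> p = Re (cinner u (poly_op p u)) / c" for p
  have "positive_functional \<Lambda>"
    using positive_functional_poly_op[of u] c
    by (auto simp: positive_functional_def \<Lambda>_def add_divide_distrib)
  moreover have "\<Lambda> 1 = 1" using c by (simp add: \<Lambda>_def cinner_self c_def)
  ultimately obtain M where M: "real_distribution M" "AE x in M. 0 \<le> x \<and> x \<le> 1"
    "\<And>p. integral\<^sup>L M (poly p) = \<Lambda> p" using hausdorff_moment[of \<Lambda>] by blast
  interpret M: real_distribution M by (rule M)
  have cont: "poly p \<in> borel_measurable M" for p :: "real poly"
    by (subst measurable_cong_sets[OF M.events_eq_borel refl])
      (auto intro!: borel_measurable_continuous_onI continuous_intros)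
  have "represents u (density M (\<lambda>x. ennreal c))"
    unfolding represents_def
  proof (intro conjI allI)
    show "finite_measure (density M (\<lambda>x. ennreal c))"
      using M.emeasure_space_1 by (intro finite_measureI) (simp add: emeasure_density)
    show "AE x in density M (\<lambda>x. ennreal c). 0 \<le> x \<and> x \<le> 1"
      using M(2) by (subst AE_density) auto
    show "integral\<^sup>L (density M (\<lambda>x. ennreal c)) (poly p) = Re (cinner u (poly_op p u))" for p
      using c by (subst integral_density) (auto simp: cont M(3) \<Lambda>_def)
  qed simp
  then show ?thesis by blast
qed

definition \<mu> :: "'h \<Rightarrow> real measure" where
  "\<mu> u = (SOME M. represents u M)"

lemma mu:
  shows "finite_measure (\<mu> u)" "sets (\<mu> u) = sets borel" "AE x in \<mu> u. 0 \<le> x \<and> x \<le> 1"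
    "integral\<^sup>L (\<mu> u) (poly p) = Re (cinner u (poly_op p u))"
proof -
  have "represents u (\<mu> u)" unfolding \<mu>_def by (rule someI_ex[OF represents_exists])
  then show "finite_measure (\<mu> u)" "sets (\<mu> u) = sets borel" "AE x in \<mu> u. 0 \<le> x \<and> x \<le> 1"
    "integral\<^sup>L (\<mu> u) (poly p) = Re (cinner u (poly_op p u))"
    unfolding represents_def by blast+
qed

lemma poly_meas: "poly p \<in> borel_measurable (borel :: real measure)"
  by (auto intro!: borel_measurable_continuous_onI continuous_intros)

lemma poly_integrable: "integrable (\<mu> u) (poly p)"
proof -
  interpret finite_measure "\<mu> u" by (rule mu)
  have "bounded (poly p ` {0..1})"
    by (intro compact_imp_bounded compact_continuous_image continuous_intros) auto
  then obtain B where "\<And>x. x \<in> {0..1} \<Longrightarrow> norm (poly p x) \<le> B" unfolding bounded_iff by blast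
  then have "AE x in \<mu> u. norm (poly p x) \<le> B" using mu(3)[of u] by (auto elim!: AE_mp)
  then show ?thesis
    by (rule integrable_const_bound) (simp add: measurable_cong_sets[OF mu(2) refl] poly_meas)
qed

text \<open>First extension: F consists of indicators, whose images are the spectral
  projections.\<close>

sublocale l2_calculus "range (\<lambda>p. (poly p, poly_op p))" \<mu> "indicator ` sets borel"
proof (rule l2_calculus.intro, goal_cases)
  case 1 show ?case by (rule mu)
next
  case 2 show ?case by (rule mu)
next
  case 3 show ?case by (rule image_eqI[of _ _ 0]) auto
next
  case (4 f S g T)
  then obtain p q where "f = poly p" "S = poly_op p" "g = poly q" "T = poly_op q" by auto
  then show ?case by (intro image_eqI[of _ _ "p + q"]) (auto simp: poly_op_add)
next
  case (5 f S c)
  then obtain p where "f = poly p" "S = poly_op p" by auto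
  then show ?case by (intro image_eqI[of _ _ "smult c p"]) (auto simp: poly_op_smult)
next
  case (6 f S)
  then show ?case using poly_op_linear by auto
next
  case (7 f S u v)
  then show ?case using poly_op_sym by auto
next
  case (8 f S)
  then show ?case using poly_meas by auto
next
  case (9 f S u)
  then obtain p where "f = poly p" by auto
  moreover have "poly (p * p) = (\<lambda>x. (poly p x)\<^sup>2)" by (auto simp: power2_eq_square)
  ultimately show ?case using poly_integrable[of u "p * p"] by simp
next
  case (10 f S u)
  then obtain p where p: "f = poly p" "S = poly_op p" by auto
  have "(norm (S u))\<^sup>2 = Re (cinner u (poly_op (p * p) u))"
    by (simp add: p poly_op_mult norm_sq_cinner poly_op_sym)
  also have "\<dots> = integral\<^sup>L (\<mu> u) (poly (p * p))" by (simp add: mu)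
  also have "poly (p * p) = (\<lambda>x. (f x)\<^sup>2)" by (auto simp: p power2_eq_square)
  finally show ?case .
next
  case (11 f S u)
  then show ?case by (auto simp: mu)
next
  case (12 f)
  then show ?case by auto
next
  case (13 f V e)
  then obtain A where A: "A \<in> sets borel" "f = indicator A" by auto
  obtain p where "\<And>v. v \<in> V \<Longrightarrow> integral\<^sup>L (\<mu> v) (\<lambda>x. (indicator A x - poly p x)\<^sup>2) < e"
    using polynomial_L2_dense[OF 13(2) mu(1) mu(2) mu(3) A(1) 13(4), of "\<lambda>u. u"] by auto
  then show ?case using A by (intro bexI[of _ "(poly p, poly_op p)"]) auto
qed

lemma sq_int_indicator: "A \<in> sets borel \<Longrightarrow> sq_int (indicator A) u"
proof -
  assume A: "A \<in> sets borel"
  interpret finite_measure "\<mu> u" by (rule mu)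
  show ?thesis unfolding sq_int_def
    by (rule integrable_const_bound[of _ 1]) (use A in \<open>auto simp: indicator_def\<close>)
qed

theorem spectral_measure_exists:
  obtains E where "projection_valued_measure E"
    "\<And>u. AE x in scalar_measure E u. 0 \<le> x \<and> x \<le> 1"
    "\<And>u. Re (cinner u (R u)) = integral\<^sup>L (scalar_measure E u) (\<lambda>x. x)"
proof -
  define E where "E A = ext (indicator A)" for A
  have sp: "space (\<mu> u) = UNIV" for u using sets_eq_imp_space_eq[OF mu(2)[of u]] by simp
  have total: "measure (\<mu> u) UNIV = (norm u)\<^sup>2" for u
  proof -
    have "poly 1 = (\<lambda>x::real. 1)" by auto
    then show ?thesis using mu(4)[of u 1] sp[of u] by (simp add: cinner_self)
  qed
  have E: "clinear_on UNIV (E A)" "(norm (E A u))\<^sup>2 = measure (\<mu> u) A"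
    "cinner u (E A u) = complex_of_real (measure (\<mu> u) A)" "cinner (E A u) v = cinner u (E A v)"
    if A: "A \<in> sets borel" for A u v
  proof -
    have F: "indicator A \<in> indicator ` sets borel" using A by auto
    note s = sq_int_indicator[OF A]
    have sq: "(\<lambda>x. (indicator A x :: real)\<^sup>2) = indicator A" by (auto simp: indicator_def)
    have int: "integral\<^sup>L (\<mu> u) (indicator A) = measure (\<mu> u) A" for u by (simp add: sp)
    show "clinear_on UNIV (E A)"
      by (rule clinear_onI) (auto simp: E_def ext_add[OF F s s s] ext_scaleC[OF F s s])
    show "(norm (E A u))\<^sup>2 = measure (\<mu> u) A"
      using ext_norm[OF F s, of u] by (simp only: E_def sq int)
    show "cinner u (E A u) = complex_of_real (measure (\<mu> u) A)"
      using ext_mean[OF F s, of u] by (simp only: E_def int)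
    show "cinner (E A u) v = cinner u (E A v)"
      unfolding E_def by (rule ext_sym[OF F s s])
  qed
  note pvmI = projection_valued_measureI[OF mu(1,2) total E]
  have sm: "scalar_measure E u = \<mu> u" for u by (rule pvmI; assumption)
  show ?thesis
  proof (rule that)
    show "projection_valued_measure E" by (rule pvmI; assumption)
    show "AE x in scalar_measure E u. 0 \<le> x \<and> x \<le> 1" for u unfolding sm by (rule mu)
    have "poly [:0, 1:] = (\<lambda>x::real. x)" by auto
    then show "Re (cinner u (R u)) = integral\<^sup>L (scalar_measure E u) (\<lambda>x. x)" for u
      using mu(4)[of u "[:0, 1:]"] by (simp add: sm R_linear)
  qed
qed

end

section \<open>Functional calculus of a projection-valued measure\<close>

text \<open>Two measures stand on the right so that the parallelogram inequality for M (u + v) fits;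
  with equal measures it also handles scalar multiples.\<close>

lemma nn_integral_emeasure_le:
  assumes [measurable_cong]: "sets M = sets borel" "sets N = sets borel" "sets N' = sets borel"
    and le: "\<And>A. A \<in> sets borel \<Longrightarrow> emeasure M A \<le> c * (emeasure N A + emeasure N' A)"
    and h: "h \<in> borel_measurable borel"
  shows "(\<integral>\<^sup>+x. h x \<partial>M) \<le> c * ((\<integral>\<^sup>+x. h x \<partial>N) + (\<integral>\<^sup>+x. h x \<partial>N'))"
  using h
proof (induction h rule: borel_measurable_induct)
  case (cong f g)
  then have "f = g" by (auto simp: fun_eq_iff)
  then show ?case using cong by simp
next
  case (set A)
  then show ?case using le[of A] by (simp add: assms)
next
  case (mult u d)
  note [measurable] = mult.hyps(2)
  have "d * (\<integral>\<^sup>+x. u x \<partial>M) \<le> d * (c * ((\<integral>\<^sup>+x. u x \<partial>N) + (\<integral>\<^sup>+x. u x \<partial>N')))"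
    by (intro mult_left_mono mult.IH) simp
  then show ?case by (simp add: nn_integral_cmult distrib_left mult_ac)
next
  case (add u v)
  note [measurable] = add.hyps(1,3)
  show ?case using add_mono[OF add.IH] by (simp add: nn_integral_add distrib_left add_ac)
next
  case (seq U)
  note [measurable] = seq.hyps(1)
  have "(\<integral>\<^sup>+x. (SUP i. U i) x \<partial>M) = (SUP i. \<integral>\<^sup>+x. U i x \<partial>M)"
    unfolding SUP_apply by (rule nn_integral_monotone_convergence_SUP) (auto intro: seq.hyps)
  also have "\<dots> \<le> c * ((\<integral>\<^sup>+x. (SUP i. U i) x \<partial>N) + (\<integral>\<^sup>+x. (SUP i. U i) x \<partial>N'))"
  proof (rule SUP_least)
    fix i
    have "U i x \<le> (SUP i. U i) x" for x by (rule le_funD[OF SUP_upper]) simp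
    then have "(\<integral>\<^sup>+x. U i x \<partial>K) \<le> (\<integral>\<^sup>+x. (SUP i. U i) x \<partial>K)" for K by (rule nn_integral_mono)
    then show "(\<integral>\<^sup>+x. U i x \<partial>M) \<le> c * ((\<integral>\<^sup>+x. (SUP i. U i) x \<partial>N) + (\<integral>\<^sup>+x. (SUP i. U i) x \<partial>N'))"
      by (intro order.trans[OF seq.IH] mult_left_mono add_mono) auto
  qed
  finally show ?case .
qed

text \<open>Generated as pairs, which spares a normal form for step functions and a proof that the
  operator depends on the function alone.\<close>

inductive_set step_calculus :: "(real set \<Rightarrow> 'h::complex_hilbert \<Rightarrow> 'h) \<Rightarrow> ((real \<Rightarrow> real) \<times> ('h \<Rightarrow> 'h)) set"
  for E where
  zero: "(\<lambda>x. 0, \<lambda>u. 0) \<in> step_calculus E"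
| add: "(f, S) \<in> step_calculus E \<Longrightarrow> A \<in> sets borel \<Longrightarrow>
    (\<lambda>x. f x + c * indicator A x, \<lambda>u. S u + c *\<^sub>R E A u) \<in> step_calculus E"

locale pvm =
  fixes E :: "real set \<Rightarrow> 'h::complex_hilbert \<Rightarrow> 'h"
  assumes pvm: "projection_valued_measure E"
begin

lemma E_linear: "A \<in> sets borel \<Longrightarrow> clinear_on UNIV (E A)"
  and E_sym: "A \<in> sets borel \<Longrightarrow> cinner (E A u) v = cinner u (E A v)"
  and E_Int: "A \<in> sets borel \<Longrightarrow> B \<in> sets borel \<Longrightarrow> E A (E B u) = E (A \<inter> B) u"
  and E_UNIV [simp]: "E UNIV u = u"
  and E_sums: "range F \<subseteq> sets borel \<Longrightarrow> disjoint_family F \<Longrightarrow> (\<lambda>n. E (F n) u) sums E (\<Union>n::nat. F n) u"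
  using pvm by (auto simp: projection_valued_measure_def)

lemma E_norm: "A \<in> sets borel \<Longrightarrow> (norm (E A u))\<^sup>2 = Re (cinner u (E A u))"
  by (simp add: norm_sq_cinner E_sym E_Int)

abbreviation M :: "'h \<Rightarrow> real measure" where "M \<equiv> scalar_measure E"

lemma sets_M [simp, measurable_cong]: "sets (M u) = sets borel"
  by (simp add: scalar_measure_def sets.sigma_sets_eq[of borel, simplified])

lemma space_M [simp]: "space (M u) = UNIV"
  by (simp add: scalar_measure_def)

lemma meas_M: "f \<in> borel_measurable borel \<Longrightarrow> f \<in> borel_measurable (M u)"
  by (subst measurable_cong_sets[OF sets_M refl])

text \<open>The squared norm of E A u equals Re <u, E A u>, which is linear and continuous in E A u,
  so the vector-valued countable additivity passes to the masses.\<close>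

lemma emeasure_M: "A \<in> sets borel \<Longrightarrow> emeasure (M u) A = ennreal ((norm (E A u))\<^sup>2)"
proof (rule emeasure_measure_of[OF scalar_measure_def])
  show "positive (sets (M u)) (\<lambda>A. ennreal ((norm (E A u))\<^sup>2))"
  proof -
    have "(\<lambda>n::nat. E {} u) sums E {} u"
      using E_sums[of "\<lambda>n. {}" u] by (simp add: disjoint_family_on_def)
    then have "E {} u = 0" by (metis sums_iff summable_const_iff)
    then show ?thesis by (simp add: positive_def)
  qed
  show "countably_additive (sets (M u)) (\<lambda>A. ennreal ((norm (E A u))\<^sup>2))"
    unfolding countably_additive_def
  proof (intro allI impI)
    fix A :: "nat \<Rightarrow> real set" assume A: "range A \<subseteq> sets (M u)" "disjoint_family A"
    have "bounded_linear (\<lambda>v. Re (cinner u v))"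
      by (intro bounded_linear_compose[OF bounded_linear_Re]
          bounded_bilinear.bounded_linear_right[OF bounded_bilinear_cinner])
    from bounded_linear.sums[OF this E_sums[OF _ A(2), of u]] A(1)
    have "(\<lambda>n. Re (cinner u (E (A n) u))) sums Re (cinner u (E (\<Union>n. A n) u))" by simp
    moreover have "A n \<in> sets borel" for n using A by auto
    ultimately have "(\<lambda>n. (norm (E (A n) u))\<^sup>2) sums (norm (E (\<Union>n. A n) u))\<^sup>2"
      by (simp add: E_norm)
    then show "(\<Sum>n. ennreal ((norm (E (A n) u))\<^sup>2)) = ennreal ((norm (E (\<Union>n. A n) u))\<^sup>2)"
      by (intro suminf_ennreal_eq) auto
  qed
qed auto

lemma finite_M: "finite_measure (M u)"
  by (rule finite_measureI) (simp add: emeasure_M)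

lemma measure_M: "A \<in> sets borel \<Longrightarrow> measure (M u) A = (norm (E A u))\<^sup>2"
  by (simp add: Sigma_Algebra.measure_def emeasure_M)

lemma step_add:
  assumes "(f, S) \<in> step_calculus E" "(g, T) \<in> step_calculus E"
  shows "(\<lambda>x. f x + g x, \<lambda>u. S u + T u) \<in> step_calculus E"
  using assms(2)
proof (induction g T rule: step_calculus.induct)
  case (add g T A c)
  from step_calculus.add[OF add(3,2), of c] show ?case by (simp add: add.assoc)
qed (use assms(1) in simp)

lemma step_scale:
  assumes "(f, S) \<in> step_calculus E"
  shows "(\<lambda>x. d * f x, \<lambda>u. d *\<^sub>R S u) \<in> step_calculus E"
  using assms
proof (induction f S rule: step_calculus.induct)
  case (add g T A c)
  from step_calculus.add[OF add(3,2), of "d * c"] show ?case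
    by (simp add: distrib_left scaleR_add_right mult.assoc)
qed (simp add: step_calculus.zero)

lemma step_indicator: "A \<in> sets borel \<Longrightarrow> (\<lambda>x. c * indicator A x, \<lambda>u. c *\<^sub>R E A u) \<in> step_calculus E"
  using step_calculus.add[OF step_calculus.zero, of A c] by simp

lemma step_linear: "(f, S) \<in> step_calculus E \<Longrightarrow> clinear_on UNIV S"
proof (induction f S rule: step_calculus.induct)
  case (add f S A c)
  then show ?case using E_linear[of A]
    by (auto simp: clinear_on_def scaleR_add_right scaleC_add_right scaleC_scaleR)
qed (simp add: clinear_on_def)

lemma step_sym: "(f, S) \<in> step_calculus E \<Longrightarrow> cinner (S u) v = cinner u (S v)"
  by (induction f S rule: step_calculus.induct) (auto simp: cinner_simps E_sym)

lemma step_meas: "(f, S) \<in> step_calculus E \<Longrightarrow> f \<in> borel_measurable borel"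
  by (induction f S rule: step_calculus.induct) auto

lemma step_bounded: "(f, S) \<in> step_calculus E \<Longrightarrow> \<exists>B. \<forall>x. \<bar>f x\<bar> \<le> B"
proof (induction f S rule: step_calculus.induct)
  case (add f S A c)
  then obtain B where "\<And>x. \<bar>f x\<bar> \<le> B" by auto
  moreover have "\<bar>c * indicator A x\<bar> \<le> \<bar>c\<bar>" for x by (auto simp: indicator_def)
  ultimately have "\<bar>f x + c * indicator A x\<bar> \<le> B + \<bar>c\<bar>" for x by (meson abs_triangle_ineq add_mono order.trans)
  then show ?case by blast
qed auto

lemma integrable_bounded:
  assumes "f \<in> borel_measurable borel" "\<And>x. \<bar>f x :: real\<bar> \<le> B"
  shows "integrable (M u) f"
  by (rule finite_measure.integrable_const_bound[OF finite_M, of _ B]) (use assms meas_M in auto)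

lemma step_integrable:
  assumes "(f, S) \<in> step_calculus E"
  shows "integrable (M u) f"
  using step_bounded[OF assms] integrable_bounded[OF step_meas[OF assms]] by blast

lemma step_mean: "(f, S) \<in> step_calculus E \<Longrightarrow> Re (cinner u (S u)) = integral\<^sup>L (M u) f"
proof (induction f S rule: step_calculus.induct)
  case (add f S A c)
  have "integrable (M u) (\<lambda>x. c * indicator A x)"
    using step_integrable[OF step_indicator[OF add(2)]] .
  then show ?case
    using add step_integrable[OF add(1), of u]
    by (simp add: cinner_simps E_norm[symmetric] measure_M)
qed simp

lemma step_restrict:
  assumes "(f, S) \<in> step_calculus E" "A \<in> sets borel"
  shows "(\<lambda>x. indicator A x * f x, \<lambda>u. E A (S u)) \<in> step_calculus E"
  using assms(1)
proof (induction f S rule: step_calculus.induct)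
  case zero
  then show ?case using clinear_onD(4)[OF E_linear[OF assms(2)]] step_calculus.zero by simp
next
  case (add f S B c)
  have "(\<lambda>x. indicator A x * f x + c * indicator (A \<inter> B) x, \<lambda>u. E A (S u) + c *\<^sub>R E (A \<inter> B) u) \<in> step_calculus E"
    using step_calculus.add[OF add(3), of "A \<inter> B" c] add(2) assms(2) by simp
  moreover have "E A (S u + c *\<^sub>R E B u) = E A (S u) + c *\<^sub>R E (A \<inter> B) u" for u
    using clinear_onD(2,6)[OF E_linear[OF assms(2)]] E_Int[OF assms(2) add(2)] by simp
  moreover have "indicator A x * (f x + c * indicator B x) = indicator A x * f x + c * indicator (A \<inter> B) x" for x
    by (simp add: indicator_def)
  ultimately show ?case by simp
qed

text \<open>Products include squares, from which the isometry property \<open>G_norm\<close> of the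
  second extension is read off.\<close>

lemma step_mult:
  assumes "(f, S) \<in> step_calculus E" "(g, T) \<in> step_calculus E"
  shows "(\<lambda>x. f x * g x, \<lambda>u. S (T u)) \<in> step_calculus E"
  using assms(1)
proof (induction f S rule: step_calculus.induct)
  case (add f S A c)
  from step_add[OF add(3) step_scale[OF step_restrict[OF assms(2) add(2)], of c]]
  show ?case by (simp add: distrib_right mult.assoc)
qed (simp add: step_calculus.zero)

lemma simple_function_step:
  fixes f :: "real \<Rightarrow> real"
  assumes "simple_function borel f"
  obtains S where "(f, S) \<in> step_calculus E"
proof -
  have fin: "finite (range f)" using simple_functionD(1)[OF assms] by simp
  have m: "f -` {y} \<in> sets borel" for y using simple_functionD(2)[OF assms, of "{y}"] by simp
  have "\<exists>S. ((\<lambda>x. \<Sum>y\<in>I. y * indicator (f -` {y}) x), S) \<in> step_calculus E" if "finite I" for I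
    using that
  proof (induction I rule: finite_induct)
    case (insert y I)
    then obtain S where "((\<lambda>x. \<Sum>y\<in>I. y * indicator (f -` {y}) x), S) \<in> step_calculus E" by auto
    from step_calculus.add[OF this m, of y y]
    have "(\<lambda>x. (\<Sum>y\<in>I. y * indicator (f -` {y}) x) + y * indicator (f -` {y}) x, \<lambda>u. S u + y *\<^sub>R E (f -` {y}) u)
      \<in> step_calculus E" .
    moreover have "(\<Sum>y\<in>insert y I. y * indicator (f -` {y}) x)
      = (\<Sum>y\<in>I. y * indicator (f -` {y}) x) + y * indicator (f -` {y}) x" for x
      by (subst sum.insert[OF insert(1,2)]) (rule add.commute)
    ultimately show ?case by (simp only:) blast
  qed (use step_calculus.zero in auto)
  from this[OF fin] obtain S where "((\<lambda>x. \<Sum>y\<in>range f. y * indicator (f -` {y}) x), S) \<in> step_calculus E" ..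
  moreover have "(\<Sum>y\<in>range f. y * indicator (f -` {y}) x) = f x" for x
    using fin by (simp add: indicator_def if_distrib[of "(*) _"] sum.delta' cong: if_cong)
  ultimately show ?thesis using that by simp
qed

text \<open>Simple approximations dominated by 2 |f| serve all measures at once; then (f - s)^2 <=
  (3 f)^2 allows dominated convergence.\<close>

lemma step_dense:
  assumes f: "f \<in> borel_measurable borel" and V: "finite V"
    and int: "\<And>v. v \<in> V \<Longrightarrow> integrable (M v) (\<lambda>x. (f x)\<^sup>2)" and e: "0 < e"
  shows "\<exists>(g, T)\<in>step_calculus E. \<forall>v\<in>V. integral\<^sup>L (M v) (\<lambda>x. (f x - g x)\<^sup>2) < e"
proof -
  obtain s where s: "\<And>i. simple_function borel (s i)" "\<And>x. (\<lambda>i. s i x) \<longlonglongrightarrow> f x"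
    "\<And>i x. dist (s i x) 0 \<le> 2 * dist (f x) 0"
    using borel_measurable_implies_sequence_metric[OF f, of 0] by auto
  have sm: "s i \<in> borel_measurable borel" for i by (rule borel_measurable_simple_function[OF s(1)])
  have "(\<lambda>i. integral\<^sup>L (M v) (\<lambda>x. (f x - s i x)\<^sup>2)) \<longlonglongrightarrow> integral\<^sup>L (M v) (\<lambda>x. 0)" if v: "v \<in> V" for v
  proof (rule integral_dominated_convergence)
    show "integrable (M v) (\<lambda>x. 9 * (f x)\<^sup>2)" using int[OF v] by simp
    show "AE x in M v. (\<lambda>i. (f x - s i x)\<^sup>2) \<longlonglongrightarrow> 0"
    proof (rule AE_I2)
      fix x
      have "(\<lambda>i. (f x - s i x)\<^sup>2) \<longlonglongrightarrow> (f x - f x)\<^sup>2" by (intro tendsto_intros s)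
      then show "(\<lambda>i. (f x - s i x)\<^sup>2) \<longlonglongrightarrow> 0" by simp
    qed
    show "AE x in M v. norm ((f x - s i x)\<^sup>2) \<le> 9 * (f x)\<^sup>2" for i
    proof (rule AE_I2)
      fix x
      have "\<bar>f x - s i x\<bar> \<le> \<bar>3 * f x\<bar>" using s(3)[of i x] by (auto simp: dist_real_def)
      then have "(f x - s i x)\<^sup>2 \<le> (3 * f x)\<^sup>2" by (simp only: abs_le_square_iff)
      then show "norm ((f x - s i x)\<^sup>2) \<le> 9 * (f x)\<^sup>2" by (simp add: power_mult_distrib)
    qed
  qed (use f sm meas_M in auto)
  then have "\<forall>\<^sub>F i in sequentially. \<forall>v\<in>V. integral\<^sup>L (M v) (\<lambda>x. (f x - s i x)\<^sup>2) < e"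
    using e V by (intro eventually_ball_finite ballI order_tendstoD(2)[of _ 0]) auto
  then obtain i where i: "\<forall>v\<in>V. integral\<^sup>L (M v) (\<lambda>x. (f x - s i x)\<^sup>2) < e"
    using eventually_happens'[of sequentially] by auto
  obtain S where "(s i, S) \<in> step_calculus E" using simple_function_step[OF s(1)] by blast
  then show ?thesis using i by (intro bexI[of _ "(s i, S)"]) auto
qed

text \<open>Second extension: F is the class of all Borel functions, each acting on the vectors for
  which it is square integrable.\<close>

sublocale l2_calculus "step_calculus E" "scalar_measure E" "borel_measurable borel"
proof (rule l2_calculus.intro, goal_cases)
  case (9 f S u)
  have "(\<lambda>x. f x * f x, \<lambda>u. S (S u)) \<in> step_calculus E" using step_mult[OF 9 9] .
  from step_integrable[OF this] show ?case by (simp add: power2_eq_square)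
next
  case (10 f S u)
  have "(\<lambda>x. f x * f x, \<lambda>u. S (S u)) \<in> step_calculus E" using step_mult[OF 10 10] .
  from step_mean[OF this, of u] show ?case
    by (simp add: power2_eq_square norm_sq_cinner[unfolded power2_eq_square] step_sym[OF 10])
next
  case (13 f V e)
  then show ?case by (intro step_dense) auto
qed (auto intro: finite_M step_calculus.zero step_add step_scale step_linear step_sym step_meas step_mean)

end

section \<open>Domains, comparison and composition in the Borel functional calculus\<close>

context pvm
begin

lemma spectral_domain_eq: "spectral_domain E f = {u. sq_int f u}"
  by (simp add: spectral_domain_def sq_int_def)

lemma sq_int_iff_nn:
  assumes "f \<in> borel_measurable borel"
  shows "sq_int f u \<longleftrightarrow> (\<integral>\<^sup>+x. ennreal ((f x)\<^sup>2) \<partial>M u) < \<infinity>"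
  unfolding sq_int_def integrable_iff_bounded using meas_M[OF assms] by simp

lemma norm_ext_nn:
  assumes "f \<in> borel_measurable borel" "sq_int f u"
  shows "(\<integral>\<^sup>+x. ennreal ((f x)\<^sup>2) \<partial>M u) = ennreal ((norm (ext f u))\<^sup>2)"
  using assms nn_integral_eq_integral[of "M u" "\<lambda>x. (f x)\<^sup>2"] by (simp add: ext_norm sq_int_def)

lemma M_add_le:
  assumes "A \<in> sets borel"
  shows "emeasure (M (u + v)) A \<le> 2 * (emeasure (M u) A + emeasure (M v) A)"
proof -
  have "(norm (E A (u + v)))\<^sup>2 \<le> 2 * ((norm (E A u))\<^sup>2 + (norm (E A v))\<^sup>2)"
    using parallelogram_le[of "E A u" "E A v"] clinear_onD(2)[OF E_linear[OF assms], of u v] by simp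
  then have "ennreal ((norm (E A (u + v)))\<^sup>2) \<le> ennreal (2 * ((norm (E A u))\<^sup>2 + (norm (E A v))\<^sup>2))"
    by (rule ennreal_leI)
  then show ?thesis using assms by (simp add: emeasure_M ennreal_mult ennreal_plus)
qed

lemma nn_integral_M_add_le:
  assumes "h \<in> borel_measurable borel"
  shows "(\<integral>\<^sup>+x. h x \<partial>M (u + v)) \<le> 2 * ((\<integral>\<^sup>+x. h x \<partial>M u) + (\<integral>\<^sup>+x. h x \<partial>M v))"
  by (rule nn_integral_emeasure_le[OF sets_M sets_M sets_M M_add_le assms])

lemma M_scaleC:
  assumes "A \<in> sets borel"
  shows "emeasure (M (a *\<^sub>C u)) A = ennreal ((cmod a)\<^sup>2) * emeasure (M u) A"
  using assms clinear_onD(3)[OF E_linear[OF assms], of u a]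
  by (simp add: emeasure_M norm_scaleC power_mult_distrib ennreal_mult)

text \<open>Sums stay in the domain because M (x + y) is at most twice the sum of the measures of x
  and y.\<close>

lemma sq_int_csubspace:
  assumes f: "f \<in> borel_measurable borel"
  shows "csubspace {u. sq_int f u}"
  unfolding csubspace_def
proof (intro conjI ballI allI)
  note [measurable] = f
  show "x + y \<in> {u. sq_int f u}" if "x \<in> {u. sq_int f u}" "y \<in> {u. sq_int f u}" for x y
  proof -
    have "(\<integral>\<^sup>+z. ennreal ((f z)\<^sup>2) \<partial>M (x + y)) \<le> 2 * ((\<integral>\<^sup>+z. ennreal ((f z)\<^sup>2) \<partial>M x) + (\<integral>\<^sup>+z. ennreal ((f z)\<^sup>2) \<partial>M y))"
      by (rule nn_integral_M_add_le) simp
    also have "\<dots> < \<infinity>" using that by (simp add: sq_int_iff_nn[OF f] ennreal_mult_less_top)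
    finally show ?thesis by (simp add: sq_int_iff_nn[OF f])
  qed
  have sc: "sq_int f (a *\<^sub>C x)" if "sq_int f x" for a x
  proof -
    have "(\<integral>\<^sup>+z. ennreal ((f z)\<^sup>2) \<partial>M (a *\<^sub>C x))
        \<le> ennreal ((cmod a)\<^sup>2) * ((\<integral>\<^sup>+z. ennreal ((f z)\<^sup>2) \<partial>M x) + (\<integral>\<^sup>+z. ennreal ((f z)\<^sup>2) \<partial>M x))"
      by (rule nn_integral_emeasure_le) (auto simp: M_scaleC intro!: mult_left_mono)
    also have "\<dots> < \<infinity>" using that by (simp add: sq_int_iff_nn[OF f] ennreal_mult_less_top)
    finally show ?thesis by (simp add: sq_int_iff_nn[OF f])
  qed
  then show "a *\<^sub>C x \<in> {u. sq_int f u}" if "x \<in> {u. sq_int f u}" for a x using that by simp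
  have "emeasure (M 0) UNIV = 0" by (simp add: emeasure_M)
  then have "(\<integral>\<^sup>+z. ennreal ((f z)\<^sup>2) \<partial>M 0) = 0"
    by (intro nn_integral_0_iff_AE[THEN iffD2] AE_I[of _ _ UNIV]) (auto intro: meas_M)
  then show "0 \<in> {u. sq_int f u}" by (simp add: sq_int_iff_nn[OF f])
qed

lemma ext_linear:
  assumes f: "f \<in> borel_measurable borel"
  shows "clinear_on {u. sq_int f u} (ext f)"
  using csubspaceD(2,3)[OF sq_int_csubspace[OF f]]
  by (intro clinear_onI sq_int_csubspace f) (auto intro: ext_add ext_scaleC f)

lemma sq_int_bounded:
  assumes "f \<in> borel_measurable borel" "\<And>x. \<bar>f x\<bar> \<le> B"
  shows "sq_int f u"
proof -
  have "\<bar>(f x)\<^sup>2\<bar> \<le> B\<^sup>2" for x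
    using assms(2)[of x] abs_le_square_iff[of "f x" B] by simp
  then show ?thesis unfolding sq_int_def by (intro integrable_bounded) (use assms in auto)
qed

text \<open>Comparison of functions becomes comparison of operators. The inequality is asked only
  almost everywhere for the measure of u, which lets the lower bound of the spectrum enter
  later.\<close>

lemma sq_int_dominated:
  assumes m: "f \<in> borel_measurable borel" "g \<in> borel_measurable borel"
    and le: "AE x in M u. \<bar>f x\<bar> \<le> C * \<bar>g x\<bar>" and g: "sq_int g u" and C: "0 \<le> C"
  shows "sq_int f u" "norm (ext f u) \<le> C * norm (ext g u)"
proof -
  have le2: "AE x in M u. (f x)\<^sup>2 \<le> C\<^sup>2 * (g x)\<^sup>2"
    using le
  proof eventually_elim
    fix x assume "\<bar>f x\<bar> \<le> C * \<bar>g x\<bar>"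
    then have "\<bar>f x\<bar>\<^sup>2 \<le> (C * \<bar>g x\<bar>)\<^sup>2" by (rule power_mono) simp
    then show "(f x)\<^sup>2 \<le> C\<^sup>2 * (g x)\<^sup>2" by (simp add: power_mult_distrib)
  qed
  have gi: "integrable (M u) (\<lambda>x. C\<^sup>2 * (g x)\<^sup>2)" using g by (simp add: sq_int_def)
  show f: "sq_int f u" unfolding sq_int_def
    by (rule Bochner_Integration.integrable_bound[OF gi]) (use le2 meas_M m in auto)
  have "(norm (ext f u))\<^sup>2 \<le> (C * norm (ext g u))\<^sup>2"
    using integral_mono_AE[OF f[unfolded sq_int_def] gi le2] f g m
    by (simp add: ext_norm power_mult_distrib)
  then show "norm (ext f u) \<le> C * norm (ext g u)"
    by (rule power2_le_imp_le) (use C in auto)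
qed

lemma sq_int_cong_AE:
  assumes m: "f \<in> borel_measurable borel" "g \<in> borel_measurable borel"
    and eq: "AE x in M u. f x = g x" and g: "sq_int g u"
  shows "sq_int f u" "ext f u = ext g u"
proof -
  show f: "sq_int f u" by (rule sq_int_dominated(1)[where g = g and C = 1]) (use assms in auto)
  have "integral\<^sup>L (M u) (\<lambda>x. (f x - g x)\<^sup>2) = integral\<^sup>L (M u) (\<lambda>x. 0)"
    by (rule integral_cong_AE) (use eq m meas_M in auto)
  then show "ext f u = ext g u" using ext_diff_norm[OF m(1) f m(2) g] by simp
qed

lemma ext_indicator: "A \<in> sets borel \<Longrightarrow> ext (indicator A) u = E A u"
  using ext_G[of "indicator A" "E A" u] step_indicator[of A 1] by simp

text \<open>S is bounded because s is, so it may be applied to the approximations of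
  \<open>ext g u\<close>, while multiplication by s preserves their convergence in square
  mean.\<close>

lemma step_ext:
  assumes s: "(s, S) \<in> step_calculus E" and g: "g \<in> borel_measurable borel" "sq_int g u"
  shows "sq_int (\<lambda>x. s x * g x) u" "S (ext g u) = ext (\<lambda>x. s x * g x) u"
proof -
  obtain B where B: "\<And>x. \<bar>s x\<bar> \<le> B" using step_bounded[OF s] by auto
  then have B0: "0 \<le> B" using abs_ge_zero[of "s 0"] order.trans by blast
  note sm = step_meas[OF s]
  show si: "sq_int (\<lambda>x. s x * g x) u"
    by (rule sq_int_dominated(1)[where g = g and C = B])
      (use sm g B B0 in \<open>auto simp: abs_mult intro!: mult_right_mono\<close>)
  obtain h T where h: "\<And>n. (h n, T n) \<in> step_calculus E"
    and lim: "(\<lambda>n::nat. integral\<^sup>L (M u) (\<lambda>x. (g x - h n x)\<^sup>2)) \<longlonglongrightarrow> 0"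
    using approx_seq[OF g(1), of "{u}"] g(2) by auto
  have "norm (S w) \<le> B * norm w" for w
  proof -
    have "(norm (S w))\<^sup>2 = integral\<^sup>L (M w) (\<lambda>x. (s x)\<^sup>2)" by (rule G_norm[OF s])
    also have "\<dots> \<le> integral\<^sup>L (M w) (\<lambda>x. B\<^sup>2)"
    proof (rule integral_mono[OF G_int[OF s]])
      show "integrable (M w) (\<lambda>x. B\<^sup>2)" by (rule finite_measure.integrable_const[OF finite_M])
      show "(s x)\<^sup>2 \<le> B\<^sup>2" for x using B[of x] abs_le_square_iff[of "s x" B] by simp
    qed
    also have "\<dots> = (B * norm w)\<^sup>2" using measure_M[of UNIV w] by (simp add: power_mult_distrib)
    finally show ?thesis by (rule power2_le_imp_le) (use B0 in auto)
  qed
  then have "bounded_linear S" by (rule clinear_bounded_linear[OF step_linear[OF s]])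
  then have 1: "(\<lambda>n. S (T n u)) \<longlonglongrightarrow> S (ext g u)"
    by (rule bounded_linear.tendsto) (rule ext_seq[OF g h lim])
  have "(\<lambda>n. integral\<^sup>L (M u) (\<lambda>x. (s x * g x - s x * h n x)\<^sup>2)) \<longlonglongrightarrow> 0"
  proof (rule tendsto_sandwich[OF _ _ tendsto_const])
    show "(\<lambda>n. B\<^sup>2 * integral\<^sup>L (M u) (\<lambda>x. (g x - h n x)\<^sup>2)) \<longlonglongrightarrow> 0"
      using tendsto_mult[OF tendsto_const lim, of "B\<^sup>2"] by simp
    show "\<forall>\<^sub>F n in sequentially. integral\<^sup>L (M u) (\<lambda>x. (s x * g x - s x * h n x)\<^sup>2)
        \<le> B\<^sup>2 * integral\<^sup>L (M u) (\<lambda>x. (g x - h n x)\<^sup>2)"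
    proof (rule always_eventually, rule allI)
      fix n
      have "integral\<^sup>L (M u) (\<lambda>x. (s x * g x - s x * h n x)\<^sup>2) \<le> integral\<^sup>L (M u) (\<lambda>x. B\<^sup>2 * (g x - h n x)\<^sup>2)"
      proof (rule integral_mono)
        show "integrable (M u) (\<lambda>x. B\<^sup>2 * (g x - h n x)\<^sup>2)" using sq_int_diff_G[OF g h] by simp
        show "integrable (M u) (\<lambda>x. (s x * g x - s x * h n x)\<^sup>2)"
          using sq_int_diff_G[OF _ si step_mult[OF s h]] sm g by simp
        fix x
        have "(s x)\<^sup>2 \<le> B\<^sup>2" using B[of x] abs_le_square_iff[of "s x" B] by simp
        then have "(s x)\<^sup>2 * (g x - h n x)\<^sup>2 \<le> B\<^sup>2 * (g x - h n x)\<^sup>2" by (rule mult_right_mono) simp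
        then show "(s x * g x - s x * h n x)\<^sup>2 \<le> B\<^sup>2 * (g x - h n x)\<^sup>2"
          by (simp add: right_diff_distrib[symmetric] power_mult_distrib)
      qed
      then show "integral\<^sup>L (M u) (\<lambda>x. (s x * g x - s x * h n x)\<^sup>2)
        \<le> B\<^sup>2 * integral\<^sup>L (M u) (\<lambda>x. (g x - h n x)\<^sup>2)" by simp
    qed
  qed auto
  then have "(\<lambda>n. S (T n u)) \<longlonglongrightarrow> ext (\<lambda>x. s x * g x) u"
    using sm g by (intro ext_seq[OF _ si step_mult[OF s h]]) auto
  with 1 show "S (ext g u) = ext (\<lambda>x. s x * g x) u" by (rule LIMSEQ_unique)
qed

text \<open>Projecting with E A multiplies g by the indicator of A, so the mass of A is the integral
  of g^2 over A. This density turns domains of compositions into integrability of products.\<close>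

lemma M_ext:
  assumes g: "g \<in> borel_measurable borel" "sq_int g u"
  shows "M (ext g u) = density (M u) (\<lambda>x. ennreal ((g x)\<^sup>2))"
proof (rule measure_eqI)
  fix A assume "A \<in> sets (M (ext g u))"
  then have A [measurable]: "A \<in> sets borel" by simp
  note [measurable] = g(1) meas_M[OF g(1)]
  note s = step_ext[OF step_indicator[OF A, of 1] g]
  have "emeasure (M (ext g u)) A = ennreal ((norm (E A (ext g u)))\<^sup>2)" by (simp add: emeasure_M)
  also have "\<dots> = (\<integral>\<^sup>+x. ennreal ((indicator A x * g x)\<^sup>2) \<partial>M u)"
    using s g by (subst norm_ext_nn) auto
  also have "\<dots> = (\<integral>\<^sup>+x. ennreal ((g x)\<^sup>2) * indicator A x \<partial>M u)"
    by (intro nn_integral_cong) (auto simp: indicator_def)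
  also have "\<dots> = emeasure (density (M u) (\<lambda>x. ennreal ((g x)\<^sup>2))) A"
    by (subst emeasure_density) auto
  finally show "emeasure (M (ext g u)) A = emeasure (density (M u) (\<lambda>x. ennreal ((g x)\<^sup>2))) A" .
qed simp

lemma integral_M_ext:
  assumes g: "g \<in> borel_measurable borel" "sq_int g u" and h: "h \<in> borel_measurable borel"
  shows "integrable (M (ext g u)) h \<longleftrightarrow> integrable (M u) (\<lambda>x. (g x)\<^sup>2 * h x)"
    "integral\<^sup>L (M (ext g u)) h = integral\<^sup>L (M u) (\<lambda>x. (g x)\<^sup>2 * (h x :: real))"
  unfolding M_ext[OF g] using meas_M[OF h] meas_M[OF g(1)]
  by (simp_all add: integrable_density integral_density)

lemma sq_int_ext:
  assumes "g \<in> borel_measurable borel" "sq_int g u" "f \<in> borel_measurable borel"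
  shows "sq_int f (ext g u) \<longleftrightarrow> sq_int (\<lambda>x. f x * g x) u"
  unfolding sq_int_def using assms by (subst integral_M_ext) (auto simp: power_mult_distrib mult.commute)

lemma ext_ext:
  assumes g: "g \<in> borel_measurable borel" "sq_int g u" and f: "f \<in> borel_measurable borel"
    and fg: "sq_int (\<lambda>x. f x * g x) u"
  shows "ext f (ext g u) = ext (\<lambda>x. f x * g x) u"
proof -
  have sf: "sq_int f (ext g u)" using sq_int_ext[OF g f] fg by simp
  obtain s S where s: "\<And>n. (s n, S n) \<in> step_calculus E"
    and lim: "(\<lambda>n::nat. integral\<^sup>L (M (ext g u)) (\<lambda>x. (f x - s n x)\<^sup>2)) \<longlonglongrightarrow> 0"
    using approx_seq[OF f, of "{ext g u}"] sf by auto
  have 1: "(\<lambda>n. S n (ext g u)) \<longlonglongrightarrow> ext f (ext g u)" by (rule ext_seq[OF f sf s lim])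
  \<comment> \<open>By the density g^2, approximating f for the measure of \<open>ext g u\<close>
    amounts to approximating f g for the measure of u.\<close>
  have "(norm (ext (\<lambda>x. f x * g x) u - S n (ext g u)))\<^sup>2 = integral\<^sup>L (M (ext g u)) (\<lambda>x. (f x - s n x)\<^sup>2)" for n
  proof -
    note se = step_ext[OF s g, of n]
    have "(norm (ext (\<lambda>x. f x * g x) u - S n (ext g u)))\<^sup>2
        = integral\<^sup>L (M u) (\<lambda>x. (f x * g x - s n x * g x)\<^sup>2)"
      unfolding se(2) by (rule ext_diff_norm) (use f g fg se step_meas[OF s] in auto)
    also have "\<dots> = integral\<^sup>L (M (ext g u)) (\<lambda>x. (f x - s n x)\<^sup>2)"
      using f step_meas[OF s]
      by (subst integral_M_ext(2)[OF g]) (auto simp: power_mult_distrib[symmetric] right_diff_distrib mult.commute)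
    finally show ?thesis .
  qed
  then have "(\<lambda>n. S n (ext g u)) \<longlonglongrightarrow> ext (\<lambda>x. f x * g x) u"
    using lim by - (rule tendsto_of_norm_sq, simp)
  with 1 show ?thesis by (rule LIMSEQ_unique)
qed

lemma ext_one: "ext (\<lambda>x. 1) u = u"
  using ext_indicator[of UNIV u] by (simp add: indicator_def)

text \<open>The vectors cut off where |f| <= n lie in the domain of f by
  \<open>sq_int_cutoff\<close>; their convergence makes that domain dense.\<close>

lemma cutoff_tendsto:
  assumes f: "f \<in> borel_measurable borel"
  shows "(\<lambda>n. E {x. \<bar>f x\<bar> \<le> real n} u) \<longlonglongrightarrow> u"
proof (rule tendsto_of_norm_sq)
  define A where "A n = {x. \<bar>f x\<bar> \<le> real n}" for n
  have A: "A n \<in> sets borel" for n unfolding A_def using f by measurable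
  have sq: "sq_int (indicator B) u" if "B \<in> sets borel" for B
    using that by (intro sq_int_bounded[of _ 1]) (auto simp: indicator_def)
  have "(norm (u - E (A n) u))\<^sup>2 = integral\<^sup>L (M u) (\<lambda>x. (1 - indicator (A n) x)\<^sup>2)" for n
    using ext_diff_norm[OF _ sq[of UNIV] _ sq[OF A], of n] A[of n]
    by (simp add: ext_indicator ext_one)
  moreover have "(\<lambda>n. integral\<^sup>L (M u) (\<lambda>x. (1 - indicator (A n) x)\<^sup>2)) \<longlonglongrightarrow> integral\<^sup>L (M u) (\<lambda>x. 0 :: real)"
  proof (rule integral_dominated_convergence)
    show "integrable (M u) (\<lambda>x. 1)" by (rule finite_measure.integrable_const[OF finite_M])
    show "AE x in M u. (\<lambda>n. (1 - indicator (A n) x :: real)\<^sup>2) \<longlonglongrightarrow> 0"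
    proof (rule AE_I2)
      fix x
      obtain N where N: "\<bar>f x\<bar> \<le> real N" using real_arch_simple by blast
      have "\<forall>\<^sub>F n in sequentially. (1 - indicator (A n) x :: real)\<^sup>2 = 0"
        using eventually_ge_at_top[of N] by eventually_elim (use N in \<open>auto simp: A_def\<close>)
      then show "(\<lambda>n. (1 - indicator (A n) x :: real)\<^sup>2) \<longlonglongrightarrow> 0" by (rule tendsto_eventually)
    qed
  qed (use A in \<open>auto simp: indicator_def\<close>)
  ultimately show "(\<lambda>n. (norm (u - E {x. \<bar>f x\<bar> \<le> real n} u))\<^sup>2) \<longlonglongrightarrow> 0" by (simp add: A_def)
qed

lemma sq_int_cutoff:
  assumes f: "f \<in> borel_measurable borel" and A: "A \<in> sets borel" and B: "\<And>x. x \<in> A \<Longrightarrow> \<bar>f x\<bar> \<le> B"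
  shows "sq_int f (E A u)"
proof -
  have B': "\<bar>f x * indicator A x\<bar> \<le> \<bar>B\<bar>" for x using B[of x] by (auto simp: indicator_def)
  have "sq_int (\<lambda>x. f x * indicator A x) u" by (rule sq_int_bounded[OF _ B']) (use f A in auto)
  moreover have "sq_int (indicator A) u" by (rule sq_int_bounded[of _ 1]) (use A in \<open>auto simp: indicator_def\<close>)
  ultimately show ?thesis
    using sq_int_ext[of "indicator A" u f] f A by (simp add: ext_indicator)
qed

lemma spectral_domain_dense:
  assumes f: "f \<in> borel_measurable borel"
  shows "closure {u. sq_int f u} = UNIV"
proof -
  have "u \<in> closure {u. sq_int f u}" for u
    unfolding closure_sequential
  proof (intro exI[of _ "\<lambda>n. E {x. \<bar>f x\<bar> \<le> real n} u"] conjI allI)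
    fix n
    have A: "{x. \<bar>f x\<bar> \<le> real n} \<in> sets borel" using f by measurable
    have "sq_int f (E {x. \<bar>f x\<bar> \<le> real n} u)" by (rule sq_int_cutoff[OF f A, of "real n"]) blast
    then show "E {x. \<bar>f x\<bar> \<le> real n} u \<in> {u. sq_int f u}" by blast
  qed (rule cutoff_tendsto[OF f])
  then show ?thesis by auto
qed

lemma is_spectral_integral_ext: "f \<in> borel_measurable borel \<Longrightarrow> is_spectral_integral E f (ext f)"
  unfolding is_spectral_integral_def spectral_domain_eq
  by (intro conjI ballI ext_linear) (auto intro: ext_mean)

text \<open>On a dense domain the form leaves no freedom, so operators chosen by \<open>SOME\<close>
  through \<open>is_spectral_integral\<close> are determined on their domains.\<close>

lemma is_spectral_integral_unique:
  assumes f: "f \<in> borel_measurable borel" and T: "is_spectral_integral E f T" and u: "sq_int f u"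
  shows "T u = ext f u"
proof (rule quadratic_form_determines[of "{u. sq_int f u}" T "ext f"])
  show "clinear_on {u. sq_int f u} T"
    using T unfolding is_spectral_integral_def spectral_domain_eq by blast
  show "clinear_on {u. sq_int f u} (ext f)" by (rule ext_linear[OF f])
  show "closure {u. sq_int f u} = UNIV" by (rule spectral_domain_dense[OF f])
  show "u \<in> {u. sq_int f u}" using u by simp
  fix v assume "v \<in> {u. sq_int f u}"
  then show "cinner v (T v) = cinner v (ext f v)"
    using T ext_mean[OF f, of v] unfolding is_spectral_integral_def spectral_domain_eq by simp
qed

end

section \<open>The spectral theorem for positive self-adjoint operators\<close>

lemma positive_self_adjointE:
  assumes "positive_self_adjoint D (H :: 'h::complex_hilbert \<Rightarrow> 'h)"
  obtains c where "c > 0" "clinear_on D H"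
    "\<And>u. u \<in> D \<Longrightarrow> c * (norm u)\<^sup>2 \<le> Re (cinner u (H u))"
    "\<And>u v. u \<in> D \<Longrightarrow> v \<in> D \<Longrightarrow> cinner (H u) v = cinner u (H v)"
    "\<And>v w. (\<And>u. u \<in> D \<Longrightarrow> cinner v (H u) = cinner w u) \<Longrightarrow> v \<in> D \<and> H v = w"
proof -
  have gr: "op_graph D H = adjoint_graph (op_graph D H)" and lin: "clinear_on D H"
    using assms by (auto simp: positive_self_adjoint_def self_adjoint_def)
  have "(v, H v) \<in> adjoint_graph (op_graph D H)" if "v \<in> D" for v
    using that gr by (auto simp: op_graph_def)
  then have sym: "cinner (H u) v = cinner u (H v)" if "u \<in> D" "v \<in> D" for u v
    using that by (auto simp: adjoint_graph_def op_graph_def)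
  have "v \<in> D \<and> H v = w" if "\<And>u. u \<in> D \<Longrightarrow> cinner v (H u) = cinner w u" for v w
  proof -
    have "(v, w) \<in> adjoint_graph (op_graph D H)"
      using that by (auto simp: adjoint_graph_def op_graph_def)
    then have "(v, w) \<in> op_graph D H" using gr by simp
    then show ?thesis by (auto simp: op_graph_def)
  qed
  moreover obtain c where "c > 0" "\<And>u. u \<in> D \<Longrightarrow> c * (norm u)\<^sup>2 \<le> Re (cinner u (H u))"
    using assms by (auto simp: positive_self_adjoint_def)
  ultimately show ?thesis using that lin sym by blast
qed

lemma positive_self_adjoint_lower:
  assumes "c * (norm u)\<^sup>2 \<le> Re (cinner u (w::'h::complex_hilbert))"
  shows "c * norm u \<le> norm w"
proof (cases "u = 0")
  case False
  have "(c * norm u) * norm u \<le> norm w * norm u"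
    using assms Re_cinner_le[of u w] by (simp add: power2_eq_square mult_ac)
  then show ?thesis using False by simp
qed simp

text \<open>The lower bound c makes the range closed. A vector orthogonal to the range lies in D by
  self-adjointness and is annihilated by H, so the lower bound forces it to vanish.\<close>

lemma positive_self_adjoint_onto:
  assumes psa: "positive_self_adjoint D (H :: 'h::complex_hilbert \<Rightarrow> 'h)"
  shows "H ` D = UNIV"
proof -
  obtain c where c: "c > 0" "clinear_on D H"
    "\<And>u. u \<in> D \<Longrightarrow> c * (norm u)\<^sup>2 \<le> Re (cinner u (H u))"
    and sym: "\<And>u v. u \<in> D \<Longrightarrow> v \<in> D \<Longrightarrow> cinner (H u) v = cinner u (H v)"
    and adj: "\<And>v w. (\<And>u. u \<in> D \<Longrightarrow> cinner v (H u) = cinner w u) \<Longrightarrow> v \<in> D \<and> H v = w"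
    using positive_self_adjointE[OF psa] by metis
  note l = clinear_onD[OF c(2)] note s = csubspaceD[OF l(1)]
  have low: "c * norm u \<le> norm (H u)" if "u \<in> D" for u
    by (rule positive_self_adjoint_lower[OF c(3)[OF that]])
  show ?thesis
  proof (rule range_dense_onto)
    show "csubspace (H ` D)"
      unfolding csubspace_def
    proof (intro conjI ballI allI)
      show "0 \<in> H ` D" using l(4) s(1) by (metis image_eqI)
      show "x + y \<in> H ` D" if "x \<in> H ` D" "y \<in> H ` D" for x y
        using that l(2) s(2) by (metis (no_types, lifting) imageE image_eqI)
      show "a *\<^sub>C x \<in> H ` D" if "x \<in> H ` D" for a x
        using that l(3) s(3) by (metis (no_types, lifting) imageE image_eqI)
    qed
    show "closed (H ` D)"
      unfolding closed_sequential_limits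
    proof (intro allI impI, elim conjE)
      fix x z assume x: "\<forall>n. x n \<in> H ` D" "x \<longlonglongrightarrow> z"
      then have "\<forall>n. \<exists>u. u \<in> D \<and> H u = x n" by (metis imageE)
      then obtain u where u: "\<And>n. u n \<in> D" "\<And>n. H (u n) = x n" by metis
      have "Cauchy u"
      proof (rule metric_CauchyI)
        fix e :: real assume e: "0 < e"
        obtain N where N: "\<And>m n. m \<ge> N \<Longrightarrow> n \<ge> N \<Longrightarrow> dist (x m) (x n) < c * e"
          using LIMSEQ_imp_Cauchy[OF x(2)] e c(1) unfolding Cauchy_def by (metis mult_pos_pos)
        show "\<exists>N. \<forall>m\<ge>N. \<forall>n\<ge>N. dist (u m) (u n) < e"
        proof (intro exI allI impI)
          fix m n assume "N \<le> m" "N \<le> n"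
          then have "norm (H (u m) - H (u n)) < c * e" using N by (simp add: u dist_norm)
          then have "c * norm (u m - u n) < c * e"
            using low[of "u m - u n"] l(5)[OF u(1) u(1), of m n] s(4)[OF u(1) u(1), of m n] by simp
          then show "dist (u m) (u n) < e" using c(1) by (simp add: dist_norm)
        qed
      qed
      then obtain w where w: "u \<longlonglongrightarrow> w" by (auto simp: Cauchy_convergent_iff convergent_def)
      have "cinner w (H v) = cinner z v" if "v \<in> D" for v
      proof -
        have "(\<lambda>n. cinner (u n) (H v)) \<longlonglongrightarrow> cinner w (H v)" by (intro tendsto_cinner w tendsto_const)
        moreover have "(\<lambda>n. cinner (x n) v) \<longlonglongrightarrow> cinner z v" by (intro tendsto_cinner x tendsto_const)
        moreover have "cinner (x n) v = cinner (u n) (H v)" for n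
          using sym[OF u(1) that] u(2) by simp
        ultimately show ?thesis by (simp add: LIMSEQ_unique)
      qed
      then have "w \<in> D \<and> H w = z" by (rule adj)
      then show "z \<in> H ` D" by auto
    qed
    fix v assume "\<And>u. u \<in> H ` D \<Longrightarrow> cinner v u = 0"
    then have "v \<in> D \<and> H v = 0" by (intro adj) auto
    then show "v = 0" using low[of v] c(1) by (simp add: mult_le_0_iff)
  qed
qed

theorem spectral_theorem_positive:
  assumes psa: "positive_self_adjoint D (H :: 'h::complex_hilbert \<Rightarrow> 'h)"
  obtains E where "projection_valued_measure E" "D = spectral_domain E (\<lambda>x. x)"
    "is_spectral_integral E (\<lambda>x. x) H"
proof -
  obtain c where c: "c > 0" and lin: "clinear_on D H"
    and pos: "\<And>u. u \<in> D \<Longrightarrow> c * (norm u)\<^sup>2 \<le> Re (cinner u (H u))"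
    and sym: "\<And>u v. u \<in> D \<Longrightarrow> v \<in> D \<Longrightarrow> cinner (H u) v = cinner u (H v)"
    using positive_self_adjointE[OF psa] by metis
  note l = clinear_onD[OF lin] note s = csubspaceD[OF l(1)]
  have inj: "u = v" if "u \<in> D" "v \<in> D" "H u = H v" for u v
  proof -
    have "c * norm (u - v) \<le> norm (H (u - v))"
      by (rule positive_self_adjoint_lower[OF pos]) (use that s in auto)
    then show ?thesis using that l(5) c by (simp add: mult_le_0_iff)
  qed
  \<comment> \<open>The inverse of H, chosen pointwise; the lower bound makes the preimage
    unique.\<close>
  define K where "K z = (SOME u. u \<in> D \<and> H u = z)" for z
  have K: "K z \<in> D" "H (K z) = z" for z
  proof -
    have "\<exists>u. u \<in> D \<and> H u = z" using positive_self_adjoint_onto[OF psa] by (metis UNIV_I imageE)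
    from someI_ex[OF this] show "K z \<in> D" "H (K z) = z" by (auto simp: K_def)
  qed
  have Klin: "clinear_on UNIV K"
  proof (rule clinear_onI)
    show "K (x + y) = K x + K y" for x y
      by (rule inj[OF K(1) s(2)[OF K(1) K(1)]]) (simp add: K l(2)[OF K(1) K(1)])
    show "K (a *\<^sub>C x) = a *\<^sub>C K x" for a x
      by (rule inj[OF K(1) s(3)[OF K(1)]]) (simp add: K l(3)[OF K(1)])
  qed simp
  have Ksym: "cinner (K z) w = cinner z (K w)" for z w
    using sym[OF K(1) K(1), of z w] by (simp add: K)
  \<comment> \<open>The lower bound of H at K u reads c |K u|^2 <= Re <K u, u>, which is exactly
    \<open>pos\<close> for c K.\<close>
  interpret R: positive_contraction "\<lambda>z. c *\<^sub>R K z"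
  proof
    show "clinear_on UNIV (\<lambda>z. c *\<^sub>R K z)"
      using clinear_onD[OF Klin] by (auto simp: clinear_on_def scaleR_add_right scaleC_scaleR)
    show "cinner (c *\<^sub>R K u) v = cinner u (c *\<^sub>R K v)" for u v by (simp add: cinner_simps Ksym)
    fix u
    have "c * (c * (norm (K u))\<^sup>2) \<le> c * Re (cinner (K u) u)"
      using mult_left_mono[OF pos[OF K(1)[of u]], of c] c K(2) by simp
    then show "(norm (c *\<^sub>R K u))\<^sup>2 \<le> Re (cinner u (c *\<^sub>R K u))"
      using c by (simp add: cinner_simps Re_cinner_commute[of u] power2_eq_square mult_ac)
  qed
  obtain E0 where E0: "projection_valued_measure E0"
    and AE0: "\<And>u. AE x in scalar_measure E0 u. 0 \<le> x \<and> x \<le> 1"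
    and mean0: "\<And>u. Re (cinner u (c *\<^sub>R K u)) = integral\<^sup>L (scalar_measure E0 u) (\<lambda>x. x)"
    using R.spectral_measure_exists by metis
  interpret P0: pvm E0 by standard (rule E0)
  \<comment> \<open>Undoes the passage to c K: a spectral value x in (0, 1] corresponds to c / x >=
    c for H. Since \<open>c / 0\<close> is 0, the point 0 stays fixed and has to be excluded
    separately.\<close>
  define g where "g x = c / x" for x :: real
  have g [measurable]: "g \<in> borel_measurable borel" unfolding g_def by measurable
  have gv: "g -` A \<in> sets borel" if "A \<in> sets borel" for A
    using measurable_sets[OF g that] by simp
  define E where "E A = E0 (g -` A)" for A
  have pvmE: "projection_valued_measure E"
    unfolding projection_valued_measure_def
  proof (intro conjI ballI allI impI)
    fix A u assume A: "range A \<subseteq> sets borel \<and> disjoint_family (A :: nat \<Rightarrow> real set)"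
    then have "range (\<lambda>n. g -` A n) \<subseteq> sets borel" "disjoint_family (\<lambda>n. g -` A n)"
      using gv unfolding disjoint_family_on_def by blast+
    from P0.E_sums[OF this, of u] show "(\<lambda>n. E (A n) u) sums E (\<Union>n. A n) u"
      by (simp add: E_def vimage_UN)
  qed (auto simp: E_def gv P0.E_linear P0.E_sym P0.E_Int fun_eq_iff)
  interpret P: pvm E by standard (rule pvmE)
  have M: "P.M u = distr (P0.M u) borel g" for u
    by (rule measure_eqI) (simp_all add: P.emeasure_M emeasure_distr measurable_cong_sets[OF P0.sets_M refl]
        P0.emeasure_M gv E_def)
  have inv [measurable]: "(inverse :: real \<Rightarrow> real) \<in> borel_measurable borel" by measurable
  have inv_le: "AE x in P.M u. \<bar>inverse x\<bar> \<le> inverse c * \<bar>1::real\<bar>" for u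
    unfolding M
  proof (subst AE_distr_iff)
    show "AE x in P0.M u. \<bar>inverse (g x)\<bar> \<le> inverse c * \<bar>1\<bar>"
      using AE0[of u] by (rule AE_mp) (use c in \<open>auto simp: g_def field_simps\<close>)
  qed (auto simp: measurable_cong_sets[OF P0.sets_M refl])
  have sq1: "P.sq_int (\<lambda>x. 1) u" for u by (rule P.sq_int_bounded[of _ 1]) auto
  have sqinv: "P.sq_int inverse u" for u
    by (rule P.sq_int_dominated(1)[OF _ _ inv_le sq1]) (use c in auto)
  have ext_inv: "P.ext inverse u = K u" for u
  proof (rule quadratic_form_determines[of UNIV "P.ext inverse" K])
    show "clinear_on UNIV (P.ext inverse)" using P.ext_linear[OF inv] sqinv by simp
    fix u
    have "integral\<^sup>L (P.M u) inverse = integral\<^sup>L (P0.M u) (\<lambda>x. inverse (g x))"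
      unfolding M by (rule integral_distr) (auto simp: measurable_cong_sets[OF P0.sets_M refl])
    also have "(\<lambda>x. inverse (g x)) = (\<lambda>x. x / c)" by (auto simp: g_def)
    also have "integral\<^sup>L (P0.M u) (\<lambda>x. x / c) = Re (cinner u (K u))"
      using mean0[of u] c by (simp add: cinner_simps field_simps)
    also have "complex_of_real \<dots> = cinner u (K u)"
    proof -
      have "cnj (cinner u (K u)) = cinner u (K u)" by (metis Ksym cinner_commute)
      then show ?thesis by (metis Reals_cnj_iff of_real_Re)
    qed
    finally show "cinner u (P.ext inverse u) = cinner u (K u)"
      using P.ext_mean[OF inv sqinv, of u] by simp
  qed (use Klin in auto)
  \<comment> \<open>A vector in the range of E {0} is annihilated by K because
    \<open>inverse 0\<close> is 0; but H inverts K.\<close>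
  have E00: "E {0} u = 0" for u
  proof -
    have si: "P.sq_int (indicator {0}) u" by (rule P.sq_int_bounded[of _ 1]) (auto simp: indicator_def)
    have "K (E {0} u) = P.ext inverse (P.ext (indicator {0}) u)" by (simp add: ext_inv P.ext_indicator)
    also have "\<dots> = P.ext (\<lambda>x. inverse x * indicator {0} x) u"
      by (rule P.ext_ext) (auto intro!: si P.sq_int_bounded[of _ 0] simp: indicator_def)
    also have "(\<lambda>x. inverse x * indicator {0} x) = (\<lambda>x::real. 0)" by (auto simp: indicator_def)
    also have "P.ext (\<lambda>x. 0) u = 0" using P.ext_G[OF _ step_calculus.zero] by simp
    finally show ?thesis using K(2)[of "E {0} u"] l(4) by simp
  qed
  have nz: "AE x in P.M u. x \<noteq> 0" for u
    by (rule AE_I[of _ _ "{0}"]) (auto simp: P.emeasure_M E00)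
  have id_inv: "P.sq_int (\<lambda>x. x * inverse x) u" "P.ext (\<lambda>x. x * inverse x) u = u" for u
  proof -
    have "AE x in P.M u. x * inverse x = 1" using nz[of u] by (rule AE_mp) auto
    from P.sq_int_cong_AE[OF _ _ this sq1]
    show "P.sq_int (\<lambda>x. x * inverse x) u" "P.ext (\<lambda>x. x * inverse x) u = u"
      by (simp_all add: P.ext_one)
  qed
  have D1: "P.sq_int (\<lambda>x. x) u \<and> P.ext (\<lambda>x. x) u = H u" if "u \<in> D" for u
  proof -
    have u: "u = P.ext inverse (H u)" unfolding ext_inv by (rule inj) (auto simp: that K)
    have "P.sq_int (\<lambda>x. x) (P.ext inverse (H u))"
      by (subst P.sq_int_ext) (auto simp: sqinv id_inv)
    moreover have "P.ext (\<lambda>x. x) (P.ext inverse (H u)) = H u"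
      by (subst P.ext_ext) (auto simp: sqinv id_inv)
    ultimately show ?thesis using u by simp
  qed
  have D2: "u \<in> D" if "P.sq_int (\<lambda>x. x) u" for u
  proof -
    have "P.ext inverse (P.ext (\<lambda>x. x) u) = u"
      by (subst P.ext_ext) (use that id_inv in \<open>auto simp: mult.commute[of "inverse _"]\<close>)
    then show ?thesis unfolding ext_inv using K(1) by metis
  qed
  have D: "D = spectral_domain E (\<lambda>x. x)" using D1 D2 by (auto simp: P.spectral_domain_eq)
  show ?thesis
  proof (rule that[OF pvmE D])
    show "is_spectral_integral E (\<lambda>x. x) H"
      unfolding is_spectral_integral_def D[symmetric]
    proof (intro conjI ballI lin)
      fix u assume u: "u \<in> D"
      show "cinner u (H u) = complex_of_real (integral\<^sup>L (P.M u) (\<lambda>x. x))"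
        using P.ext_mean[of "\<lambda>x. x" u] D1[OF u] by simp
    qed
  qed
qed

section \<open>Powers of a strictly positive operator\<close>

locale positive_pvm = pvm E for E :: "real set \<Rightarrow> 'h::complex_hilbert \<Rightarrow> 'h" +
  fixes c :: real
  assumes c_pos: "0 < c" and E_below: "E {..<c} u = 0"
begin

text \<open>\<open>X s\<close> is the power H^s and \<open>dm s\<close> its domain, so the index k
  of the scale corresponds to s = k / 2 here.\<close>

definition X :: "real \<Rightarrow> 'h \<Rightarrow> 'h" where
  "X s = ext (\<lambda>x. x powr s)"

definition dm :: "real \<Rightarrow> 'h set" where
  "dm s = {u. sq_int (\<lambda>x. x powr s) u}"

definition P :: "real \<Rightarrow> 'h \<Rightarrow> 'h" where
  "P r = E {..r}"

lemma AE_ge: "AE x in M u. c \<le> x"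
  by (rule AE_I[of _ _ "{..<c}"]) (auto simp: emeasure_M E_below)

lemma dm_csubspace: "csubspace (dm s)"
  unfolding dm_def by (rule sq_int_csubspace) simp

lemma X_linear: "clinear_on (dm s) (X s)"
  unfolding dm_def X_def by (rule ext_linear) simp

lemma sq_int_one: "sq_int (\<lambda>x. 1) u"
  by (rule sq_int_bounded[of _ 1]) auto

lemma sq_int_ind: "A \<in> sets borel \<Longrightarrow> sq_int (indicator A) u"
  by (rule sq_int_bounded[of _ 1]) (auto simp: indicator_def)

text \<open>On the spectrum x >= c the quotient x^(a - b) is at most c^(a - b); this is the
  embedding of the scale.\<close>

lemma dm_mono:
  assumes "a \<le> b" "u \<in> dm b"
  shows "u \<in> dm a" "norm (X a u) \<le> c powr (a - b) * norm (X b u)"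
proof -
  have "AE x in M u. \<bar>x powr a\<bar> \<le> c powr (a - b) * \<bar>x powr b\<bar>"
    using AE_ge[of u]
  proof eventually_elim
    fix x assume x: "c \<le> x"
    have "x powr (a - b) \<le> c powr (a - b)"
      by (rule powr_mono2') (use x assms c_pos in auto)
    then have "x powr (a - b) * x powr b \<le> c powr (a - b) * x powr b" by (rule mult_right_mono) simp
    then show "\<bar>x powr a\<bar> \<le> c powr (a - b) * \<bar>x powr b\<bar>" by (simp add: powr_add[symmetric])
  qed
  from sq_int_dominated[OF _ _ this] assms(2)
  show "u \<in> dm a" "norm (X a u) \<le> c powr (a - b) * norm (X b u)"
    by (auto simp: dm_def X_def)
qed

lemma dm_0 [simp]: "u \<in> dm 0" and X_0 [simp]: "X 0 u = u"
proof -
  \<comment> \<open>\<open>0 powr 0\<close> is 0, so positivity of the spectrum is used even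
    here.\<close>
  have "AE x in M u. x powr 0 = 1"
    using AE_ge[of u] by eventually_elim (use c_pos in auto)
  from sq_int_cong_AE[OF _ _ this sq_int_one] show "u \<in> dm 0" "X 0 u = u"
    by (auto simp: dm_def X_def ext_one)
qed

lemma dm_nonpos: "s \<le> 0 \<Longrightarrow> u \<in> dm s"
  by (rule dm_mono(1)[of s 0]) auto

lemma dm_le: "u \<in> dm b \<Longrightarrow> a \<le> b \<Longrightarrow> u \<in> dm a"
  by (rule dm_mono)

text \<open>The equivalence of domains converts regularity of X b u into regularity of u; the
  induction for conjugated operators climbs the scale in this way.\<close>

lemma X_X:
  assumes "u \<in> dm b"
  shows "X b u \<in> dm a \<longleftrightarrow> u \<in> dm (a + b)" "u \<in> dm (a + b) \<Longrightarrow> X a (X b u) = X (a + b) u"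
proof -
  have eq: "(\<lambda>x::real. x powr a * x powr b) = (\<lambda>x. x powr (a + b))" by (simp add: powr_add)
  show "X b u \<in> dm a \<longleftrightarrow> u \<in> dm (a + b)"
    using assms sq_int_ext[of "\<lambda>x. x powr b" u "\<lambda>x. x powr a"] by (simp add: dm_def X_def eq)
  show "u \<in> dm (a + b) \<Longrightarrow> X a (X b u) = X (a + b) u"
    using assms ext_ext[of "\<lambda>x. x powr b" u "\<lambda>x. x powr a"] by (simp add: dm_def X_def eq)
qed

lemma X_neg_X: "u \<in> dm s \<Longrightarrow> X (- s) (X s u) = u"
  using X_X(2)[of u s "- s"] by simp

lemma X_X_neg: "0 \<le> s \<Longrightarrow> X (- s) u \<in> dm s" "0 \<le> s \<Longrightarrow> X s (X (- s) u) = u"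
  using X_X[of u "- s" s] dm_nonpos[of "- s" u] by auto

lemma X_sym: "u \<in> dm s \<Longrightarrow> v \<in> dm s \<Longrightarrow> cinner (X s u) v = cinner u (X s v)"
  unfolding X_def dm_def by (intro ext_sym) auto

lemma dm_dense: "closure (dm s) = UNIV"
  unfolding dm_def by (rule spectral_domain_dense) simp

lemma X_neg_bounded: "0 \<le> s \<Longrightarrow> norm (X (- s) u) \<le> c powr (- s) * norm u"
  using dm_mono(2)[of "- s" 0 u] by simp

lemma X_neg_bounded_linear: "0 \<le> s \<Longrightarrow> bounded_linear (X (- s))"
proof (rule clinear_bounded_linear)
  assume "0 \<le> s"
  then have "dm (- s) = UNIV" using dm_nonpos[of "- s"] by auto
  then show "clinear_on UNIV (X (- s))" using X_linear[of "- s"] by simp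
qed (rule X_neg_bounded)

section \<open>Spectral truncations, their rates, and interpolation\<close>

lemma P_linear: "clinear_on UNIV (P r)"
  unfolding P_def by (rule E_linear) simp

lemma P_sym: "cinner (P r u) v = cinner u (P r v)"
  unfolding P_def by (rule E_sym) simp

lemma norm_P_le: "norm (P r u) \<le> norm u"
proof -
  have "(norm (P r u))\<^sup>2 \<le> (norm u)\<^sup>2"
    using finite_measure.finite_measure_mono[OF finite_M, of "{..r}" UNIV u]
    by (simp add: P_def measure_M)
  then show ?thesis by (rule power2_le_imp_le) simp
qed

lemma X_E:
  assumes A: "A \<in> sets borel"
  shows "E A u \<in> dm s \<longleftrightarrow> sq_int (\<lambda>x. x powr s * indicator A x) u"
    "E A u \<in> dm s \<Longrightarrow> X s (E A u) = ext (\<lambda>x. x powr s * indicator A x) u"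
proof -
  show 1: "E A u \<in> dm s \<longleftrightarrow> sq_int (\<lambda>x. x powr s * indicator A x) u"
    using sq_int_ext[OF _ sq_int_ind[OF A], of "\<lambda>x. x powr s"] A by (simp add: dm_def ext_indicator)
  show "E A u \<in> dm s \<Longrightarrow> X s (E A u) = ext (\<lambda>x. x powr s * indicator A x) u"
    using ext_ext[OF _ sq_int_ind[OF A], of "\<lambda>x. x powr s"] A 1 by (simp add: X_def ext_indicator)
qed

lemma P_X:
  assumes "u \<in> dm s"
  shows "P r u \<in> dm s" "X s (P r u) = P r (X s u)"
proof -
  note s = step_ext[OF step_indicator[of "{..r}" 1], of "\<lambda>x. x powr s" u]
  show 1: "P r u \<in> dm s"
    using s(1) assms unfolding P_def by (subst X_E) (auto simp: dm_def mult.commute)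
  then show "X s (P r u) = P r (X s u)"
    using s(2) assms X_E(2)[of "{..r}" u s] by (simp add: P_def dm_def X_def mult.commute)
qed

lemma P_smooth:
  obtains C where "0 \<le> C" "\<And>u. P r u \<in> dm s" "\<And>u. norm (X s (P r u)) \<le> C * norm u"
proof -
  \<comment> \<open>On the spectrum up to r the power is monotone, so its end values bound it for
    either sign of s; \<open>max r c\<close> covers the case r < c.\<close>
  define C where "C = c powr s + (max r c) powr s"
  have C: "0 \<le> C" by (simp add: C_def)
  have "AE x in M u. \<bar>x powr s * indicator {..r} x\<bar> \<le> C * \<bar>1\<bar>" for u
    using AE_ge[of u]
  proof eventually_elim
    fix x assume x: "c \<le> x"
    show "\<bar>x powr s * indicator {..r} x\<bar> \<le> C * \<bar>1\<bar>"
    proof (cases "x \<le> r")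
      case True
      have "x powr s \<le> C"
      proof (cases "0 \<le> s")
        case True
        then have "x powr s \<le> (max r c) powr s" using \<open>x \<le> r\<close> x c_pos by (intro powr_mono2) auto
        then show ?thesis by (simp add: C_def add_increasing)
      next
        case False
        then have "x powr s \<le> c powr s" using x c_pos by (intro powr_mono2') auto
        then show ?thesis by (simp add: C_def add_increasing2)
      qed
      then show ?thesis using True by simp
    qed (use C in simp)
  qed
  then have *: "sq_int (\<lambda>x. x powr s * indicator {..r} x) u"
    "norm (ext (\<lambda>x. x powr s * indicator {..r} x) u) \<le> C * norm u" for u
    using sq_int_dominated[where f = "\<lambda>x. x powr s * indicator {..r} x" and g = "\<lambda>x. 1" and u = u and C = C] sq_int_one C
    by (auto simp: ext_one)
  show ?thesis
    by (rule that[OF C]) (use * X_E[of "{..r}" _ s] in \<open>auto simp: P_def\<close>)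
qed

lemma P_dm [simp]: "P r u \<in> dm s"
  using P_smooth by metis

lemma XP_bounded_linear: "bounded_linear (\<lambda>u. X s (P r u))"
proof -
  obtain C where "\<And>u. norm (X s (P r u)) \<le> C * norm u" using P_smooth by metis
  moreover have "clinear_on UNIV (\<lambda>u. X s (P r u))"
    using clinear_onD[OF X_linear[of s]] clinear_onD[OF P_linear[of r]] by (intro clinear_onI) auto
  ultimately show ?thesis by (intro clinear_bounded_linear)
qed

lemma P_complement: "u - P r u = E {r<..} u"
proof -
  have "(\<lambda>x. 0 + 1 * indicator {..r} x + 1 * indicator {r<..} x, \<lambda>u. 0 + 1 *\<^sub>R E {..r} u + 1 *\<^sub>R E {r<..} u)
      \<in> step_calculus E"
    by (intro step_calculus.add step_calculus.zero) auto
  moreover have "(\<lambda>x::real. 0 + 1 * indicator {..r} x + 1 * indicator {r<..} x) = (\<lambda>x. 1::real)"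
    by (auto simp: indicator_def fun_eq_iff)
  ultimately have "ext (\<lambda>x. 1) u = E {..r} u + E {r<..} u"
    by (subst ext_G) auto
  then show ?thesis by (simp add: ext_one P_def algebra_simps)
qed

text \<open>Above r one has x^s <= x^(s + 1) / r: one extra power of H buys the factor 1 / r. All
  rates of convergence of the truncations go back to this.\<close>

lemma P_diff_le:
  assumes r: "0 < r" and u: "u \<in> dm (s + 1)"
  shows "norm (X s (u - P r u)) \<le> (1 / r) * norm (X (s + 1) u)"
proof -
  have "AE x in M u. \<bar>x powr s * indicator {r<..} x\<bar> \<le> (1 / r) * \<bar>x powr (s + 1)\<bar>"
  proof (rule AE_I2)
    fix x
    show "\<bar>x powr s * indicator {r<..} x\<bar> \<le> (1 / r) * \<bar>x powr (s + 1)\<bar>"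
    proof (cases "r < x")
      case True
      then have "r * x powr s \<le> x * x powr s" by (intro mult_right_mono) auto
      also have "x * x powr s = x powr (s + 1)" using True r by (simp add: powr_add)
      finally show ?thesis using True r by (simp add: field_simps)
    qed (use r in simp)
  qed
  note d = sq_int_dominated[OF _ _ this]
  have "E {r<..} u \<in> dm s" using d(1) u r by (subst X_E) (auto simp: dm_def)
  then show ?thesis
    using d(2) u r X_E(2)[of "{r<..}" u s] by (simp add: P_complement X_def dm_def)
qed

lemma P_tendsto: "(\<lambda>n. P (real n) u) \<longlonglongrightarrow> u"
proof -
  have "E {x. \<bar>x\<bar> \<le> real n} u = P (real n) u" for n
  proof -
    have A: "{x. \<bar>x\<bar> \<le> real n} \<in> sets borel" by measurable
    have "AE x in M u. indicator {x. \<bar>x\<bar> \<le> real n} x = (indicator {..real n} x :: real)"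
      using AE_ge[of u] by eventually_elim (use c_pos in \<open>auto simp: indicator_def\<close>)
    from sq_int_cong_AE(2)[OF _ _ this sq_int_ind] A show ?thesis
      by (simp add: ext_indicator P_def)
  qed
  then show ?thesis using cutoff_tendsto[of "\<lambda>x. x" u] by simp
qed

lemma X_P_tendsto: "u \<in> dm s \<Longrightarrow> (\<lambda>n. X s (P (real n) u)) \<longlonglongrightarrow> X s u"
  using P_tendsto[of "X s u"] by (simp add: P_X)

text \<open>Monotone convergence of the truncated norms. It carries bounds over to limits taken in
  the base norm, where X s itself is not continuous.\<close>

lemma dm_of_bounded:
  assumes b: "\<And>n::nat. norm (X s (P (real n) u)) \<le> B"
  shows "u \<in> dm s" "norm (X s u) \<le> B"
proof -
  have B: "0 \<le> B" using b[of 0] norm_ge_zero order.trans by blast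
  define f where "f n x = ennreal ((x powr s * indicator {..real n} x)\<^sup>2)" for n :: nat and x :: real
  have fm [measurable]: "f n \<in> borel_measurable (M u)" for n
    unfolding f_def by (rule meas_M) measurable
  have le: "(\<integral>\<^sup>+x. f n x \<partial>M u) \<le> ennreal (B\<^sup>2)" for n
  proof -
    have "sq_int (\<lambda>x. x powr s * indicator {..real n} x) u"
      using X_E(1)[of "{..real n}" u s] P_dm[of "real n" u s] by (simp add: P_def)
    then have "(\<integral>\<^sup>+x. f n x \<partial>M u) = ennreal ((norm (X s (P (real n) u)))\<^sup>2)"
      using X_E(2)[of "{..real n}" u s] P_dm[of "real n" u s] unfolding f_def
      by (subst norm_ext_nn) (auto simp: P_def)
    also have "\<dots> \<le> ennreal (B\<^sup>2)" using b[of n] by (intro ennreal_leI power_mono) auto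
    finally show ?thesis .
  qed
  have "(\<lambda>n. \<integral>\<^sup>+x. f n x \<partial>M u) \<longlonglongrightarrow> (\<integral>\<^sup>+x. ennreal ((x powr s)\<^sup>2) \<partial>M u)"
  proof (rule nn_integral_LIMSEQ)
    show "incseq f"
      unfolding incseq_def le_fun_def f_def
      by (intro allI impI ennreal_leI) (auto simp: indicator_def)
    show "(\<lambda>n. f n x) \<longlonglongrightarrow> ennreal ((x powr s)\<^sup>2)" for x
    proof (rule tendsto_eventually)
      obtain N where "x \<le> real N" using real_arch_simple by blast
      then show "\<forall>\<^sub>F n in sequentially. f n x = ennreal ((x powr s)\<^sup>2)"
        unfolding eventually_sequentially by (intro exI[of _ N]) (auto simp: f_def)
    qed
  qed simp
  then have "(\<integral>\<^sup>+x. ennreal ((x powr s)\<^sup>2) \<partial>M u) \<le> ennreal (B\<^sup>2)"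
    by (rule LIMSEQ_le_const2) (use le in auto)
  moreover from this show dm: "u \<in> dm s"
    unfolding dm_def by (auto simp: sq_int_iff_nn intro: le_less_trans)
  ultimately have "(norm (X s u))\<^sup>2 \<le> B\<^sup>2"
    unfolding X_def using norm_ext_nn[of "\<lambda>x. x powr s" u] by (simp add: dm_def)
  then show "norm (X s u) \<le> B" using B by (rule power2_le_imp_le)
qed

text \<open>Split the spectrum at r: below it x^(2a) <= r^(2a), above it x^(2a - 2b) <= r^(2a - 2b).
  The free parameter r later trades smallness of u against a bound on X b u.\<close>

lemma X_interpolation:
  assumes a: "0 \<le> a" "a \<le> b" and u: "u \<in> dm b" and r: "0 < r"
  shows "(norm (X a u))\<^sup>2 \<le> r powr (2 * a) * (norm u)\<^sup>2 + r powr (2 * a - 2 * b) * (norm (X b u))\<^sup>2"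
proof -
  have ua: "u \<in> dm a" using dm_le[OF u a(2)] .
  have sq: "(x powr s)\<^sup>2 = x powr (2 * s)" for x s :: real
    by (simp add: power2_eq_square powr_add[symmetric])
  have int: "integrable (M u) (\<lambda>x. x powr (2 * s))" if "u \<in> dm s" for s
    using that by (simp add: dm_def sq_int_def sq)
  have norm: "(norm (X s u))\<^sup>2 = integral\<^sup>L (M u) (\<lambda>x. x powr (2 * s))" if "u \<in> dm s" for s
    using that ext_norm[of "\<lambda>x. x powr s" u] by (simp add: X_def dm_def sq)
  have "integral\<^sup>L (M u) (\<lambda>x. x powr (2 * a))
      \<le> integral\<^sup>L (M u) (\<lambda>x. r powr (2 * a) * 1 + r powr (2 * a - 2 * b) * x powr (2 * b))"
  proof (rule integral_mono_AE)
    show "integrable (M u) (\<lambda>x. r powr (2 * a) * 1 + r powr (2 * a - 2 * b) * x powr (2 * b))"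
      by (intro Bochner_Integration.integrable_add integrable_mult_right int[OF u]
          finite_measure.integrable_const[OF finite_M])
    show "AE x in M u. x powr (2 * a) \<le> r powr (2 * a) * 1 + r powr (2 * a - 2 * b) * x powr (2 * b)"
      using AE_ge[of u]
    proof eventually_elim
      fix x assume "c \<le> x"
      then have x: "0 < x" using c_pos by simp
      show "x powr (2 * a) \<le> r powr (2 * a) * 1 + r powr (2 * a - 2 * b) * x powr (2 * b)"
      proof (cases "x \<le> r")
        case True
        then have "x powr (2 * a) \<le> r powr (2 * a)" using x a by (intro powr_mono2) auto
        then show ?thesis by (simp add: add_increasing2)
      next
        case False
        have "x powr (2 * a - 2 * b) \<le> r powr (2 * a - 2 * b)"
          using False r a by (intro powr_mono2') auto
        then have "x powr (2 * a - 2 * b) * x powr (2 * b) \<le> r powr (2 * a - 2 * b) * x powr (2 * b)"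
          by (rule mult_right_mono) simp
        then show ?thesis by (simp add: powr_add[symmetric] add_increasing)
      qed
    qed
  qed (use int[OF ua] in auto)
  also have "\<dots> = r powr (2 * a) * (norm u)\<^sup>2 + r powr (2 * a - 2 * b) * (norm (X b u))\<^sup>2"
    using int[OF u] measure_M[of UNIV u] finite_measure.integrable_const[OF finite_M, of u "r powr (2 * a)"]
    by (simp add: norm[OF u])
  finally show ?thesis by (simp add: norm[OF ua])
qed

text \<open>The proof is the K-method of real interpolation: with \<open>y = x\<^sup>2\<^sup>b\<close> and
  \<open>\<theta> = a / b\<close>, the function \<open>y\<^sup>\<theta>\<close> is a multiple of
  \<open>\<integral> \<lambda>\<^sup>\<theta>\<^sup>-\<^sup>1 y / (y + \<lambda>) d\<lambda>\<close>, and the quadratic form of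
  \<open>y / (y + \<lambda>)\<close> is the infimum of \<open>\<parallel>u\<^sub>0\<parallel>\<^sup>2 + \<parallel>X b u\<^sub>1\<parallel>\<^sup>2 / \<lambda>\<close> over the
  decompositions \<open>u = u\<^sub>0 + u\<^sub>1\<close>.\<close>

lemma K_functional_bound:
  assumes T: "\<And>u v. T (u + v) = T u + T v" and T0: "\<And>u. norm (T u) \<le> K * norm u"
    and Tb: "\<And>u. u \<in> dm b \<Longrightarrow> T u \<in> dm b \<and> norm (X b (T u)) \<le> K * norm (X b u)"
    and K: "0 \<le> K" and l: "0 < l"
  shows "(\<integral>\<^sup>+x. ennreal (x powr (2 * b) / (x powr (2 * b) + l)) \<partial>M (T u))
    \<le> ennreal (2 * K\<^sup>2) * (\<integral>\<^sup>+x. ennreal (x powr (2 * b) / (x powr (2 * b) + l)) \<partial>M u)"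
proof -
  define h where "h x = x powr (2 * b) / (x powr (2 * b) + l)" for x :: real
  define f where "f x = l / (x powr (2 * b) + l)" for x :: real
  have [measurable]: "h \<in> borel_measurable borel" "f \<in> borel_measurable borel"
    unfolding h_def f_def by measurable
  have pos: "0 \<le> x powr (2 * b)" "0 < x powr (2 * b) + l" for x :: real
    using l by (auto intro: add_nonneg_pos)
  have h01: "0 \<le> h x" "h x \<le> 1" and hl: "h x \<le> x powr (2 * b) / l" and f01: "0 \<le> f x" "f x \<le> 1" for x
    using pos[of x] l by (auto simp: h_def f_def field_simps)
  have fh: "1 - f x = h x" for x using pos[of x] by (simp add: h_def f_def field_simps)
  have sf: "sq_int f u" by (rule sq_int_bounded[of _ 1]) (use f01 in auto)
  \<comment> \<open>The optimal decomposition: at each x, the value f minimizes (1 - f)^2 + x^(2b)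
    f^2 / l.\<close>
  define u1 where "u1 = ext f u"
  define u0 where "u0 = u - u1"
  have yf: "(x powr b * f x)\<^sup>2 = l * f x * h x" for x
  proof -
    have "(x powr b)\<^sup>2 = x powr (2 * b)" by (simp add: power2_eq_square powr_add[symmetric])
    then show ?thesis using pos[of x] l by (simp add: power_mult_distrib h_def f_def power2_eq_square field_simps)
  qed
  have fh1: "f x * h x \<le> 1" for x using mult_mono[OF f01(2)[of x] h01(2)[of x]] h01(1)[of x] by simp
  have sxf: "sq_int (\<lambda>x. x powr b * f x) u"
    unfolding sq_int_def yf
  proof (rule integrable_bounded)
    show "\<bar>l * f x * h x\<bar> \<le> l * 1" for x
      using mult_left_mono[OF fh1[of x], of l] l f01(1)[of x] h01(1)[of x] by (simp add: mult.assoc)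
  qed measurable
  have u1: "u1 \<in> dm b" and Xu1: "X b u1 = ext (\<lambda>x. x powr b * f x) u"
    using sq_int_ext[OF _ sf, of "\<lambda>x. x powr b"] ext_ext[OF _ sf, of "\<lambda>x. x powr b"] sxf
    by (auto simp: u1_def dm_def X_def)
  have n1: "ennreal ((norm (X b u1))\<^sup>2) = (\<integral>\<^sup>+x. ennreal (l * f x * h x) \<partial>M u)"
    unfolding Xu1 using sxf by (subst norm_ext_nn[symmetric]) (auto simp: yf)
  have n0: "ennreal ((norm u0)\<^sup>2) = (\<integral>\<^sup>+x. ennreal ((h x)\<^sup>2) \<partial>M u)"
  proof -
    have i: "integrable (M u) (\<lambda>x. (h x)\<^sup>2)"
      by (rule integrable_bounded[of _ 1]) (use h01 in \<open>auto intro!: power_le_one\<close>)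
    have "(norm u0)\<^sup>2 = integral\<^sup>L (M u) (\<lambda>x. (1 - f x)\<^sup>2)"
      using ext_diff_norm[OF _ sq_int_one _ sf] by (simp add: u0_def u1_def ext_one)
    then show ?thesis using i by (simp add: fh nn_integral_eq_integral)
  qed
  \<comment> \<open>The factor 2 of the result arises here. Next, h <= 1 serves for T u0 and h <=
    x^(2b) / l for T u1.\<close>
  have "(\<integral>\<^sup>+x. ennreal (h x) \<partial>M (T u)) \<le> 2 * ((\<integral>\<^sup>+x. ennreal (h x) \<partial>M (T u0)) + (\<integral>\<^sup>+x. ennreal (h x) \<partial>M (T u1)))"
    using nn_integral_M_add_le[of "\<lambda>x. ennreal (h x)" "T u0" "T u1"] by (simp add: T[symmetric] u0_def)
  also have "\<dots> \<le> 2 * (ennreal (K\<^sup>2 * (norm u0)\<^sup>2) + ennreal ((1 / l) * (K\<^sup>2 * (norm (X b u1))\<^sup>2)))"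
  proof (intro mult_left_mono add_mono)
    have "(\<integral>\<^sup>+x. ennreal (h x) \<partial>M (T u0)) \<le> (\<integral>\<^sup>+x. 1 \<partial>M (T u0))"
      by (rule nn_integral_mono) (use h01 in auto)
    also have "\<dots> = ennreal ((norm (T u0))\<^sup>2)" by (simp add: emeasure_M)
    also have "\<dots> \<le> ennreal (K\<^sup>2 * (norm u0)\<^sup>2)"
      using power_mono[OF T0[of u0], of 2] by (intro ennreal_leI) (simp add: power_mult_distrib)
    finally show "(\<integral>\<^sup>+x. ennreal (h x) \<partial>M (T u0)) \<le> ennreal (K\<^sup>2 * (norm u0)\<^sup>2)" .
    have sq: "(x powr b)\<^sup>2 = x powr (2 * b)" for x :: real by (simp add: power2_eq_square powr_add[symmetric])
    have "(\<integral>\<^sup>+x. ennreal (h x) \<partial>M (T u1)) \<le> (\<integral>\<^sup>+x. ennreal (1 / l) * ennreal ((x powr b)\<^sup>2) \<partial>M (T u1))"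
      unfolding sq using l by (intro nn_integral_mono) (simp add: ennreal_mult[symmetric] hl ennreal_leI)
    also have "\<dots> = ennreal (1 / l) * (\<integral>\<^sup>+x. ennreal ((x powr b)\<^sup>2) \<partial>M (T u1))"
      by (rule nn_integral_cmult) simp
    also have "\<dots> = ennreal (1 / l) * ennreal ((norm (X b (T u1)))\<^sup>2)"
      using Tb[OF u1] by (subst norm_ext_nn) (auto simp: dm_def X_def)
    also have "\<dots> \<le> ennreal (1 / l) * ennreal (K\<^sup>2 * (norm (X b u1))\<^sup>2)"
      using Tb[OF u1] power_mono[of "norm (X b (T u1))" "K * norm (X b u1)" 2]
      by (intro mult_left_mono ennreal_leI) (auto simp: power_mult_distrib)
    also have "\<dots> = ennreal ((1 / l) * (K\<^sup>2 * (norm (X b u1))\<^sup>2))"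
      using l by (subst ennreal_mult) auto
    finally show "(\<integral>\<^sup>+x. ennreal (h x) \<partial>M (T u1)) \<le> ennreal ((1 / l) * (K\<^sup>2 * (norm (X b u1))\<^sup>2))" .
  qed auto
  also have "\<dots> = ennreal (2 * K\<^sup>2) * (ennreal ((norm u0)\<^sup>2) + ennreal (1 / l) * ennreal ((norm (X b u1))\<^sup>2))"
    using l by (simp add: ennreal_mult[symmetric] ennreal_plus[symmetric] distrib_left mult_ac
        del: ennreal_plus ennreal_mult)
      (simp add: ennreal_plus[symmetric] ennreal_mult''[symmetric] ennreal_numeral[symmetric] algebra_simps
        del: ennreal_plus ennreal_numeral)
  also have "ennreal ((norm u0)\<^sup>2) + ennreal (1 / l) * ennreal ((norm (X b u1))\<^sup>2)
      = (\<integral>\<^sup>+x. ennreal ((h x)\<^sup>2) + ennreal (1 / l) * ennreal (l * f x * h x) \<partial>M u)"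
    unfolding n0 n1 by (subst nn_integral_add) (auto simp: nn_integral_cmult)
  \<comment> \<open>Since f = 1 - h, the sum h^2 + f h is h: the optimal splitting loses
    nothing.\<close>
  also have "(\<lambda>x. ennreal ((h x)\<^sup>2) + ennreal (1 / l) * ennreal (l * f x * h x)) = (\<lambda>x. ennreal (h x))"
  proof
    fix x
    have "ennreal ((h x)\<^sup>2) + ennreal (1 / l) * ennreal (l * f x * h x) = ennreal ((h x)\<^sup>2 + f x * h x)"
      using l f01[of x] h01[of x] by (simp add: ennreal_mult[symmetric] mult_ac)
    also have "(h x)\<^sup>2 + f x * h x = h x" using fh[of x] by (simp add: power2_eq_square distrib_right[symmetric])
    finally show "ennreal ((h x)\<^sup>2) + ennreal (1 / l) * ennreal (l * f x * h x) = ennreal (h x)" .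
  qed
  finally show ?thesis unfolding h_def .
qed

end

text \<open>Substituting y l for l extracts y^\<theta>. The remaining constant is the Beta integral
  pi / sin(pi \<theta>), of which finiteness and positivity suffice.\<close>

lemma powr_integral_kernel:
  assumes t: "0 < \<theta>" "\<theta> < (1::real)"
  obtains k where "0 < k"
    "\<And>y. 0 < y \<Longrightarrow> (\<integral>\<^sup>+l. ennreal (indicator {0<..} l * l powr (\<theta> - 1) * (y / (y + l))) \<partial>lborel)
      = ennreal (k * y powr \<theta>)"
proof -
  define w where "w l = indicator {0<..} l * l powr (\<theta> - 1) * (1 / (1 + l))" for l :: real
  have [measurable]: "w \<in> borel_measurable borel" unfolding w_def by measurable
  define \<kappa> where "\<kappa> = (\<integral>\<^sup>+l. ennreal (w l) \<partial>lborel)"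
  \<comment> \<open>Integrability at 0 comes from \<theta> > 0; the next integral, at infinity, from
    \<theta> < 1.\<close>
  have "((\<lambda>x. x powr (\<theta> - 1)) has_integral (1 powr (\<theta> - 1 + 1) / (\<theta> - 1 + 1))) {0..1}"
    by (rule has_integral_powr_from_0) (use t in auto)
  from nn_integral_has_integral_lebesgue[OF _ this]
  have i0: "(\<integral>\<^sup>+x. indicator {0..1} x * ennreal (x powr (\<theta> - 1)) \<partial>lborel) < \<infinity>" by (auto simp: ennreal_mult' ennreal_indicator)
  have "((\<lambda>x. x powr (\<theta> - 2)) has_integral (- (1 powr (\<theta> - 2 + 1)) / (\<theta> - 2 + 1))) {1..}"
    by (rule has_integral_powr_to_inf) (use t in auto)
  from nn_integral_has_integral_lebesgue[OF _ this]
  have i1: "(\<integral>\<^sup>+x. indicator {1..} x * ennreal (x powr (\<theta> - 2)) \<partial>lborel) < \<infinity>" by (auto simp: ennreal_mult' ennreal_indicator)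
  have "\<kappa> \<le> (\<integral>\<^sup>+x. indicator {0..1} x * ennreal (x powr (\<theta> - 1)) + indicator {1..} x * ennreal (x powr (\<theta> - 2)) \<partial>lborel)"
    unfolding \<kappa>_def
  proof (rule nn_integral_mono)
    fix x :: real
    consider "x \<le> 0" | "0 < x" "x \<le> 1" | "1 < x" by linarith
    then show "ennreal (w x) \<le> indicator {0..1} x * ennreal (x powr (\<theta> - 1)) + indicator {1..} x * ennreal (x powr (\<theta> - 2))"
    proof cases
      case 2
      then have "w x \<le> x powr (\<theta> - 1)" by (simp add: w_def divide_le_eq mult_left_le_one_le field_simps)
      then show ?thesis using 2 by (auto intro!: add_increasing2 ennreal_leI)
    next
      case 3
      have "w x \<le> x powr (\<theta> - 1) * (1 / x)"
        using 3 by (auto simp: w_def intro!: divide_left_mono)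
      also have "\<dots> = x powr (\<theta> - 2)" using 3 powr_add[of x "\<theta> - 2" 1] by (simp add: field_simps)
      finally show ?thesis using 3 by (auto intro!: add_increasing ennreal_leI)
    qed (simp add: w_def)
  qed
  also have "\<dots> = (\<integral>\<^sup>+x. indicator {0..1} x * ennreal (x powr (\<theta> - 1)) \<partial>lborel) + (\<integral>\<^sup>+x. indicator {1..} x * ennreal (x powr (\<theta> - 2)) \<partial>lborel)"
    by (rule nn_integral_add) auto
  also have "\<dots> < \<infinity>" using i0 i1 by simp
  finally have fin: "\<kappa> < \<infinity>" .
  have "\<kappa> \<noteq> 0"
  proof
    assume "\<kappa> = 0"
    then have ae: "AE x in lborel. ennreal (w x) = 0" unfolding \<kappa>_def by (subst (asm) nn_integral_0_iff_AE) auto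
    have wp: "0 < w x" if "x \<in> {1..2}" for x using that by (simp add: w_def)
    from ae have "AE x in lborel. x \<notin> {1..2::real}"
    proof eventually_elim
      fix x assume "ennreal (w x) = 0"
      then show "x \<notin> {1..2}" using wp[of x] by (auto simp: ennreal_eq_0_iff)
    qed
    then have "emeasure lborel {1..2::real} = 0"
      by (subst (asm) AE_iff_measurable[of "{1..2}"]) auto
    then show False by simp
  qed
  then obtain k where k: "0 < k" "\<kappa> = ennreal k" using fin by (cases \<kappa>) (auto simp: ennreal_eq_0_iff)
  show ?thesis
  proof (rule that[OF k(1)])
    fix y :: real assume y: "0 < y"
    have "(\<integral>\<^sup>+l. ennreal (indicator {0<..} l * l powr (\<theta> - 1) * (y / (y + l))) \<partial>lborel)
      = ennreal \<bar>y\<bar> * (\<integral>\<^sup>+l. ennreal (indicator {0<..} (0 + y * l) * (0 + y * l) powr (\<theta> - 1) * (y / (y + (0 + y * l)))) \<partial>lborel)"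
      by (rule nn_integral_real_affine) (use y in auto)
    also have "(\<lambda>l. ennreal (indicator {0<..} (0 + y * l) * (0 + y * l) powr (\<theta> - 1) * (y / (y + (0 + y * l)))))
        = (\<lambda>l. ennreal (y powr (\<theta> - 1)) * ennreal (w l))"
    proof
      fix l :: real
      show "ennreal (indicator {0<..} (0 + y * l) * (0 + y * l) powr (\<theta> - 1) * (y / (y + (0 + y * l))))
        = ennreal (y powr (\<theta> - 1)) * ennreal (w l)"
      proof (cases "0 < l")
        case True
        have "y + y * l = y * (1 + l)" by (simp add: algebra_simps)
        then have "y / (y + y * l) = 1 / (1 + l)" using y by simp
        then show ?thesis using True y by (simp add: w_def powr_mult ennreal_mult[symmetric])
      next
        case False
        then show ?thesis using y by (simp add: w_def zero_less_mult_iff)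
      qed
    qed
    also have "(\<integral>\<^sup>+l. ennreal (y powr (\<theta> - 1)) * ennreal (w l) \<partial>lborel) = ennreal (y powr (\<theta> - 1)) * ennreal k"
      unfolding k(2)[symmetric] \<kappa>_def by (rule nn_integral_cmult) measurable
    also have "ennreal \<bar>y\<bar> * (ennreal (y powr (\<theta> - 1)) * ennreal k) = ennreal (k * y powr \<theta>)"
    proof -
      have "y * y powr (\<theta> - 1) = y powr \<theta>" using y powr_add[of y 1 "\<theta> - 1"] by simp
      then show ?thesis using y k(1) by (simp add: ennreal_mult[symmetric] mult_ac)
    qed
    finally show "(\<integral>\<^sup>+l. ennreal (indicator {0<..} l * l powr (\<theta> - 1) * (y / (y + l))) \<partial>lborel)
      = ennreal (k * y powr \<theta>)" .
  qed
qed

context positive_pvm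
begin

text \<open>Integrating the bound for each l against l^(\<theta> - 1) and exchanging the integrals
  gives the squared norm of X a on both sides. The constant 2 rounds up the square root of
  2.\<close>

theorem operator_interpolation:
  assumes T: "\<And>u v. T (u + v) = T u + T v" and T0: "\<And>u. norm (T u) \<le> K * norm u"
    and Tb: "\<And>u. u \<in> dm b \<Longrightarrow> T u \<in> dm b \<and> norm (X b (T u)) \<le> K * norm (X b u)"
    and K: "0 \<le> K" and a: "0 < a" "a < b" and u: "u \<in> dm a"
  shows "T u \<in> dm a" "norm (X a (T u)) \<le> 2 * K * norm (X a u)"
proof -
  define \<theta> where "\<theta> = a / b"
  have \<theta>: "0 < \<theta>" "\<theta> < 1" using a by (auto simp: \<theta>_def)
  obtain k where k: "0 < k" "\<And>y. 0 < y \<Longrightarrow>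
      (\<integral>\<^sup>+l. ennreal (indicator {0<..} l * l powr (\<theta> - 1) * (y / (y + l))) \<partial>lborel) = ennreal (k * y powr \<theta>)"
    using powr_integral_kernel[OF \<theta>] by blast
  define w where "w l x = indicator {0<..} l * l powr (\<theta> - 1) * (x powr (2 * b) / (x powr (2 * b) + l))" for l x :: real
  have key: "ennreal k * (\<integral>\<^sup>+x. ennreal ((x powr a)\<^sup>2) \<partial>M v)
      = (\<integral>\<^sup>+l. (\<integral>\<^sup>+x. ennreal (w l x) \<partial>M v) \<partial>lborel)" for v
  proof -
    interpret fm: finite_measure "M v" by (rule finite_M)
    interpret pair_sigma_finite lborel "M v" by standard
    have "AE x in M v. (\<integral>\<^sup>+l. ennreal (w l x) \<partial>lborel) = ennreal k * ennreal ((x powr a)\<^sup>2)"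
      using AE_ge[of v]
    proof eventually_elim
      fix x assume "c \<le> x"
      then have x: "0 < x" using c_pos by simp
      have "(x powr (2 * b)) powr \<theta> = (x powr a)\<^sup>2"
        using a by (simp add: powr_powr \<theta>_def power2_eq_square powr_add[symmetric])
      then show "(\<integral>\<^sup>+l. ennreal (w l x) \<partial>lborel) = ennreal k * ennreal ((x powr a)\<^sup>2)"
        using k(2)[of "x powr (2 * b)"] x k(1) by (simp add: w_def ennreal_mult)
    qed
    then have "(\<integral>\<^sup>+x. (\<integral>\<^sup>+l. ennreal (w l x) \<partial>lborel) \<partial>M v) = (\<integral>\<^sup>+x. ennreal k * ennreal ((x powr a)\<^sup>2) \<partial>M v)"
      by (rule nn_integral_cong_AE)
    also have "\<dots> = ennreal k * (\<integral>\<^sup>+x. ennreal ((x powr a)\<^sup>2) \<partial>M v)" by (rule nn_integral_cmult) simp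
    also have "(\<integral>\<^sup>+x. (\<integral>\<^sup>+l. ennreal (w l x) \<partial>lborel) \<partial>M v) = (\<integral>\<^sup>+l. (\<integral>\<^sup>+x. ennreal (w l x) \<partial>M v) \<partial>lborel)"
      using Fubini'[of "\<lambda>l x. ennreal (w l x)"] unfolding w_def by simp
    finally show ?thesis by simp
  qed
  have "ennreal k * (\<integral>\<^sup>+x. ennreal ((x powr a)\<^sup>2) \<partial>M (T u))
      \<le> (\<integral>\<^sup>+l. ennreal (2 * K\<^sup>2) * (\<integral>\<^sup>+x. ennreal (w l x) \<partial>M u) \<partial>lborel)"
    unfolding key
  proof (rule nn_integral_mono)
    fix l :: real
    show "(\<integral>\<^sup>+x. ennreal (w l x) \<partial>M (T u)) \<le> ennreal (2 * K\<^sup>2) * (\<integral>\<^sup>+x. ennreal (w l x) \<partial>M u)"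
    proof (cases "0 < l")
      case True
      have e: "(\<integral>\<^sup>+x. ennreal (w l x) \<partial>M v) = ennreal (l powr (\<theta> - 1)) * (\<integral>\<^sup>+x. ennreal (x powr (2 * b) / (x powr (2 * b) + l)) \<partial>M v)" for v
        unfolding w_def using True
        by (subst nn_integral_cmult[symmetric]) (auto simp: ennreal_mult[symmetric] intro!: nn_integral_cong)
      show ?thesis
        unfolding e using mult_left_mono[OF K_functional_bound[OF T T0 Tb K True, of u], of "ennreal (l powr (\<theta> - 1))"]
        by (simp add: mult_ac)
    qed (simp add: w_def)
  qed
  also have "\<dots> = ennreal (2 * K\<^sup>2) * (\<integral>\<^sup>+l. (\<integral>\<^sup>+x. ennreal (w l x) \<partial>M u) \<partial>lborel)"
  proof (rule nn_integral_cmult)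
    interpret fm: finite_measure "M u" by (rule finite_M)
    show "(\<lambda>l. \<integral>\<^sup>+x. ennreal (w l x) \<partial>M u) \<in> borel_measurable lborel"
      unfolding w_def by measurable
  qed
  also have "\<dots> = ennreal k * (ennreal (2 * K\<^sup>2) * (\<integral>\<^sup>+x. ennreal ((x powr a)\<^sup>2) \<partial>M u))"
    unfolding key[symmetric] by (simp add: mult_ac)
  finally have "(\<integral>\<^sup>+x. ennreal ((x powr a)\<^sup>2) \<partial>M (T u)) \<le> ennreal (2 * K\<^sup>2) * (\<integral>\<^sup>+x. ennreal ((x powr a)\<^sup>2) \<partial>M u)"
    using k(1) by (subst (asm) ennreal_mult_le_mult_iff) auto
  also have "\<dots> = ennreal (2 * K\<^sup>2 * (norm (X a u))\<^sup>2)"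
    using norm_ext_nn[of "\<lambda>x. x powr a" u] u by (simp add: dm_def X_def ennreal_mult)
  finally have le: "(\<integral>\<^sup>+x. ennreal ((x powr a)\<^sup>2) \<partial>M (T u)) \<le> ennreal (2 * K\<^sup>2 * (norm (X a u))\<^sup>2)" .
  then show dm: "T u \<in> dm a"
    unfolding dm_def by (auto simp: sq_int_iff_nn intro: le_less_trans)
  have "(norm (X a (T u)))\<^sup>2 \<le> 2 * K\<^sup>2 * (norm (X a u))\<^sup>2"
    using le norm_ext_nn[of "\<lambda>x. x powr a" "T u"] dm by (simp add: dm_def X_def)
  also have "\<dots> \<le> (2 * K * norm (X a u))\<^sup>2"
    by (simp add: power_mult_distrib mult_right_mono)
  finally show "norm (X a (T u)) \<le> 2 * K * norm (X a u)"
    by (rule power2_le_imp_le) (use K in auto)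
qed

end

section \<open>Identification of the operator powers\<close>

text \<open>A nonzero vector in a spectral subspace below c would have an H-form less than c times
  its squared norm. The sets \<open>A n\<close> are cut off at -n so that their projections map into
  D.\<close>

lemma spectral_measure_positive:
  assumes psa: "positive_self_adjoint D (H :: 'h::complex_hilbert \<Rightarrow> 'h)"
  obtains c where "positive_pvm (spectral_measure D H) c"
    "D = spectral_domain (spectral_measure D H) (\<lambda>x. x)"
    "is_spectral_integral (spectral_measure D H) (\<lambda>x. x) H"
proof -
  define E where "E = spectral_measure D H"
  have "\<exists>E. projection_valued_measure E \<and> D = spectral_domain E (\<lambda>x. x) \<and> is_spectral_integral E (\<lambda>x. x) H"
    using spectral_theorem_positive[OF psa] by metis
  from someI_ex[OF this] have E: "projection_valued_measure E" "D = spectral_domain E (\<lambda>x. x)"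
    "is_spectral_integral E (\<lambda>x. x) H"
    by (simp_all only: E_def spectral_measure_def)
  interpret pvm E by standard (rule E)
  obtain c where c: "c > 0" and pos: "\<And>u. u \<in> D \<Longrightarrow> c * (norm u)\<^sup>2 \<le> Re (cinner u (H u))"
    using positive_self_adjointE[OF psa] by metis
  have "E {..<c} u = 0" for u
  proof -
    define A where "A n = {- real n..<c}" for n :: nat
    have "emeasure (M u) (A n) = 0" for n
    proof -
      have A [measurable]: "A n \<in> sets borel" by (simp add: A_def)
      have bd: "\<bar>x\<bar> \<le> real n + c" if "x \<in> A n" for x using that c by (auto simp: A_def)
      define w where "w = E (A n) u"
      have "sq_int (\<lambda>x. x) w" unfolding w_def by (rule sq_int_cutoff[OF _ A bd]) simp_all
      then have w: "w \<in> D" by (subst E(2)) (simp add: spectral_domain_eq)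
      have si: "sq_int (indicator (A n)) u"
        by (rule sq_int_bounded[of _ 1]) (rule borel_measurable_indicator[OF A], simp add: indicator_def)
      have ind: "(indicator (A n) x)\<^sup>2 * y = indicator (A n) x * y" for x y :: real
        by (simp add: indicator_def)
      have iw: "integral\<^sup>L (M w) (\<lambda>x. x) = integral\<^sup>L (M u) (\<lambda>x. indicator (A n) x * x)"
        using integral_M_ext(2)[OF borel_measurable_indicator[OF A] si, of "\<lambda>x. x"]
        by (simp add: w_def ext_indicator[OF A] ind)
      have nw: "(norm w)\<^sup>2 = integral\<^sup>L (M u) (indicator (A n))"
        by (simp add: w_def measure_M[OF A, symmetric])
      have i1: "integrable (M u) (\<lambda>x. indicator (A n) x * x)"
        by (rule integrable_bounded[of _ "real n + c"]) (use bd c in \<open>auto simp: indicator_def\<close>)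
      have i2: "integrable (M u) (indicator (A n) :: real \<Rightarrow> real)"
        by (rule integrable_bounded[of _ 1]) (auto simp: indicator_def)
      have "cinner w (H w) = complex_of_real (integral\<^sup>L (M w) (\<lambda>x. x))"
        using E(2,3) w by (auto simp: is_spectral_integral_def)
      then have "c * (norm w)\<^sup>2 \<le> integral\<^sup>L (M w) (\<lambda>x. x)" using pos[OF w] by simp
      then have "integral\<^sup>L (M u) (\<lambda>x. c * indicator (A n) x - indicator (A n) x * x) \<le> 0"
        using i1 i2 by (simp add: iw nw)
      moreover have nn: "0 \<le> c * indicator (A n) x - indicator (A n) x * x" for x
        by (auto simp: A_def indicator_def)
      ultimately have "integral\<^sup>L (M u) (\<lambda>x. c * indicator (A n) x - indicator (A n) x * x) = 0"
        by (intro antisym integral_nonneg) auto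
      then have "AE x in M u. c * indicator (A n) x - indicator (A n) x * x = 0"
        using i1 i2 nn by (subst (asm) integral_nonneg_eq_0_iff_AE) auto
      then have "AE x in M u. x \<notin> A n"
        by eventually_elim (auto simp: A_def)
      then show ?thesis by (subst (asm) AE_iff_measurable[OF _ refl]) auto
    qed
    then have "emeasure (M u) (\<Union>n. A n) = 0"
      by (intro emeasure_UN_eq_0) (auto simp: A_def)
    moreover have "(\<Union>n. A n) = {..<c}"
    proof (intro set_eqI iffI)
      fix x assume "x \<in> {..<c}"
      moreover obtain n where "- x \<le> real n" using real_arch_simple by blast
      ultimately show "x \<in> (\<Union>n. A n)" by (auto simp: A_def intro!: exI[of _ n])
    qed (auto simp: A_def)
    ultimately show ?thesis by (simp add: emeasure_M ennreal_eq_0_iff)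
  qed
  then have "positive_pvm E c" by unfold_locales (use c in auto)
  then show ?thesis using that E unfolding E_def by blast
qed

locale positive_operator =
  fixes D :: "'h::complex_hilbert set" and H :: "'h \<Rightarrow> 'h" and c :: real
  assumes pp: "positive_pvm (spectral_measure D H) c"
    and D_eq: "D = spectral_domain (spectral_measure D H) (\<lambda>x. x)"
    and H_eq: "is_spectral_integral (spectral_measure D H) (\<lambda>x. x) H"
begin

sublocale positive_pvm "spectral_measure D H" c by (rule pp)

lemma pow_domain_eq: "pow_domain D H s = dm s"
  by (simp add: pow_domain_def spectral_domain_eq dm_def)

lemma sob_eq: "sob D H k = dm (k / 2)"
  by (simp add: sob_def pow_domain_eq)

lemma op_pow_eq:
  assumes "u \<in> dm s"
  shows "op_pow D H s u = X s u"
proof -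
  have "is_spectral_integral (spectral_measure D H) (\<lambda>x. x powr s) (op_pow D H s)"
    unfolding op_pow_def by (rule someI[where x = "ext (\<lambda>x. x powr s)"], rule is_spectral_integral_ext) simp
  from is_spectral_integral_unique[OF _ this] assms show ?thesis by (simp add: dm_def X_def)
qed

lemma snorm_eq: "u \<in> dm (k / 2) \<Longrightarrow> snorm D H k u = norm (X (k / 2) u)"
  by (simp add: snorm_def op_pow_eq)

lemma D_dm: "D = dm 1" and H_X: "u \<in> D \<Longrightarrow> H u = X 1 u"
proof -
  \<comment> \<open>\<open>x powr 1\<close> equals x only for x >= 0, so the two functions are
    compared almost everywhere.\<close>
  have ae: "AE x in M u. x powr 1 = x" for u
    using AE_ge[of u] by eventually_elim (use c_pos in auto)
  have ae': "AE x in M u. x = x powr 1" for u using ae[of u] by eventually_elim simp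
  have 1: "sq_int (\<lambda>x. x powr 1) u" if "sq_int (\<lambda>x. x) u" for u
    by (rule sq_int_cong_AE(1)[OF _ _ ae that]) auto
  have 2: "sq_int (\<lambda>x. x) u" if "sq_int (\<lambda>x. x powr 1) u" for u
    by (rule sq_int_cong_AE(1)[OF _ _ ae' that]) auto
  have "D = {u. sq_int (\<lambda>x. x) u}" by (subst D_eq) (rule spectral_domain_eq)
  then show "D = dm 1" unfolding dm_def using 1 2 by blast
  assume u: "u \<in> D"
  then have u': "sq_int (\<lambda>x. x) u" by (subst (asm) D_eq) (simp add: spectral_domain_eq)
  have "H u = ext (\<lambda>x. x) u" by (rule is_spectral_integral_unique[OF _ H_eq u']) simp
  also have "\<dots> = ext (\<lambda>x. x powr 1) u" by (rule sq_int_cong_AE(2)[OF _ _ ae' 1[OF u']]) auto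
  finally show "H u = X 1 u" by (simp only: X_def)
qed

end

section \<open>Linear evolution equations with bounded generator\<close>

lemma norm_sq_has_derivative:
  fixes \<psi> :: "real \<Rightarrow> 'h::complex_hilbert"
  assumes "(\<psi> has_vector_derivative \<psi>') (at t)"
  shows "((\<lambda>t. (norm (\<psi> t))\<^sup>2) has_real_derivative 2 * Re (cinner (\<psi> t) \<psi>')) (at t)"
proof -
  have "((\<lambda>t. cinner (\<psi> t) (\<psi> t)) has_vector_derivative (cinner (\<psi> t) \<psi>' + cinner \<psi>' (\<psi> t))) (at t)"
    by (rule bounded_bilinear.has_vector_derivative[OF bounded_bilinear_cinner assms assms])
  from bounded_linear.has_vector_derivative[OF bounded_linear_Re this]
  have "((\<lambda>t. Re (cinner (\<psi> t) (\<psi> t))) has_vector_derivative (2 * Re (cinner (\<psi> t) \<psi>'))) (at t)"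
    by (simp add: Re_cinner_commute[of \<psi>'])
  then show ?thesis by (simp add: norm_sq_cinner has_real_derivative_iff_has_vector_derivative)
qed

text \<open>Adding b / a to f makes the inequality homogeneous, and an exponential factor then makes
  f monotone. The bound on |f'| serves both time directions.\<close>

lemma gronwall:
  fixes f :: "real \<Rightarrow> real"
  assumes a: "0 < a" and b: "0 \<le> b"
    and d: "\<And>x. \<bar>x - s\<bar> \<le> \<bar>t - s\<bar> \<Longrightarrow> (f has_real_derivative f' x) (at x)"
    and le: "\<And>x. \<bar>x - s\<bar> \<le> \<bar>t - s\<bar> \<Longrightarrow> \<bar>f' x\<bar> \<le> a * f x + b"
  shows "f t \<le> (f s + b / a) * exp (a * \<bar>t - s\<bar>)"
proof -
  have "f t + b / a \<le> (f s + b / a) * exp (a * \<bar>t - s\<bar>)"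
  proof (cases "s \<le> t")
    case True
    define h where "h x = (f x + b / a) * exp (- a * (x - s))" for x
    have "h t \<le> h s"
    proof (rule DERIV_nonpos_imp_nonincreasing[OF True])
      fix x assume "s \<le> x" "x \<le> t"
      then have x: "\<bar>x - s\<bar> \<le> \<bar>t - s\<bar>" by simp
      have "(h has_real_derivative (f' x - (a * f x + b)) * exp (- a * (x - s))) (at x)"
        unfolding h_def using a d[OF x]
        by (auto intro!: derivative_eq_intros simp: field_simps)
      moreover have "(f' x - (a * f x + b)) * exp (- a * (x - s)) \<le> 0"
        using le[OF x] by (intro mult_nonpos_nonneg) auto
      ultimately show "\<exists>y. (h has_real_derivative y) (at x) \<and> y \<le> 0" by blast
    qed
    then have "(f t + b / a) * exp (- (a * (t - s))) \<le> f s + b / a" by (simp add: h_def)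
    then have "(f t + b / a) * exp (- (a * (t - s))) * exp (a * (t - s)) \<le> (f s + b / a) * exp (a * (t - s))"
      by (rule mult_right_mono) simp
    then show ?thesis using True by (simp add: mult.assoc exp_add[symmetric])
  next
    case False
    define h where "h x = (f x + b / a) * exp (a * (x - s))" for x
    have ts: "t \<le> s" using False by simp
    have "h t \<le> h s"
    proof (rule DERIV_nonneg_imp_nondecreasing[OF ts])
      fix x assume "t \<le> x" "x \<le> s"
      then have x: "\<bar>x - s\<bar> \<le> \<bar>t - s\<bar>" by simp
      have "(h has_real_derivative (f' x + (a * f x + b)) * exp (a * (x - s))) (at x)"
        unfolding h_def using a d[OF x]
        by (auto intro!: derivative_eq_intros simp: field_simps)
      moreover have "0 \<le> (f' x + (a * f x + b)) * exp (a * (x - s))"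
        using le[OF x] by (intro mult_nonneg_nonneg) auto
      ultimately show "\<exists>y. (h has_real_derivative y) (at x) \<and> 0 \<le> y" by blast
    qed
    then have "(f t + b / a) * exp (a * (t - s)) \<le> f s + b / a" by (simp add: h_def)
    then have "(f t + b / a) * exp (a * (t - s)) * exp (- (a * (t - s))) \<le> (f s + b / a) * exp (- (a * (t - s)))"
      by (rule mult_right_mono) simp
    then show ?thesis using ts by (simp add: mult.assoc exp_add[symmetric] abs_if algebra_simps)
  qed
  then show ?thesis using a b by (smt (verit) divide_nonneg_pos)
qed

lemma vector_derivative_bound:
  fixes f :: "real \<Rightarrow> 'a::real_normed_vector"
  assumes "\<And>x. x \<in> closed_segment s t \<Longrightarrow> (f has_vector_derivative f' x) (at x)"
    and "\<And>x. x \<in> closed_segment s t \<Longrightarrow> norm (f' x) \<le> B"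
  shows "norm (f t - f s) \<le> B * \<bar>t - s\<bar>"
proof -
  have "norm (f t - f s) \<le> B * norm (t - s)"
  proof (rule differentiable_bound[of "closed_segment s t" f "\<lambda>x h. h *\<^sub>R f' x"])
    show "(f has_derivative (\<lambda>h. h *\<^sub>R f' x)) (at x within closed_segment s t)"
      if "x \<in> closed_segment s t" for x
      using assms(1)[OF that] unfolding has_vector_derivative_def by (rule has_derivative_at_withinI)
    show "onorm (\<lambda>h. h *\<^sub>R f' x) \<le> B" if "x \<in> closed_segment s t" for x
      by (rule onorm_le) (use assms(2)[OF that] in \<open>simp add: mult_left_mono mult.commute[of B]\<close>)
  qed auto
  then show ?thesis by simp
qed

text \<open>Integrating the weight exp(a |t - s|) gains the factor 1 / a, which is what makes the
  Picard map contract.\<close>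

lemma exp_derivative_bound:
  fixes F :: "real \<Rightarrow> 'a::real_normed_vector"
  assumes d: "\<And>x. (F has_vector_derivative f x) (at x)" and a: "0 < a" and B: "0 \<le> B"
    and le: "\<And>x. norm (f x) \<le> B * exp (a * \<bar>x - s\<bar>)"
  shows "norm (F t - F s) \<le> (B / a) * exp (a * \<bar>t - s\<bar>)"
proof -
  have cont: "continuous_on X F" for X
    by (rule continuous_at_imp_continuous_on) (blast intro: has_vector_derivative_continuous d)
  have "norm (F t - F s) \<le> (B / a) * exp (a * \<bar>t - s\<bar>) - B / a"
  proof (cases t s rule: linorder_cases)
    case greater
    have "norm (F t - F s) \<le> (B / a) * exp (a * (t - s)) - (B / a) * exp (a * (s - s))"
    proof (rule differentiable_bound_general[OF greater cont _ d])
      show "((\<lambda>x. (B / a) * exp (a * (x - s))) has_vector_derivative (B * exp (a * (x - s)))) (at x)" for x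
        using a unfolding has_real_derivative_iff_has_vector_derivative[symmetric]
        by (auto intro!: derivative_eq_intros)
      show "norm (f x) \<le> B * exp (a * (x - s))" if "s < x" for x using le[of x] that by simp
    qed (intro continuous_intros)
    then show ?thesis using greater by simp
  next
    case less
    have "norm (F s - F t) \<le> - (B / a) * exp (- a * (s - s)) - (- (B / a) * exp (- a * (t - s)))"
    proof (rule differentiable_bound_general[OF less cont _ d])
      show "((\<lambda>x. - (B / a) * exp (- a * (x - s))) has_vector_derivative (B * exp (- a * (x - s)))) (at x)" for x
        using a unfolding has_real_derivative_iff_has_vector_derivative[symmetric]
        by (auto intro!: derivative_eq_intros)
      show "norm (f x) \<le> B * exp (- a * (x - s))" if "x < s" for x
        using le[of x] that by (simp add: abs_if algebra_simps)
    qed (intro continuous_intros)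
    then show ?thesis using less by (simp add: norm_minus_commute abs_if algebra_simps)
  qed simp
  then show ?thesis using a B by (smt (verit) divide_nonneg_pos)
qed

lemma global_antiderivative:
  fixes f :: "real \<Rightarrow> 'a::banach"
  assumes "continuous_on UNIV f"
  obtains F where "F s = 0" "\<And>t. (F has_vector_derivative f t) (at t)"
proof -
  define G where "G a t = integral {a..t} f - integral {a..s} f" for a t
  \<comment> \<open>The integral over a reversed interval is 0, so the base point moves with t to
    stay left of both s and t; by additivity it does not affect the value.\<close>
  define F where "F t = G (s - \<bar>t - s\<bar> - 1) t" for t
  have int: "f integrable_on {a..b}" for a b
    using assms by (intro integrable_continuous_interval continuous_on_subset[OF assms]) auto
  have eq: "F t = G a t" if a: "a \<le> s - \<bar>t - s\<bar> - 1" for a t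
  proof -
    define a' where "a' = s - \<bar>t - s\<bar> - 1"
    have "integral {a..a'} f + integral {a'..t} f = integral {a..t} f"
      "integral {a..a'} f + integral {a'..s} f = integral {a..s} f"
      by (rule Henstock_Kurzweil_Integration.integral_combine; use a int in \<open>auto simp: a'_def\<close>)+
    note ic = this
    have "F t = G a' t" by (simp only: F_def a'_def)
    then show ?thesis unfolding G_def ic[symmetric] by simp
  qed
  have d: "(F has_vector_derivative f t) (at t)" for t
  proof -
    \<comment> \<open>Far enough to the left to serve every point within distance 1 of t.\<close>
    define a where "a = s - \<bar>t - s\<bar> - 3"
    have "((\<lambda>u. integral {a..u} f) has_vector_derivative f t) (at t within {a..t + 1})"
      by (rule integral_has_vector_derivative) (use assms in \<open>auto simp: a_def intro: continuous_on_subset\<close>)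
    then have "((\<lambda>u. integral {a..u} f) has_vector_derivative f t) (at t within {a<..<t + 1})"
      by (rule has_vector_derivative_within_subset) auto
    then have "((\<lambda>u. integral {a..u} f) has_vector_derivative f t) (at t)"
      by (subst (asm) has_vector_derivative_within_open) (auto simp: a_def)
    then have "(G a has_vector_derivative f t) (at t)"
      unfolding G_def by (auto intro!: derivative_eq_intros)
    then show ?thesis
      by (rule has_vector_derivative_transform_within_open[of _ _ _ "{t - 1<..<t + 1}"])
        (auto simp: a_def intro!: eq[symmetric])
  qed
  show ?thesis by (rule that[OF _ d]) (simp add: F_def G_def)
qed

text \<open>Picard iteration in Bielecki's norm: with the weight exp(a |t - s|) the map contracts on
  the whole line, so a single fixed point is already a global solution.\<close>

theorem linear_ode_exists:
  fixes A :: "real \<Rightarrow> 'a::banach \<Rightarrow> 'a"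
  assumes lin: "\<And>t. bounded_linear (A t)" and bd: "\<And>t v. norm (A t v) \<le> M * norm v"
    and cont: "\<And>t e. 0 < e \<Longrightarrow> \<exists>d>0. \<forall>t'. \<bar>t' - t\<bar> < d \<longrightarrow> (\<forall>v. norm (A t' v - A t v) \<le> e * norm v)"
  obtains \<psi> where "\<psi> s = u" "\<And>t. (\<psi> has_vector_derivative A t (\<psi> t)) (at t)"
proof -
  \<comment> \<open>Twice a bound for the operator norms, hence the contraction constant 1/2; the
    summand 1 keeps a positive.\<close>
  define a where "a = 2 * (\<bar>M\<bar> + 1)"
  have a: "0 < a" by (simp add: a_def)
  have bd': "norm (A t v) \<le> (a / 2) * norm v" for t v
  proof -
    have "M * norm v \<le> (\<bar>M\<bar> + 1) * norm v" by (rule mult_right_mono) auto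
    then have "norm (A t v) \<le> (\<bar>M\<bar> + 1) * norm v" by (rule order.trans[OF bd])
    moreover have "a / 2 = \<bar>M\<bar> + 1" by (simp add: a_def)
    ultimately show ?thesis by (simp only:)
  qed
  have A_diff: "A t (x - y) = A t x - A t y" for t x y
    using bounded_linear.linear[OF lin] linear_diff by blast
  define e where "e t = exp (a * \<bar>t - s\<bar>)" for t
  have e_cont: "continuous_on X e" for X unfolding e_def by (intro continuous_intros)
  have e1: "1 \<le> e t" "0 < e t" for t using a by (simp_all add: e_def)
  have A_cont: "continuous_on UNIV (\<lambda>t. A t (y t))" if y: "continuous_on UNIV y" for y
    unfolding continuous_on_eq_continuous_within continuous_within
  proof
    fix t :: real
    have ylim: "(y \<longlongrightarrow> y t) (at t)" using y by (simp add: continuous_on_eq_continuous_within continuous_within)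
    show "((\<lambda>t. A t (y t)) \<longlongrightarrow> A t (y t)) (at t)"
    proof (rule LIM_zero_cancel, rule tendstoI)
      fix r :: real assume r: "0 < r"
      \<comment> \<open>The error r is halved: q controls the change of A t, and r / a below the
        change of y.\<close>
      define q where "q = r / (2 * (norm (y t) + 1))"
      have np: "0 < norm (y t) + 1" using norm_ge_zero[of "y t"] by linarith
      have q: "0 < q" using r np by (simp add: q_def)
      obtain d where d: "d > 0" "\<And>t'. \<bar>t' - t\<bar> < d \<Longrightarrow> norm (A t' v - A t v) \<le> q * norm v" for v
        using cont[OF q] by metis
      have "\<forall>\<^sub>F t' in at t. dist (y t') (y t) < r / a" using ylim r a by (intro tendstoD) auto
      moreover have "\<forall>\<^sub>F t' in at t. dist t' t < d"
        using d(1) by (auto simp: eventually_at intro!: exI[of _ d])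
      ultimately show "\<forall>\<^sub>F t' in at t. dist (A t' (y t') - A t (y t)) 0 < r"
      proof eventually_elim
        case (elim t')
        have "norm (A t' (y t') - A t (y t)) \<le> norm (A t' (y t' - y t)) + norm (A t' (y t) - A t (y t))"
          unfolding A_diff by (rule norm_diff_triangle_le) (rule order_refl)+
        also have "norm (A t' (y t' - y t)) \<le> (a / 2) * norm (y t' - y t)" by (rule bd')
        also have "\<dots> < r / 2" using elim(1) a by (simp add: dist_norm field_simps)
        also have "norm (A t' (y t) - A t (y t)) \<le> q * norm (y t)"
          using elim(2) by (intro d) (simp add: dist_real_def)
        also have "\<dots> \<le> r / 2" using r np by (simp add: q_def field_simps)
        finally show ?case by simp
      qed
    qed
  qed
  define I where "I f = (SOME F. F s = 0 \<and> (\<forall>t. (F has_vector_derivative f t) (at t)))" for f :: "real \<Rightarrow> 'a"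
  have I: "I f s = 0" "(I f has_vector_derivative f t) (at t)" if "continuous_on UNIV f" for f t
  proof -
    have "\<exists>F. F s = 0 \<and> (\<forall>t. (F has_vector_derivative f t) (at t))"
      using global_antiderivative[OF that, of s] by metis
    from someI_ex[OF this] show "I f s = 0" "(I f has_vector_derivative f t) (at t)"
      unfolding I_def by blast+
  qed
  \<comment> \<open>The unknown is the solution divided by the weight e, a bounded continuous
    function.\<close>
  define g where "g \<phi> t = A t (e t *\<^sub>R apply_bcontfun \<phi> t)" for \<phi> t
  have g_cont: "continuous_on UNIV (g \<phi>)" for \<phi>
    unfolding g_def by (rule A_cont, rule continuous_on_scaleR[OF e_cont]) simp
  note Ig = I[OF g_cont]
  have Ig_cont: "continuous_on UNIV (I (g \<phi>))" for \<phi>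
    by (rule continuous_at_imp_continuous_on) (blast intro: has_vector_derivative_continuous Ig(2))
  have diff_bound: "norm (I (g \<phi>) t - I (g \<eta>) t) \<le> (1 / 2 * norm (\<phi> - \<eta>)) * e t" for \<phi> \<eta> t
  proof -
    have "norm ((I (g \<phi>) t - I (g \<eta>) t) - (I (g \<phi>) s - I (g \<eta>) s))
        \<le> ((a / 2 * norm (\<phi> - \<eta>)) / a) * exp (a * \<bar>t - s\<bar>)"
    proof (rule exp_derivative_bound[of "\<lambda>t. I (g \<phi>) t - I (g \<eta>) t" "\<lambda>t. g \<phi> t - g \<eta> t"])
      show "((\<lambda>t. I (g \<phi>) t - I (g \<eta>) t) has_vector_derivative g \<phi> x - g \<eta> x) (at x)" for x
        by (intro has_vector_derivative_diff Ig)
      show "norm (g \<phi> x - g \<eta> x) \<le> (a / 2 * norm (\<phi> - \<eta>)) * exp (a * \<bar>x - s\<bar>)" for x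
      proof -
        have "g \<phi> x - g \<eta> x = A x (e x *\<^sub>R apply_bcontfun (\<phi> - \<eta>) x)"
          by (simp add: g_def A_diff[symmetric] scaleR_diff_right)
        also have "norm \<dots> \<le> (a / 2) * (e x * norm (apply_bcontfun (\<phi> - \<eta>) x))"
          using bd'[of x "e x *\<^sub>R apply_bcontfun (\<phi> - \<eta>) x"] e1(2)[of x] by simp
        also have "\<dots> \<le> (a / 2) * (e x * norm (\<phi> - \<eta>))"
          using a e1(2)[of x] by (intro mult_left_mono norm_bounded) auto
        finally show ?thesis by (simp add: e_def mult_ac)
      qed
    qed (use a in auto)
    then show ?thesis using a by (simp add: Ig(1) e_def)
  qed
  have g0: "g 0 = (\<lambda>t. 0)" using bounded_linear.linear[OF lin] linear_0 by (fastforce simp: g_def)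
  have I0: "norm (I (g 0) t) = 0" for t
    using vector_derivative_bound[of s t "I (g 0)" "g 0" 0] Ig[of 0] g0 by simp
  define T where "T \<phi> = Bcontfun (\<lambda>t. (1 / e t) *\<^sub>R (u + I (g \<phi>) t))" for \<phi>
  have T: "apply_bcontfun (T \<phi>) t = (1 / e t) *\<^sub>R (u + I (g \<phi>) t)" for \<phi> t
  proof -
    have "(\<lambda>t. (1 / e t) *\<^sub>R (u + I (g \<phi>) t)) \<in> bcontfun"
    proof (rule bcontfun_normI)
      show "continuous_on UNIV (\<lambda>t. (1 / e t) *\<^sub>R (u + I (g \<phi>) t))"
      proof (intro continuous_on_scaleR continuous_on_divide continuous_on_add continuous_on_const e_cont Ig_cont ballI)
        show "e t \<noteq> 0" for t using e1(2)[of t] by simp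
      qed
      fix t
      have "norm (u + I (g \<phi>) t) \<le> norm u * e t + (1 / 2 * norm \<phi>) * e t"
        using diff_bound[of \<phi> t 0] I0[of t] mult_left_mono[OF e1(1)[of t] norm_ge_zero[of u]]
        by (intro norm_triangle_le add_mono) auto
      moreover have "norm ((1 / e t) *\<^sub>R v) = norm v / e t" for v :: 'a using e1(2)[of t] by simp
      ultimately show "norm ((1 / e t) *\<^sub>R (u + I (g \<phi>) t)) \<le> norm u + 1 / 2 * norm \<phi>"
        using e1(2)[of t] by (simp only: pos_divide_le_eq distrib_right)
    qed
    then show ?thesis by (simp add: T_def Bcontfun_inverse)
  qed
  have "dist (T \<phi>) (T \<eta>) \<le> (1 / 2) * dist \<phi> \<eta>" for \<phi> \<eta>
    unfolding dist_norm
  proof (rule norm_bound)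
    fix t
    have "apply_bcontfun (T \<phi> - T \<eta>) t = (1 / e t) *\<^sub>R (I (g \<phi>) t - I (g \<eta>) t)"
      by (simp add: T scaleR_diff_right[symmetric])
    moreover have "norm ((1 / e t) *\<^sub>R v) = norm v / e t" for v :: 'a using e1(2)[of t] by simp
    ultimately show "norm (apply_bcontfun (T \<phi> - T \<eta>) t) \<le> 1 / 2 * norm (\<phi> - \<eta>)"
      using diff_bound[of \<phi> t \<eta>] e1(2)[of t] by (simp only: pos_divide_le_eq)
  qed
  then obtain \<phi> where \<phi>: "T \<phi> = \<phi>"
    using banach_fix_type[of "1 / 2" T] by auto
  have sol: "e t *\<^sub>R apply_bcontfun \<phi> t = u + I (g \<phi>) t" for t
    using T[of \<phi> t] e1(2)[of t] by (simp add: \<phi>)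
  have gA: "A t (u + I (g \<phi>) t) = g \<phi> t" for t
    by (rule trans[OF arg_cong[OF sol[symmetric]]]) (simp add: g_def)
  have "((\<lambda>t. u + I (g \<phi>) t) has_vector_derivative A t (u + I (g \<phi>) t)) (at t)" for t
    using has_vector_derivative_add[OF has_vector_derivative_const Ig(2)[of \<phi> t], of u]
    by (simp only: gA add_0_left)
  then show ?thesis by (intro that[of "\<lambda>t. u + I (g \<phi>) t"]) (auto simp: Ig(1))
qed

section \<open>The propagator\<close>

text \<open>The hypotheses in terms of powers of H: L costs m of them, B is bounded at the integer
  levels up to J, and the commutator is stored as H L H^-1 = L - B so that every domain is
  explicit.\<close>

locale evolution = positive_pvm E c for E :: "real set \<Rightarrow> 'h::complex_hilbert \<Rightarrow> 'h" and c +
  fixes L B :: "real \<Rightarrow> 'h \<Rightarrow> 'h" and m J :: nat and C\<^sub>L C\<^sub>B :: real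
  assumes mJ: "m \<le> J" and C_nonneg: "0 \<le> C\<^sub>L" "0 \<le> C\<^sub>B"
    and L_linear: "clinear_on (dm m) (L t)"
    and L_bound: "u \<in> dm m \<Longrightarrow> norm (L t u) \<le> C\<^sub>L * norm (X m u)"
    and L_cont: "0 < e \<Longrightarrow> \<exists>d>0. \<forall>t'. \<bar>t' - t\<bar> < d \<longrightarrow> (\<forall>u\<in>dm m. norm (L t' u - L t u) \<le> e * norm (X m u))"
    and L_sym: "u \<in> dm m \<Longrightarrow> v \<in> dm m \<Longrightarrow> cinner (L t u) v = cinner u (L t v)"
    and B_bound: "j \<le> J \<Longrightarrow> u \<in> dm (real j) \<Longrightarrow> B t u \<in> dm (real j) \<and>
      norm (X (real j) (B t u)) \<le> C\<^sub>B * norm (X (real j) u)"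
    and commutator: "u \<in> dm m \<Longrightarrow> L t (X (- 1) u) \<in> dm 1 \<and> X 1 (L t (X (- 1) u)) = L t u - B t u"
begin

declare scaleC_minus_left [simp del]

lemma dm_real_mono: "u \<in> dm b \<Longrightarrow> a \<le> b \<Longrightarrow> u \<in> dm a"
  by (rule dm_le)

lemma X_neg_dm: "u \<in> dm a \<Longrightarrow> X (- s) u \<in> dm (a + s)" if "0 \<le> s"
  using X_X(1)[of u "- s" "a + s"] dm_nonpos[of "- s" u] that by simp

lemma X_lin: "u \<in> dm s \<Longrightarrow> v \<in> dm s \<Longrightarrow> X s (u + v) = X s u + X s v"
  "u \<in> dm s \<Longrightarrow> v \<in> dm s \<Longrightarrow> X s (u - v) = X s u - X s v"
  "u \<in> dm s \<Longrightarrow> X s (a *\<^sub>C u) = a *\<^sub>C X s u"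
  by (rule clinear_onD[OF X_linear]; assumption)+

definition K :: "nat \<Rightarrow> real \<Rightarrow> 'h \<Rightarrow> 'h" where
  "K n t w = (\<Sum>j<n. X (real j) (B t (X (- real j) w)))"

text \<open>The sum ends at j = n - 1, so bounds on B up to J still control n = Suc J, the top level
  b of the energy estimates.\<close>

lemma norm_K_le:
  assumes "n \<le> Suc J"
  shows "norm (K n t w) \<le> real n * C\<^sub>B * norm w"
proof -
  have "norm (X (real j) (B t (X (- real j) w))) \<le> C\<^sub>B * norm w" if "j < n" for j
    using B_bound[of j "X (- real j) w" t] that assms X_X_neg[of "real j" w] by auto
  then have "norm (K n t w) \<le> (\<Sum>j<n. C\<^sub>B * norm w)"
    unfolding K_def by (intro sum_norm_le) auto
  then show ?thesis by simp
qed

text \<open>The conjugated operator \<open>H\<^sup>n L H\<^sup>-\<^sup>n\<close> differs from \<open>L\<close> by the bounded operator \<open>K n\<close>: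
  each conjugation by \<open>H\<close> subtracts \<open>B = [L, H] H\<^sup>-\<^sup>1\<close>.\<close>

lemma conjugated_L:
  assumes "n \<le> Suc J" "w \<in> dm m"
  shows "L t (X (- real n) w) \<in> dm (real n) \<and> X (real n) (L t (X (- real n) w)) = L t w - K n t w"
  using assms(1)
proof (induction n)
  case 0
  have "X (- real 0) w = w" by simp
  then show ?case by (simp add: K_def)
next
  case (Suc n)
  define w' where "w' = X (- real n) w"
  have w': "w' \<in> dm (real n)" "w' \<in> dm m" "X (real n) w' = w"
    using X_X_neg[of "real n" w] X_neg_dm[of "real n" w m] assms(2) dm_real_mono[of w' "m + n" m]
    by (auto simp: w'_def add.commute)
  have eq: "X (- real (Suc n)) w = X (- 1) w'"
    using X_X(2)[of w "- real n" "- 1"] dm_nonpos[of "- real (Suc n)" w] dm_nonpos[of "- real n" w]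
    by (simp add: w'_def algebra_simps)
  have IH: "L t w' \<in> dm (real n)" "X (real n) (L t w') = L t w - K n t w"
    using Suc by (auto simp: w'_def)
  have Bw: "B t w' \<in> dm (real n)" using B_bound[of n w' t] Suc.prems w' by auto
  define z where "z = L t (X (- 1) w')"
  have z: "z \<in> dm 1" "X 1 z = L t w' - B t w'" using commutator[OF w'(2)] by (auto simp: z_def)
  have "X 1 z \<in> dm (real n)" unfolding z(2) using csubspaceD(4)[OF dm_csubspace] IH(1) Bw by blast
  then have zn: "z \<in> dm (real n + 1)" using X_X(1)[OF z(1)] by simp
  have "X (real n + 1) z = X (real n) (L t w' - B t w')" using X_X(2)[OF z(1) zn] z(2) by simp
  also have "\<dots> = L t w - K n t w - X (real n) (B t w')" using X_lin(2)[OF IH(1) Bw] IH(2) by simp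
  also have "\<dots> = L t w - K (Suc n) t w" by (simp add: K_def w'_def)
  finally have "X (real n + 1) z = L t w - K (Suc n) t w" .
  moreover have "real (Suc n) = real n + 1" by simp
  ultimately show ?case using zn unfolding eq z_def[symmetric] by (simp only:)
qed

section \<open>Truncated equations and energy estimates\<close>

lemma Im_cinner_L: "u \<in> dm m \<Longrightarrow> Im (cinner u (L t u)) = 0"
proof -
  assume "u \<in> dm m"
  then have "cinner u (L t u) = cnj (cinner u (L t u))"
    using L_sym[of u u t] cinner_commute[of "L t u" u] by simp
  from arg_cong[OF this, of Im] show ?thesis by simp
qed

text \<open>Truncation on both sides preserves symmetry; one side alone would make the operator
  bounded without keeping it symmetric.\<close>

definition L\<^sub>N :: "real \<Rightarrow> real \<Rightarrow> 'h \<Rightarrow> 'h" where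
  "L\<^sub>N r t u = P r (L t (P r u))"

lemma L_diff: "u \<in> dm m \<Longrightarrow> v \<in> dm m \<Longrightarrow> L t (u - v) = L t u - L t v"
  and L_add: "u \<in> dm m \<Longrightarrow> v \<in> dm m \<Longrightarrow> L t (u + v) = L t u + L t v"
  by (rule clinear_onD[OF L_linear]; assumption)+

lemma LP_bounded_linear: "bounded_linear (\<lambda>u. L t (P r u))"
proof -
  obtain C where C: "0 \<le> C" "\<And>u. norm (X m (P r u)) \<le> C * norm u" using P_smooth[of r "real m"] by metis
  have "norm (L t (P r u)) \<le> (C\<^sub>L * C) * norm u" for u
    using order.trans[OF L_bound[OF P_dm] mult_left_mono[OF C(2) C_nonneg(1)]] by (simp add: mult.assoc)
  moreover have "clinear_on UNIV (\<lambda>u. L t (P r u))"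
    using clinear_onD[OF L_linear[of t]] clinear_onD[OF P_linear[of r]] by (intro clinear_onI) auto
  ultimately show ?thesis by (intro clinear_bounded_linear)
qed

text \<open>The truncated generator conjugated by H^n, again bounded. Solving its equation directly
  yields H^n of the truncated solution without differentiating under an unbounded operator; n = 0 is
  the equation itself.\<close>

definition A\<^sub>N :: "nat \<Rightarrow> real \<Rightarrow> real \<Rightarrow> 'h \<Rightarrow> 'h" where
  "A\<^sub>N n r t w = - \<i> *\<^sub>C X (real n) (P r (L t (P r (X (- real n) w))))"

lemma A\<^sub>N_solution:
  obtains \<eta> where "\<eta> s = w" "\<And>t. (\<eta> has_vector_derivative A\<^sub>N n r t (\<eta> t)) (at t)"
proof -
  obtain C1 where C1: "0 \<le> C1" "\<And>u. norm (X (real n) (P r u)) \<le> C1 * norm u"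
    using P_smooth[of r "real n"] by metis
  obtain C2 where C2: "0 \<le> C2" "\<And>u. norm (X m (P r u)) \<le> C2 * norm u"
    using P_smooth[of r "real m"] by metis
  define C3 where "C3 = c powr (- real n)"
  have C3: "0 \<le> C3" "\<And>u. norm (X (- real n) u) \<le> C3 * norm u"
    using X_neg_bounded[of "real n"] by (auto simp: C3_def)
  have lin: "bounded_linear (A\<^sub>N n r t)" for t
  proof -
    have "A\<^sub>N n r t = (\<lambda>w. - \<i> *\<^sub>C X (real n) (P r (L t (P r (X (- real n) w)))))"
      by (simp add: fun_eq_iff A\<^sub>N_def)
    then show ?thesis
      by (simp only:) (rule bounded_linear_compose[OF bounded_linear_scaleC bounded_linear_compose[OF XP_bounded_linear
        bounded_linear_compose[OF LP_bounded_linear X_neg_bounded_linear[OF of_nat_0_le_iff]]]])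
  qed
  have XmP: "norm (X m (P r (X (- real n) v))) \<le> C2 * C3 * norm v" for v
    using order.trans[OF C2(2) mult_left_mono[OF C3(2) C2(1)]] by (simp add: mult.assoc)
  have bd: "norm (A\<^sub>N n r t v) \<le> (C1 * (C\<^sub>L * (C2 * C3))) * norm v" for t v
  proof -
    have "norm (A\<^sub>N n r t v) \<le> C1 * norm (L t (P r (X (- real n) v)))"
      using C1(2) by (simp add: A\<^sub>N_def norm_scaleC)
    also have "\<dots> \<le> C1 * (C\<^sub>L * norm (X m (P r (X (- real n) v))))"
      using C1(1) by (intro mult_left_mono L_bound) auto
    also have "\<dots> \<le> C1 * (C\<^sub>L * (C2 * C3 * norm v))"
      using C1(1) C_nonneg by (intro mult_left_mono XmP) auto
    finally show ?thesis by (simp add: mult.assoc)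
  qed
  have cont: "\<exists>d>0. \<forall>t'. \<bar>t' - t\<bar> < d \<longrightarrow> (\<forall>v. norm (A\<^sub>N n r t' v - A\<^sub>N n r t v) \<le> e * norm v)"
    if e: "0 < e" for t e
  proof -
    define q where "q = e / (C1 * (C2 * C3) + 1)"
    have p: "0 < C1 * (C2 * C3) + 1" using C1 C2 C3 by (intro add_nonneg_pos mult_nonneg_nonneg) auto
    have q: "0 < q" using e p by (simp add: q_def)
    obtain d where d: "0 < d" "\<And>t' u. \<bar>t' - t\<bar> < d \<Longrightarrow> u \<in> dm m \<Longrightarrow> norm (L t' u - L t u) \<le> q * norm (X m u)"
      using L_cont[OF q, of t] by metis
    have "norm (A\<^sub>N n r t' v - A\<^sub>N n r t v) \<le> e * norm v" if t': "\<bar>t' - t\<bar> < d" for t' v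
    proof -
      define z where "z = P r (X (- real n) v)"
      have "A\<^sub>N n r t' v - A\<^sub>N n r t v = - \<i> *\<^sub>C X (real n) (P r (L t' z - L t z))"
        using X_lin(2)[OF P_dm P_dm] clinear_onD(5)[OF P_linear]
        by (simp add: A\<^sub>N_def z_def scaleC_diff_right del: scaleC_minus_left)
      then have "norm (A\<^sub>N n r t' v - A\<^sub>N n r t v) \<le> C1 * norm (L t' z - L t z)"
        using C1(2) by (simp add: norm_scaleC)
      also have "\<dots> \<le> C1 * (q * norm (X m z))"
        using C1(1) by (intro mult_left_mono d t') (auto simp: z_def)
      also have "\<dots> \<le> C1 * (q * (C2 * C3 * norm v))"
        unfolding z_def using C1(1) q by (intro mult_left_mono XmP) auto
      also have "\<dots> = (C1 * (C2 * C3) * q) * norm v" by simp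
      also have "\<dots> \<le> e * norm v"
      proof (rule mult_right_mono)
        have "C1 * (C2 * C3) * q \<le> (C1 * (C2 * C3) + 1) * q" using q by simp
        also have "\<dots> = e" using p by (simp add: q_def)
        finally show "C1 * (C2 * C3) * q \<le> e" .
      qed simp
      finally show ?thesis .
    qed
    with d(1) show ?thesis by blast
  qed
  show ?thesis using linear_ode_exists[of "A\<^sub>N n r", OF lin bd cont] that by blast
qed

definition is_sol :: "real \<Rightarrow> real \<Rightarrow> 'h \<Rightarrow> (real \<Rightarrow> 'h) \<Rightarrow> bool" where
  "is_sol r s u \<psi> \<longleftrightarrow> \<psi> s = u \<and> (\<forall>t. (\<psi> has_vector_derivative - \<i> *\<^sub>C L\<^sub>N r t (\<psi> t)) (at t))"

text \<open>The propagator of the equation cut off at r, from time s to time t;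
  \<open>is_sol_unique\<close> makes the choice canonical.\<close>

definition S :: "real \<Rightarrow> real \<Rightarrow> real \<Rightarrow> 'h \<Rightarrow> 'h" where
  "S r t s u = (SOME \<psi>. is_sol r s u \<psi>) t"

lemma is_sol_S: "is_sol r s u (\<lambda>t. S r t s u)"
proof -
  obtain \<eta> where "\<eta> s = u" "\<And>t. (\<eta> has_vector_derivative A\<^sub>N 0 r t (\<eta> t)) (at t)"
    using A\<^sub>N_solution by blast
  then have "is_sol r s u \<eta>" by (simp add: is_sol_def A\<^sub>N_def L\<^sub>N_def)
  from someI[of "is_sol r s u", OF this] show ?thesis by (simp add: S_def)
qed

lemma S_start: "S r s s u = u"
  and S_deriv: "((\<lambda>t. S r t s u) has_vector_derivative - \<i> *\<^sub>C L\<^sub>N r t (S r t s u)) (at t)"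
  using is_sol_S[of r s u] by (auto simp: is_sol_def)

lemma Re_cinner_L\<^sub>N: "Re (cinner u (- \<i> *\<^sub>C L\<^sub>N r t u)) = 0"
  using Im_cinner_L[of "P r u" t] by (simp add: cinner_scaleC_right L\<^sub>N_def P_sym[symmetric])

lemma L\<^sub>N_linear: "clinear_on UNIV (L\<^sub>N r t)"
  using clinear_onD[OF L_linear[of t]] clinear_onD[OF P_linear[of r]]
  unfolding L\<^sub>N_def by (intro clinear_onI) auto

lemma is_sol_norm:
  assumes "is_sol r s u \<psi>"
  shows "norm (\<psi> t) = norm u"
proof -
  have "((\<lambda>t. (norm (\<psi> t))\<^sup>2) has_real_derivative 0) (at x)" for x
  proof -
    have "(\<psi> has_vector_derivative - \<i> *\<^sub>C L\<^sub>N r x (\<psi> x)) (at x)" using assms by (simp add: is_sol_def)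
    from norm_sq_has_derivative[OF this] show ?thesis by (simp only: Re_cinner_L\<^sub>N mult_zero_right)
  qed
  then have "(norm (\<psi> t))\<^sup>2 = (norm (\<psi> s))\<^sup>2" by (intro DERIV_isconst_all) auto
  then show ?thesis using assms by (simp add: is_sol_def)
qed

lemma is_sol_add:
  assumes "is_sol r s u \<psi>" "is_sol r s v \<eta>"
  shows "is_sol r s (u + v) (\<lambda>t. \<psi> t + \<eta> t)"
  using assms clinear_onD(2)[OF L\<^sub>N_linear]
  unfolding is_sol_def by (auto intro!: derivative_eq_intros simp: scaleC_add_right)

lemma is_sol_scaleC:
  assumes "is_sol r s u \<psi>"
  shows "is_sol r s (a *\<^sub>C u) (\<lambda>t. a *\<^sub>C \<psi> t)"
  unfolding is_sol_def
proof (intro conjI allI)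
  fix t
  have "((\<lambda>t. a *\<^sub>C \<psi> t) has_vector_derivative a *\<^sub>C (- \<i> *\<^sub>C L\<^sub>N r t (\<psi> t))) (at t)"
    using assms by (intro bounded_linear.has_vector_derivative[OF bounded_linear_scaleC]) (simp add: is_sol_def)
  then show "((\<lambda>t. a *\<^sub>C \<psi> t) has_vector_derivative - \<i> *\<^sub>C L\<^sub>N r t (a *\<^sub>C \<psi> t)) (at t)"
    using clinear_onD(3)[OF L\<^sub>N_linear, of "\<psi> t" r t a] by (simp add: scaleC_scaleC mult.commute)
qed (use assms in \<open>simp add: is_sol_def\<close>)

text \<open>The difference solves the same equation with initial value 0, and norms are
  conserved.\<close>

lemma is_sol_unique:
  assumes "is_sol r s u \<psi>" "is_sol r s u \<eta>"
  shows "\<psi> t = \<eta> t"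
  using is_sol_norm[OF is_sol_add[OF assms(1) is_sol_scaleC[OF assms(2), of "-1"]], of t]
  by (simp add: scaleC_minus_left)

lemma S_eqI: "is_sol r s u \<psi> \<Longrightarrow> S r t s u = \<psi> t"
  using is_sol_unique[OF is_sol_S] .

lemma norm_S: "norm (S r t s u) = norm u"
  by (rule is_sol_norm[OF is_sol_S])

lemma S_linear: "clinear_on UNIV (S r t s)"
  by (rule clinear_onI) (auto intro!: S_eqI[OF is_sol_add[OF is_sol_S is_sol_S]] S_eqI[OF is_sol_scaleC[OF is_sol_S]])

lemma S_diff: "S r t s (u - v) = S r t s u - S r t s v"
  by (rule clinear_onD(5)[OF S_linear]) auto

lemma S_group: "S r t q (S r q s u) = S r t s u"
  by (rule S_eqI) (auto simp: is_sol_def S_deriv)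

text \<open>Bounds n times \<open>C\<^sub>B\<close> for every n up to Suc J; the summand 1 makes it
  a positive rate for Gronwall's inequality.\<close>

definition \<kappa> :: real where "\<kappa> = (real J + 1) * C\<^sub>B + 1"

lemma kappa: "0 < \<kappa>" "1 \<le> \<kappa>" "n \<le> Suc J \<Longrightarrow> real n * C\<^sub>B \<le> \<kappa>"
proof -
  show "1 \<le> \<kappa>" using C_nonneg by (simp add: \<kappa>_def)
  then show "0 < \<kappa>" by simp
  assume "n \<le> Suc J"
  then have "real n * C\<^sub>B \<le> (real J + 1) * C\<^sub>B" using C_nonneg by (intro mult_right_mono) auto
  then show "real n * C\<^sub>B \<le> \<kappa>" by (simp add: \<kappa>_def)
qed

text \<open>Solving the conjugated equation first and identifying it through uniqueness shows the
  regularity of S; the norm of that solution then obeys Gronwall's inequality with K n as the only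
  source of growth.\<close>

lemma S_level:
  assumes n: "n \<le> Suc J" and u: "u \<in> dm (real n)"
  shows "S r t s u \<in> dm (real n)" "norm (X (real n) (S r t s u)) \<le> exp (\<kappa> * \<bar>t - s\<bar>) * norm (X (real n) u)"
proof -
  obtain \<eta> where \<eta>: "\<eta> s = X (real n) u" "\<And>t. (\<eta> has_vector_derivative A\<^sub>N n r t (\<eta> t)) (at t)"
    using A\<^sub>N_solution by blast
  have sol: "is_sol r s u (\<lambda>t. X (- real n) (\<eta> t))"
    unfolding is_sol_def
  proof (intro conjI allI)
    show "X (- real n) (\<eta> s) = u" using X_neg_X[OF u] by (simp add: \<eta>)
    fix t
    have "((\<lambda>t. X (- real n) (\<eta> t)) has_vector_derivative X (- real n) (A\<^sub>N n r t (\<eta> t))) (at t)"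
      by (rule bounded_linear.has_vector_derivative[OF X_neg_bounded_linear \<eta>(2)]) simp
    also have "X (- real n) (A\<^sub>N n r t (\<eta> t)) = - \<i> *\<^sub>C L\<^sub>N r t (X (- real n) (\<eta> t))"
      unfolding A\<^sub>N_def L\<^sub>N_def by (subst X_lin(3)) (auto simp: dm_nonpos X_neg_X)
    finally show "((\<lambda>t. X (- real n) (\<eta> t)) has_vector_derivative - \<i> *\<^sub>C L\<^sub>N r t (X (- real n) (\<eta> t))) (at t)" .
  qed
  have S: "S r t s u = X (- real n) (\<eta> t)" by (rule S_eqI[OF sol])
  show "S r t s u \<in> dm (real n)" unfolding S by (rule X_X_neg) simp
  have XS: "X (real n) (S r t s u) = \<eta> t" unfolding S by (rule X_X_neg) simp
  have bound: "\<bar>2 * Re (cinner (\<eta> x) (A\<^sub>N n r x (\<eta> x)))\<bar> \<le> (2 * \<kappa>) * (norm (\<eta> x))\<^sup>2 + 0" for x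
  proof -
    \<comment> \<open>P r is symmetric and commutes with powers of H, so L is paired with w on both
      sides and drops out of the real part.\<close>
    define w where "w = P r (\<eta> x)"
    have w: "w \<in> dm m" by (simp add: w_def)
    have "X (real n) (P r (L x (P r (X (- real n) (\<eta> x))))) = P r (L x w - K n x w)"
    proof -
      have "P r (X (- real n) (\<eta> x)) = X (- real n) w"
        unfolding w_def by (rule P_X(2)[symmetric]) (simp add: dm_nonpos)
      then show ?thesis using conjugated_L[OF n w, of x] by (simp add: P_X(2))
    qed
    then have "cinner (\<eta> x) (A\<^sub>N n r x (\<eta> x)) = - \<i> * (cinner w (L x w) - cinner w (K n x w))"
      by (simp add: A\<^sub>N_def cinner_scaleC_right P_sym[symmetric] w_def[symmetric] cinner_diff_right
          del: scaleC_minus_left)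
    then have "Re (cinner (\<eta> x) (A\<^sub>N n r x (\<eta> x))) = - Im (cinner w (K n x w))"
      using Im_cinner_L[OF w] by simp
    also have "\<bar>\<dots>\<bar> \<le> norm w * norm (K n x w)"
      using abs_Im_le_cmod[of "cinner w (K n x w)"] cinner_le[of w "K n x w"] by simp
    also have "\<dots> \<le> norm w * (\<kappa> * norm w)"
      using order.trans[OF norm_K_le[OF n, of x w] mult_right_mono[OF kappa(3)[OF n]]]
      by (intro mult_left_mono) auto
    also have "\<dots> \<le> norm (\<eta> x) * (\<kappa> * norm (\<eta> x))"
      using kappa(1) norm_P_le[of r "\<eta> x"] unfolding w_def by (intro mult_mono) auto
    finally show ?thesis by (simp add: power2_eq_square mult_ac abs_mult)
  qed
  have "(norm (\<eta> t))\<^sup>2 \<le> ((norm (\<eta> s))\<^sup>2 + 0 / (2 * \<kappa>)) * exp (2 * \<kappa> * \<bar>t - s\<bar>)"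
    by (rule gronwall[where f = "\<lambda>x. (norm (\<eta> x))\<^sup>2" and f' = "\<lambda>x. 2 * Re (cinner (\<eta> x) (A\<^sub>N n r x (\<eta> x)))"])
      (use kappa(1) bound norm_sq_has_derivative[OF \<eta>(2)] in auto)
  also have "\<dots> = (exp (\<kappa> * \<bar>t - s\<bar>) * norm (\<eta> s))\<^sup>2"
    by (simp add: power_mult_distrib exp_double[symmetric] mult_ac)
  finally have "norm (\<eta> t) \<le> exp (\<kappa> * \<bar>t - s\<bar>) * norm (\<eta> s)"
    by (rule power2_le_imp_le) simp
  then show "norm (X (real n) (S r t s u)) \<le> exp (\<kappa> * \<bar>t - s\<bar>) * norm (X (real n) u)"
    by (simp only: XS \<eta>(1))
qed

section \<open>Convergence of the truncated propagators\<close>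

abbreviation b :: real where "b \<equiv> real (Suc J)"

lemma b_ge: "real m + 1 \<le> b" using mJ by simp

text \<open>Two errors occur. Removing the inner P r costs m + 1 powers on v; removing the outer one
  costs one power on L v, and H L v = L H v - B H v by the commutator. Both costs fit below
  b.\<close>

lemma L\<^sub>N_rate:
  obtains C where "0 \<le> C" "\<And>r t v. 0 < r \<Longrightarrow> v \<in> dm b \<Longrightarrow> norm (L\<^sub>N r t v - L t v) \<le> C / r * norm (X b v)"
proof -
  define D1 where "D1 = c powr (real m + 1 - b)"
  define D2 where "D2 = c powr (1 - b)"
  have D: "0 \<le> D1" "0 \<le> D2" by (simp_all add: D1_def D2_def)
  \<comment> \<open>The inner error contributes \<open>C\<^sub>L * D1\<close>, the outer one
    \<open>C\<^sub>L * D1 + C\<^sub>B * D2\<close>.\<close>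
  define C where "C = 2 * C\<^sub>L * D1 + C\<^sub>B * D2"
  show ?thesis
  proof (rule that[of C])
    show "0 \<le> C" using C_nonneg D by (simp add: C_def)
    fix r t v assume r: "(0::real) < r" and v: "v \<in> dm b"
    have vm1: "v \<in> dm (real m + 1)" "norm (X (real m + 1) v) \<le> D1 * norm (X b v)"
      using dm_mono[OF b_ge v] by (auto simp: D1_def)
    have vm: "v \<in> dm m" by (rule dm_le[OF vm1(1)]) simp
    have v1: "v \<in> dm 1" "norm (X 1 v) \<le> D2 * norm (X b v)"
      using dm_mono[of 1 b v] v by (auto simp: D2_def)
    define w where "w = X 1 v"
    have w: "w \<in> dm m" "v = X (- 1) w" "norm (X m w) = norm (X (real m + 1) v)"
      using X_X[OF v1(1), of "real m"] vm1(1) X_neg_X[OF v1(1)] by (auto simp: w_def)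
    have Lv: "L t v \<in> dm 1" "X 1 (L t v) = L t w - B t w" using commutator[OF w(1), of t] w(2) by auto
    have Bw: "norm (B t w) \<le> C\<^sub>B * norm w" using B_bound[of 0 w t] by simp
    have XL: "norm (X 1 (L t v)) \<le> (C\<^sub>L * D1 + C\<^sub>B * D2) * norm (X b v)"
    proof -
      have "norm (X 1 (L t v)) \<le> norm (L t w) + norm (B t w)" unfolding Lv(2) by (rule norm_triangle_ineq4)
      also have "\<dots> \<le> C\<^sub>L * (D1 * norm (X b v)) + C\<^sub>B * (D2 * norm (X b v))"
      proof (rule add_mono)
        show "norm (L t w) \<le> C\<^sub>L * (D1 * norm (X b v))"
          using order.trans[OF L_bound[OF w(1)] mult_left_mono[OF _ C_nonneg(1)]] vm1(2) w(3) by simp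
        show "norm (B t w) \<le> C\<^sub>B * (D2 * norm (X b v))"
          using order.trans[OF Bw mult_left_mono[OF _ C_nonneg(2)]] v1(2) by (simp add: w_def)
      qed
      finally show ?thesis by (simp add: algebra_simps)
    qed
    have d: "v - P r v \<in> dm m" using csubspaceD(4)[OF dm_csubspace vm P_dm] .
    have e: "L\<^sub>N r t v - L t v = - P r (L t (v - P r v)) - (L t v - P r (L t v))"
      using L_diff[OF vm P_dm] clinear_onD(5)[OF P_linear] by (simp add: L\<^sub>N_def)
    have "norm (L\<^sub>N r t v - L t v) \<le> norm (P r (L t (v - P r v))) + norm (L t v - P r (L t v))"
      unfolding e using norm_triangle_ineq4[of "- P r (L t (v - P r v))" "L t v - P r (L t v)"]
      by (simp only: norm_minus_cancel)
    also have "norm (P r (L t (v - P r v))) \<le> C\<^sub>L * ((1 / r) * norm (X (real m + 1) v))"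
      using norm_P_le[of r "L t (v - P r v)"] L_bound[OF d, of t]
        mult_left_mono[OF P_diff_le[OF r vm1(1)] C_nonneg(1)] by linarith
    also have "norm (L t v - P r (L t v)) \<le> (1 / r) * norm (X 1 (L t v))"
      using P_diff_le[of r "L t v" 0] r Lv(1) by simp
    finally have "norm (L\<^sub>N r t v - L t v) \<le> (1 / r) * (C\<^sub>L * norm (X (real m + 1) v) + norm (X 1 (L t v)))"
      by (simp add: algebra_simps)
    also have "\<dots> \<le> (1 / r) * (C\<^sub>L * (D1 * norm (X b v)) + (C\<^sub>L * D1 + C\<^sub>B * D2) * norm (X b v))"
      using r C_nonneg by (intro mult_left_mono add_mono vm1(2) XL) auto
    also have "\<dots> = C / r * norm (X b v)" by (simp add: C_def algebra_simps add_divide_distrib)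
    finally show "norm (L\<^sub>N r t v - L t v) \<le> C / r * norm (X b v)" .
  qed
qed

definition C\<^sub>R :: real where
  "C\<^sub>R = (SOME C. 0 \<le> C \<and> (\<forall>r t v. 0 < r \<longrightarrow> v \<in> dm b \<longrightarrow> norm (L\<^sub>N r t v - L t v) \<le> C / r * norm (X b v)))"

lemma C\<^sub>R: "0 \<le> C\<^sub>R" "0 < r \<Longrightarrow> v \<in> dm b \<Longrightarrow> norm (L\<^sub>N r t v - L t v) \<le> C\<^sub>R / r * norm (X b v)"
proof -
  have "\<exists>C. 0 \<le> C \<and> (\<forall>r t v. 0 < r \<longrightarrow> v \<in> dm b \<longrightarrow> norm (L\<^sub>N r t v - L t v) \<le> C / r * norm (X b v))"
    using L\<^sub>N_rate by metis
  from someI_ex[OF this] show "0 \<le> C\<^sub>R" "0 < r \<Longrightarrow> v \<in> dm b \<Longrightarrow> norm (L\<^sub>N r t v - L t v) \<le> C\<^sub>R / r * norm (X b v)"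
    by (auto simp: C\<^sub>R_def)
qed

text \<open>The difference solves the equation cut off at r with a source, the difference of the two
  generators at S q x s u, which is small by the bound at level b. The generator itself drops out by
  symmetry.\<close>

lemma S_cauchy:
  assumes r: "0 < r" "0 < q" and u: "u \<in> dm b"
  shows "norm (S r t s u - S q t s u) \<le> C\<^sub>R * (1 / r + 1 / q) * exp ((\<kappa> + 1) * \<bar>t - s\<bar>) * norm (X b u)"
proof -
  define \<epsilon> where "\<epsilon> = C\<^sub>R * (1 / r + 1 / q) * exp (\<kappa> * \<bar>t - s\<bar>) * norm (X b u)"
  have e0: "0 \<le> \<epsilon>" using C\<^sub>R r by (simp add: \<epsilon>_def)
  define \<delta> where "\<delta> x = S r x s u - S q x s u" for x
  define \<delta>' where "\<delta>' x = - \<i> *\<^sub>C L\<^sub>N r x (\<delta> x) - \<i> *\<^sub>C (L\<^sub>N r x (S q x s u) - L\<^sub>N q x (S q x s u))" for x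
  have d: "(\<delta> has_vector_derivative \<delta>' x) (at x)" for x
  proof -
    have "(\<delta> has_vector_derivative (- \<i> *\<^sub>C L\<^sub>N r x (S r x s u) - - \<i> *\<^sub>C L\<^sub>N q x (S q x s u))) (at x)"
      unfolding \<delta>_def by (intro has_vector_derivative_diff S_deriv)
    moreover have "\<delta>' x = - \<i> *\<^sub>C L\<^sub>N r x (S r x s u) - - \<i> *\<^sub>C L\<^sub>N q x (S q x s u)"
      using clinear_onD(5)[OF L\<^sub>N_linear] by (simp add: \<delta>'_def \<delta>_def scaleC_diff_right scaleC_minus_left)
    ultimately show ?thesis by simp
  qed
  have bound: "\<bar>2 * Re (cinner (\<delta> x) (\<delta>' x))\<bar> \<le> 1 * (norm (\<delta> x))\<^sup>2 + \<epsilon>\<^sup>2" if x: "\<bar>x - s\<bar> \<le> \<bar>t - s\<bar>" for x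
  proof -
    define z where "z = L\<^sub>N r x (S q x s u) - L\<^sub>N q x (S q x s u)"
    have Sb: "S q x s u \<in> dm b" and Sn: "norm (X b (S q x s u)) \<le> exp (\<kappa> * \<bar>x - s\<bar>) * norm (X b u)"
      using S_level[of "Suc J" u q x s] u by auto
    have "exp (\<kappa> * \<bar>x - s\<bar>) * norm (X b u) \<le> exp (\<kappa> * \<bar>t - s\<bar>) * norm (X b u)"
      using x kappa(1) by (intro mult_right_mono) auto
    with Sn have Sn: "norm (X b (S q x s u)) \<le> exp (\<kappa> * \<bar>t - s\<bar>) * norm (X b u)" by linarith
    have "norm z \<le> norm (L\<^sub>N r x (S q x s u) - L x (S q x s u)) + norm (L\<^sub>N q x (S q x s u) - L x (S q x s u))"
    proof -
      have "z = (L\<^sub>N r x (S q x s u) - L x (S q x s u)) - (L\<^sub>N q x (S q x s u) - L x (S q x s u))"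
        by (simp add: z_def)
      then show ?thesis by (simp only: norm_triangle_ineq4)
    qed
    also have "\<dots> \<le> C\<^sub>R / r * norm (X b (S q x s u)) + C\<^sub>R / q * norm (X b (S q x s u))"
      by (intro add_mono C\<^sub>R r Sb)
    also have "\<dots> = C\<^sub>R * (1 / r + 1 / q) * norm (X b (S q x s u))" by (simp add: algebra_simps)
    also have "\<dots> \<le> C\<^sub>R * (1 / r + 1 / q) * (exp (\<kappa> * \<bar>t - s\<bar>) * norm (X b u))"
      using C\<^sub>R r by (intro mult_left_mono Sn) auto
    finally have z: "norm z \<le> \<epsilon>" by (simp add: \<epsilon>_def mult.assoc)
    have "Re (cinner (\<delta> x) (\<delta>' x)) = Re (cinner (\<delta> x) (- \<i> *\<^sub>C z))"
      using Re_cinner_L\<^sub>N[of "\<delta> x" r x] by (simp add: \<delta>'_def z_def[symmetric] cinner_diff_right scaleC_minus_left)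
    then have "\<bar>Re (cinner (\<delta> x) (\<delta>' x))\<bar> \<le> norm (\<delta> x) * norm z"
      using abs_Re_le_cmod[of "cinner (\<delta> x) (- \<i> *\<^sub>C z)"] cinner_le[of "\<delta> x" "- \<i> *\<^sub>C z"]
      by (simp add: norm_scaleC)
    also have "\<dots> \<le> norm (\<delta> x) * \<epsilon>" by (intro mult_left_mono z) simp
    finally show ?thesis using sum_squares_bound[of "norm (\<delta> x)" \<epsilon>] by simp
  qed
  \<comment> \<open>The rate 1 stems from 2 |\<delta>| \<epsilon> <= |\<delta>|^2 + \<epsilon>^2 and
    accounts for the \<kappa> + 1 in the result.\<close>
  have "(norm (\<delta> t))\<^sup>2 \<le> ((norm (\<delta> s))\<^sup>2 + \<epsilon>\<^sup>2 / 1) * exp (1 * \<bar>t - s\<bar>)"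
    by (rule gronwall[where f = "\<lambda>x. (norm (\<delta> x))\<^sup>2" and f' = "\<lambda>x. 2 * Re (cinner (\<delta> x) (\<delta>' x))"])
      (use bound norm_sq_has_derivative[OF d] in auto)
  also have "\<dots> = \<epsilon>\<^sup>2 * exp \<bar>t - s\<bar>" by (simp add: \<delta>_def S_start)
  \<comment> \<open>The exponential is at least 1, so squaring it only loosens the bound and permits
    taking roots.\<close>
  also have "\<dots> \<le> \<epsilon>\<^sup>2 * (exp \<bar>t - s\<bar>)\<^sup>2"
    by (intro mult_left_mono) (auto simp: exp_double[symmetric])
  also have "\<dots> = (\<epsilon> * exp \<bar>t - s\<bar>)\<^sup>2" by (simp add: power_mult_distrib)
  finally have "norm (\<delta> t) \<le> \<epsilon> * exp \<bar>t - s\<bar>" by (rule power2_le_imp_le) (use e0 in simp)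
  also have "\<dots> = C\<^sub>R * (1 / r + 1 / q) * exp ((\<kappa> + 1) * \<bar>t - s\<bar>) * norm (X b u)"
  proof -
    have "exp ((\<kappa> + 1) * \<bar>t - s\<bar>) = exp (\<kappa> * \<bar>t - s\<bar>) * exp \<bar>t - s\<bar>"
      by (simp add: distrib_right exp_add)
    then show ?thesis unfolding \<epsilon>_def by (simp only: mult_ac)
  qed
  finally show ?thesis by (simp add: \<delta>_def)
qed

end

context positive_pvm
begin

text \<open>In \<open>X_interpolation\<close> first take r so large that the term with X d is small,
  then \<delta> so small that the other term is.\<close>

lemma X_small:
  assumes a: "0 \<le> a" "a < d" and K: "0 \<le> K" and e: "0 < e"
  obtains \<delta> where "0 < \<delta>" "\<And>u. u \<in> dm d \<Longrightarrow> norm u < \<delta> \<Longrightarrow> norm (X d u) \<le> K \<Longrightarrow> norm (X a u) < e"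
proof -
  have "((\<lambda>r::real. r powr (2 * a - 2 * d) * K\<^sup>2) \<longlongrightarrow> 0 * K\<^sup>2) at_top"
    by (intro tendsto_mult tendsto_const tendsto_neg_powr filterlim_ident) (use a in auto)
  then have "\<forall>\<^sub>F r in at_top. (r::real) powr (2 * a - 2 * d) * K\<^sup>2 < e\<^sup>2 / 2"
    using e by (intro order_tendstoD(2)) auto
  then have "\<forall>\<^sub>F r in at_top. (r::real) powr (2 * a - 2 * d) * K\<^sup>2 < e\<^sup>2 / 2 \<and> 0 < r"
    using eventually_gt_at_top[of 0] by eventually_elim simp
  then obtain r :: real where r: "r powr (2 * a - 2 * d) * K\<^sup>2 < e\<^sup>2 / 2" "0 < r"
    using eventually_happens'[of "at_top :: real filter"] by auto
  define \<delta> where "\<delta> = sqrt (e\<^sup>2 / 2 / r powr (2 * a))"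
  have rp: "0 < r powr (2 * a)" using r(2) by simp
  have \<delta>2: "\<delta>\<^sup>2 = e\<^sup>2 / 2 / r powr (2 * a)" using rp by (simp add: \<delta>_def)
  show ?thesis
  proof (rule that[of \<delta>])
    show "0 < \<delta>" using e rp by (simp add: \<delta>_def)
    fix u assume u: "u \<in> dm d" "norm u < \<delta>" "norm (X d u) \<le> K"
    have "(norm u)\<^sup>2 \<le> \<delta>\<^sup>2" using u(2) by (intro power_mono) auto
    then have "r powr (2 * a) * (norm u)\<^sup>2 \<le> e\<^sup>2 / 2" using rp by (simp add: \<delta>2 field_simps)
    moreover have "(norm (X d u))\<^sup>2 \<le> K\<^sup>2" using u(3) by (intro power_mono) auto
    then have "r powr (2 * a - 2 * d) * (norm (X d u))\<^sup>2 \<le> r powr (2 * a - 2 * d) * K\<^sup>2"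
      by (intro mult_left_mono) auto
    ultimately have "(norm (X a u))\<^sup>2 < e\<^sup>2"
      using X_interpolation[OF a(1) less_imp_le[OF a(2)] u(1) r(2)] r(1) by linarith
    then show "norm (X a u) < e" using e by (simp add: power_less_imp_less_base)
  qed
qed

end

section \<open>The limit propagator\<close>

context evolution
begin

lemma S_convergent: "convergent (\<lambda>N. S (real (Suc N)) t s u)"
proof -
  define G where "G v = C\<^sub>R * exp ((\<kappa> + 1) * \<bar>t - s\<bar>) * norm (X b v)" for v
  have G: "0 \<le> G v" for v using C\<^sub>R by (simp add: G_def)
  have "Cauchy (\<lambda>N. S (real (Suc N)) t s u)"
  proof (rule metric_CauchyI)
    fix e :: real assume e: "0 < e"
    obtain v where v: "v \<in> dm b" "norm (u - v) < e / 4"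
    proof -
      have "u \<in> closure (dm b)" by (simp add: dm_dense)
      then obtain v where "v \<in> dm b" "dist v u < e / 4" using e closure_approachable by (metis divide_pos_pos zero_less_numeral)
      then show ?thesis using that by (simp add: dist_norm norm_minus_commute)
    qed
    obtain M :: nat where M: "4 * (G v + 1) / e < real M" using reals_Archimedean2 by blast
    have M1: "G v * (1 / real (Suc i)) \<le> e / 4" if "M \<le> i" for i
    proof -
      have "4 * (G v + 1) / e < real (Suc i)" using M that by linarith
      then have "4 * (G v + 1) < real (Suc i) * e" using e by (simp add: pos_divide_less_eq)
      then show ?thesis by (simp add: field_simps)
    qed
    show "\<exists>M. \<forall>i\<ge>M. \<forall>j\<ge>M. dist (S (real (Suc i)) t s u) (S (real (Suc j)) t s u) < e"
    proof (intro exI allI impI)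
      fix i j assume ij: "M \<le> i" "M \<le> j"
      have "S (real (Suc i)) t s u - S (real (Suc j)) t s u
        = S (real (Suc i)) t s (u - v) - S (real (Suc j)) t s (u - v) + (S (real (Suc i)) t s v - S (real (Suc j)) t s v)"
        by (simp add: S_diff)
      then have "norm (S (real (Suc i)) t s u - S (real (Suc j)) t s u)
        \<le> norm (S (real (Suc i)) t s (u - v) - S (real (Suc j)) t s (u - v)) + norm (S (real (Suc i)) t s v - S (real (Suc j)) t s v)"
        by (simp only: norm_triangle_ineq)
      also have "norm (S (real (Suc i)) t s (u - v) - S (real (Suc j)) t s (u - v)) \<le> norm (u - v) + norm (u - v)"
        using norm_triangle_ineq4[of "S (real (Suc i)) t s (u - v)" "S (real (Suc j)) t s (u - v)"]
        by (simp only: norm_S)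
      also have "norm (S (real (Suc i)) t s v - S (real (Suc j)) t s v) \<le> G v * (1 / real (Suc i)) + G v * (1 / real (Suc j))"
        using S_cauchy[of "real (Suc i)" "real (Suc j)" v t s] v(1) by (simp add: G_def algebra_simps)
      finally show "dist (S (real (Suc i)) t s u) (S (real (Suc j)) t s u) < e"
        using v(2) M1[OF ij(1)] M1[OF ij(2)] unfolding dist_norm by linarith
    qed
  qed
  then show ?thesis by (simp add: Cauchy_convergent_iff)
qed

text \<open>The cutoffs start at 1, because the rate estimates divide by them.\<close>

definition W :: "real \<Rightarrow> real \<Rightarrow> 'h \<Rightarrow> 'h" where
  "W t s u = lim (\<lambda>N. S (real (Suc N)) t s u)"

lemma S_tendsto: "(\<lambda>N. S (real (Suc N)) t s u) \<longlonglongrightarrow> W t s u"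
  using S_convergent convergent_LIMSEQ_iff unfolding W_def by blast

lemma W_linear: "clinear_on UNIV (W t s)"
proof (rule clinear_onI)
  show "W t s (x + y) = W t s x + W t s y" for x y
  proof (rule LIMSEQ_unique[OF S_tendsto])
    have "S r t s (x + y) = S r t s x + S r t s y" for r by (rule clinear_onD(2)[OF S_linear]) auto
    then show "(\<lambda>N. S (real (Suc N)) t s (x + y)) \<longlonglongrightarrow> W t s x + W t s y"
      using tendsto_add[OF S_tendsto[of t s x] S_tendsto[of t s y]] by simp
  qed
  show "W t s (a *\<^sub>C x) = a *\<^sub>C W t s x" for a x
  proof (rule LIMSEQ_unique[OF S_tendsto])
    have "S r t s (a *\<^sub>C x) = a *\<^sub>C S r t s x" for r by (rule clinear_onD(3)[OF S_linear]) auto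
    then show "(\<lambda>N. S (real (Suc N)) t s (a *\<^sub>C x)) \<longlonglongrightarrow> a *\<^sub>C W t s x"
      using tendsto_scaleC[OF S_tendsto[of t s x], of a] by simp
  qed
qed simp

lemma W_diff: "W t s (u - v) = W t s u - W t s v"
  and W_add: "W t s (u + v) = W t s u + W t s v"
  by (rule clinear_onD[OF W_linear]; simp)+

lemma norm_W: "norm (W t s u) = norm u"
  using tendsto_norm[OF S_tendsto[of t s u]] by (simp add: norm_S LIMSEQ_const_iff)

lemma W_start: "W s s u = u"
  using S_tendsto[of s s u] by (simp add: S_start LIMSEQ_const_iff)

lemma W_group: "W t q (W q s u) = W t s u"
proof (rule LIMSEQ_unique[OF _ S_tendsto])
  \<comment> \<open>The inner vector moves with N as well; as S is isometric, the resulting error is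
    the distance of that vector from its limit.\<close>
  have "(\<lambda>N. S (real (Suc N)) t q (W q s u) + S (real (Suc N)) t q (S (real (Suc N)) q s u - W q s u))
      \<longlonglongrightarrow> W t q (W q s u) + 0"
  proof (rule tendsto_add[OF S_tendsto])
    have "(\<lambda>N. norm (S (real (Suc N)) q s u - W q s u)) \<longlonglongrightarrow> 0"
      using S_tendsto[of q s u] by (simp add: LIM_zero tendsto_norm_zero)
    then show "(\<lambda>N. S (real (Suc N)) t q (S (real (Suc N)) q s u - W q s u)) \<longlonglongrightarrow> 0"
      by - (rule tendsto_norm_zero_cancel, simp only: norm_S)
  qed
  then show "(\<lambda>N. S (real (Suc N)) t s u) \<longlonglongrightarrow> W t q (W q s u)"
    by (simp add: S_diff S_group)
qed

text \<open>Norm preservation gives real parts by polarization and imaginary parts through i v; W s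
  t is the inverse.\<close>

lemma W_unitary: "unitary (W t s)"
proof -
  have inn: "cinner (W t s u) (W t s v) = cinner u v" for u v
  proof -
    have "clinear_on UNIV (\<lambda>v. W t s v)" by (rule W_linear)
    have re: "Re (cinner (W t s u) (W t s v)) = Re (cinner u v)" for u v
      using norm_sq_add[of "W t s u" "W t s v"] norm_sq_add[of u v] norm_W[of t s "u + v"]
      by (simp add: W_add norm_W)
    have "Re (cinner (W t s u) (W t s (\<i> *\<^sub>C v))) = Re (cinner u (\<i> *\<^sub>C v))" by (rule re)
    then have "Im (cinner (W t s u) (W t s v)) = Im (cinner u v)"
      using clinear_onD(3)[OF W_linear, of v t s "\<i>"] by (simp add: cinner_scaleC_right)
    with re show ?thesis by (simp add: complex_eq_iff)
  qed
  moreover have "surj (W t s)"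
    by (rule surjI[of _ "W s t"]) (simp add: W_group W_start)
  ultimately show ?thesis using W_linear by (simp add: unitary_def)
qed

lemma S_rate:
  assumes u: "u \<in> dm b"
  shows "norm (S (real (Suc N)) t s u - W t s u)
    \<le> C\<^sub>R * (1 / real (Suc N)) * exp ((\<kappa> + 1) * \<bar>t - s\<bar>) * norm (X b u)"
proof (rule LIMSEQ_le)
  show "(\<lambda>M. norm (S (real (Suc N)) t s u - S (real (Suc M)) t s u)) \<longlonglongrightarrow> norm (S (real (Suc N)) t s u - W t s u)"
    by (intro tendsto_intros S_tendsto)
  have "(\<lambda>M. C\<^sub>R * (1 / real (Suc N) + 1 / real (Suc M)) * exp ((\<kappa> + 1) * \<bar>t - s\<bar>) * norm (X b u))
    \<longlonglongrightarrow> C\<^sub>R * (1 / real (Suc N) + 0) * exp ((\<kappa> + 1) * \<bar>t - s\<bar>) * norm (X b u)"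
    by (intro tendsto_intros LIMSEQ_Suc[OF lim_1_over_n])
  then show "(\<lambda>M. C\<^sub>R * (1 / real (Suc N) + 1 / real (Suc M)) * exp ((\<kappa> + 1) * \<bar>t - s\<bar>) * norm (X b u))
    \<longlonglongrightarrow> C\<^sub>R * (1 / real (Suc N)) * exp ((\<kappa> + 1) * \<bar>t - s\<bar>) * norm (X b u)" by simp
  show "\<exists>M. \<forall>n\<ge>M. norm (S (real (Suc N)) t s u - S (real (Suc n)) t s u)
      \<le> C\<^sub>R * (1 / real (Suc N) + 1 / real (Suc n)) * exp ((\<kappa> + 1) * \<bar>t - s\<bar>) * norm (X b u)"
    using S_cauchy[OF _ _ u] by (auto simp del: of_nat_Suc)
qed

text \<open>Convergence holds only in the base norm, where X b is not continuous. X b P n is, so the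
  bound passes to the limit for each n, and \<open>dm_of_bounded\<close> removes P n.\<close>

lemma W_level_b:
  assumes u: "u \<in> dm b"
  shows "W t s u \<in> dm b" "norm (X b (W t s u)) \<le> exp (\<kappa> * \<bar>t - s\<bar>) * norm (X b u)"
proof -
  have "norm (X b (P (real n) (W t s u))) \<le> exp (\<kappa> * \<bar>t - s\<bar>) * norm (X b u)" for n
  proof (rule LIMSEQ_le_const2)
    show "(\<lambda>N. norm (X b (P (real n) (S (real (Suc N)) t s u)))) \<longlonglongrightarrow> norm (X b (P (real n) (W t s u)))"
      by (intro tendsto_norm bounded_linear.tendsto[OF XP_bounded_linear] S_tendsto)
    have "norm (X b (P (real n) (S (real (Suc N)) t s u))) \<le> exp (\<kappa> * \<bar>t - s\<bar>) * norm (X b u)" for N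
      using S_level[of "Suc J" u "real (Suc N)" t s] u P_X(2)[of "S (real (Suc N)) t s u" b "real n"]
        norm_P_le[of "real n" "X b (S (real (Suc N)) t s u)"] by simp
    then show "\<exists>M. \<forall>N\<ge>M. norm (X b (P (real n) (S (real (Suc N)) t s u))) \<le> exp (\<kappa> * \<bar>t - s\<bar>) * norm (X b u)"
      by blast
  qed
  from dm_of_bounded[OF this] show "W t s u \<in> dm b" "norm (X b (W t s u)) \<le> exp (\<kappa> * \<bar>t - s\<bar>) * norm (X b u)"
    by auto
qed

text \<open>Interpolation between the isometry at level 0 and the bound at level b; the factor 2 is
  that of \<open>operator_interpolation\<close>, which demands a > 0.\<close>

lemma W_level:
  assumes a: "0 \<le> a" "a < b" and u: "u \<in> dm a"
  shows "W t s u \<in> dm a" "norm (X a (W t s u)) \<le> 2 * exp (\<kappa> * \<bar>t - s\<bar>) * norm (X a u)"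
proof -
  have e1: "1 \<le> exp (\<kappa> * \<bar>t - s\<bar>)" using kappa(1) by simp
  have bd: "norm v \<le> exp (\<kappa> * \<bar>t - s\<bar>) * norm v" for v :: 'h
    using mult_right_mono[OF e1 norm_ge_zero[of v]] by simp
  have "W t s u \<in> dm a \<and> norm (X a (W t s u)) \<le> 2 * exp (\<kappa> * \<bar>t - s\<bar>) * norm (X a u)"
  proof (cases "a = 0")
    case True
    have "norm u \<le> 2 * exp (\<kappa> * \<bar>t - s\<bar>) * norm u"
      using bd[of u] norm_ge_zero[of u] unfolding mult.assoc by linarith
    then show ?thesis using True by (simp add: norm_W)
  next
    case False
    then show ?thesis
      using operator_interpolation[of "W t s" "exp (\<kappa> * \<bar>t - s\<bar>)" b a u] W_level_b[of _ t s] W_add bd a u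
      by (simp add: norm_W)
  qed
  then show "W t s u \<in> dm a" "norm (X a (W t s u)) \<le> 2 * exp (\<kappa> * \<bar>t - s\<bar>) * norm (X a u)" by auto
qed

section \<open>Strong continuity on the scale\<close>

definition C\<^sub>W :: real where "C\<^sub>W = C\<^sub>L * c powr (real m - b)"

lemma C\<^sub>W: "0 \<le> C\<^sub>W" "v \<in> dm b \<Longrightarrow> C\<^sub>L * norm (X m v) \<le> C\<^sub>W * norm (X b v)"
  using C_nonneg dm_mono(2)[of "real m" b v] mJ
  by (auto simp: C\<^sub>W_def mult.assoc intro!: mult_left_mono)

lemma dm_b_m: "v \<in> dm b \<Longrightarrow> v \<in> dm m"
  using dm_le[of v b "real m"] mJ by simp

text \<open>From level b to the base space the generator is bounded by \<open>C\<^sub>W\<close>. The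
  estimate is made for S, whose derivative is known, and passed to the limit.\<close>

lemma W_lipschitz:
  assumes u: "u \<in> dm b"
  shows "norm (W t s u - u) \<le> C\<^sub>W * exp (\<kappa> * \<bar>t - s\<bar>) * norm (X b u) * \<bar>t - s\<bar>"
proof (rule LIMSEQ_le_const2)
  show "(\<lambda>N. norm (S (real (Suc N)) t s u - u)) \<longlonglongrightarrow> norm (W t s u - u)"
    by (intro tendsto_intros S_tendsto)
  have "norm (S r t s u - S r s s u) \<le> C\<^sub>W * exp (\<kappa> * \<bar>t - s\<bar>) * norm (X b u) * \<bar>t - s\<bar>" for r
  proof (rule vector_derivative_bound[OF S_deriv])
    fix x assume "x \<in> closed_segment s t"
    then have x: "\<bar>x - s\<bar> \<le> \<bar>t - s\<bar>" by (auto simp: closed_segment_eq_real_ivl split: if_splits)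
    define v where "v = S r x s u"
    have v: "v \<in> dm b" "norm (X b v) \<le> exp (\<kappa> * \<bar>x - s\<bar>) * norm (X b u)"
      using S_level[of "Suc J" u r x s] u by (auto simp: v_def)
    have "norm (- \<i> *\<^sub>C L\<^sub>N r x v) \<le> norm (L x (P r v))" using norm_P_le by (simp add: norm_scaleC L\<^sub>N_def)
    also have "\<dots> \<le> C\<^sub>L * norm (X m (P r v))" by (rule L_bound) simp
    also have "\<dots> \<le> C\<^sub>L * norm (X m v)"
      using P_X(2)[OF dm_b_m[OF v(1)], of r] norm_P_le[of r "X m v"] C_nonneg by (intro mult_left_mono) auto
    also have "\<dots> \<le> C\<^sub>W * norm (X b v)" by (rule C\<^sub>W(2)[OF v(1)])
    also have "\<dots> \<le> C\<^sub>W * (exp (\<kappa> * \<bar>x - s\<bar>) * norm (X b u))" by (intro mult_left_mono v C\<^sub>W)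
    also have "\<dots> \<le> C\<^sub>W * (exp (\<kappa> * \<bar>t - s\<bar>) * norm (X b u))"
      using x kappa(1) C\<^sub>W(1) by (intro mult_left_mono mult_right_mono) auto
    finally show "norm (- \<i> *\<^sub>C L\<^sub>N r x (S r x s u)) \<le> C\<^sub>W * exp (\<kappa> * \<bar>t - s\<bar>) * norm (X b u)"
      by (simp add: v_def mult.assoc)
  qed
  then show "\<exists>M. \<forall>N\<ge>M. norm (S (real (Suc N)) t s u - u) \<le> C\<^sub>W * exp (\<kappa> * \<bar>t - s\<bar>) * norm (X b u) * \<bar>t - s\<bar>"
    by (simp add: S_start)
qed

text \<open>A Lipschitz bound in the base norm together with a bound at level b gives continuity at
  every level below b, by \<open>X_small\<close>.\<close>

lemma X_W_continuous_b:
  assumes a: "0 \<le> a" "a < b" and u: "u \<in> dm b"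
  shows "((\<lambda>y. X a (W (fst y) (snd y) u)) \<longlongrightarrow> X a (W (fst x) (snd x) u)) (at x)"
proof (rule LIM_zero_cancel, rule tendstoI)
  fix e :: real assume e: "0 < e"
  define k where "k y = exp (\<kappa> * \<bar>fst y - snd y\<bar>)" for y :: "real \<times> real"
  \<comment> \<open>Near x the growth factor stays below k x + 1, so this bounds X b of the
    difference of the two orbits.\<close>
  define Kb where "Kb = (k x + 1 + k x) * norm (X b u)"
  have Kb: "0 \<le> Kb" by (simp add: Kb_def k_def)
  obtain \<delta> where \<delta>: "0 < \<delta>" "\<And>v. v \<in> dm b \<Longrightarrow> norm v < \<delta> \<Longrightarrow> norm (X b v) \<le> Kb \<Longrightarrow> norm (X a v) < e"
    using X_small[OF a Kb e] by metis
  \<comment> \<open>Bounds the base norm of the difference by moving the two time arguments one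
    after the other; it vanishes at x.\<close>
  define F where "F y = C\<^sub>W * exp (\<kappa> * \<bar>fst y - fst x\<bar>) * (exp (\<kappa> * \<bar>fst x - snd y\<bar>) * norm (X b u)) * \<bar>fst y - fst x\<bar>
      + C\<^sub>W * exp (\<kappa> * \<bar>snd x - snd y\<bar>) * norm (X b u) * \<bar>snd x - snd y\<bar>" for y
  have "(F \<longlongrightarrow> C\<^sub>W * exp (\<kappa> * \<bar>fst x - fst x\<bar>) * (exp (\<kappa> * \<bar>fst x - snd x\<bar>) * norm (X b u)) * \<bar>fst x - fst x\<bar>
      + C\<^sub>W * exp (\<kappa> * \<bar>snd x - snd x\<bar>) * norm (X b u) * \<bar>snd x - snd x\<bar>) (at x)"
    unfolding F_def by (intro tendsto_intros)
  then have "(F \<longlongrightarrow> 0) (at x)" by simp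
  then have "\<forall>\<^sub>F y in at x. F y < \<delta>" by (rule order_tendstoD) (rule \<delta>)
  moreover have "(k \<longlongrightarrow> k x) (at x)" unfolding k_def by (intro tendsto_intros)
  then have "\<forall>\<^sub>F y in at x. k y < k x + 1" by (rule order_tendstoD) simp
  ultimately show "\<forall>\<^sub>F y in at x. dist (X a (W (fst y) (snd y) u) - X a (W (fst x) (snd x) u)) 0 < e"
  proof eventually_elim
    case (elim y)
    obtain t s where y: "y = (t, s)" by (cases y)
    obtain t' s' where x: "x = (t', s')" by (cases x)
    define d where "d = W t s u - W t' s' u"
    note lb = W_level_b[OF u]
    have d: "d \<in> dm b" unfolding d_def by (rule csubspaceD(4)[OF dm_csubspace lb(1) lb(1)])
    have "d = (W t t' (W t' s u) - W t' s u) + W t' s (u - W s s' u)"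
      by (simp add: d_def W_group W_diff)
    then have "norm d \<le> norm (W t t' (W t' s u) - W t' s u) + norm (u - W s s' u)"
      using norm_triangle_ineq[of "W t t' (W t' s u) - W t' s u" "W t' s (u - W s s' u)"] by (simp only: norm_W)
    also have "norm (u - W s s' u) = norm (W s' s u - u)"
    proof -
      have "W s' s (u - W s s' u) = W s' s u - u" by (simp add: W_diff W_group W_start)
      then show ?thesis by (metis norm_W)
    qed
    also have "norm (W t t' (W t' s u) - W t' s u) \<le> C\<^sub>W * exp (\<kappa> * \<bar>t - t'\<bar>) * norm (X b (W t' s u)) * \<bar>t - t'\<bar>"
      by (rule W_lipschitz[OF lb(1)])
    also have "\<dots> \<le> C\<^sub>W * exp (\<kappa> * \<bar>t - t'\<bar>) * (exp (\<kappa> * \<bar>t' - s\<bar>) * norm (X b u)) * \<bar>t - t'\<bar>"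
      by (intro mult_right_mono mult_left_mono lb(2)) (auto simp: C\<^sub>W(1))
    also have "norm (W s' s u - u) \<le> C\<^sub>W * exp (\<kappa> * \<bar>s' - s\<bar>) * norm (X b u) * \<bar>s' - s\<bar>"
      by (rule W_lipschitz[OF u])
    finally have "norm d \<le> F y" by (simp add: F_def x y)
    then have "norm d < \<delta>" using elim(1) by simp
    moreover have "norm (X b d) \<le> Kb"
    proof -
      have "norm (X b d) \<le> norm (X b (W t s u)) + norm (X b (W t' s' u))"
        unfolding d_def X_lin(2)[OF lb(1) lb(1)] by (rule norm_triangle_ineq4)
      also have "\<dots> \<le> k y * norm (X b u) + k x * norm (X b u)"
        using lb(2)[of t s] lb(2)[of t' s'] by (simp add: k_def x y)
      also have "\<dots> \<le> (k x + 1) * norm (X b u) + k x * norm (X b u)"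
        using elim(2) by (intro add_mono mult_right_mono) auto
      finally show ?thesis by (simp add: Kb_def distrib_right)
    qed
    ultimately have "norm (X a d) < e" using \<delta>(2) d by blast
    moreover have "X a d = X a (W t s u) - X a (W t' s' u)"
      unfolding d_def using a by (intro X_lin(2) dm_le[OF lb(1)]) auto
    ultimately show ?case by (simp add: x y)
  qed
qed

text \<open>Truncated vectors P n u approximate u at level a, and W is locally uniformly bounded
  there: a three-epsilon argument.\<close>

lemma X_W_continuous:
  assumes a: "0 \<le> a" "a < b" and u: "u \<in> dm a"
  shows "((\<lambda>y. X a (W (fst y) (snd y) u)) \<longlongrightarrow> X a (W (fst x) (snd x) u)) (at x)"
proof (rule LIM_zero_cancel, rule tendstoI)
  fix e :: real assume e: "0 < e"
  define k where "k y = exp (\<kappa> * \<bar>fst y - snd y\<bar>)" for y :: "real \<times> real"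
  have kp: "0 < k x" by (simp add: k_def)
  \<comment> \<open>Makes 2 (k x + 1) q equal to e / 3, the share allotted to each replacement of u
    by v.\<close>
  define q where "q = e / 3 / (2 * (k x + 1))"
  have q: "0 < q" using e kp by (simp add: q_def)
  obtain n where n: "norm (X a (P (real n) u) - X a u) < q"
    using LIMSEQ_D[OF X_P_tendsto[OF u] q] by blast
  define v where "v = P (real n) u"
  have v: "v \<in> dm b" "v \<in> dm a" by (simp_all add: v_def)
  have uv: "u - v \<in> dm a" using csubspaceD(4)[OF dm_csubspace u v(2)] .
  have Xuv: "norm (X a (u - v)) < q" unfolding X_lin(2)[OF u v(2)] using n by (simp add: v_def norm_minus_commute)
  have est: "norm (X a (W t s u) - X a (W t s v)) \<le> 2 * exp (\<kappa> * \<bar>t - s\<bar>) * norm (X a (u - v))" for t s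
    using W_level[OF a uv, of t s] X_lin(2)[OF W_level(1)[OF a u] W_level(1)[OF a v(2)], of t s t s]
    by (simp add: W_diff)
  have small: "norm (X a (W (fst y) (snd y) u) - X a (W (fst y) (snd y) v)) < e / 3" if "k y < k x + 1" for y
  proof -
    have "2 * k y * norm (X a (u - v)) \<le> 2 * (k x + 1) * norm (X a (u - v))"
      using that by (intro mult_right_mono) auto
    also have "\<dots> < 2 * (k x + 1) * q" using Xuv kp by (intro mult_strict_left_mono) auto
    also have "\<dots> = e / 3"
    proof -
      have "0 < 6 * k x + 6" using kp by simp
      then show ?thesis by (simp add: q_def field_simps)
    qed
    finally show ?thesis using est[of "fst y" "snd y"] by (simp add: k_def)
  qed
  have "(k \<longlongrightarrow> k x) (at x)" unfolding k_def by (intro tendsto_intros)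
  then have "\<forall>\<^sub>F y in at x. k y < k x + 1" by (rule order_tendstoD) simp
  moreover have "\<forall>\<^sub>F y in at x. dist (X a (W (fst y) (snd y) v)) (X a (W (fst x) (snd x) v)) < e / 3"
    using X_W_continuous_b[OF a v(1)] e by (intro tendstoD) auto
  ultimately show "\<forall>\<^sub>F y in at x. dist (X a (W (fst y) (snd y) u) - X a (W (fst x) (snd x) u)) 0 < e"
  proof eventually_elim
    case (elim y)
    have tri: "norm (p - r) \<le> norm (p - p') + norm (p' - r') + norm (r - r')" for p p' r r' :: 'h
    proof -
      have "p - r = (p - p') + (p' - r') - (r - r')" by simp
      then have "norm (p - r) \<le> norm ((p - p') + (p' - r')) + norm (r - r')" by (metis norm_triangle_ineq4)
      also have "norm ((p - p') + (p' - r')) \<le> norm (p - p') + norm (p' - r')" by (rule norm_triangle_ineq)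
      finally show ?thesis by simp
    qed
    show ?case
      using tri[of "X a (W (fst y) (snd y) u)" "X a (W (fst x) (snd x) u)" "X a (W (fst y) (snd y) v)" "X a (W (fst x) (snd x) v)"]
        small[OF elim(1)] small[of x] elim(2) by (simp add: dist_norm)
  qed
qed

section \<open>Differentiability in time and uniqueness\<close>

lemma W_deriv_b:
  assumes u: "u \<in> dm b"
  shows "((\<lambda>t. W t s u) has_vector_derivative - \<i> *\<^sub>C L t (W t s u)) (at t)"
proof -
  define T where "T = {t - 1<..<t + 1}"
  define k where "k = \<bar>t - s\<bar> + 1"
  have k: "\<bar>x - s\<bar> \<le> k" if "x \<in> T" for x using that by (auto simp: T_def k_def)
  define Kb where "Kb = exp (\<kappa> * k) * norm (X b u)"
  define G where "G = C\<^sub>R * exp ((\<kappa> + 1) * k) * norm (X b u)"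
  have Kb: "0 \<le> Kb" and G: "0 \<le> G" using C\<^sub>R by (simp_all add: Kb_def G_def)
  have Sb: "S r x s u \<in> dm b" "norm (X b (S r x s u)) \<le> Kb" if "x \<in> T" for r x
  proof -
    show "S r x s u \<in> dm b" using S_level(1)[of "Suc J" u r x s] u by simp
    have "exp (\<kappa> * \<bar>x - s\<bar>) * norm (X b u) \<le> Kb"
      unfolding Kb_def using k[OF that] kappa(1) by (intro mult_right_mono) auto
    then show "norm (X b (S r x s u)) \<le> Kb" using S_level(2)[of "Suc J" u r x s] u by simp
  qed
  have Wb: "W x s u \<in> dm b" "norm (X b (W x s u)) \<le> Kb" if "x \<in> T" for x
  proof -
    show "W x s u \<in> dm b" using W_level_b(1)[OF u] .
    have "exp (\<kappa> * \<bar>x - s\<bar>) * norm (X b u) \<le> Kb"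
      unfolding Kb_def using k[OF that] kappa(1) by (intro mult_right_mono) auto
    then show "norm (X b (W x s u)) \<le> Kb" using W_level_b(2)[OF u, of x s] by simp
  qed
  have rate: "norm (S (real (Suc N)) x s u - W x s u) \<le> G * (1 / real (Suc N))" if "x \<in> T" for N x
  proof -
    have "C\<^sub>R * (1 / real (Suc N)) * exp ((\<kappa> + 1) * \<bar>x - s\<bar>) * norm (X b u)
        \<le> C\<^sub>R * (1 / real (Suc N)) * exp ((\<kappa> + 1) * k) * norm (X b u)"
      using k[OF that] kappa(1) C\<^sub>R(1) by (intro mult_right_mono mult_left_mono) auto
    then show ?thesis using S_rate[OF u, of N x s] by (simp add: G_def mult_ac)
  qed
  \<comment> \<open>Differentiation passes to the limit if the derivatives converge uniformly near
    t. The cutoff error is O(1/N) at level b, and L S - L W is small because S tends to W even at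
    level m.\<close>
  have unif: "\<forall>\<^sub>F N in sequentially. \<forall>x\<in>T. norm (L\<^sub>N (real (Suc N)) x (S (real (Suc N)) x s u) - L x (W x s u)) \<le> e"
    if e: "0 < e" for e
  proof -
    \<comment> \<open>Makes \<open>(C\<^sub>L + 1) * q\<close> equal to e / 2; the summand 1 avoids
      division by 0.\<close>
    define q where "q = e / 2 / (C\<^sub>L + 1)"
    have q: "0 < q" using e C_nonneg by (simp add: q_def)
    have mb: "0 \<le> real m" "real m < b" using mJ by auto
    have K2: "0 \<le> Kb + Kb" using Kb by simp
    obtain \<delta> where \<delta>: "0 < \<delta>" "\<And>v. v \<in> dm b \<Longrightarrow> norm v < \<delta> \<Longrightarrow> norm (X b v) \<le> Kb + Kb \<Longrightarrow> norm (X m v) < q"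
      using X_small[OF mb K2 q] by metis
    have l0: "(\<lambda>N. a * (1 / real (Suc N))) \<longlonglongrightarrow> 0" for a
      using tendsto_mult[OF tendsto_const[of a] LIMSEQ_Suc[OF lim_1_over_n]] by simp
    have "\<forall>\<^sub>F N in sequentially. G * (1 / real (Suc N)) < \<delta>" by (rule order_tendstoD(2)[OF l0 \<delta>(1)])
    moreover have "\<forall>\<^sub>F N in sequentially. (C\<^sub>R * Kb) * (1 / real (Suc N)) < e / 2"
      by (rule order_tendstoD(2)[OF l0]) (use e in simp)
    ultimately show ?thesis
    proof eventually_elim
      case (elim N)
      show ?case
      proof
        fix x assume x: "x \<in> T"
        define v where "v = S (real (Suc N)) x s u"
        define w where "w = W x s u"
        have v: "v \<in> dm b" "norm (X b v) \<le> Kb" and w: "w \<in> dm b" "norm (X b w) \<le> Kb"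
          using Sb[OF x] Wb[OF x] by (simp_all add: v_def w_def)
        have vw: "v - w \<in> dm b" using csubspaceD(4)[OF dm_csubspace v(1) w(1)] .
        have "norm (v - w) < \<delta>" using rate[OF x, of N] elim(1) by (simp add: v_def w_def)
        moreover have "norm (X b (v - w)) \<le> Kb + Kb"
          using X_lin(2)[OF v(1) w(1)] norm_triangle_ineq4[of "X b v" "X b w"] v(2) w(2) by simp
        ultimately have Xm: "norm (X m (v - w)) < q" using \<delta>(2)[OF vw] by simp
        have "norm (L x v - L x w) \<le> C\<^sub>L * norm (X m (v - w))"
          using L_bound[OF dm_b_m[OF vw], of x] L_diff[OF dm_b_m[OF v(1)] dm_b_m[OF w(1)]] by simp
        also have "\<dots> \<le> (C\<^sub>L + 1) * q" using Xm C_nonneg by (intro mult_mono) auto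
        also have "\<dots> = e / 2"
        proof -
          have "0 < 2 * C\<^sub>L + 2" using C_nonneg by linarith
          then show ?thesis by (simp add: q_def field_simps)
        qed
        finally have 1: "norm (L x v - L x w) \<le> e / 2" .
        have "norm (L\<^sub>N (real (Suc N)) x v - L x v) \<le> C\<^sub>R / real (Suc N) * norm (X b v)"
          by (rule C\<^sub>R(2)[OF _ v(1)]) simp
        also have "\<dots> \<le> C\<^sub>R / real (Suc N) * Kb" using C\<^sub>R(1) v(2) by (intro mult_left_mono) auto
        also have "\<dots> \<le> e / 2" using elim(2) by simp
        finally have 2: "norm (L\<^sub>N (real (Suc N)) x v - L x v) \<le> e / 2" .
        have "norm (L\<^sub>N (real (Suc N)) x v - L x w) \<le> norm (L\<^sub>N (real (Suc N)) x v - L x v) + norm (L x v - L x w)"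
          using norm_triangle_ineq[of "L\<^sub>N (real (Suc N)) x v - L x v" "L x v - L x w"] by simp
        then show "norm (L\<^sub>N (real (Suc N)) x (S (real (Suc N)) x s u) - L x (W x s u)) \<le> e"
          using 1 2 by (simp add: v_def w_def)
      qed
    qed
  qed
  have "\<exists>g. \<forall>x\<in>T. (\<lambda>N. S (real (Suc N)) x s u) \<longlonglongrightarrow> g x \<and>
      (g has_derivative (\<lambda>h. h *\<^sub>R (- \<i> *\<^sub>C L x (W x s u)))) (at x within T)"
  proof (rule has_derivative_sequence[where ?x0.0 = t and l = "W t s u"])
    show "((\<lambda>x. S (real (Suc N)) x s u) has_derivative
        (\<lambda>h. h *\<^sub>R (- \<i> *\<^sub>C L\<^sub>N (real (Suc N)) x (S (real (Suc N)) x s u)))) (at x within T)" for N x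
      using S_deriv[of "real (Suc N)" s u x] unfolding has_vector_derivative_def by (rule has_derivative_at_withinI)
    show "\<forall>\<^sub>F N in sequentially. \<forall>x\<in>T. \<forall>h. norm (h *\<^sub>R (- \<i> *\<^sub>C L\<^sub>N (real (Suc N)) x (S (real (Suc N)) x s u))
        - h *\<^sub>R (- \<i> *\<^sub>C L x (W x s u))) \<le> e * norm h" if "0 < e" for e
      using unif[OF that]
    proof eventually_elim
      case (elim N)
      show ?case
      proof (intro ballI allI)
        fix x h assume "x \<in> T"
        have "norm (h *\<^sub>R (- \<i> *\<^sub>C L\<^sub>N (real (Suc N)) x (S (real (Suc N)) x s u)) - h *\<^sub>R (- \<i> *\<^sub>C L x (W x s u)))
          = \<bar>h\<bar> * norm (L\<^sub>N (real (Suc N)) x (S (real (Suc N)) x s u) - L x (W x s u))"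
          unfolding scaleR_diff_right[symmetric] scaleC_diff_right[symmetric] by (simp add: norm_scaleC)
        also have "\<dots> \<le> \<bar>h\<bar> * e" using elim \<open>x \<in> T\<close> by (intro mult_left_mono) auto
        finally show "norm (h *\<^sub>R (- \<i> *\<^sub>C L\<^sub>N (real (Suc N)) x (S (real (Suc N)) x s u)) - h *\<^sub>R (- \<i> *\<^sub>C L x (W x s u))) \<le> e * norm h"
          by (simp add: mult.commute)
      qed
    qed
  qed (use S_tendsto in \<open>auto simp: T_def simp del: of_nat_Suc\<close>)
  then obtain g where g: "\<And>x. x \<in> T \<Longrightarrow> (\<lambda>N. S (real (Suc N)) x s u) \<longlonglongrightarrow> g x"
    "\<And>x. x \<in> T \<Longrightarrow> (g has_derivative (\<lambda>h. h *\<^sub>R (- \<i> *\<^sub>C L x (W x s u)))) (at x within T)" by blast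
  have gW: "g x = W x s u" if "x \<in> T" for x using LIMSEQ_unique[OF g(1)[OF that] S_tendsto] .
  have tT: "t \<in> T" "open T" by (auto simp: T_def)
  have "(g has_vector_derivative - \<i> *\<^sub>C L t (W t s u)) (at t)"
    using g(2)[OF tT(1)] at_within_open[OF tT] by (simp add: has_vector_derivative_def)
  then show ?thesis
    by (rule has_vector_derivative_transform_within_open[OF _ tT(2,1)]) (rule gW)
qed

text \<open>The same limit theorem, now with u approximated by its truncations: once
  differentiability is known on \<open>dm b\<close>, bounds at level m make the derivatives converge
  uniformly.\<close>

lemma W_deriv:
  assumes u: "u \<in> dm m"
  shows "((\<lambda>t. W t s u) has_vector_derivative - \<i> *\<^sub>C L t (W t s u)) (at t)"
proof -
  define T where "T = {t - 1<..<t + 1}"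
  define k where "k = \<bar>t - s\<bar> + 1"
  have k: "\<bar>x - s\<bar> \<le> k" if "x \<in> T" for x using that by (auto simp: T_def k_def)
  define v where "v n = P (real n) u" for n :: nat
  have v: "v n \<in> dm a" for n a by (simp add: v_def)
  have mb: "0 \<le> real m" "real m < b" using mJ by auto
  have Wm: "W x s z \<in> dm m" "norm (X m (W x s z)) \<le> 2 * exp (\<kappa> * \<bar>x - s\<bar>) * norm (X m z)" if "z \<in> dm m" for x z
    using W_level[OF mb that] by auto
  have Xlim: "(\<lambda>n. norm (X m (v n - u))) \<longlonglongrightarrow> 0"
    using X_P_tendsto[OF u] unfolding v_def X_lin(2)[OF P_dm u] by (simp add: LIM_zero tendsto_norm_zero)
  have bound: "norm (L x (W x s (v n)) - L x (W x s u)) \<le> (C\<^sub>L * (2 * exp (\<kappa> * k))) * norm (X m (v n - u))"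
    if x: "x \<in> T" for x n
  proof -
    have vu: "v n - u \<in> dm m" using csubspaceD(4)[OF dm_csubspace v u] .
    have Wd: "W x s (v n) \<in> dm m" "W x s u \<in> dm m" "W x s (v n - u) \<in> dm m"
      by (rule Wm(1); fact v u vu)+
    have "norm (L x (W x s (v n)) - L x (W x s u)) \<le> C\<^sub>L * norm (X m (W x s (v n - u)))"
      using L_bound[OF Wd(3), of x] L_diff[OF Wd(1,2), of x] by (simp add: W_diff)
    also have "\<dots> \<le> C\<^sub>L * (2 * exp (\<kappa> * \<bar>x - s\<bar>) * norm (X m (v n - u)))"
      by (intro mult_left_mono Wm vu C_nonneg)
    also have "\<dots> \<le> C\<^sub>L * (2 * exp (\<kappa> * k) * norm (X m (v n - u)))"
      using k[OF x] kappa(1) C_nonneg by (intro mult_left_mono mult_right_mono) auto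
    finally show ?thesis by (simp add: mult.assoc)
  qed
  have "\<exists>g. \<forall>x\<in>T. (\<lambda>n. W x s (v n)) \<longlonglongrightarrow> g x \<and>
      (g has_derivative (\<lambda>h. h *\<^sub>R (- \<i> *\<^sub>C L x (W x s u)))) (at x within T)"
  proof (rule has_derivative_sequence[where ?x0.0 = t and l = "W t s u"])
    show "((\<lambda>x. W x s (v n)) has_derivative (\<lambda>h. h *\<^sub>R (- \<i> *\<^sub>C L x (W x s (v n))))) (at x within T)" for n x
      using W_deriv_b[OF v] unfolding has_vector_derivative_def by (rule has_derivative_at_withinI)
    show "\<forall>\<^sub>F n in sequentially. \<forall>x\<in>T. \<forall>h. norm (h *\<^sub>R (- \<i> *\<^sub>C L x (W x s (v n)))
        - h *\<^sub>R (- \<i> *\<^sub>C L x (W x s u))) \<le> e * norm h" if e: "0 < e" for e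
    proof -
      have "(\<lambda>n. (C\<^sub>L * (2 * exp (\<kappa> * k))) * norm (X m (v n - u))) \<longlonglongrightarrow> (C\<^sub>L * (2 * exp (\<kappa> * k))) * 0"
        by (intro tendsto_mult tendsto_const Xlim)
      then have "\<forall>\<^sub>F n in sequentially. (C\<^sub>L * (2 * exp (\<kappa> * k))) * norm (X m (v n - u)) < e"
        by (rule order_tendstoD) (use e in simp)
      then show ?thesis
      proof eventually_elim
        case (elim n)
        show ?case
        proof (intro ballI allI)
          fix x h assume x: "x \<in> T"
          have "norm (h *\<^sub>R (- \<i> *\<^sub>C L x (W x s (v n))) - h *\<^sub>R (- \<i> *\<^sub>C L x (W x s u)))
            = \<bar>h\<bar> * norm (L x (W x s (v n)) - L x (W x s u))"
            unfolding scaleR_diff_right[symmetric] scaleC_diff_right[symmetric] by (simp add: norm_scaleC)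
          also have "\<dots> \<le> \<bar>h\<bar> * e" using elim bound[OF x, of n] by (intro mult_left_mono) auto
          finally show "norm (h *\<^sub>R (- \<i> *\<^sub>C L x (W x s (v n))) - h *\<^sub>R (- \<i> *\<^sub>C L x (W x s u))) \<le> e * norm h"
            by (simp add: mult.commute)
        qed
      qed
    qed
    have "(\<lambda>n. norm (v n - u)) \<longlonglongrightarrow> 0"
      using P_tendsto[of u] by (simp add: v_def LIM_zero tendsto_norm_zero)
    then have "(\<lambda>n. norm (W t s (v n) - W t s u)) \<longlonglongrightarrow> 0" by (simp add: W_diff[symmetric] norm_W)
    then show "(\<lambda>n. W t s (v n)) \<longlonglongrightarrow> W t s u"
      using LIM_zero_cancel tendsto_norm_zero_iff by blast
  qed (auto simp: T_def)
  then obtain g where g: "\<And>x. x \<in> T \<Longrightarrow> (\<lambda>n. W x s (v n)) \<longlonglongrightarrow> g x"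
    "\<And>x. x \<in> T \<Longrightarrow> (g has_derivative (\<lambda>h. h *\<^sub>R (- \<i> *\<^sub>C L x (W x s u)))) (at x within T)" by blast
  have gW: "g x = W x s u" if "x \<in> T" for x
  proof (rule LIMSEQ_unique[OF g(1)[OF that]])
    have "(\<lambda>n. norm (v n - u)) \<longlonglongrightarrow> 0"
      using P_tendsto[of u] by (simp add: v_def LIM_zero tendsto_norm_zero)
    then have "(\<lambda>n. norm (W x s (v n) - W x s u)) \<longlonglongrightarrow> 0" by (simp add: W_diff[symmetric] norm_W)
    then show "(\<lambda>n. W x s (v n)) \<longlonglongrightarrow> W x s u"
      using LIM_zero_cancel tendsto_norm_zero_iff by blast
  qed
  have tT: "t \<in> T" "open T" by (auto simp: T_def)
  have "(g has_vector_derivative - \<i> *\<^sub>C L t (W t s u)) (at t)"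
    using g(2)[OF tT(1)] at_within_open[OF tT] by (simp add: has_vector_derivative_def)
  then show ?thesis
    by (rule has_vector_derivative_transform_within_open[OF _ tT(2,1)]) (rule gW)
qed

text \<open>Symmetry of L on \<open>dm m\<close> conserves the norm of the difference of two
  solutions.\<close>

lemma W_unique:
  assumes u: "u \<in> dm m" and d: "\<And>t. \<phi> t \<in> dm m" "\<And>t. (\<phi> has_vector_derivative - \<i> *\<^sub>C L t (\<phi> t)) (at t)"
    and s: "\<phi> s = u"
  shows "\<phi> t = W t s u"
proof -
  have mb: "0 \<le> real m" "real m < b" using mJ by auto
  define \<delta> where "\<delta> t = \<phi> t - W t s u" for t
  have Wm: "W x s u \<in> dm m" for x using W_level(1)[OF mb u] .
  have \<delta>m: "\<delta> x \<in> dm m" for x unfolding \<delta>_def by (rule csubspaceD(4)[OF dm_csubspace d(1) Wm])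
  have d': "(\<delta> has_vector_derivative - \<i> *\<^sub>C L x (\<delta> x)) (at x)" for x
    using has_vector_derivative_diff[OF d(2)[of x] W_deriv[OF u, of s x]] L_diff[OF d(1)[of x] Wm[of x], of x]
    by (simp add: \<delta>_def[abs_def] scaleC_diff_right)
  have "((\<lambda>t. (norm (\<delta> t))\<^sup>2) has_real_derivative 0) (at x)" for x
    using norm_sq_has_derivative[OF d'[of x]] Im_cinner_L[OF \<delta>m[of x], of x] by (simp add: cinner_scaleC_right)
  then have "(norm (\<delta> t))\<^sup>2 = (norm (\<delta> s))\<^sup>2" by (intro DERIV_isconst_all) auto
  then show ?thesis by (simp add: \<delta>_def s W_start)
qed

text \<open>The derivative is known in the base norm and has to be upgraded to level q. Continuity
  of X q L W u feeds the mean value inequality, which is applied behind the bounded operator X q P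
  n; \<open>dm_of_bounded\<close> then removes P n.\<close>

lemma W_deriv_level:
  assumes q: "0 \<le> q" "q + real m < b"
    and Lq: "\<And>t u. u \<in> dm (q + m) \<Longrightarrow> L t u \<in> dm q \<and> norm (X q (L t u)) \<le> C * norm (X (q + m) u)"
    and Lc: "\<And>t e. 0 < e \<Longrightarrow> \<exists>d>0. \<forall>t'. \<bar>t' - t\<bar> < d \<longrightarrow>
      (\<forall>u\<in>dm (q + m). norm (X q (L t' u - L t u)) \<le> e * norm (X (q + m) u))"
    and u: "u \<in> dm (q + m)"
  shows "((\<lambda>x. X q (L x (W x s u))) \<longlongrightarrow> X q (L t (W t s u))) (at t)"
    and "((\<lambda>h. norm (X q ((1 / h) *\<^sub>R (W (t + h) s u - W t s u) - (- \<i> *\<^sub>C L t (W t s u))))) \<longlongrightarrow> 0) (at 0)"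
proof -
  have qm: "0 \<le> q + real m" using q by simp
  have um: "u \<in> dm m" by (rule dm_le[OF u]) (use q in simp)
  define \<psi> where "\<psi> x = W x s u" for x
  have \<psi>: "\<psi> x \<in> dm (q + m)" for x unfolding \<psi>_def by (rule W_level(1)[OF qm q(2) u])
  have \<psi>q: "\<psi> x \<in> dm q" for x by (rule dm_le[OF \<psi>]) simp
  have L\<psi>: "L x (\<psi> x) \<in> dm q" for x using Lq[OF \<psi>] by auto
  have cont: "((\<lambda>x. X (q + m) (\<psi> x)) \<longlongrightarrow> X (q + m) (\<psi> t)) (at t)"
  proof -
    have "((\<lambda>x. (x, s)) \<longlongrightarrow> (t, s)) (at t)" by (intro tendsto_intros)
    moreover have "\<forall>\<^sub>F x in at t. (x, s) \<noteq> (t, s)" by (simp add: eventually_at_filter)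
    ultimately have "filterlim (\<lambda>x. (x, s)) (at (t, s)) (at t)" by (simp add: filterlim_at)
    from filterlim_compose[OF X_W_continuous[OF qm q(2) u, of "(t, s)"] this]
    show ?thesis by (simp add: \<psi>_def)
  qed
  show lim: "((\<lambda>x. X q (L x (W x s u))) \<longlongrightarrow> X q (L t (W t s u))) (at t)"
  proof (rule LIM_zero_cancel, rule tendstoI)
    fix e :: real assume e: "0 < e"
    define n0 where "n0 = norm (X (q + m) (\<psi> t)) + 1"
    have n0: "0 < n0" using norm_ge_zero[of "X (q + m) (\<psi> t)"] unfolding n0_def by linarith
    have "0 < e / 2 / n0" using e n0 by simp
    from Lc[OF this, of t] obtain d where d: "0 < d" "\<And>t' u. \<bar>t' - t\<bar> < d \<Longrightarrow> u \<in> dm (q + m) \<Longrightarrow>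
        norm (X q (L t' u - L t u)) \<le> e / 2 / n0 * norm (X (q + m) u)" by metis
    define C' where "C' = \<bar>C\<bar> + 1"
    have C': "0 < C'" "C \<le> C'" by (auto simp: C'_def)
    have "\<forall>\<^sub>F x in at t. dist (X (q + m) (\<psi> x)) (X (q + m) (\<psi> t)) < min 1 (e / 2 / C')"
      using cont e C' by (intro tendstoD) auto
    moreover have "\<forall>\<^sub>F x in at t. dist x t < d" using d(1) by (auto simp: eventually_at)
    ultimately show "\<forall>\<^sub>F x in at t. dist (X q (L x (W x s u)) - X q (L t (W t s u))) 0 < e"
    proof eventually_elim
      case (elim x)
      define y where "y = \<psi> x - \<psi> t"
      have y: "y \<in> dm (q + m)" unfolding y_def by (rule csubspaceD(4)[OF dm_csubspace \<psi> \<psi>])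
      have Xy: "norm (X (q + m) y) < min 1 (e / 2 / C')"
        using elim(1) by (simp add: y_def X_lin(2)[OF \<psi> \<psi>] dist_norm)
      have "norm (X (q + m) (\<psi> x)) \<le> norm (X (q + m) (\<psi> t)) + norm (X (q + m) y)"
        using norm_triangle_ineq[of "X (q + m) (\<psi> t)" "X (q + m) y"] by (simp add: y_def X_lin(2)[OF \<psi> \<psi>])
      then have nx: "norm (X (q + m) (\<psi> x)) \<le> n0" using Xy by (simp add: n0_def)
      have Ldm: "L x (\<psi> x) \<in> dm q" "L t (\<psi> x) \<in> dm q" "L t (\<psi> t) \<in> dm q" "L t y \<in> dm q"
        using Lq[OF \<psi>] Lq[OF y] by auto
      have ym: "\<psi> x \<in> dm m" "\<psi> t \<in> dm m" using dm_le[OF \<psi>, of "real m"] q(1) by auto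
      have "X q (L x (\<psi> x)) - X q (L t (\<psi> t)) = X q (L x (\<psi> x) - L t (\<psi> x)) + X q (L t y)"
        by (simp add: y_def L_diff[OF ym] X_lin(2)[OF Ldm(1,2)] X_lin(2)[OF Ldm(2,3)])
      then have "norm (X q (L x (\<psi> x)) - X q (L t (\<psi> t))) \<le> norm (X q (L x (\<psi> x) - L t (\<psi> x))) + norm (X q (L t y))"
        by (simp only: norm_triangle_ineq)
      also have "norm (X q (L x (\<psi> x) - L t (\<psi> x))) \<le> e / 2 / n0 * norm (X (q + m) (\<psi> x))"
        using elim(2) by (intro d(2) \<psi>) (simp add: dist_real_def)
      also have "\<dots> \<le> e / 2 / n0 * n0" using e n0 nx by (intro mult_left_mono) auto
      also have "\<dots> = e / 2" using n0 by simp
      also have "norm (X q (L t y)) \<le> C * norm (X (q + m) y)" using Lq[OF y] by auto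
      also have "\<dots> \<le> C' * norm (X (q + m) y)" using C' by (intro mult_right_mono) auto
      also have "\<dots> < C' * (e / 2 / C')" using Xy C' by (intro mult_strict_left_mono) auto
      also have "\<dots> = e / 2" using C' by simp
      finally show ?case by (simp add: \<psi>_def)
    qed
  qed
  show "((\<lambda>h. norm (X q ((1 / h) *\<^sub>R (W (t + h) s u - W t s u) - (- \<i> *\<^sub>C L t (W t s u))))) \<longlongrightarrow> 0) (at 0)"
  proof (rule tendstoI)
    fix e :: real assume e: "0 < e"
    have "\<forall>\<^sub>F x in at t. dist (X q (L x (W x s u))) (X q (L t (W t s u))) < e / 2"
      using lim e by (intro tendstoD) auto
    then obtain d where d: "0 < d" "\<And>x. x \<noteq> t \<Longrightarrow> dist x t < d \<Longrightarrow> dist (X q (L x (\<psi> x))) (X q (L t (\<psi> t))) < e / 2"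
      by (auto simp: eventually_at \<psi>_def)
    have close: "norm (X q (L x (\<psi> x) - L t (\<psi> t))) \<le> e / 2" if "\<bar>x - t\<bar> < d" for x
      using d(2)[of x] that e by (cases "x = t")
        (auto simp: X_lin(2)[OF L\<psi> L\<psi>] clinear_onD(4)[OF X_linear] dist_norm dist_real_def intro: less_imp_le)
    have small: "norm (X q ((1 / h) *\<^sub>R (\<psi> (t + h) - \<psi> t) - (- \<i> *\<^sub>C L t (\<psi> t)))) \<le> e / 2"
      if h: "h \<noteq> 0" "\<bar>h\<bar> < d" for h
    proof -
      define y where "y = \<psi> (t + h) - \<psi> t - h *\<^sub>R (- \<i> *\<^sub>C L t (\<psi> t))"
      have iL: "- \<i> *\<^sub>C L t (\<psi> t) \<in> dm q" using csubspaceD(3)[OF dm_csubspace L\<psi>] .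
      have y: "y \<in> dm q"
        unfolding y_def by (intro csubspaceD(4,5)[OF dm_csubspace] \<psi>q iL)
      have "norm (X q (P (real n) y)) \<le> e / 2 * \<bar>h\<bar>" for n
      proof -
        \<comment> \<open>The tangent at t is subtracted, so that the derivative of f is small along
          the whole segment.\<close>
        define f where "f x = X q (P (real n) (\<psi> x - x *\<^sub>R (- \<i> *\<^sub>C L t (\<psi> t))))" for x
        have "norm (f (t + h) - f t) \<le> e / 2 * \<bar>t + h - t\<bar>"
        proof (rule vector_derivative_bound)
          fix x assume "x \<in> closed_segment t (t + h)"
          then have "\<bar>x - t\<bar> < d" using h by (auto simp: closed_segment_eq_real_ivl split: if_splits)
          note cl = close[OF this]
          have "((\<lambda>x. \<psi> x - x *\<^sub>R (- \<i> *\<^sub>C L t (\<psi> t))) has_vector_derivative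
              (- \<i> *\<^sub>C L x (\<psi> x) - 1 *\<^sub>R (- \<i> *\<^sub>C L t (\<psi> t)))) (at x)"
            unfolding \<psi>_def
            by (intro has_vector_derivative_diff W_deriv um
                bounded_linear.has_vector_derivative[OF bounded_linear_scaleR_left has_vector_derivative_id])
          then have "((\<lambda>x. \<psi> x - x *\<^sub>R (- \<i> *\<^sub>C L t (\<psi> t))) has_vector_derivative
              - \<i> *\<^sub>C (L x (\<psi> x) - L t (\<psi> t))) (at x)"
            by (simp add: scaleC_diff_right)
          from bounded_linear.has_vector_derivative[OF XP_bounded_linear this]
          show "(f has_vector_derivative X q (P (real n) (- \<i> *\<^sub>C (L x (\<psi> x) - L t (\<psi> t))))) (at x)"
            unfolding f_def .
          define z where "z = L x (\<psi> x) - L t (\<psi> t)"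
          have z: "z \<in> dm q" unfolding z_def by (rule csubspaceD(4)[OF dm_csubspace L\<psi> L\<psi>])
          have "X q (P (real n) (- \<i> *\<^sub>C z)) = P (real n) (- \<i> *\<^sub>C X q z)"
            using P_X(2)[OF csubspaceD(3)[OF dm_csubspace z], of "real n" "- \<i>"] X_lin(3)[OF z, of "- \<i>"] by simp
          then show "norm (X q (P (real n) (- \<i> *\<^sub>C (L x (\<psi> x) - L t (\<psi> t))))) \<le> e / 2"
            using norm_P_le[of "real n" "- \<i> *\<^sub>C X q z"] cl by (simp add: z_def norm_scaleC)
        qed
        moreover have "f (t + h) - f t = X q (P (real n) y)"
        proof -
          have "y = (\<psi> (t + h) - (t + h) *\<^sub>R (- \<i> *\<^sub>C L t (\<psi> t))) - (\<psi> t - t *\<^sub>R (- \<i> *\<^sub>C L t (\<psi> t)))"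
            by (simp add: y_def scaleR_add_left)
          then show ?thesis
            using linear_diff[OF bounded_linear.linear[OF XP_bounded_linear]] by (simp only: f_def)
        qed
        ultimately show ?thesis by simp
      qed
      from dm_of_bounded(2)[OF this] have Xy: "norm (X q y) \<le> e / 2 * \<bar>h\<bar>" .
      have "(1 / h) *\<^sub>R (\<psi> (t + h) - \<psi> t) - (- \<i> *\<^sub>C L t (\<psi> t)) = (1 / h) *\<^sub>R y"
        using h(1) by (simp add: y_def scaleR_diff_right)
      moreover have "X q ((1 / h) *\<^sub>R y) = (1 / h) *\<^sub>R X q y"
        by (rule clinear_onD(6)[OF X_linear y])
      ultimately show ?thesis using Xy h(1) by (simp add: field_simps)
    qed
    have "\<forall>\<^sub>F h in at 0. h \<noteq> 0 \<and> \<bar>h\<bar> < d" using d(1) by (auto simp: eventually_at dist_real_def)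
    then show "\<forall>\<^sub>F h in at 0. dist (norm (X q ((1 / h) *\<^sub>R (W (t + h) s u - W t s u) - (- \<i> *\<^sub>C L t (W t s u))))) 0 < e"
    proof eventually_elim
      case (elim h)
      then show ?case using small[of h] e by (simp add: \<psi>_def)
    qed
  qed
qed

section \<open>Essential self-adjointness\<close>

text \<open>Pairing a deficiency vector \<open>v\<close> with \<open>\<phi> = H\<^sup>-\<^sup>2\<^sup>m v\<close> gives, for \<open>w = H\<^sup>-\<^sup>m v\<close>,
  \<open>\<langle>v, L \<phi>\<rangle> = \<langle>w, L w\<rangle> - \<langle>w, K w\<rangle>\<close>, whose first summand is real.\<close>

lemma deficiency_trivial:
  assumes \<nu>: "real m * C\<^sub>B < \<bar>\<nu>\<bar>"
    and v: "\<And>\<phi>. \<phi> \<in> dm m \<Longrightarrow> cinner v (L t \<phi> + (\<i> * of_real \<nu>) *\<^sub>C \<phi>) = 0"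
  shows "v = 0"
proof -
  define w where "w = X (- real m) v"
  have w: "w \<in> dm m" and Xw: "X (real m) w = v" unfolding w_def by (rule X_X_neg; simp)+
  define \<phi> where "\<phi> = X (- real m) w"
  have \<phi>: "\<phi> \<in> dm m" unfolding \<phi>_def by (rule X_X_neg) simp
  have X_neg_sym: "cinner v (X (- real m) z) = cinner w z" for z
    unfolding w_def by (rule X_sym[symmetric]) (simp_all add: dm_nonpos)
  have cj: "L t \<phi> \<in> dm m" "X (real m) (L t \<phi>) = L t w - K m t w"
    using conjugated_L[of m w t] mJ w by (auto simp: \<phi>_def)
  have "L t \<phi> = X (- real m) (L t w - K m t w)" using X_neg_X[OF cj(1)] by (simp only: cj(2))
  then have 1: "cinner v (L t \<phi>) = cinner w (L t w) - cinner w (K m t w)"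
    by (simp add: X_neg_sym cinner_diff_right)
  have 2: "cinner v \<phi> = of_real ((norm w)\<^sup>2)" unfolding \<phi>_def X_neg_sym by (rule cinner_self)
  have "Im (cinner w (L t w) - cinner w (K m t w) + \<i> * of_real \<nu> * of_real ((norm w)\<^sup>2)) = 0"
    using v[OF \<phi>] by (simp only: cinner_add_right cinner_scaleC_right 1 2) simp
  then have "\<nu> * (norm w)\<^sup>2 = Im (cinner w (K m t w))"
    using Im_cinner_L[OF w, of t] by simp
  then have "\<bar>\<nu>\<bar> * (norm w)\<^sup>2 = \<bar>Im (cinner w (K m t w))\<bar>" by (metis abs_mult abs_power2)
  also have "\<dots> \<le> norm w * norm (K m t w)"
    using abs_Im_le_cmod[of "cinner w (K m t w)"] cinner_le[of w "K m t w"] by simp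
  also have "\<dots> \<le> norm w * (real m * C\<^sub>B * norm w)"
    using mJ by (intro mult_left_mono norm_K_le) auto
  finally have "(\<bar>\<nu>\<bar> - real m * C\<^sub>B) * (norm w)\<^sup>2 \<le> 0" by (simp add: power2_eq_square algebra_simps)
  then have "(norm w)\<^sup>2 \<le> 0" using \<nu> by (simp add: mult_le_0_iff)
  then have "w = 0" by simp
  then show ?thesis using Xw clinear_onD(4)[OF X_linear] by metis
qed

end

lemma adjoint_graph_closure: "adjoint_graph (closure G) = adjoint_graph (G :: ('h::complex_hilbert \<times> 'h) set)"
proof
  show "adjoint_graph (closure G) \<subseteq> adjoint_graph G"
    using closure_subset[of G] by (fastforce simp: adjoint_graph_def)
  show "adjoint_graph G \<subseteq> adjoint_graph (closure G)"
  proof clarify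
    fix v w assume vw: "(v, w) \<in> adjoint_graph G"
    have "cinner v z = cinner w u" if uz: "(u, z) \<in> closure G" for u z
    proof -
      obtain x where x: "\<And>n. x n \<in> G" "x \<longlonglongrightarrow> (u, z)" using uz unfolding closure_sequential by blast
      have "(\<lambda>n. cinner v (snd (x n))) \<longlonglongrightarrow> cinner v z" "(\<lambda>n. cinner w (fst (x n))) \<longlonglongrightarrow> cinner w u"
        using tendsto_cinner[OF tendsto_const tendsto_snd[OF x(2)]] tendsto_cinner[OF tendsto_const tendsto_fst[OF x(2)]]
        by auto
      moreover have "cinner v (snd (x n)) = cinner w (fst (x n))" for n
        using vw x(1)[of n] by (cases "x n") (auto simp: adjoint_graph_def)
      ultimately show ?thesis by (simp add: LIMSEQ_unique)
    qed
    then show "(v, w) \<in> adjoint_graph (closure G)" by (auto simp: adjoint_graph_def)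
  qed
qed

text \<open>Von Neumann's criterion. The identity \<open>T_norm\<close> makes the range of the
  shifted closure closed, \<open>def_pos\<close> makes it the whole space, and
  \<open>def_neg\<close> shows that a pair of the adjoint coincides with the pair of the closure
  having the same image.\<close>

lemma essentially_self_adjointI:
  fixes A :: "'h::complex_hilbert \<Rightarrow> 'h"
  assumes lin: "clinear_on S A" and dense: "closure S = UNIV" and sym: "symmetric_on S A"
    and l: "0 < \<nu>"
    and def_pos: "\<And>v. (\<And>u. u \<in> S \<Longrightarrow> cinner v (A u + (\<i> * of_real \<nu>) *\<^sub>C u) = 0) \<Longrightarrow> v = 0"
    and def_neg: "\<And>v. (\<And>u. u \<in> S \<Longrightarrow> cinner v (A u + (\<i> * of_real (- \<nu>)) *\<^sub>C u) = 0) \<Longrightarrow> v = 0"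
  shows "essentially_self_adjoint S A"
proof -
  note ld = clinear_onD[OF lin] note sd = csubspaceD[OF ld(1)]
  define G where "G = op_graph S A"
  define \<Gamma> where "\<Gamma> = closure G"
  have GI: "(u, A u) \<in> \<Gamma>" if "u \<in> S" for u
    using that closure_subset[of G] by (auto simp: \<Gamma>_def G_def op_graph_def)
  have adj: "adjoint_graph \<Gamma> = adjoint_graph G" unfolding \<Gamma>_def by (rule adjoint_graph_closure)
  have closed_adj: "closed (adjoint_graph G)"
    unfolding closed_sequential_limits
  proof (intro allI impI, elim conjE)
    fix x l assume x: "\<forall>n. x n \<in> adjoint_graph G" "x \<longlonglongrightarrow> l"
    have "cinner (fst l) z = cinner (snd l) u" if "(u, z) \<in> G" for u z
    proof -
      have "(\<lambda>n. cinner (fst (x n)) z) \<longlonglongrightarrow> cinner (fst l) z" "(\<lambda>n. cinner (snd (x n)) u) \<longlonglongrightarrow> cinner (snd l) u"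
        using tendsto_cinner[OF tendsto_fst[OF x(2)] tendsto_const] tendsto_cinner[OF tendsto_snd[OF x(2)] tendsto_const]
        by auto
      moreover have "cinner (fst (x n)) z = cinner (snd (x n)) u" for n
        using x(1)[rule_format, of n] that by (cases "x n") (auto simp: adjoint_graph_def)
      ultimately show ?thesis by (simp add: LIMSEQ_unique)
    qed
    then show "l \<in> adjoint_graph G" by (cases l) (auto simp: adjoint_graph_def)
  qed
  have "G \<subseteq> adjoint_graph G"
  proof (clarsimp simp: G_def op_graph_def adjoint_graph_def)
    fix v u assume "v \<in> S" "u \<in> S"
    then show "cinner v (A u) = cinner (A v) u" using sym by (simp add: symmetric_on_def)
  qed
  then have sub: "\<Gamma> \<subseteq> adjoint_graph G" unfolding \<Gamma>_def using closed_adj by (rule closure_minimal)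
  have \<Gamma>_sym: "cinner v z = cinner w u" if "(v, w) \<in> \<Gamma>" "(u, z) \<in> \<Gamma>" for u v w z
  proof -
    have "(v, w) \<in> adjoint_graph \<Gamma>" using that(1) sub adj by blast
    then show ?thesis using that(2) unfolding adjoint_graph_def by blast
  qed
  have \<Gamma>_seq: "\<exists>x. (\<forall>n. fst (x n) \<in> S \<and> snd (x n) = A (fst (x n))) \<and> x \<longlonglongrightarrow> p" if "p \<in> \<Gamma>" for p
  proof -
    obtain x where x: "\<And>n. x n \<in> G" "x \<longlonglongrightarrow> p"
      using \<open>p \<in> \<Gamma>\<close> unfolding \<Gamma>_def closure_sequential by blast
    have "fst (x n) \<in> S \<and> snd (x n) = A (fst (x n))" for n
      using x(1)[of n] by (auto simp: G_def op_graph_def)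
    then show ?thesis using x(2) by blast
  qed
  have \<Gamma>_lim: "p \<in> \<Gamma>" if "\<And>n. fst (x n) \<in> S \<and> snd (x n) = A (fst (x n))" "x \<longlonglongrightarrow> p" for x p
  proof -
    have "x n \<in> G" for n using that(1)[of n] by (cases "x n") (auto simp: G_def op_graph_def)
    then show ?thesis unfolding \<Gamma>_def closure_sequential using that(2) by blast
  qed
  have \<Gamma>_add: "p + p' \<in> \<Gamma>" if pp: "p \<in> \<Gamma>" "p' \<in> \<Gamma>" for p p'
  proof -
    obtain x y where "\<forall>n. fst (x n) \<in> S \<and> snd (x n) = A (fst (x n))" "x \<longlonglongrightarrow> p"
      "\<forall>n. fst (y n) \<in> S \<and> snd (y n) = A (fst (y n))" "y \<longlonglongrightarrow> p'"
      using \<Gamma>_seq[OF pp(1)] \<Gamma>_seq[OF pp(2)] by metis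
    then show ?thesis by (intro \<Gamma>_lim[of "\<lambda>n. x n + y n"] tendsto_add) (auto simp: ld sd)
  qed
  have \<Gamma>_scale: "(a *\<^sub>C fst p, a *\<^sub>C snd p) \<in> \<Gamma>" if pp: "p \<in> \<Gamma>" for p a
  proof -
    obtain x where "\<forall>n. fst (x n) \<in> S \<and> snd (x n) = A (fst (x n))" "x \<longlonglongrightarrow> p"
      using \<Gamma>_seq[OF pp] by metis
    then show ?thesis
      by (intro \<Gamma>_lim[of "\<lambda>n. (a *\<^sub>C fst (x n), a *\<^sub>C snd (x n))"] tendsto_Pair tendsto_scaleC tendsto_fst tendsto_snd)
        (auto simp: ld sd)
  qed
  \<comment> \<open>The shift of the closure by i \<nu>, written as a map on its graph.\<close>
  define T where "T p = snd p + (\<i> * of_real \<nu>) *\<^sub>C fst p" for p :: "'h \<times> 'h"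
  have T_norm: "(norm (T p))\<^sup>2 = (norm (snd p))\<^sup>2 + \<nu>\<^sup>2 * (norm (fst p))\<^sup>2" if "p \<in> \<Gamma>" for p
  proof -
    have "cinner (fst p) (snd p) = cinner (snd p) (fst p)" using \<Gamma>_sym[of "fst p" "snd p" "fst p" "snd p"] that by simp
    then have "cinner (snd p) (fst p) = cnj (cinner (snd p) (fst p))" by (metis cinner_commute)
    from arg_cong[OF this, of Im] have "Im (cinner (snd p) (fst p)) = 0" by simp
    then have "Re (cinner (snd p) ((\<i> * of_real \<nu>) *\<^sub>C fst p)) = 0" by (simp add: cinner_scaleC_right)
    then show ?thesis by (simp add: T_def norm_sq_add norm_scaleC norm_mult power_mult_distrib)
  qed
  have T_add: "T (p + p') = T p + T p'" for p p' by (simp add: T_def scaleC_add_right)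
  have T_scale: "T (a *\<^sub>C fst p, a *\<^sub>C snd p) = a *\<^sub>C T p" for a p
    by (simp add: T_def scaleC_add_right scaleC_scaleC mult.commute)
  have "T ` \<Gamma> = UNIV"
  proof (rule range_dense_onto)
    show "csubspace (T ` \<Gamma>)"
      unfolding csubspace_def
    proof (intro conjI ballI allI)
      have "(0, A 0) \<in> \<Gamma>" by (rule GI[OF sd(1)])
      then show "0 \<in> T ` \<Gamma>" by (rule image_eqI[rotated]) (simp add: T_def ld)
      show "x + y \<in> T ` \<Gamma>" if "x \<in> T ` \<Gamma>" "y \<in> T ` \<Gamma>" for x y
        using that \<Gamma>_add T_add by (metis (no_types, lifting) imageE image_eqI)
      show "a *\<^sub>C x \<in> T ` \<Gamma>" if "x \<in> T ` \<Gamma>" for a x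
        using that \<Gamma>_scale T_scale by (metis (no_types, lifting) imageE image_eqI)
    qed
    show "closed (T ` \<Gamma>)"
      unfolding closed_sequential_limits
    proof (intro allI impI, elim conjE)
      fix x z assume x: "\<forall>n. x n \<in> T ` \<Gamma>" "x \<longlonglongrightarrow> z"
      then have "\<forall>n. \<exists>p. p \<in> \<Gamma> \<and> T p = x n" by (metis imageE)
      then obtain p where p: "\<And>n. p n \<in> \<Gamma>" "\<And>n. T (p n) = x n" by metis
      have diff: "p i - p j \<in> \<Gamma>" for i j
        using \<Gamma>_add[OF p(1)[of i] \<Gamma>_scale[OF p(1)[of j], of "-1"]]
        by (cases "p i"; cases "p j") (simp add: scaleC_minus_left)
      have Tdiff: "T (p i - p j) = x i - x j" for i j
        using T_add[of "p i - p j" "p j"] p(2) by (simp add: eq_diff_eq)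
      have le: "norm (snd (p i - p j)) \<le> norm (x i - x j)" "\<nu> * norm (fst (p i - p j)) \<le> norm (x i - x j)" for i j
      proof -
        note tn = T_norm[OF diff[of i j], unfolded Tdiff]
        show "norm (snd (p i - p j)) \<le> norm (x i - x j)"
          by (rule power2_le_imp_le) (use tn in auto)
        show "\<nu> * norm (fst (p i - p j)) \<le> norm (x i - x j)"
          by (rule power2_le_imp_le) (use tn in \<open>auto simp: power_mult_distrib\<close>)
      qed
      have cx: "Cauchy x" by (rule LIMSEQ_imp_Cauchy[OF x(2)])
      have "Cauchy (\<lambda>n. snd (p n))"
      proof (rule metric_CauchyI)
        fix e :: real assume "0 < e"
        then obtain N where N: "\<And>i j. i \<ge> N \<Longrightarrow> j \<ge> N \<Longrightarrow> dist (x i) (x j) < e" using cx unfolding Cauchy_def by metis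
        have "dist (snd (p i)) (snd (p j)) < e" if "i \<ge> N" "j \<ge> N" for i j
          using le(1)[of i j] N[OF that] by (simp add: dist_norm)
        then show "\<exists>N. \<forall>i\<ge>N. \<forall>j\<ge>N. dist (snd (p i)) (snd (p j)) < e" by blast
      qed
      moreover have "Cauchy (\<lambda>n. fst (p n))"
      proof (rule metric_CauchyI)
        fix e :: real assume "0 < e"
        then obtain N where N: "\<And>i j. i \<ge> N \<Longrightarrow> j \<ge> N \<Longrightarrow> dist (x i) (x j) < \<nu> * e"
          using cx l unfolding Cauchy_def by (metis mult_pos_pos)
        have "dist (fst (p i)) (fst (p j)) < e" if "i \<ge> N" "j \<ge> N" for i j
        proof -
          have "\<nu> * norm (fst (p i - p j)) < \<nu> * e" using le(2)[of i j] N[OF that] by (simp add: dist_norm)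
          then show ?thesis using l by (simp add: dist_norm)
        qed
        then show "\<exists>N. \<forall>i\<ge>N. \<forall>j\<ge>N. dist (fst (p i)) (fst (p j)) < e" by blast
      qed
      ultimately obtain u w where uw: "(\<lambda>n. fst (p n)) \<longlonglongrightarrow> u" "(\<lambda>n. snd (p n)) \<longlonglongrightarrow> w"
        by (auto simp: Cauchy_convergent_iff convergent_def)
      have "(\<lambda>n. (fst (p n), snd (p n))) \<longlonglongrightarrow> (u, w)" by (intro tendsto_Pair uw)
      then have "p \<longlonglongrightarrow> (u, w)" by simp
      then have "(u, w) \<in> \<Gamma>" using closed_sequentially[of \<Gamma> p] p(1) by (auto simp: \<Gamma>_def)
      moreover have "(\<lambda>n. T (p n)) \<longlonglongrightarrow> T (u, w)"
        unfolding T_def using uw by (intro tendsto_add tendsto_scaleC) auto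
      then have "z = T (u, w)" using LIMSEQ_unique[OF x(2)] by (simp add: p(2))
      ultimately show "z \<in> T ` \<Gamma>" by blast
    qed
    fix v assume v: "\<And>u. u \<in> T ` \<Gamma> \<Longrightarrow> cinner v u = 0"
    show "v = 0"
    proof (rule def_pos)
      fix u assume "u \<in> S"
      then have "T (u, A u) \<in> T ` \<Gamma>" using GI by blast
      from v[OF this] show "cinner v (A u + (\<i> * of_real \<nu>) *\<^sub>C u) = 0" by (simp add: T_def)
    qed
  qed
  have "adjoint_graph \<Gamma> \<subseteq> \<Gamma>"
  proof clarify
    fix v w assume vw: "(v, w) \<in> adjoint_graph \<Gamma>"
    have "w + (\<i> * of_real \<nu>) *\<^sub>C v \<in> T ` \<Gamma>" using \<open>T ` \<Gamma> = UNIV\<close> by simp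
    then obtain u z where uz: "(u, z) \<in> \<Gamma>" "z + (\<i> * of_real \<nu>) *\<^sub>C u = w + (\<i> * of_real \<nu>) *\<^sub>C v"
      by (auto simp: T_def)
    have wz: "w - z = - ((\<i> * of_real \<nu>) *\<^sub>C (v - u))"
      using uz(2) by (simp add: scaleC_diff_right algebra_simps)
    have "v - u = 0"
    proof (rule def_neg)
      fix x assume x: "x \<in> S"
      have "cinner v (A x) = cinner w x" using vw GI[OF x] by (auto simp: adjoint_graph_def)
      moreover have "cinner u (A x) = cinner z x" by (rule \<Gamma>_sym[OF uz(1) GI[OF x]])
      ultimately have "cinner (v - u) (A x) = cinner (w - z) x" by (simp add: cinner_diff_left)
      also have "\<dots> = \<i> * of_real \<nu> * cinner (v - u) x" unfolding wz by (simp add: cinner_scaleC_left)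
      finally show "cinner (v - u) (A x + (\<i> * of_real (- \<nu>)) *\<^sub>C x) = 0"
        by (simp add: cinner_add_right cinner_diff_right cinner_scaleC_right)
    qed
    then show "(v, w) \<in> \<Gamma>" using uz wz by simp
  qed
  then have "\<Gamma> = adjoint_graph \<Gamma>" using sub adj by auto
  then show ?thesis using lin dense sym by (simp add: essentially_self_adjoint_def \<Gamma>_def G_def)
qed

context evolution
begin

text \<open>A deficiency vector for the smaller domain \<open>dm k\<close> is one for
  \<open>dm m\<close> as well, because truncations approximate each \<phi> in the graph norm of L;
  so \<open>deficiency_trivial\<close> applies.\<close>

lemma L_essentially_self_adjoint:
  assumes k: "real m \<le> k"
  shows "essentially_self_adjoint (dm k) (L t)"
proof -
  have sub: "dm k \<subseteq> dm m" using dm_le k by blast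
  \<comment> \<open>Just above the threshold of \<open>deficiency_trivial\<close>, for both signs of
    the shift.\<close>
  define \<nu> where "\<nu> = real m * C\<^sub>B + 1"
  have \<nu>: "0 < \<nu>" "real m * C\<^sub>B < \<bar>\<nu>\<bar>" "real m * C\<^sub>B < \<bar>- \<nu>\<bar>"
  proof -
    have "0 \<le> real m * C\<^sub>B" using C_nonneg by simp
    then show "0 < \<nu>" "real m * C\<^sub>B < \<bar>\<nu>\<bar>" "real m * C\<^sub>B < \<bar>- \<nu>\<bar>" by (auto simp: \<nu>_def)
  qed
  have ext: "cinner v (L t \<phi> + z *\<^sub>C \<phi>) = 0"
    if v: "\<And>u. u \<in> dm k \<Longrightarrow> cinner v (L t u + z *\<^sub>C u) = 0" and \<phi>: "\<phi> \<in> dm m" for v z \<phi>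
  proof -
    have "(\<lambda>n. L t (P (real n) \<phi>)) \<longlonglongrightarrow> L t \<phi>"
    proof (rule LIM_zero_cancel, rule Lim_null_comparison)
      show "\<forall>\<^sub>F n in sequentially. norm (L t (P (real n) \<phi>) - L t \<phi>) \<le> C\<^sub>L * norm (X m (P (real n) \<phi>) - X m \<phi>)"
        using L_bound[OF csubspaceD(4)[OF dm_csubspace P_dm \<phi>]] L_diff[OF P_dm \<phi>] X_lin(2)[OF P_dm \<phi>]
        by (intro always_eventually allI) (metis)
      have "(\<lambda>n. C\<^sub>L * norm (X m (P (real n) \<phi>) - X m \<phi>)) \<longlonglongrightarrow> C\<^sub>L * norm (X m \<phi> - X m \<phi>)"
        by (intro tendsto_intros X_P_tendsto \<phi>)
      then show "(\<lambda>n. C\<^sub>L * norm (X m (P (real n) \<phi>) - X m \<phi>)) \<longlonglongrightarrow> 0" by simp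
    qed
    then have "(\<lambda>n. cinner v (L t (P (real n) \<phi>) + z *\<^sub>C P (real n) \<phi>)) \<longlonglongrightarrow> cinner v (L t \<phi> + z *\<^sub>C \<phi>)"
      by (intro tendsto_cinner tendsto_const tendsto_add tendsto_scaleC P_tendsto)
    moreover have "cinner v (L t (P (real n) \<phi>) + z *\<^sub>C P (real n) \<phi>) = 0" for n by (rule v) simp
    ultimately show ?thesis by (simp add: LIMSEQ_const_iff)
  qed
  show ?thesis
  proof (rule essentially_self_adjointI[OF _ dm_dense _ \<nu>(1)])
    show "clinear_on (dm k) (L t)" by (rule clinear_on_subset[OF L_linear dm_csubspace sub])
    show "symmetric_on (dm k) (L t)" unfolding symmetric_on_def using L_sym sub by blast
    show "v = 0" if "\<And>u. u \<in> dm k \<Longrightarrow> cinner v (L t u + (\<i> * of_real \<nu>) *\<^sub>C u) = 0" for v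
      by (rule deficiency_trivial[OF \<nu>(2) ext[OF that]])
    show "v = 0" if "\<And>u. u \<in> dm k \<Longrightarrow> cinner v (L t u + (\<i> * of_real (- \<nu>)) *\<^sub>C u) = 0" for v
      by (rule deficiency_trivial[OF \<nu>(3) ext[OF that]])
  qed
qed

end

section \<open>Bounded operators between the spaces of the scale\<close>

context positive_operator
begin

lemma sob_csubspace: "csubspace (sob D H k)"
  unfolding sob_eq by (rule dm_csubspace)

lemma snorm_scaleR: "u \<in> sob D H k \<Longrightarrow> snorm D H k (r *\<^sub>R u) = \<bar>r\<bar> * snorm D H k u"
  using clinear_onD(6)[OF X_linear[of "k / 2"], of u r] csubspaceD(5)[OF dm_csubspace[of "k / 2"], of u r]
  by (simp add: sob_eq snorm_eq)

lemma snorm_zero: "snorm D H k 0 = 0"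
  using snorm_eq[OF csubspaceD(1)[OF dm_csubspace], of k] clinear_onD(4)[OF X_linear] by simp

lemma snorm_nonneg: "0 \<le> snorm D H k u"
  by (simp add: snorm_def)

lemma snorm_triangle: "u \<in> sob D H k \<Longrightarrow> v \<in> sob D H k \<Longrightarrow> snorm D H k (u - v) \<le> snorm D H k u + snorm D H k v"
  using clinear_onD(5)[OF X_linear[of "k / 2"], of u v] csubspaceD(4)[OF dm_csubspace[of "k / 2"], of u v]
  by (simp add: sob_eq snorm_eq norm_triangle_ineq4)

lemma op_norm_least:
  assumes "0 \<le> K" "\<And>u. u \<in> sob D H a \<Longrightarrow> snorm D H d (A u) \<le> K * snorm D H a u"
  shows "op_norm D H a d A \<le> K"
  unfolding op_norm_def
proof (rule cSUP_least)
  show "{u \<in> sob D H a. snorm D H a u \<le> 1} \<noteq> {}"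
    using csubspaceD(1)[OF sob_csubspace, of a] snorm_zero[of a] by force
  fix u assume u: "u \<in> {u \<in> sob D H a. snorm D H a u \<le> 1}"
  then have "snorm D H d (A u) \<le> K * snorm D H a u" using assms(2) by simp
  also have "\<dots> \<le> K * 1" using u assms(1) by (intro mult_left_mono) auto
  finally show "snorm D H d (A u) \<le> K" by simp
qed

text \<open>A supremum of reals is informative only for a set bounded above;
  \<open>bounded_op\<close> provides the bound, and scaling to unit norm does the rest.\<close>

lemma op_norm_bound:
  assumes A: "bounded_op D H a d A" and u: "u \<in> sob D H a"
  shows "snorm D H d (A u) \<le> op_norm D H a d A * snorm D H a u"
proof -
  obtain C where C: "\<And>u. u \<in> sob D H a \<Longrightarrow> snorm D H d (A u) \<le> C * snorm D H a u"
    and lin: "clinear_on (sob D H a) A" and maps: "A ` sob D H a \<subseteq> sob D H d"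
    using A by (auto simp: bounded_op_def)
  have bdd: "bdd_above ((\<lambda>u. snorm D H d (A u)) ` {u \<in> sob D H a. snorm D H a u \<le> 1})"
  proof (rule bdd_aboveI2)
    fix u assume u: "u \<in> {u \<in> sob D H a. snorm D H a u \<le> 1}"
    have "snorm D H d (A u) \<le> C * snorm D H a u" using C u by simp
    also have "\<dots> \<le> \<bar>C\<bar> * snorm D H a u" using snorm_nonneg by (intro mult_right_mono) auto
    also have "\<dots> \<le> \<bar>C\<bar> * 1" using u by (intro mult_left_mono) auto
    finally show "snorm D H d (A u) \<le> \<bar>C\<bar>" by simp
  qed
  show ?thesis
  proof (cases "snorm D H a u = 0")
    case True
    then show ?thesis using C[OF u] by simp
  next
    case False
    define r where "r = snorm D H a u"
    have r: "0 < r" using False snorm_nonneg[of a u] by (simp add: r_def)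
    define w where "w = (1 / r) *\<^sub>R u"
    have w: "w \<in> sob D H a" unfolding w_def by (rule csubspaceD(5)[OF sob_csubspace u])
    have "snorm D H a w = 1" using r by (simp add: w_def snorm_scaleR[OF u] r_def)
    then have "snorm D H d (A w) \<le> op_norm D H a d A"
      unfolding op_norm_def using w by (intro cSUP_upper[OF _ bdd]) auto
    moreover have "A w = (1 / r) *\<^sub>R A u" unfolding w_def by (rule clinear_onD(6)[OF lin u])
    then have "snorm D H d (A w) = (1 / r) * snorm D H d (A u)"
      using snorm_scaleR[of "A u" d "1 / r"] maps u r by auto
    ultimately show ?thesis using r by (simp add: r_def[symmetric] field_simps)
  qed
qed

text \<open>Ensures that the operator norms of differences in \<open>Cb_op\<close> are genuine
  suprema.\<close>

lemma bounded_op_diff: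
  assumes "bounded_op D H a d A" "bounded_op D H a d A'"
  shows "bounded_op D H a d (\<lambda>u. A u - A' u)"
proof -
  obtain C C' where C: "\<forall>u\<in>sob D H a. snorm D H d (A u) \<le> C * snorm D H a u"
    "\<forall>u\<in>sob D H a. snorm D H d (A' u) \<le> C' * snorm D H a u"
    and m: "A ` sob D H a \<subseteq> sob D H d" "A' ` sob D H a \<subseteq> sob D H d"
    using assms by (auto simp: bounded_op_def)
  have "snorm D H d (A u - A' u) \<le> (C + C') * snorm D H a u" if u: "u \<in> sob D H a" for u
  proof -
    have "snorm D H d (A u - A' u) \<le> snorm D H d (A u) + snorm D H d (A' u)"
      using m u by (intro snorm_triangle) auto
    also have "\<dots> \<le> C * snorm D H a u + C' * snorm D H a u" using C u by (intro add_mono) auto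
    finally show ?thesis by (simp add: distrib_right)
  qed
  moreover have "clinear_on (sob D H a) (\<lambda>u. A u - A' u)"
    using assms by (auto simp: bounded_op_def clinear_on_def scaleC_diff_right)
  moreover have "A u - A' u \<in> sob D H d" if "u \<in> sob D H a" for u
    by (rule csubspaceD(4)[OF sob_csubspace]) (use m that in auto)
  ultimately show ?thesis unfolding bounded_op_def by blast
qed

text \<open>Translation into powers of H, where the indices of the scale are halved.\<close>

lemma Cb_opD:
  assumes A: "Cb_op D H a d A"
  shows "clinear_on (dm (a / 2)) (A t)" "u \<in> dm (a / 2) \<Longrightarrow> A t u \<in> dm (d / 2)"
    "\<exists>C\<ge>0. \<forall>t. \<forall>u\<in>dm (a / 2). norm (X (d / 2) (A t u)) \<le> C * norm (X (a / 2) u)"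
    "0 < e \<Longrightarrow> \<exists>r>0. \<forall>t'. \<bar>t' - t\<bar> < r \<longrightarrow>
      (\<forall>u\<in>dm (a / 2). norm (X (d / 2) (A t' u - A t u)) \<le> e * norm (X (a / 2) u))"
proof -
  have bo: "bounded_op D H a d (A t)" for t using A by (simp add: Cb_op_def)
  show "clinear_on (dm (a / 2)) (A t)" using bo[of t] by (simp add: bounded_op_def sob_eq)
  have maps: "A t u \<in> dm (d / 2)" if "u \<in> dm (a / 2)" for u t
    using bo[of t] that by (auto simp: bounded_op_def sob_eq)
  then show "u \<in> dm (a / 2) \<Longrightarrow> A t u \<in> dm (d / 2)" .
  obtain C where C: "\<And>t. op_norm D H a d (A t) \<le> C" using A by (auto simp: Cb_op_def)
  have "norm (X (d / 2) (A t u)) \<le> \<bar>C\<bar> * norm (X (a / 2) u)" if u: "u \<in> dm (a / 2)" for t u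
  proof -
    have "snorm D H d (A t u) \<le> op_norm D H a d (A t) * snorm D H a u"
      by (rule op_norm_bound[OF bo]) (simp add: sob_eq u)
    also have "\<dots> \<le> \<bar>C\<bar> * snorm D H a u" using C[of t] snorm_nonneg by (intro mult_right_mono) auto
    finally show ?thesis using u maps[OF u] by (simp add: snorm_eq)
  qed
  then show "\<exists>C\<ge>0. \<forall>t. \<forall>u\<in>dm (a / 2). norm (X (d / 2) (A t u)) \<le> C * norm (X (a / 2) u)"
    by (intro exI[of _ "\<bar>C\<bar>"]) auto
  assume e: "0 < e"
  have "((\<lambda>\<tau>. op_norm D H a d (\<lambda>u. A \<tau> u - A t u)) \<longlongrightarrow> 0) (at t)" using A by (simp add: Cb_op_def)
  then have "\<forall>\<^sub>F \<tau> in at t. op_norm D H a d (\<lambda>u. A \<tau> u - A t u) < e" by (rule order_tendstoD) (rule e)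
  then obtain r where r: "0 < r" "\<And>\<tau>. \<tau> \<noteq> t \<Longrightarrow> dist \<tau> t < r \<Longrightarrow> op_norm D H a d (\<lambda>u. A \<tau> u - A t u) < e"
    by (auto simp: eventually_at)
  \<comment> \<open>The limit along \<open>at t\<close> omits t itself, hence the separate case t' =
    t.\<close>
  have "norm (X (d / 2) (A t' u - A t u)) \<le> e * norm (X (a / 2) u)" if t': "\<bar>t' - t\<bar> < r" and u: "u \<in> dm (a / 2)" for t' u
  proof (cases "t' = t")
    case True
    then show ?thesis using e clinear_onD(4)[OF X_linear] by simp
  next
    case False
    have "snorm D H d (A t' u - A t u) \<le> op_norm D H a d (\<lambda>u. A t' u - A t u) * snorm D H a u"
      by (rule op_norm_bound[OF bounded_op_diff[OF bo bo]]) (simp add: sob_eq u)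
    also have "\<dots> \<le> e * snorm D H a u"
      using r(2)[OF False] t' snorm_nonneg by (intro mult_right_mono) (auto simp: dist_real_def)
    finally show ?thesis
      using u csubspaceD(4)[OF dm_csubspace maps[OF u] maps[OF u]] by (simp add: snorm_eq)
  qed
  then show "\<exists>r>0. \<forall>t'. \<bar>t' - t\<bar> < r \<longrightarrow>
      (\<forall>u\<in>dm (a / 2). norm (X (d / 2) (A t' u - A t u)) \<le> e * norm (X (a / 2) u))"
    using r(1) by blast
qed

lemma C0_sobI:
  assumes "\<And>x. \<psi> x \<in> dm (k / 2)" "\<And>x. ((\<lambda>y. X (k / 2) (\<psi> y)) \<longlongrightarrow> X (k / 2) (\<psi> x)) (at x)"
  shows "C0_sob D H k \<psi>"
  unfolding C0_sob_def
proof (intro conjI allI)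
  fix x
  show "\<psi> x \<in> sob D H k" using assms(1) by (simp add: sob_eq)
  have "snorm D H k (\<psi> y - \<psi> x) = norm (X (k / 2) (\<psi> y) - X (k / 2) (\<psi> x))" for y
    using clinear_onD(5)[OF X_linear assms(1) assms(1)] csubspaceD(4)[OF dm_csubspace assms(1) assms(1)]
    by (simp add: snorm_eq)
  then show "((\<lambda>y. snorm D H k (\<psi> y - \<psi> x)) \<longlongrightarrow> 0) (at x)"
    using tendsto_norm_zero[OF LIM_zero[OF assms(2)[of x]]] by simp
qed

text \<open>For k >= 0 the norm of index k dominates the base norm up to a constant, so competing
  solutions can be compared in the base space.\<close>

lemma has_sob_derivative_imp_vector_derivative:
  assumes k: "0 \<le> k" and \<psi>: "\<And>t. \<psi> t \<in> sob D H k" "\<And>t. \<psi>' t \<in> sob D H k"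
    and d: "has_sob_derivative D H k \<psi> \<psi>'"
  shows "(\<psi> has_vector_derivative \<psi>' t) (at t)"
proof -
  define Q where "Q h = (1 / h) *\<^sub>R (\<psi> (t + h) - \<psi> t) - \<psi>' t" for h
  have Q: "Q h \<in> dm (k / 2)" for h
    unfolding Q_def using csubspaceD(4,5)[OF dm_csubspace[of "k / 2"]] \<psi> by (simp add: sob_eq)
  have le: "norm (Q h) \<le> c powr (0 - k / 2) * snorm D H k (Q h)" for h
    using dm_mono(2)[OF _ Q[of h], of 0] k by (simp add: snorm_eq[OF Q])
  have "((\<lambda>h. snorm D H k (Q h)) \<longlongrightarrow> 0) (at 0)" using d by (simp add: has_sob_derivative_def Q_def)
  then have lim: "((\<lambda>h. c powr (0 - k / 2) * snorm D H k (Q h)) \<longlongrightarrow> c powr (0 - k / 2) * 0) (at 0)"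
    by (intro tendsto_mult tendsto_const)
  have Q0: "((\<lambda>h. norm (Q h)) \<longlongrightarrow> 0) (at 0)"
  proof (rule tendsto_sandwich[OF _ _ tendsto_const lim[unfolded mult_zero_right]])
    show "\<forall>\<^sub>F h in at 0. norm (Q h) \<le> c powr (0 - k / 2) * snorm D H k (Q h)"
      by (intro always_eventually allI le)
  qed simp
  have "((\<lambda>h. norm (\<psi> (t + h) - \<psi> t - h *\<^sub>R \<psi>' t) / norm h) \<longlongrightarrow> 0) (at 0)"
  proof (rule Lim_transform_eventually[OF Q0])
    have "\<forall>\<^sub>F h in at (0::real). h \<noteq> 0" by (simp add: eventually_at_filter)
    then show "\<forall>\<^sub>F h in at 0. norm (Q h) = norm (\<psi> (t + h) - \<psi> t - h *\<^sub>R \<psi>' t) / norm h"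
    proof eventually_elim
      case (elim h)
      then have "\<psi> (t + h) - \<psi> t - h *\<^sub>R \<psi>' t = h *\<^sub>R Q h" by (simp add: Q_def scaleR_diff_right)
      then show ?case using elim by simp
    qed
  qed
  then show ?thesis
    unfolding has_vector_derivative_def has_derivative_at by (simp add: bounded_linear_scaleR_left)
qed

end

section \<open>The main theorem\<close>

locale theorem_setting = positive_operator D H c + evolution "spectral_measure D H" c L B m J C\<^sub>L C\<^sub>B
  for D :: "'h::complex_hilbert set" and H c L B m J C\<^sub>L C\<^sub>B
begin

text \<open>The target level is q = k / 2 and L costs m more; the strict inequality q + m < b is
  what continuity at both levels demands.\<close>

lemma is_propagator_W:
  assumes k: "0 \<le> k" "k / 2 + real m < b" and L: "Cb_op D H (k + 2 * real m) k L"
  shows "is_propagator D H L m k W"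
proof -
  define q where "q = k / 2"
  have q: "0 \<le> q" "q + real m < b" "q < b" using k by (simp_all add: q_def)
  have sq: "sob D H k = dm q" and sqm: "sob D H (k + 2 * real m) = dm (q + m)"
    by (simp_all add: sob_eq q_def add_divide_distrib)
  have k2: "(k + 2 * real m) / 2 = q + m" "k / 2 = q" by (simp_all add: q_def add_divide_distrib)
  obtain C where C: "\<And>t u. u \<in> dm (q + m) \<Longrightarrow> norm (X q (L t u)) \<le> C * norm (X (q + m) u)"
    using Cb_opD(3)[OF L, unfolded k2] by blast
  note Lmaps = Cb_opD(2)[OF L, unfolded k2] and Lcont = Cb_opD(4)[OF L, unfolded k2]
  have Lq: "L t u \<in> dm q \<and> norm (X q (L t u)) \<le> C * norm (X (q + m) u)" if "u \<in> dm (q + m)" for t u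
    using C[OF that] Lmaps[OF that] by simp
  have qm: "0 \<le> q + real m" using q by simp
  have cont1: "((\<lambda>x. X a (W x s u)) \<longlongrightarrow> X a (W t s u)) (at t)" if a: "0 \<le> a" "a < b" "u \<in> dm a" for a u s t
  proof -
    have "((\<lambda>x. (x, s)) \<longlongrightarrow> (t, s)) (at t)" by (intro tendsto_intros)
    moreover have "\<forall>\<^sub>F x in at t. (x, s) \<noteq> (t, s)" by (simp add: eventually_at_filter)
    ultimately have "filterlim (\<lambda>x. (x, s)) (at (t, s)) (at t)" by (simp add: filterlim_at)
    from filterlim_compose[OF X_W_continuous[OF a, of "(t, s)"] this] show ?thesis by simp
  qed
  have bop: "bounded_op D H k k (W t s)" for t s
    unfolding bounded_op_def sq
  proof (intro conjI exI ballI)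
    show "clinear_on (dm q) (W t s)" by (rule clinear_on_subset[OF W_linear dm_csubspace]) simp
    show "W t s ` dm q \<subseteq> dm q" using W_level(1)[OF q(1,3)] by blast
    fix u assume "u \<in> dm q"
    then show "snorm D H k (W t s u) \<le> (2 * exp (\<kappa> * \<bar>t - s\<bar>)) * snorm D H k u"
      using W_level[OF q(1,3), of u t s] by (simp add: snorm_eq k2)
  qed
  have C0: "C0_sob D H k (\<lambda>(t, s). W t s u)" if "u \<in> sob D H k" for u
  proof (rule C0_sobI)
    have u: "u \<in> dm q" using that by (simp add: sq)
    show "(case x of (t, s) \<Rightarrow> W t s u) \<in> dm (k / 2)" for x
      unfolding k2 using W_level(1)[OF q(1,3) u] by (simp add: split_beta)
    show "((\<lambda>y. X (k / 2) (case y of (t, s) \<Rightarrow> W t s u)) \<longlongrightarrow> X (k / 2) (case x of (t, s) \<Rightarrow> W t s u)) (at x)" for x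
      unfolding k2 using X_W_continuous[OF q(1,3) u, of x] by (simp add: split_beta)
  qed
  have sol: "is_solution D H L m k s u (\<lambda>t. W t s u)" if "u \<in> sob D H (k + 2 * real m)" for s u
  proof -
    have u: "u \<in> dm (q + m)" using that by (simp add: sqm)
    have uq: "u \<in> dm q" by (rule dm_le[OF u]) simp
    have Wqm: "W t s u \<in> dm (q + m)" for t by (rule W_level(1)[OF qm q(2) u])
    define \<psi>' where "\<psi>' t = - \<i> *\<^sub>C L t (W t s u)" for t
    have \<psi>'q: "\<psi>' t \<in> dm q" for t
      unfolding \<psi>'_def by (rule csubspaceD(3)[OF dm_csubspace Lmaps[OF Wqm]])
    have Wd: "((\<lambda>x. X q (L x (W x s u))) \<longlongrightarrow> X q (L t (W t s u))) (at t)"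
      "((\<lambda>h. norm (X q ((1 / h) *\<^sub>R (W (t + h) s u - W t s u) - (- \<i> *\<^sub>C L t (W t s u))))) \<longlongrightarrow> 0) (at 0)" for t
      by (rule W_deriv_level[OF q(1,2) Lq Lcont u]; assumption)+
    have "C0_sob D H (k + 2 * real m) (\<lambda>t. W t s u)"
      by (rule C0_sobI; unfold k2; rule Wqm cont1[OF qm q(2) u])
    moreover have "C0_sob D H k (\<lambda>t. W t s u)"
      by (rule C0_sobI; unfold k2; rule W_level(1)[OF q(1,3) uq] cont1[OF q(1,3) uq])
    moreover have "C0_sob D H k \<psi>'"
    proof (rule C0_sobI; unfold k2)
      show "\<psi>' t \<in> dm q" for t by (rule \<psi>'q)
      have "X q (\<psi>' t) = - \<i> *\<^sub>C X q (L t (W t s u))" for t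
        unfolding \<psi>'_def by (rule X_lin(3)[OF Lmaps[OF Wqm]])
      then show "((\<lambda>x. X q (\<psi>' x)) \<longlongrightarrow> X q (\<psi>' t)) (at t)" for t
        using tendsto_scaleC[OF Wd(1)[of t], of "- \<i>"] by simp
    qed
    moreover have "has_sob_derivative D H k (\<lambda>t. W t s u) \<psi>'"
      unfolding has_sob_derivative_def
    proof
      fix t
      have "(1 / h) *\<^sub>R (W (t + h) s u - W t s u) - \<psi>' t \<in> dm (k / 2)" for h
        unfolding k2 by (intro csubspaceD(4,5)[OF dm_csubspace] W_level(1)[OF q(1,3) uq] \<psi>'q)
      then have "snorm D H k ((1 / h) *\<^sub>R (W (t + h) s u - W t s u) - \<psi>' t)
          = norm (X q ((1 / h) *\<^sub>R (W (t + h) s u - W t s u) - (- \<i> *\<^sub>C L t (W t s u))))" for h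
        by (simp add: snorm_eq k2 \<psi>'_def)
      then show "((\<lambda>h. snorm D H k ((1 / h) *\<^sub>R (W (t + h) s u - W t s u) - \<psi>' t)) \<longlongrightarrow> 0) (at 0)"
        using Wd(2)[of t] by simp
    qed
    moreover have "\<i> *\<^sub>C \<psi>' t = L t (W t s u)" for t
      by (simp add: \<psi>'_def scaleC_scaleC)
    ultimately show ?thesis unfolding is_solution_def using W_start by blast
  qed
  have uniq: "\<phi> = (\<lambda>t. W t s u)"
    if u: "u \<in> sob D H (k + 2 * real m)" and \<phi>: "is_solution D H L m k s u \<phi>" for s u \<phi>
  proof
    fix t
    obtain \<psi>' where *: "C0_sob D H (k + 2 * real m) \<phi>" "\<phi> s = u" "C0_sob D H k \<phi>" "C0_sob D H k \<psi>'"
      "has_sob_derivative D H k \<phi> \<psi>'" "\<And>t. \<i> *\<^sub>C \<psi>' t = L t (\<phi> t)"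
      using \<phi> unfolding is_solution_def by blast
    have um: "u \<in> dm m" using u dm_le[of u "q + m" "real m"] q(1) by (simp add: sqm)
    have \<phi>m: "\<phi> x \<in> dm m" for x
      using *(1) dm_le[of "\<phi> x" "q + m" "real m"] q(1) by (simp add: C0_sob_def sqm)
    have "(\<phi> has_vector_derivative \<psi>' x) (at x)" for x
      by (rule has_sob_derivative_imp_vector_derivative[OF k(1) _ _ *(5)])
        (use *(3,4) in \<open>simp_all add: C0_sob_def\<close>)
    moreover have "\<psi>' x = - \<i> *\<^sub>C L x (\<phi> x)" for x
      by (simp add: *(6)[symmetric] scaleC_scaleC)
    ultimately have d: "(\<phi> has_vector_derivative - \<i> *\<^sub>C L x (\<phi> x)) (at x)" for x by metis
    show "\<phi> t = W t s u" by (rule W_unique[where \<phi> = \<phi>]; fact um \<phi>m d *(2))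
  qed
  \<comment> \<open>One constant has to serve both as factor and as rate; \<kappa> + 2 exceeds 2 and
    \<kappa>.\<close>
  have grow: "op_norm D H k k (W t s) \<le> (\<kappa> + 2) * exp ((\<kappa> + 2) * \<bar>t - s\<bar>)" for t s
  proof -
    have "op_norm D H k k (W t s) \<le> 2 * exp (\<kappa> * \<bar>t - s\<bar>)"
    proof (rule op_norm_least)
      fix u assume "u \<in> sob D H k"
      then show "snorm D H k (W t s u) \<le> 2 * exp (\<kappa> * \<bar>t - s\<bar>) * snorm D H k u"
        using W_level[OF q(1,3), of u t s] by (simp add: sq snorm_eq k2)
    qed simp
    also have "\<dots> \<le> (\<kappa> + 2) * exp ((\<kappa> + 2) * \<bar>t - s\<bar>)"
      using kappa(1) by (intro mult_mono) (auto intro!: mult_right_mono)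
    finally show ?thesis .
  qed
  show ?thesis
    unfolding is_propagator_def group_property_def
  proof (intro conjI allI ballI impI)
    show "\<exists>C>0. \<forall>t s. op_norm D H k k (W t s) \<le> C * exp (C * \<bar>t - s\<bar>)"
      using grow kappa(1) by (intro exI[of _ "\<kappa> + 2"]) auto
  qed (auto simp: norm_W W_group W_start bop C0 sol uniq)
qed

text \<open>Truncated vectors lie in every space of the scale, and agreement on them spreads by the
  norm bounds. This serves the uniqueness of the propagator as well as that of its unitary
  extension.\<close>

lemma W_agree:
  assumes u: "\<And>n::nat. V (P (real n) u) = W t s (P (real n) u)"
    and d: "\<And>n::nat. norm (V u - V (P (real n) u)) \<le> norm (u - P (real n) u)"
  shows "V u = W t s u"
proof -
  have n0: "(\<lambda>n. norm (u - P (real n) u)) \<longlonglongrightarrow> 0"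
    using tendsto_norm[OF tendsto_diff[OF tendsto_const P_tendsto[of u]], of u] by simp
  have "(\<lambda>n. norm (V u - W t s u)) \<longlonglongrightarrow> 0"
  proof (rule tendsto_sandwich[OF _ _ tendsto_const])
    show "(\<lambda>n. norm (u - P (real n) u) + norm (u - P (real n) u)) \<longlonglongrightarrow> 0"
      using tendsto_add[OF n0 n0] by simp
    have "norm (V u - W t s u) \<le> norm (u - P (real n) u) + norm (u - P (real n) u)" for n
    proof -
      have "V u - W t s u = (V u - V (P (real n) u)) - W t s (u - P (real n) u)"
        by (simp add: u W_diff)
      then have "norm (V u - W t s u) \<le> norm (V u - V (P (real n) u)) + norm (W t s (u - P (real n) u))"
        by (simp only: norm_triangle_ineq4)
      then show ?thesis using d[of n] by (simp add: norm_W)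
    qed
    then show "\<forall>\<^sub>F n in sequentially. norm (V u - W t s u) \<le> norm (u - P (real n) u) + norm (u - P (real n) u)"
      by (intro always_eventually allI)
  qed auto
  then show ?thesis by (simp add: LIMSEQ_const_iff)
qed

lemma propagator_unique:
  assumes W: "is_propagator D H L m k W" and V: "is_propagator D H L m k V" and u: "u \<in> sob D H k"
  shows "V t s u = W t s u"
proof (rule W_agree)
  fix n :: nat
  have P: "P (real n) u \<in> sob D H j" for j by (simp add: sob_eq)
  have "is_solution D H L m k s (P (real n) u) (\<lambda>t. V t s (P (real n) u))"
    using V P unfolding is_propagator_def by blast
  then have "(\<lambda>t. V t s (P (real n) u)) = (\<lambda>t. W t s (P (real n) u))"
    using W P unfolding is_propagator_def by blast
  then show "V t s (P (real n) u) = W t s (P (real n) u)" by (rule fun_cong)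
  have "clinear_on (sob D H k) (V t s)" using V by (simp add: is_propagator_def bounded_op_def)
  from clinear_onD(5)[OF this u P] have "V t s u - V t s (P (real n) u) = V t s (u - P (real n) u)" ..
  moreover have "u - P (real n) u \<in> sob D H k" by (rule csubspaceD(4)[OF sob_csubspace u P])
  ultimately show "norm (V t s u - V t s (P (real n) u)) \<le> norm (u - P (real n) u)"
    using V by (simp add: is_propagator_def)
qed

lemma unitary_extension_unique:
  assumes W': "unitary W'" and eq: "\<And>u. u \<in> sob D H k \<Longrightarrow> W' u = W t s u"
  shows "W' = W t s"
proof
  fix u
  have lin: "clinear_on UNIV W'" and inn: "\<And>u v. cinner (W' u) (W' v) = cinner u v"
    using W' by (auto simp: unitary_def)
  have nrm: "norm (W' v) = norm v" for v
  proof -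
    have "(norm (W' v))\<^sup>2 = (norm v)\<^sup>2" unfolding norm_sq_cinner inn ..
    then show ?thesis by simp
  qed
  show "W' u = W t s u"
  proof (rule W_agree)
    fix n :: nat
    show "W' (P (real n) u) = W t s (P (real n) u)" by (rule eq) (simp add: sob_eq)
    show "norm (W' u - W' (P (real n) u)) \<le> norm (u - P (real n) u)"
      using nrm[of "u - P (real n) u"] clinear_onD(5)[OF lin, of u "P (real n) u"] by simp
  qed
qed

end

theorem theorem1p2:
  fixes D :: "'h::complex_hilbert set" and H :: "'h \<Rightarrow> 'h"
    and L :: "real \<Rightarrow> 'h \<Rightarrow> 'h" and m k0 :: nat and k1 :: real
  assumes H_pos: "positive_self_adjoint D H"
    and k0: "k0 > 2 * m"
    and H0: "\<And>k::real. 0 \<le> k \<Longrightarrow> k \<le> real k0 \<Longrightarrow> Cb_op D H (k + 2 * real m) k L"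
    and H1: "\<And>t. symmetric_on (sob D H (real k0 + 2 * real m)) (L t)"
    and k1: "k1 > 2 * real m"
    and H2: "\<exists>B. (\<forall>t. \<forall>u\<in>sob D H (2 * real m).
                     L t (op_pow D H (- 1) u) \<in> D \<and> B t u = comm_inv D H (L t) u) \<and>
                 (\<forall>k. 0 \<le> k \<and> k \<le> 2 * k1 \<longrightarrow> Cb_op D H k k B)"
  shows "(\<forall>k::real. 0 \<le> k \<and> k \<le> min (real k0) k1 - 4 * real m \<longrightarrow>
            (\<exists>U. is_propagator D H L m k U \<and>
                 (\<forall>V. is_propagator D H L m k V \<longrightarrow>
                    (\<forall>t s. \<forall>u\<in>sob D H k. V t s u = U t s u)) \<and>
                 (\<exists>W. (\<forall>t s. unitary (W t s) \<and> (\<forall>u\<in>sob D H k. W t s u = U t s u) \<and>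
                          (\<forall>W'. unitary W' \<and> (\<forall>u\<in>sob D H k. W' u = U t s u) \<longrightarrow> W' = W t s)) \<and>
                      group_property UNIV W)))
       \<and> (\<forall>t. \<forall>k::real. 2 * real m \<le> k \<longrightarrow> essentially_self_adjoint (sob D H k) (L t))"
proof -
  obtain c where c: "positive_pvm (spectral_measure D H) c" "D = spectral_domain (spectral_measure D H) (\<lambda>x. x)"
    "is_spectral_integral (spectral_measure D H) (\<lambda>x. x) H"
    using spectral_measure_positive[OF H_pos] by metis
  interpret O: positive_operator D H c by (rule positive_operator.intro[OF c])
  obtain B where B: "\<And>t u. u \<in> sob D H (2 * real m) \<Longrightarrow> L t (op_pow D H (- 1) u) \<in> D \<and> B t u = comm_inv D H (L t) u"
    and CbB: "\<And>k. 0 \<le> k \<Longrightarrow> k \<le> 2 * k1 \<Longrightarrow> Cb_op D H k k B"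
    using H2 by blast
  \<comment> \<open>For j <= floor(k1) the index 2 j is at most 2 k1, so \<open>H2\<close> covers
    every integer power up to J.\<close>
  define J where "J = nat \<lfloor>k1\<rfloor>"
  have k1_pos: "0 \<le> k1" using k1 by linarith
  have Jk: "real J \<le> k1" "k1 < real (Suc J)"
    using k1_pos by (simp_all add: J_def) linarith
  have mJ: "m \<le> J"
  proof -
    have "real m < real (Suc J)" using Jk(2) k1 by linarith
    then show ?thesis by simp
  qed
  have L0: "Cb_op D H (0 + 2 * real m) 0 L" by (rule H0) auto
  have half: "(0 + 2 * real m) / 2 = real m" "(0::real) / 2 = 0" by auto
  note L0D = O.Cb_opD[OF L0, unfolded half]
  obtain C\<^sub>L where CL: "0 \<le> C\<^sub>L" "\<And>t u. u \<in> O.dm m \<Longrightarrow> norm (L t u) \<le> C\<^sub>L * norm (O.X m u)"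
    using L0D(3) by auto
  have "\<exists>C\<ge>0. \<forall>t. \<forall>u\<in>O.dm (real j). norm (O.X (real j) (B t u)) \<le> C * norm (O.X (real j) u)" if "j \<le> J" for j
    using O.Cb_opD(3)[OF CbB[of "2 * real j"]] that Jk(1) by simp
  then obtain Cj where Cj: "\<And>j. j \<le> J \<Longrightarrow> 0 \<le> Cj j"
    "\<And>j t u. j \<le> J \<Longrightarrow> u \<in> O.dm (real j) \<Longrightarrow> norm (O.X (real j) (B t u)) \<le> Cj j * norm (O.X (real j) u)"
    by metis
  \<comment> \<open>The sum of finitely many nonnegative constants is a common bound for
    them.\<close>
  define C\<^sub>B where "C\<^sub>B = (\<Sum>j\<le>J. Cj j)"
  have CB: "0 \<le> C\<^sub>B" "\<And>j. j \<le> J \<Longrightarrow> Cj j \<le> C\<^sub>B"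
    using Cj(1) by (auto simp: C\<^sub>B_def intro!: sum_nonneg member_le_sum)
  \<comment> \<open>Symmetry is assumed at index k0 + 2m; truncated vectors lie there and converge
    in the graph norm of L, which extends it to all of \<open>dm m\<close>.\<close>
  have L_sym: "cinner (L t u) v = cinner u (L t v)" if u: "u \<in> O.dm m" and v: "v \<in> O.dm m" for t u v
  proof -
    have lim: "(\<lambda>n. L t (O.P (real n) w)) \<longlonglongrightarrow> L t w" if w: "w \<in> O.dm m" for w
    proof (rule LIM_zero_cancel, rule Lim_null_comparison)
      have "norm (L t (O.P (real n) w) - L t w) \<le> C\<^sub>L * norm (O.X m (O.P (real n) w) - O.X m w)" for n
        using CL(2)[OF csubspaceD(4)[OF O.dm_csubspace O.P_dm w], of t "real n"]
          clinear_onD(5)[OF L0D(1) O.P_dm w, of t "real n"]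
          clinear_onD(5)[OF O.X_linear O.P_dm w, of "real n"] by simp
      then show "\<forall>\<^sub>F n in sequentially. norm (L t (O.P (real n) w) - L t w) \<le> C\<^sub>L * norm (O.X m (O.P (real n) w) - O.X m w)"
        by (intro always_eventually allI)
      have "(\<lambda>n. C\<^sub>L * norm (O.X m (O.P (real n) w) - O.X m w)) \<longlonglongrightarrow> C\<^sub>L * norm (O.X m w - O.X m w)"
        by (intro tendsto_intros O.X_P_tendsto w)
      then show "(\<lambda>n. C\<^sub>L * norm (O.X m (O.P (real n) w) - O.X m w)) \<longlonglongrightarrow> 0" by simp
    qed
    have "(\<lambda>n. cinner (L t (O.P (real n) u)) (O.P (real n) v)) \<longlonglongrightarrow> cinner (L t u) v"
      by (intro tendsto_cinner lim u O.P_tendsto)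
    moreover have "(\<lambda>n. cinner (O.P (real n) u) (L t (O.P (real n) v))) \<longlonglongrightarrow> cinner u (L t v)"
      by (intro tendsto_cinner lim v O.P_tendsto)
    moreover have "cinner (L t (O.P (real n) u)) (O.P (real n) v) = cinner (O.P (real n) u) (L t (O.P (real n) v))" for n
    proof -
      have "O.P (real n) w \<in> sob D H (real k0 + 2 * real m)" for w
        unfolding O.sob_eq by (rule O.P_dm)
      then show ?thesis using H1[of t] unfolding symmetric_on_def by blast
    qed
    ultimately show ?thesis
      by (simp only:) (rule LIMSEQ_unique)
  qed
  interpret theorem_setting D H c L B m J C\<^sub>L C\<^sub>B
  proof (intro theorem_setting.intro evolution.intro evolution_axioms.intro)
    show "positive_operator D H c" by (rule O.positive_operator_axioms)
    show "positive_pvm (spectral_measure D H) c" by (rule c)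
    show "\<exists>d>0. \<forall>t'. \<bar>t' - t\<bar> < d \<longrightarrow> (\<forall>u\<in>O.dm m. norm (L t' u - L t u) \<le> e * norm (O.X m u))" if "0 < e" for e t
      using L0D(4)[OF that, of t] by (simp only: O.X_0)
    show "B t u \<in> O.dm (real j) \<and> norm (O.X (real j) (B t u)) \<le> C\<^sub>B * norm (O.X (real j) u)"
      if j: "j \<le> J" and u: "u \<in> O.dm (real j)" for j u t
    proof
      show "B t u \<in> O.dm (real j)"
        using O.Cb_opD(2)[OF CbB[of "2 * real j"], of u t] u j Jk(1) by simp
      show "norm (O.X (real j) (B t u)) \<le> C\<^sub>B * norm (O.X (real j) u)"
        by (rule order.trans[OF Cj(2)[OF j u] mult_right_mono[OF CB(2)[OF j]]]) simp
    qed
    \<comment> \<open>With v = H^-1 u the commutator [L, H] v is L u - H L H^-1 u, which is solved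
      for the conjugated operator.\<close>
    show "L t (O.X (- 1) u) \<in> O.dm 1 \<and> O.X 1 (L t (O.X (- 1) u)) = L t u - B t u"
      if u: "u \<in> O.dm m" for u t
    proof -
      have u': "u \<in> sob D H (2 * real m)" using u by (simp add: O.sob_eq)
      have pw: "op_pow D H (- 1) u = O.X (- 1) u" by (rule O.op_pow_eq) (simp add: O.dm_nonpos)
      have Lv: "L t (O.X (- 1) u) \<in> D"
        using conjunct1[OF B[OF u']] unfolding pw .
      have D_iff: "v \<in> D \<longleftrightarrow> v \<in> O.dm 1" for v
        by (rule arg_cong[OF O.D_dm, where f = "\<lambda>S. v \<in> S"])
      have vD: "O.X (- 1) u \<in> D"
        by (rule iffD2[OF D_iff], rule O.X_X_neg(1)) simp
      have Hv: "H (O.X (- 1) u) = u"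
        unfolding O.H_X[OF vD] by (rule O.X_X_neg(2)) simp
      have "B t u = comm_inv D H (L t) u" using B[OF u', of t] ..
      also have "\<dots> = L t u - O.X 1 (L t (O.X (- 1) u))"
        unfolding comm_inv_def pw Let_def Hv O.H_X[OF Lv] ..
      finally have "O.X 1 (L t (O.X (- 1) u)) = L t u - B t u" by (simp only: diff_diff_eq2 add_diff_cancel_left')
      moreover have "L t (O.X (- 1) u) \<in> O.dm 1" by (rule iffD1[OF D_iff Lv])
      ultimately show ?thesis by (rule conjI[rotated])
    qed
  qed (use mJ CL CB(1) L0D(1) L_sym in auto)
  show ?thesis
  proof (intro conjI allI impI, elim conjE)
    fix k :: real assume k: "0 \<le> k" "k \<le> min (real k0) k1 - 4 * real m"
    \<comment> \<open>From k <= k1 - 4m follows k / 2 + m <= k1, and k1 is below Suc J.\<close>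
    have kb: "k / 2 + real m < b" using k k1_pos Jk(2) by (auto simp: min_def split: if_splits)
    have W: "is_propagator D H L m k W"
      by (rule is_propagator_W[OF k(1) kb H0]) (use k in auto)
    have ext: "\<forall>t s. unitary (W t s) \<and> (\<forall>u\<in>sob D H k. W t s u = W t s u) \<and>
        (\<forall>W'. unitary W' \<and> (\<forall>u\<in>sob D H k. W' u = W t s u) \<longrightarrow> W' = W t s)"
      using W_unitary unitary_extension_unique by blast
    have "group_property UNIV W" by (simp add: group_property_def W_group W_start)
    with ext have ex: "\<exists>W'. (\<forall>t s. unitary (W' t s) \<and> (\<forall>u\<in>sob D H k. W' t s u = W t s u) \<and>
        (\<forall>W''. unitary W'' \<and> (\<forall>u\<in>sob D H k. W'' u = W t s u) \<longrightarrow> W'' = W' t s)) \<and> group_property UNIV W'"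
      by blast
    have "\<forall>V. is_propagator D H L m k V \<longrightarrow> (\<forall>t s. \<forall>u\<in>sob D H k. V t s u = W t s u)"
      using propagator_unique[OF W] by blast
    with W ex show "\<exists>U. is_propagator D H L m k U \<and>
                 (\<forall>V. is_propagator D H L m k V \<longrightarrow>
                    (\<forall>t s. \<forall>u\<in>sob D H k. V t s u = U t s u)) \<and>
                 (\<exists>W. (\<forall>t s. unitary (W t s) \<and> (\<forall>u\<in>sob D H k. W t s u = U t s u) \<and>
                          (\<forall>W'. unitary W' \<and> (\<forall>u\<in>sob D H k. W' u = U t s u) \<longrightarrow> W' = W t s)) \<and>
                      group_property UNIV W)"
      by blast
  next
    fix t and k :: real assume "2 * real m \<le> k"
    then show "essentially_self_adjoint (sob D H k) (L t)"
      unfolding O.sob_eq by (intro L_essentially_self_adjoint) simp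
  qed
qed

end
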